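(* Up to automorphisms of $\mathbb{P}^2_{\mathbb{C}}$ there are exactly $14$ homogeneous convex foliations $\mathcal{H}_1,\ldots,\mathcal{H}_{14}$ of degree $5$ on $\mathbb{P}^2_{\mathbb{C}}$ (that is, each $\mathcal{H}_i$ is a homogeneous convex foliation of degree $5$, they are pairwise non-conjugate, and every homogeneous convex foliation of degree $5$ on $\mathbb{P}^2_{\mathbb{C}}$ is conjugate to one of them by an element of $\mathrm{Aut}(\mathbb{P}^2_{\mathbb{C}})$). They are respectively described in an affine chart $(x,y)$ by the following $1$-forms: 1. $\omega_1=y^5\,\mathrm{d}x-x^5\,\mathrm{d}y$; 2. $\omega_2=y^2(10x^3+10x^2y+5xy^2+y^3)\,\mathrm{d}x-x^4(x+5y)\,\mathrm{d}y$; 3. $\omega_3=y^3(10x^2+5xy+y^2)\,\mathrm{d}x-x^3(x^2+5xy+10y^2)\,\mathrm{d}y$; 4. $\omega_4=y^4(5x-3y)\,\mathrm{d}x+x^4(3x-5y)\,\mathrm{d}y$; 5. $\omega_5=y^3(5x^2-3y^2)\,\mathrm{d}x-2x^5\,\mathrm{d}y$; 6. $\omega_6=y^3(220x^2-165xy+36y^2)\,\mathrm{d}x-121x^5\,\mathrm{d}y$; 7. $\omega_7=y^4\big((5-\sqrt5)x-2y\big)\,\mathrm{d}x+x^4\big((7-3\sqrt5)x-2(5-2\sqrt5)y\big)\,\mathrm{d}y$; 8. $\omega_8=y^4\big(5(3-\sqrt{21})x+6y\big)\,\mathrm{d}x+x^4\big(3(23-5\sqrt{21})x-10(9-2\sqrt{21})y\big)\,\mathrm{d}y$;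 9. $\omega_9=y^3\big(2(5+a)x^2-(15+a)xy+6y^2\big)\,\mathrm{d}x-x^4\big((1-a)x+2ay\big)\,\mathrm{d}y$, where $a=\sqrt{5(4\sqrt{61}-31)}$; 10. $\omega_{10}=y^3\big(2(5+\mathrm{i}b)x^2-(15+\mathrm{i}b)xy+6y^2\big)\,\mathrm{d}x-x^4\big((1-\mathrm{i}b)x+2\mathrm{i}by\big)\,\mathrm{d}y$, where $b=\sqrt{5(4\sqrt{61}+31)}$; 11. $\omega_{11}=y^3(5x^2-y^2)\,\mathrm{d}x+x^3(x^2-5y^2)\,\mathrm{d}y$; 12. $\omega_{12}=y^3(20x^2-5xy-y^2)\,\mathrm{d}x+x^3(x^2+5xy-20y^2)\,\mathrm{d}y$; 13. $\omega_{13}=y^2(5x^3-10x^2y+10xy^2-4y^3)\,\mathrm{d}x-x^5\,\mathrm{d}y$; 14. $\omega_{14}=y^3\big(u(\sigma)x^2+v(\sigma)xy+w(\sigma)y^2\big)\,\mathrm{d}x+\sigma x^4\big(2\sigma(\sigma^2-\sigma+1)x-(\sigma+1)(3\sigma^2-5\sigma+3)y\big)\,\mathrm{d}y$, where $u(\sigma)=(\sigma^2-3\sigma+1)(\sigma^2+5\sigma+1)$, $v(\sigma)=-2(\sigma+1)(\sigma^2-5\sigma+1)$, $w(\sigma)=\sigma^2-7\sigma+1$, $\sigma=\rho+\mathrm{i}\sqrt{\tfrac16-\tfrac43\rho-\tfrac13\rho^2}$ and $\rho$ is the unique real number satisfying $8\rho^3-52\rho^2+134\rho-15=0$.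
   Context: Foliations on $\mathbb{P}^2_{\mathbb{C}}$ are holomorphic, with isolated singularities. The degree of a foliation is the number of tangencies (with multiplicity) with a generic line. A foliation of degree $d$ on $\mathbb{P}^2_{\mathbb{C}}$ is homogeneous if, for a suitable choice of affine coordinates $(x,y)$, it is given by a $1$-form $\omega=A(x,y)\,\mathrm{d}x+B(x,y)\,\mathrm{d}y$ where $A,B\in\mathbb{C}[x,y]$ are homogeneous polynomials of degree $d$ with $\gcd(A,B)=1$. A foliation on $\mathbb{P}^2_{\mathbb{C}}$ is convex if its leaves other than straight lines have no inflection points. Two foliations are conjugate up to automorphisms (linearly conjugated) if some element of $\mathrm{Aut}(\mathbb{P}^2_{\mathbb{C}})=\mathrm{PGL}_3(\mathbb{C})$ maps one to the other. *)

theory Defs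
  imports "HOL-Complex_Analysis.Complex_Analysis"
    "HOL-Computational_Algebra.Computational_Algebra"
begin

text \<open>
  Points of the complex projective plane are nonzero vectors of \<open>complex^3\<close> up to nonzero scalars.
  A 1-form \<open>a dx + b dy + c dz\<close> on \<open>complex^3\<close> is represented by its coefficient map
  \<open>p \<mapsto> (a p, b p, c p)\<close>; its value at the point \<open>p\<close> on the vector \<open>v\<close> is \<open>pair (\<Omega> p) v\<close>.
  Note that \<open>pair\<close> is complex bilinear, in contrast to the real inner product of \<open>complex^3\<close>.
\<close>

definition pair :: "complex^3 \<Rightarrow> complex^3 \<Rightarrow> complex" where
  "pair w v = (\<Sum>i\<in>UNIV. w $ i * v $ i)"

type_synonym form = "complex^3 \<Rightarrow> complex^3"

definition proj_point :: "complex^3 \<Rightarrow> (complex^3) set" where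
  "proj_point p = {c *s p | c. c \<noteq> 0}"

definition indep :: "complex^3 \<Rightarrow> complex^3 \<Rightarrow> bool" where
  "indep p q \<longleftrightarrow> (\<forall>a b. a *s p + b *s q = 0 \<longrightarrow> a = 0 \<and> b = 0)"

definition hom_poly3 :: "nat \<Rightarrow> (complex^3 \<Rightarrow> complex) \<Rightarrow> bool" where
  "hom_poly3 n f \<longleftrightarrow>
     (\<exists>c :: nat \<Rightarrow> nat \<Rightarrow> complex. \<forall>p. f p =
        (\<Sum>i\<le>n. \<Sum>j\<le>n-i. c i j * (p $ 1) ^ i * (p $ 2) ^ j * (p $ 3) ^ (n - i - j)))"

text \<open>
  A holomorphic foliation with isolated singularities on the projective plane, given in homogeneous
  coordinates by a 1-form with homogeneous polynomial coefficients of the same degree which satisfies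
  the Euler condition (so that it descends to the projective plane) and which vanishes at only
  finitely many points of the projective plane. The form is unique up to a nonzero constant factor;
  all notions below are invariant under such a factor.
\<close>

definition foliation :: "form \<Rightarrow> bool" where
  "foliation \<Omega> \<longleftrightarrow>
     (\<exists>n. \<forall>i. hom_poly3 n (\<lambda>p. \<Omega> p $ i)) \<and>
     (\<forall>p. pair (\<Omega> p) p = 0) \<and>
     finite (proj_point ` {p. p \<noteq> 0 \<and> \<Omega> p = 0})"

definition regular_point :: "form \<Rightarrow> complex^3 \<Rightarrow> bool" where
  "regular_point \<Omega> p \<longleftrightarrow> p \<noteq> 0 \<and> \<Omega> p \<noteq> 0"

text \<open>
  The line with dual coordinates \<open>l \<noteq> 0\<close> consists of the points \<open>p\<close> with \<open>pair l p = 0\<close>.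
  For two distinct points \<open>p\<close>, \<open>q\<close> the map \<open>s \<mapsto> p + s q\<close> parametrizes the line through them
  with the exception of \<open>q\<close>, and the form pulls back to \<open>pair (\<Omega> (p + s q)) q ds\<close>.
  Hence \<open>tang_order \<Omega> p q\<close> is the order of tangency, at the point \<open>p\<close>, of the foliation
  with the line through \<open>p\<close> and \<open>q\<close>; it is \<open>0\<close> if the line is transverse at \<open>p\<close>.
\<close>

definition tang_order :: "form \<Rightarrow> complex^3 \<Rightarrow> complex^3 \<Rightarrow> int" where
  "tang_order \<Omega> p q = zorder (\<lambda>s. pair (\<Omega> (p + s *s q)) q) 0"

text \<open>The last summand below is the contribution of the remaining point \<open>q\<close> of the line.\<close>

definition num_tangencies :: "form \<Rightarrow> complex^3 \<Rightarrow> complex^3 \<Rightarrow> int" where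
  "num_tangencies \<Omega> p q =
     (\<Sum>s | pair (\<Omega> (p + s *s q)) q = 0. tang_order \<Omega> (p + s *s q) q) + tang_order \<Omega> q p"

text \<open>
  ``Generic'' means: outside the zero locus, in the dual plane, of some nonzero homogeneous
  polynomial \<open>G\<close>. The finiteness condition says that the line is not invariant, so that \<open>zorder\<close>
  and the sum in \<open>num_tangencies\<close> are meaningful.
\<close>

definition has_degree :: "form \<Rightarrow> nat \<Rightarrow> bool" where
  "has_degree \<Omega> d \<longleftrightarrow>
     (\<exists>n G. hom_poly3 n G \<and> (\<exists>l. G l \<noteq> 0) \<and>
        (\<forall>l p q. l \<noteq> 0 \<and> G l \<noteq> 0 \<and> pair l p = 0 \<and> pair l q = 0 \<and> indep p q \<longrightarrow>
           finite {s. pair (\<Omega> (p + s *s q)) q = 0} \<and> num_tangencies \<Omega> p q = int d))"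

text \<open>
  An affine chart with affine coordinates \<open>(x, y)\<close> is \<open>(x, y) \<mapsto> M (x, y, 1)\<close> for an invertible
  matrix \<open>M\<close>. The following says that in this chart the foliation is given by \<open>a dx + b dy\<close>.
\<close>

definition given_in_chart ::
  "complex^3^3 \<Rightarrow> form \<Rightarrow> (complex \<Rightarrow> complex \<Rightarrow> complex) \<times> (complex \<Rightarrow> complex \<Rightarrow> complex) \<Rightarrow> bool" where
  "given_in_chart M \<Omega> \<omega> \<longleftrightarrow>
     (\<exists>c. c \<noteq> 0 \<and>
       (\<forall>x y. pair (\<Omega> (M *v vector [x, y, 1])) (M *v vector [1, 0, 0]) = c * fst \<omega> x y \<and>
              pair (\<Omega> (M *v vector [x, y, 1])) (M *v vector [0, 1, 0]) = c * snd \<omega> x y))"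

text \<open>
  Polynomials in \<open>x, y\<close> are polynomials in \<open>y\<close> whose coefficients are polynomials in \<open>x\<close>.
\<close>

definition eval2 :: "complex poly poly \<Rightarrow> complex \<Rightarrow> complex \<Rightarrow> complex" where
  "eval2 P x y = poly (poly P [:y:]) x"

definition hom_poly2 :: "nat \<Rightarrow> complex poly poly \<Rightarrow> bool" where
  "hom_poly2 d P \<longleftrightarrow> (\<forall>i j. coeff (coeff P i) j \<noteq> 0 \<longrightarrow> i + j = d)"

definition homogeneous_foliation :: "nat \<Rightarrow> form \<Rightarrow> bool" where
  "homogeneous_foliation d \<Omega> \<longleftrightarrow>
     foliation \<Omega> \<and> has_degree \<Omega> d \<and>
     (\<exists>M A B. invertible M \<and> hom_poly2 d A \<and> hom_poly2 d B \<and> coprime A B \<and>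
        given_in_chart M \<Omega> (eval2 A, eval2 B))"

text \<open>
  The leaf through a regular point: all points reached from it along piecewise \<open>C\<^sup>1\<close> paths in the
  regular set that are tangent to the foliation. Everything is lifted to \<open>complex^3 - {0}\<close>, so
  the set below is the cone over the leaf (radial directions are tangent by the Euler condition).
\<close>

definition leaf :: "form \<Rightarrow> complex^3 \<Rightarrow> (complex^3) set" where
  "leaf \<Omega> p =
     {q. \<exists>g. valid_path g \<and> pathstart g = p \<and> pathfinish g = q \<and>
         (\<forall>t\<in>{0..1}. regular_point \<Omega> (g t) \<and>
            (\<forall>v. (g has_vector_derivative v) (at t within {0..1}) \<longrightarrow> pair (\<Omega> (g t)) v = 0))}"

definition in_straight_line :: "(complex^3) set \<Rightarrow> bool" where
  "in_straight_line S \<longleftrightarrow> (\<exists>l. l \<noteq> 0 \<and> (\<forall>q\<in>S. pair l q = 0))"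

definition deriv_vec :: "(complex \<Rightarrow> complex^3) \<Rightarrow> complex \<Rightarrow> complex^3" where
  "deriv_vec \<gamma> t = (\<chi> i. deriv (\<lambda>u. \<gamma> u $ i) t)"

text \<open>
  \<open>\<gamma>\<close> is (a lift of) a local holomorphic parametrization of the leaf through \<open>p\<close>; independence of
  \<open>\<gamma> 0\<close> and \<open>\<gamma>' 0\<close> means that its projection to the projective plane is immersed at \<open>0\<close>.
\<close>

definition leaf_param :: "form \<Rightarrow> complex^3 \<Rightarrow> (complex \<Rightarrow> complex^3) \<Rightarrow> bool" where
  "leaf_param \<Omega> p \<gamma> \<longleftrightarrow>
     \<gamma> 0 = p \<and> indep (\<gamma> 0) (deriv_vec \<gamma> 0) \<and>
     (\<exists>r>0. (\<forall>i. (\<lambda>t. \<gamma> t $ i) holomorphic_on ball 0 r) \<and>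
            (\<forall>t\<in>ball 0 r. pair (\<Omega> (\<gamma> t)) (deriv_vec \<gamma> t) = 0))"

text \<open>Inflection point of the leaf: some line has contact of order at least 3 with the leaf there.\<close>

definition inflection_point :: "form \<Rightarrow> complex^3 \<Rightarrow> bool" where
  "inflection_point \<Omega> p \<longleftrightarrow>
     regular_point \<Omega> p \<and>
     (\<exists>\<gamma> l. leaf_param \<Omega> p \<gamma> \<and> l \<noteq> 0 \<and>
            (\<forall>k<3. (deriv ^^ k) (\<lambda>t. pair l (\<gamma> t)) 0 = 0))"

definition convex_foliation :: "form \<Rightarrow> bool" where
  "convex_foliation \<Omega> \<longleftrightarrow>
     foliation \<Omega> \<and>
     (\<forall>p. regular_point \<Omega> p \<and> \<not> in_straight_line (leaf \<Omega> p) \<longrightarrow>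
          (\<forall>q\<in>leaf \<Omega> p. \<not> inflection_point \<Omega> q))"

definition conjugate :: "form \<Rightarrow> form \<Rightarrow> bool" where
  "conjugate \<Omega> \<Omega>' \<longleftrightarrow>
     (\<exists>M :: complex^3^3. invertible M \<and>
        (\<exists>c. c \<noteq> 0 \<and> (\<forall>p v. pair (\<Omega>' (M *v p)) (M *v v) = c * pair (\<Omega> p) v)))"

definition a_const :: complex where
  "a_const = complex_of_real (sqrt (5 * (4 * sqrt 61 - 31)))"

definition b_const :: complex where
  "b_const = complex_of_real (sqrt (5 * (4 * sqrt 61 + 31)))"

definition rho :: real where
  "rho = (THE r :: real. 8 * r ^ 3 - 52 * r ^ 2 + 134 * r - 15 = 0)"

definition sigma :: complex where
  "sigma = complex_of_real rho + \<i> * complex_of_real (sqrt (1/6 - 4/3 * rho - 1/3 * rho ^ 2))"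

definition sqrt5 :: complex where
  "sqrt5 = complex_of_real (sqrt 5)"

definition sqrt21 :: complex where
  "sqrt21 = complex_of_real (sqrt 21)"

definition u_pol :: "complex \<Rightarrow> complex" where
  "u_pol s = (s^2 - 3 * s + 1) * (s^2 + 5 * s + 1)"

definition v_pol :: "complex \<Rightarrow> complex" where
  "v_pol s = - 2 * (s + 1) * (s^2 - 5 * s + 1)"

definition w_pol :: "complex \<Rightarrow> complex" where
  "w_pol s = s^2 - 7 * s + 1"

text \<open>The pair \<open>(a, b)\<close> stands for the affine 1-form \<open>a(x,y) dx + b(x,y) dy\<close>.\<close>

definition omega_list ::
  "((complex \<Rightarrow> complex \<Rightarrow> complex) \<times> (complex \<Rightarrow> complex \<Rightarrow> complex)) list" where
  "omega_list =
    [(\<lambda>x y. y^5,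
      \<lambda>x y. - (x^5)),
     (\<lambda>x y. y^2 * (10 * x^3 + 10 * x^2 * y + 5 * x * y^2 + y^3),
      \<lambda>x y. - (x^4 * (x + 5 * y))),
     (\<lambda>x y. y^3 * (10 * x^2 + 5 * x * y + y^2),
      \<lambda>x y. - (x^3 * (x^2 + 5 * x * y + 10 * y^2))),
     (\<lambda>x y. y^4 * (5 * x - 3 * y),
      \<lambda>x y. x^4 * (3 * x - 5 * y)),
     (\<lambda>x y. y^3 * (5 * x^2 - 3 * y^2),
      \<lambda>x y. - (2 * x^5)),
     (\<lambda>x y. y^3 * (220 * x^2 - 165 * x * y + 36 * y^2),
      \<lambda>x y. - (121 * x^5)),
     (\<lambda>x y. y^4 * ((5 - sqrt5) * x - 2 * y),
      \<lambda>x y. x^4 * ((7 - 3 * sqrt5) * x - 2 * (5 - 2 * sqrt5) * y)),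
     (\<lambda>x y. y^4 * (5 * (3 - sqrt21) * x + 6 * y),
      \<lambda>x y. x^4 * (3 * (23 - 5 * sqrt21) * x - 10 * (9 - 2 * sqrt21) * y)),
     (\<lambda>x y. y^3 * (2 * (5 + a_const) * x^2 - (15 + a_const) * x * y + 6 * y^2),
      \<lambda>x y. - (x^4 * ((1 - a_const) * x + 2 * a_const * y))),
     (\<lambda>x y. y^3 * (2 * (5 + \<i> * b_const) * x^2 - (15 + \<i> * b_const) * x * y + 6 * y^2),
      \<lambda>x y. - (x^4 * ((1 - \<i> * b_const) * x + 2 * \<i> * b_const * y))),
     (\<lambda>x y. y^3 * (5 * x^2 - y^2),
      \<lambda>x y. x^3 * (x^2 - 5 * y^2)),
     (\<lambda>x y. y^3 * (20 * x^2 - 5 * x * y - y^2),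
      \<lambda>x y. x^3 * (x^2 + 5 * x * y - 20 * y^2)),
     (\<lambda>x y. y^2 * (5 * x^3 - 10 * x^2 * y + 10 * x * y^2 - 4 * y^3),
      \<lambda>x y. - (x^5)),
     (\<lambda>x y. y^3 * (u_pol sigma * x^2 + v_pol sigma * x * y + w_pol sigma * y^2),
      \<lambda>x y. sigma * x^4 * (2 * sigma * (sigma^2 - sigma + 1) * x
                             - (sigma + 1) * (3 * sigma^2 - 5 * sigma + 3) * y))]"

definition omega ::
  "nat \<Rightarrow> (complex \<Rightarrow> complex \<Rightarrow> complex) \<times> (complex \<Rightarrow> complex \<Rightarrow> complex)" where
  "omega i = omega_list ! (i - 1)"

end

theory Submission
  imports Defs
begin

text \<open>
  In homogeneous coordinates a homogeneous foliation is the cone over a pair \<open>w = (A, B)\<close> of binary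
  quintic forms, and conjugacy becomes linear equivalence of pairs. Inflection points occur along the
  critical directions of the rational map \<open>t \<mapsto> - A(1, t) / B(1, t)\<close>, so convexity means that each of
  them is fixed, i.e. is an invariant line: the critical points, of total multiplicity 8, are then a
  subset of the six fixed points with multiplicities at most 4. Normalizing three of these points by
  a projective change of the direction determines the coefficients up to finitely many solutions for each partition of 8.
  The multiset of multiplicities separates all of the fourteen forms except for three pairs, which are
  told apart by the few linear maps preserving the marked points. Conversely, when the critical
  directions are fixed, a local first integral near each invariant line shows that a leaf meeting the
  line stays in it.
\<close>

section \<open>Binary forms\<close>

text \<open>The bridge from dynamics to linear algebra is \<open>order_wronsk\<close>: at a fixed
  direction of slope t the order of A(1, u) + t B(1, u) at u = t exceeds the critical multiplicity
  by exactly one. Prescribing critical fixed directions therefore means prescribing divisibility of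
  A + t B, which is linear in the coefficients. The bound of five critical directions reflects the
  identity sum of 1 / (1 - multiplier) = 1 over the six fixed points of a rational map of degree 5,
  which fails if all multipliers are 0. When there are five, the sixth fixed point is moved to
  infinity and the slope map becomes the Newton map of a quintic (\<open>newton_form\<close>). The
  obstacle in the converse is that convexity speaks of global leaves: a computation with 2-jets only
  locates an inflection point on an invariant line, and the whole leaf must then be shown to stay in
  that line. Leaves avoid the singular points, so a first integral near the regular points of the
  line, vanishing exactly on the line, is enough.\<close>

definition homog :: "nat \<Rightarrow> complex poly \<Rightarrow> complex \<Rightarrow> complex \<Rightarrow> complex" where
  "homog n p x y = (\<Sum>k\<le>n. coeff p k * x ^ (n - k) * y ^ k)"

lemma homog_one_left: "degree p \<le> n \<Longrightarrow> homog n p 1 y = poly p y"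
  proof -
  assume d: "degree p \<le> n"
  have "poly p y = (\<Sum>k\<le>degree p. coeff p k * y ^ k)"
    by (rule poly_altdef)
  also have "\<dots> = (\<Sum>k\<le>n. coeff p k * y ^ k)"
    using d by (intro sum.mono_neutral_left) (auto simp: coeff_eq_0)
  finally show ?thesis by (simp add: homog_def)
qed

lemma homog_zero_left: "homog n p 0 y = coeff p n * y ^ n"
proof -
  have "homog n p 0 y = (\<Sum>k\<in>{n}. coeff p k * 0 ^ (n - k) * y ^ k)"
    unfolding homog_def by (rule sum.mono_neutral_right) auto
  then show ?thesis by simp
qed

lemma homog_scale: "homog n p (c * x) (c * y) = c ^ n * homog n p x y"
proof -
  have "c ^ n = c ^ (n - k) * c ^ k" if "k \<le> n" for k
    using that by (simp flip: power_add)
  then show ?thesis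
    unfolding homog_def sum_distrib_left
    by (intro sum.cong) (auto simp: power_mult_distrib algebra_simps)
qed

lemma homog_nonzero_left:
  assumes "degree p \<le> n" "x \<noteq> 0"
  shows "homog n p x y = x ^ n * poly p (y / x)"
  using homog_scale[of n p x 1 "y / x"] assms by (simp add: homog_one_left)

lemma homog_add: "homog n (p + q) x y = homog n p x y + homog n q x y"
  by (simp add: homog_def algebra_simps sum.distrib)

lemma homog_smult: "homog n (smult c p) x y = c * homog n p x y"
  by (simp add: homog_def algebra_simps sum_distrib_left)

lemma homog_0 [simp]: "homog n 0 x y = 0"
  by (simp add: homog_def)

lemma coeff_mult_top:
  fixes p q :: "'a :: comm_semiring_0 poly"
  assumes "degree p \<le> m" "degree q \<le> n"
  shows "coeff (p * q) (m + n) = coeff p m * coeff q n"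
proof -
  have "coeff (p * q) (m + n) = (\<Sum>i\<in>{m}. coeff p i * coeff q (m + n - i))"
    unfolding coeff_mult
  proof (rule sum.mono_neutral_right)
    show "\<forall>i\<in>{..m + n} - {m}. coeff p i * coeff q (m + n - i) = 0"
    proof
      fix i assume "i \<in> {..m + n} - {m}"
      then consider "i > m" | "m + n - i > n" by fastforce
      then show "coeff p i * coeff q (m + n - i) = 0"
        using assms by cases (auto simp: coeff_eq_0)
    qed
  qed auto
  then show ?thesis by simp
qed

text \<open>At x = 0 only the coefficients of degree m, n and m + n are visible; the degree bounds
  make the last one the product of the other two even when some of them vanish.\<close>

lemma homog_mult:
  assumes "degree p \<le> m" "degree q \<le> n"
  shows "homog (m + n) (p * q) x y = homog m p x y * homog n q x y"
proof (cases "x = 0")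
  case True
  then show ?thesis
    by (simp add: homog_zero_left coeff_mult_top assms power_add)
next
  case False
  have "degree (p * q) \<le> m + n"
    using assms degree_mult_le[of p q] by linarith
  then show ?thesis
    using assms False by (simp add: homog_nonzero_left power_add)
qed

text \<open>Forms are kept as functions of two variables, so that a linear substitution is a plain
  composition. The witness p is the restriction to x = 1, in the slope coordinate y / x; a degree of
  p below n records a zero in the direction (0, 1).\<close>

definition bform :: "nat \<Rightarrow> (complex \<Rightarrow> complex \<Rightarrow> complex) \<Rightarrow> bool" where
  "bform n G \<longleftrightarrow> (\<exists>p. degree p \<le> n \<and> G = homog n p)"

lemma bform_homog [simp]: "degree p \<le> n \<Longrightarrow> bform n (homog n p)"
  unfolding bform_def by blast

lemma bform_zero: "bform n (\<lambda>x y. 0)"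
proof -
  have "(\<lambda>x y. 0) = homog n 0" by (intro ext) simp
  then show ?thesis unfolding bform_def by (intro exI[of _ 0]) auto
qed

lemma bform_add:
  assumes "bform n G" "bform n H"
  shows "bform n (\<lambda>x y. G x y + H x y)"
proof -
  obtain p q where "degree p \<le> n" "G = homog n p" "degree q \<le> n" "H = homog n q"
    using assms unfolding bform_def by auto
  then show ?thesis unfolding bform_def
    by (intro exI[of _ "p + q"]) (auto simp: homog_add fun_eq_iff degree_add_le)
qed

lemma bform_mult:
  assumes "bform m G" "bform n H"
  shows "bform (m + n) (\<lambda>x y. G x y * H x y)"
proof -
  obtain p q where *: "degree p \<le> m" "G = homog m p" "degree q \<le> n" "H = homog n q"
    using assms unfolding bform_def by auto
  have "degree (p * q) \<le> m + n"
    using * degree_mult_le[of p q] by linarith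
  then show ?thesis unfolding bform_def
    by (intro exI[of _ "p * q"]) (auto simp: homog_mult * fun_eq_iff)
qed

lemma bform_const: "bform 0 (\<lambda>x y. c)"
  unfolding bform_def by (intro exI[of _ "[:c:]"]) (simp add: homog_def fun_eq_iff)

lemma bform_linear: "bform 1 (\<lambda>x y. p * x + q * y)"
  unfolding bform_def by (intro exI[of _ "[:p, q:]"]) (simp add: homog_def fun_eq_iff)

lemma bform_scale: "bform n G \<Longrightarrow> bform n (\<lambda>x y. c * G x y)"
  using bform_mult[OF bform_const, of n G c] by simp

lemma bform_power: "bform n G \<Longrightarrow> bform (k * n) (\<lambda>x y. G x y ^ k)"
proof (induction k)
  case 0
  then show ?case using bform_const[of 1] by simp
next
  case (Suc k)
  then show ?case using bform_mult[of n G "k * n" "\<lambda>x y. G x y ^ k"] by simp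
qed

lemma bform_sum:
  "finite S \<Longrightarrow> (\<And>i. i \<in> S \<Longrightarrow> bform n (G i)) \<Longrightarrow> bform n (\<lambda>x y. \<Sum>i\<in>S. G i x y)"
  by (induction rule: finite_induct) (auto simp: bform_zero bform_add)

text \<open>Expanding into monomials exhibits the composition as a sum of products of linear forms,
  so the polynomial of the substituted form never has to be computed.\<close>

lemma bform_subst:
  assumes "bform n G"
  shows "bform n (\<lambda>x y. G (p * x + q * y) (r * x + s * y))"
proof -
  obtain g where g: "degree g \<le> n" "G = homog n g"
    using assms unfolding bform_def by auto
  have "bform n (\<lambda>x y. coeff g k * ((p * x + q * y) ^ (n - k) * (r * x + s * y) ^ k))"
    if "k \<le> n" for k
    using bform_scale[OF bform_mult[OF bform_power[OF bform_linear, of "n - k" p q]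
          bform_power[OF bform_linear, of k r s]], of "coeff g k"] that by simp
  then show ?thesis
    unfolding g(2) homog_def
    by (intro bform_sum) (auto simp: mult.assoc)
qed

lemma bform_scale_args: "bform n G \<Longrightarrow> G (c * x) (c * y) = c ^ n * G x y"
  unfolding bform_def using homog_scale by blast

section \<open>Pairs of quintic forms under linear maps\<close>

lemma homog_linear_power: "homog k ([:- t, 1:] ^ k) x y = (y - t * x) ^ k"
proof (induction k)
  case 0
  then show ?case by (simp add: homog_def)
next
  case (Suc k)
  have "degree ([:- t, 1:] ^ k) \<le> k"
    by (simp add: degree_linear_power)
  then have "homog (1 + k) ([:- t, 1:] * [:- t, 1:] ^ k) x y = homog 1 [:- t, 1:] x y * homog k ([:- t, 1:] ^ k) x y"
    by (intro homog_mult) simp_all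
  then show ?case using Suc by (simp add: homog_def algebra_simps)
qed

type_synonym form2 = "(complex \<Rightarrow> complex \<Rightarrow> complex) \<times> (complex \<Rightarrow> complex \<Rightarrow> complex)"

text \<open>Absence of a common zero off the origin is coprimality of the two forms over the complex
  numbers, in a shape that is visibly invariant under linear maps; \<open>hform_eval2\<close> and
  \<open>hform_coprime\<close> translate between the two.\<close>

definition hform :: "form2 \<Rightarrow> bool" where
  "hform w \<longleftrightarrow> bform 5 (fst w) \<and> bform 5 (snd w) \<and>
     (\<forall>x y. fst w x y = 0 \<and> snd w x y = 0 \<longrightarrow> x = 0 \<and> y = 0)"

text \<open>Contraction of A dx + B dy with the radial field. Its zero directions are the invariant
  lines through the origin, equivalently the fixed points of the slope map - A / B.\<close>

definition tang :: "form2 \<Rightarrow> complex \<times> complex \<Rightarrow> complex" where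
  "tang w v = fst v * fst w (fst v) (snd v) + snd v * snd w (fst v) (snd v)"

text \<open>For a pair without common zero and m at least 1: v is fixed and critical of multiplicity
  at least m. For v = (1, t) the left side is A + t B with the constant t, so the condition is
  linear in A and B. The bound on m keeps 4 - m from being truncated.\<close>

definition fixmult :: "nat \<Rightarrow> form2 \<Rightarrow> complex \<times> complex \<Rightarrow> bool" where
  "fixmult m w v \<longleftrightarrow> m \<le> 4 \<and> (\<exists>h. bform (4 - m) h \<and>
     (\<forall>x y. fst v * fst w x y + snd v * snd w x y = (snd v * x - fst v * y) ^ (m + 1) * h x y))"

text \<open>A double zero at v of some member of the pencil spanned by A and B, that is, a critical
  point of [A : B]; in this form v = (0, 1) needs no separate treatment.\<close>

definition crit :: "form2 \<Rightarrow> complex \<times> complex \<Rightarrow> bool" where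
  "crit w v \<longleftrightarrow> (\<exists>l n h. (l \<noteq> 0 \<or> n \<noteq> 0) \<and> bform 3 h \<and>
     (\<forall>x y. l * fst w x y + n * snd w x y = (snd v * x - fst v * y) ^ 2 * h x y))"

definition cross :: "complex \<times> complex \<Rightarrow> complex \<times> complex \<Rightarrow> complex" where
  "cross v u = fst v * snd u - snd v * fst u"

text \<open>The pull-back of w' under (x, y) -> (p x + q y, r x + s y) is k w; the two equations
  compare the coefficients of dx and of dy.\<close>

definition pulls :: "complex \<Rightarrow> complex \<Rightarrow> complex \<Rightarrow> complex \<Rightarrow> complex \<Rightarrow> form2 \<Rightarrow> form2 \<Rightarrow> bool" where
  "pulls p q r s k w' w \<longleftrightarrow> p * s - q * r \<noteq> 0 \<and> k \<noteq> 0 \<and>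
     (\<forall>x y. p * fst w' (p * x + q * y) (r * x + s * y) + r * snd w' (p * x + q * y) (r * x + s * y) = k * fst w x y \<and>
            q * fst w' (p * x + q * y) (r * x + s * y) + s * snd w' (p * x + q * y) (r * x + s * y) = k * snd w x y)"

definition lconj :: "form2 \<Rightarrow> form2 \<Rightarrow> bool" where
  "lconj w w' \<longleftrightarrow> (\<exists>p q r s k. pulls p q r s k w' w)"

lemma pullsD:
  assumes "pulls p q r s k w' w"
  shows "k * fst w x y = p * fst w' (p * x + q * y) (r * x + s * y) + r * snd w' (p * x + q * y) (r * x + s * y)"
    "k * snd w x y = q * fst w' (p * x + q * y) (r * x + s * y) + s * snd w' (p * x + q * y) (r * x + s * y)"
  using assms by (auto simp: pulls_def)

lemma pulls_sym:
  assumes P: "pulls p q r s k w' w" and d: "d = p * s - q * r"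
  shows "pulls (s / d) (- q / d) (- r / d) (p / d) (1 / k) w w'"
proof -
  have d0: "d \<noteq> 0" and k: "k \<noteq> 0" using P d by (auto simp: pulls_def)
  have 1: "k * fst w x y = p * fst w' (p * x + q * y) (r * x + s * y) + r * snd w' (p * x + q * y) (r * x + s * y)"
          "k * snd w x y = q * fst w' (p * x + q * y) (r * x + s * y) + s * snd w' (p * x + q * y) (r * x + s * y)" for x y
    using P by (auto simp: pulls_def)
  have e: "s / d * (p / d) - - q / d * (- r / d) = 1 / d"
  proof -
    have "s / d * (p / d) - - q / d * (- r / d) = (p * s - q * r) / (d * d)"
      by (simp add: diff_divide_distrib)
    then show ?thesis unfolding d[symmetric] using d0 by simp
  qed
  show ?thesis
    unfolding pulls_def
  proof (intro conjI allI)
    show "s / d * (p / d) - - q / d * (- r / d) \<noteq> 0" using e d0 by simp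
    show "1 / k \<noteq> 0" using k by simp
    fix x y
    define X where "X = s / d * x + - q / d * y"
    define Y where "Y = - r / d * x + p / d * y"
    have XY: "p * X + q * Y = x" "r * X + s * Y = y"
      using d0 unfolding X_def Y_def by (simp_all add: field_simps) (simp_all add: d algebra_simps)
    have w: "fst w X Y = (p * fst w' x y + r * snd w' x y) / k"
            "snd w X Y = (q * fst w' x y + s * snd w' x y) / k"
      using 1[of X Y] k unfolding XY by (simp_all add: field_simps)
    have "s * (p * a + r * b) - r * (q * a + s * b) = d * a" "- q * (p * a + r * b) + p * (q * a + s * b) = d * b" for a b
      by (simp_all add: d algebra_simps)
    note * = this[of "fst w' x y" "snd w' x y"]
    have "s / d * fst w X Y + - r / d * snd w X Y = (s * (p * fst w' x y + r * snd w' x y) - r * (q * fst w' x y + s * snd w' x y)) / (d * k)"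
      unfolding w using d0 k by (simp add: field_simps)
    then show "s / d * fst w (s / d * x + - q / d * y) (- r / d * x + p / d * y) + - r / d * snd w (s / d * x + - q / d * y) (- r / d * x + p / d * y) =
           1 / k * fst w' x y"
      unfolding * X_def Y_def using d0 by simp
    have "- q / d * fst w X Y + p / d * snd w X Y = (- q * (p * fst w' x y + r * snd w' x y) + p * (q * fst w' x y + s * snd w' x y)) / (d * k)"
      unfolding w using d0 k by (simp add: field_simps)
    then show "- q / d * fst w (s / d * x + - q / d * y) (- r / d * x + p / d * y) + p / d * snd w (s / d * x + - q / d * y) (- r / d * x + p / d * y) =
           1 / k * snd w' x y"
      unfolding * X_def Y_def using d0 by simp
  qed
qed

lemma pulls_trans:
  assumes "pulls p q r s k w' w" "pulls p' q' r' s' k' w'' w'"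
  shows "pulls (p' * p + q' * r) (p' * q + q' * s) (r' * p + s' * r) (r' * q + s' * s) (k * k') w'' w"
proof -
  have det: "(p' * p + q' * r) * (r' * q + s' * s) - (p' * q + q' * s) * (r' * p + s' * r) = (p * s - q * r) * (p' * s' - q' * r')"
    by (simp add: algebra_simps)
  have arg: "(a' * a + b' * c) * x + (a' * b + b' * e) * y = a' * (a * x + b * y) + b' * (c * x + e * y)" for a b c e a' b' x y :: complex
    by (simp add: algebra_simps)
  have 1: "k * fst w x y = p * fst w' (p * x + q * y) (r * x + s * y) + r * snd w' (p * x + q * y) (r * x + s * y)"
          "k * snd w x y = q * fst w' (p * x + q * y) (r * x + s * y) + s * snd w' (p * x + q * y) (r * x + s * y)" for x y
    using assms(1) by (auto simp: pulls_def)
  have 2: "k' * fst w' x y = p' * fst w'' (p' * x + q' * y) (r' * x + s' * y) + r' * snd w'' (p' * x + q' * y) (r' * x + s' * y)"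
          "k' * snd w' x y = q' * fst w'' (p' * x + q' * y) (r' * x + s' * y) + s' * snd w'' (p' * x + q' * y) (r' * x + s' * y)" for x y
    using assms(2) by (auto simp: pulls_def)
  have 3: "k * k' * fst w x y = p * (k' * fst w' (p * x + q * y) (r * x + s * y)) + r * (k' * snd w' (p * x + q * y) (r * x + s * y))"
          "k * k' * snd w x y = q * (k' * fst w' (p * x + q * y) (r * x + s * y)) + s * (k' * snd w' (p * x + q * y) (r * x + s * y))" for x y
  proof -
    have "k * k' * fst w x y = k' * (k * fst w x y)" "k * k' * snd w x y = k' * (k * snd w x y)"
      by simp_all
    then show "k * k' * fst w x y = p * (k' * fst w' (p * x + q * y) (r * x + s * y)) + r * (k' * snd w' (p * x + q * y) (r * x + s * y))"
      "k * k' * snd w x y = q * (k' * fst w' (p * x + q * y) (r * x + s * y)) + s * (k' * snd w' (p * x + q * y) (r * x + s * y))"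
      unfolding 1 by (simp_all add: algebra_simps)
  qed
  show ?thesis
  proof -
    have "(p * s - q * r) * (p' * s' - q' * r') \<noteq> 0" "k * k' \<noteq> 0"
      using assms by (simp_all add: pulls_def)
    then show ?thesis
      unfolding pulls_def det arg 3 2 by (simp add: algebra_simps)
  qed
qed

lemma lconj_sym: "lconj w w' \<Longrightarrow> lconj w' w"
  unfolding lconj_def using pulls_sym by blast

lemma lconj_trans: "lconj w w' \<Longrightarrow> lconj w' w'' \<Longrightarrow> lconj w w''"
  unfolding lconj_def using pulls_trans by blast

lemma tang_pulls:
  "pulls p q r s k w' w \<Longrightarrow> tang w' (p * fst v + q * snd v, r * fst v + s * snd v) = k * tang w v"
proof -
  assume P: "pulls p q r s k w' w"
  have "k * tang w v = fst v * (k * fst w (fst v) (snd v)) + snd v * (k * snd w (fst v) (snd v))"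
    by (simp add: tang_def algebra_simps)
  then show ?thesis unfolding pullsD[OF P] by (simp add: tang_def algebra_simps)
qed

text \<open>Pairing a direction with the form is covariant: up to k, the combination of A and B
  belonging to v is the pull-back of the one belonging to the image of v, and the linear form
  vanishing at v only acquires the determinant as a factor.\<close>

lemma fixmult_pulls_aux:
  assumes P: "pulls p q r s k w' w" and F: "fixmult m w' (p * v1 + q * v2, r * v1 + s * v2)"
  shows "fixmult m w (v1, v2)"
proof -
  obtain h where h: "bform (4 - m) h" and e: "\<And>x y. (p * v1 + q * v2) * fst w' x y + (r * v1 + s * v2) * snd w' x y = ((r * v1 + s * v2) * x - (p * v1 + q * v2) * y) ^ (m + 1) * h x y"
    and m: "m \<le> 4"
    using F by (auto simp: fixmult_def)
  define d where "d = p * s - q * r"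
  have k: "k \<noteq> 0" using P by (simp add: pulls_def)
  have "k * (v1 * fst w x y + v2 * snd w x y) = (d * (v2 * x - v1 * y)) ^ (m + 1) * h (p * x + q * y) (r * x + s * y)" for x y
  proof -
    have "k * (v1 * fst w x y + v2 * snd w x y) = v1 * (k * fst w x y) + v2 * (k * snd w x y)"
      by (simp add: algebra_simps)
    also have "\<dots> = (p * v1 + q * v2) * fst w' (p * x + q * y) (r * x + s * y) + (r * v1 + s * v2) * snd w' (p * x + q * y) (r * x + s * y)"
      using P unfolding pullsD[OF P] by (simp add: algebra_simps)
    also have "\<dots> = ((r * v1 + s * v2) * (p * x + q * y) - (p * v1 + q * v2) * (r * x + s * y)) ^ (m + 1) * h (p * x + q * y) (r * x + s * y)"
      by (rule e)
    also have "(r * v1 + s * v2) * (p * x + q * y) - (p * v1 + q * v2) * (r * x + s * y) = d * (v2 * x - v1 * y)"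
      by (simp add: d_def algebra_simps)
    finally show ?thesis .
  qed
  then have "v1 * fst w x y + v2 * snd w x y = (v2 * x - v1 * y) ^ (m + 1) * (d ^ (m + 1) / k * h (p * x + q * y) (r * x + s * y))" for x y
    using k by (simp add: power_mult_distrib nonzero_eq_divide_eq mult.commute mult.left_commute flip: power_Suc)
  moreover have "bform (4 - m) (\<lambda>x y. d ^ (m + 1) / k * h (p * x + q * y) (r * x + s * y))"
    by (intro bform_scale bform_subst h)
  ultimately show ?thesis using m unfolding fixmult_def fst_conv snd_conv by blast
qed

lemma fixmult_pulls:
  assumes P: "pulls p q r s k w' w"
  shows "fixmult m w (v1, v2) \<longleftrightarrow> fixmult m w' (p * v1 + q * v2, r * v1 + s * v2)"
proof
  define d where "d = p * s - q * r"
  have d0: "d \<noteq> 0" using P by (simp add: pulls_def d_def)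
  assume F: "fixmult m w (v1, v2)"
  have "s / d * (p * v1 + q * v2) + - q / d * (r * v1 + s * v2) = v1" "- r / d * (p * v1 + q * v2) + p / d * (r * v1 + s * v2) = v2"
    using d0 by (simp_all add: field_simps) (simp_all add: d_def algebra_simps)
  then show "fixmult m w' (p * v1 + q * v2, r * v1 + s * v2)"
    using fixmult_pulls_aux[OF pulls_sym[OF P d_def], of m "p * v1 + q * v2" "r * v1 + s * v2"] F by simp
qed (rule fixmult_pulls_aux[OF P])

text \<open>Unlike in \<open>fixmult_pulls_aux\<close>, the combination (l, n) is not tied to v; it
  is carried back by the adjugate matrix, whence \<open>l'\<close> and \<open>n'\<close>.\<close>

lemma crit_pulls_aux:
  assumes P: "pulls p q r s k w' w" and F: "crit w' (p * v1 + q * v2, r * v1 + s * v2)"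
  shows "crit w (v1, v2)"
proof -
  obtain l n h where h: "bform 3 h" "l \<noteq> 0 \<or> n \<noteq> 0" and e: "\<And>x y. l * fst w' x y + n * snd w' x y = ((r * v1 + s * v2) * x - (p * v1 + q * v2) * y) ^ 2 * h x y"
    using F by (auto simp: crit_def)
  define d where "d = p * s - q * r"
  have k: "k \<noteq> 0" and d0: "d \<noteq> 0" using P by (simp_all add: pulls_def d_def)
  define l' where "l' = s * l - q * n"
  define n' where "n' = p * n - r * l"
  have ln: "l' * p + n' * q = d * l" "l' * r + n' * s = d * n"
    by (simp_all add: l'_def n'_def d_def algebra_simps)
  have "k * (l' * fst w x y + n' * snd w x y) = d ^ 3 * (v2 * x - v1 * y) ^ 2 * h (p * x + q * y) (r * x + s * y)" for x y
  proof -
    have "k * (l' * fst w x y + n' * snd w x y) = l' * (k * fst w x y) + n' * (k * snd w x y)"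
      by (simp add: algebra_simps)
    also have "\<dots> = (l' * p + n' * q) * fst w' (p * x + q * y) (r * x + s * y) + (l' * r + n' * s) * snd w' (p * x + q * y) (r * x + s * y)"
      using P unfolding pullsD[OF P] by (simp add: algebra_simps)
    also have "\<dots> = d * (l * fst w' (p * x + q * y) (r * x + s * y) + n * snd w' (p * x + q * y) (r * x + s * y))"
      unfolding ln by (simp add: algebra_simps)
    also have "\<dots> = d * (((r * v1 + s * v2) * (p * x + q * y) - (p * v1 + q * v2) * (r * x + s * y)) ^ 2 * h (p * x + q * y) (r * x + s * y))"
      unfolding e ..
    also have "(r * v1 + s * v2) * (p * x + q * y) - (p * v1 + q * v2) * (r * x + s * y) = d * (v2 * x - v1 * y)"
      by (simp add: d_def algebra_simps)
    finally show ?thesis by (simp add: power_mult_distrib power2_eq_square power3_eq_cube)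
  qed
  then have "l' * fst w x y + n' * snd w x y = (v2 * x - v1 * y) ^ 2 * (d ^ 3 / k * h (p * x + q * y) (r * x + s * y))" for x y
    using k by (simp add: field_simps)
  moreover have "bform 3 (\<lambda>x y. d ^ 3 / k * h (p * x + q * y) (r * x + s * y))"
    by (intro bform_scale bform_subst h)
  moreover have "l' \<noteq> 0 \<or> n' \<noteq> 0"
    using ln d0 h(2) by auto
  ultimately show ?thesis unfolding crit_def fst_conv snd_conv by blast
qed

lemma crit_pulls:
  assumes P: "pulls p q r s k w' w"
  shows "crit w (v1, v2) \<longleftrightarrow> crit w' (p * v1 + q * v2, r * v1 + s * v2)"
proof
  define d where "d = p * s - q * r"
  have d0: "d \<noteq> 0" using P by (simp add: pulls_def d_def)
  assume F: "crit w (v1, v2)"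
  have "s / d * (p * v1 + q * v2) + - q / d * (r * v1 + s * v2) = v1" "- r / d * (p * v1 + q * v2) + p / d * (r * v1 + s * v2) = v2"
    using d0 by (simp_all add: field_simps) (simp_all add: d_def algebra_simps)
  then show "crit w' (p * v1 + q * v2, r * v1 + s * v2)"
    using crit_pulls_aux[OF pulls_sym[OF P d_def], of "p * v1 + q * v2" "r * v1 + s * v2"] F by simp
qed (rule crit_pulls_aux[OF P])

lemma hform_pulls:
  assumes P: "pulls p q r s k w' w" and H: "hform w'"
  shows "hform w"
proof -
  define d where "d = p * s - q * r"
  have k: "k \<noteq> 0" and d0: "d \<noteq> 0" using P by (simp_all add: pulls_def d_def)
  have w: "fst w = (\<lambda>x y. (p / k) * fst w' (p * x + q * y) (r * x + s * y) + (r / k) * snd w' (p * x + q * y) (r * x + s * y))"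
    "snd w = (\<lambda>x y. (q / k) * fst w' (p * x + q * y) (r * x + s * y) + (s / k) * snd w' (p * x + q * y) (r * x + s * y))"
    using P k by (auto simp: pulls_def fun_eq_iff field_simps)
  have "bform 5 (fst w)" "bform 5 (snd w)"
    unfolding w using H[unfolded hform_def] by (auto intro!: bform_add bform_scale bform_subst simp del: times_divide_eq_left)
  moreover have "x = 0 \<and> y = 0" if "fst w x y = 0" "snd w x y = 0" for x y
  proof -
    let ?X = "p * x + q * y" and ?Y = "r * x + s * y"
    have e: "p * fst w' ?X ?Y + r * snd w' ?X ?Y = 0" "q * fst w' ?X ?Y + s * snd w' ?X ?Y = 0"
      using P that by (auto simp: pulls_def)
    have "d * fst w' ?X ?Y = s * (p * fst w' ?X ?Y + r * snd w' ?X ?Y) - r * (q * fst w' ?X ?Y + s * snd w' ?X ?Y)"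
      "d * snd w' ?X ?Y = p * (q * fst w' ?X ?Y + s * snd w' ?X ?Y) - q * (p * fst w' ?X ?Y + r * snd w' ?X ?Y)"
      by (simp_all add: d_def algebra_simps)
    then have "fst w' ?X ?Y = 0" "snd w' ?X ?Y = 0"
      unfolding e using d0 by simp_all
    then have XY: "?X = 0" "?Y = 0" using H unfolding hform_def by blast+
    have "d * x = s * ?X - q * ?Y" "d * y = p * ?Y - r * ?X"
      by (simp_all add: d_def algebra_simps)
    then show ?thesis unfolding XY using d0 by simp
  qed
  ultimately show ?thesis unfolding hform_def by blast
qed

lemma pulls_exists:
  assumes "p * s - q * r \<noteq> 0"
  obtains w where "pulls p q r s 1 w' w"
proof
  show "pulls p q r s 1 w' (\<lambda>x y. p * fst w' (p * x + q * y) (r * x + s * y) + r * snd w' (p * x + q * y) (r * x + s * y),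
     \<lambda>x y. q * fst w' (p * x + q * y) (r * x + s * y) + s * snd w' (p * x + q * y) (r * x + s * y))"
    using assms by (simp add: pulls_def)
qed

lemma fixmult_scale:
  assumes "c \<noteq> 0" "fixmult m w (v1, v2)"
  shows "fixmult m w (c * v1, c * v2)"
proof -
  obtain h where h: "bform (4 - m) h" and e: "\<And>x y. v1 * fst w x y + v2 * snd w x y = (v2 * x - v1 * y) ^ (m + 1) * h x y"
    and m: "m \<le> 4"
    using assms by (auto simp: fixmult_def)
  have "c * v1 * fst w x y + c * v2 * snd w x y = (c * v2 * x - c * v1 * y) ^ (m + 1) * (c / c ^ (m + 1) * h x y)" for x y
  proof -
    have "c * v1 * fst w x y + c * v2 * snd w x y = c * ((v2 * x - v1 * y) ^ (m + 1) * h x y)"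
      unfolding e[symmetric] by (simp add: algebra_simps)
    also have "\<dots> = (c * (v2 * x - v1 * y)) ^ (m + 1) * (c / c ^ (m + 1) * h x y)"
      using assms(1) unfolding power_mult_distrib by (simp del: power_Suc)
    finally show ?thesis by (simp only: right_diff_distrib mult.assoc)
  qed
  then show ?thesis
    using m bform_scale[OF h, of "c / c ^ (m + 1)"] unfolding fixmult_def fst_conv snd_conv by blast
qed

lemma poly_eqI_fun: "(\<And>x. poly p x = poly q x) \<Longrightarrow> p = (q :: complex poly)"
  by (simp add: poly_eq_poly_eq_iff[symmetric] fun_eq_iff)

text \<open>Setting x = 1 turns divisibility of forms into divisibility of polynomials; conversely
  the degree count 5 = (m + 1) + (4 - m) bounds the cofactor, which can then be homogenised.\<close>

lemma fixmult_finite_iff: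
  assumes "fst w = homog 5 a" "snd w = homog 5 b" "degree a \<le> 5" "degree b \<le> 5"
  shows "fixmult m w (1, t) \<longleftrightarrow> m \<le> 4 \<and> [:- t, 1:] ^ (m + 1) dvd a + smult t b"
proof
  assume "fixmult m w (1, t)"
  then obtain h where m: "m \<le> 4" and h: "bform (4 - m) h"
    and e: "\<And>x y. fst w x y + t * snd w x y = (t * x - y) ^ (m + 1) * h x y"
    by (auto simp: fixmult_def)
  obtain q where q: "degree q \<le> 4 - m" "h = homog (4 - m) q"
    using h by (auto simp: bform_def)
  have "a + smult t b = [:- t, 1:] ^ (m + 1) * smult ((- 1) ^ (m + 1)) q"
  proof (rule poly_eqI_fun)
    fix y
    have "poly (a + smult t b) y = (- 1 * (y - t)) ^ (m + 1) * poly q y"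
      using e[of 1 y] assms q by (simp add: homog_one_left)
    then show "poly (a + smult t b) y = poly ([:- t, 1:] ^ (m + 1) * smult ((- 1) ^ (m + 1)) q) y"
      unfolding power_mult_distrib by (simp add: del: power_Suc)
  qed
  then show "m \<le> 4 \<and> [:- t, 1:] ^ (m + 1) dvd a + smult t b"
    using m by (metis dvd_triv_left)
next
  assume *: "m \<le> 4 \<and> [:- t, 1:] ^ (m + 1) dvd a + smult t b"
  then obtain q where q: "a + smult t b = [:- t, 1:] ^ (m + 1) * q"
    by (auto simp: dvd_def)
  have dl: "degree ([:- t, 1:] ^ (m + 1)) = m + 1"
    by (rule degree_linear_power)
  have dq: "degree q \<le> 4 - m"
  proof (cases "q = 0")
    case False
    have "degree (a + smult t b) \<le> 5"
      using assms by (intro degree_add_le) (auto intro: order_trans[OF degree_smult_le])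
    moreover have "degree (a + smult t b) = m + 1 + degree q"
      unfolding q using False dl by (subst degree_mult_eq) auto
    ultimately show ?thesis by simp
  qed simp
  have "fst w x y + t * snd w x y = (t * x - y) ^ (m + 1) * ((- 1) ^ (m + 1) * homog (4 - m) q x y)" for x y
  proof -
    have "fst w x y + t * snd w x y = homog 5 (a + smult t b) x y"
      by (simp add: assms homog_add homog_smult)
    also have "\<dots> = homog ((m + 1) + (4 - m)) ([:- t, 1:] ^ (m + 1) * q) x y"
      using * by (simp add: q)
    also have "\<dots> = (y - t * x) ^ (m + 1) * homog (4 - m) q x y"
      using dl dq by (subst homog_mult) (simp_all only: homog_linear_power order_refl)
    also have "y - t * x = - 1 * (t * x - y)" by simp
    finally show ?thesis unfolding power_mult_distrib by simp
  qed
  then show "fixmult m w (1, t)"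
    unfolding fixmult_def using * bform_scale[OF bform_homog[OF dq], of "(- 1) ^ (m + 1)"] by auto
qed

text \<open>In the direction (0, 1) only B enters, and divisibility by a power of x is a drop of the
  degree of b.\<close>

lemma fixmult_infinity_iff:
  assumes "snd w = homog 5 b" "degree b \<le> 5"
  shows "fixmult m w (0, 1) \<longleftrightarrow> m \<le> 4 \<and> degree b \<le> 4 - m"
proof
  assume "fixmult m w (0, 1)"
  then obtain h where m: "m \<le> 4" and h: "bform (4 - m) h"
    and e: "\<And>x y. snd w x y = x ^ (m + 1) * h x y"
    by (auto simp: fixmult_def)
  obtain q where q: "degree q \<le> 4 - m" "h = homog (4 - m) q"
    using h by (auto simp: bform_def)
  have "b = q"
  proof (rule poly_eqI_fun)
    fix y show "poly b y = poly q y"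
      using e[of 1 y] assms q by (simp add: homog_one_left)
  qed
  then show "m \<le> 4 \<and> degree b \<le> 4 - m" using m q by simp
next
  assume *: "m \<le> 4 \<and> degree b \<le> 4 - m"
  have "snd w x y = x ^ (m + 1) * homog (4 - m) b x y" for x y
  proof -
    have "homog ((m + 1) + (4 - m)) (monom 1 0 * b) x y = homog (m + 1) (monom 1 0) x y * homog (4 - m) b x y"
      using * by (intro homog_mult) (auto simp: degree_monom_eq)
    moreover have "homog (m + 1) (monom 1 0) x y = x ^ (m + 1)"
      unfolding homog_def by (subst sum.remove[of _ 0]) auto
    ultimately show ?thesis using * assms by (simp add: monom_0)
  qed
  then show "fixmult m w (0, 1)"
    unfolding fixmult_def fst_conv snd_conv using * bform_homog[of b "4 - m"] by (intro conjI exI[of _ "homog (4 - m) b"]) auto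
qed

section \<open>Critical directions and the Wronskian\<close>

text \<open>Numerator of the derivative of the slope map - a / b.\<close>

definition wronsk :: "complex poly \<Rightarrow> complex poly \<Rightarrow> complex poly" where
  "wronsk a b = a * pderiv b - pderiv a * b"

lemma double_root_iff: "[:- t, 1:] ^ 2 dvd (p :: complex poly) \<longleftrightarrow> poly p t = 0 \<and> poly (pderiv p) t = 0"
proof
  assume "[:- t, 1:] ^ 2 dvd p"
  then obtain q where "p = [:- t, 1:] * ([:- t, 1:] * q)"
    unfolding dvd_def power2_eq_square mult.assoc by blast
  then show "poly p t = 0 \<and> poly (pderiv p) t = 0"
    by (simp only: pderiv_mult) simp
next
  assume *: "poly p t = 0 \<and> poly (pderiv p) t = 0"
  then obtain q where q: "p = [:- t, 1:] * q" by (auto simp: poly_eq_0_iff_dvd dvd_def)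
  have "poly q t = 0" using * unfolding q by (simp add: pderiv_mult pderiv_pCons pderiv_diff pderiv_smult)
  then obtain r where "q = [:- t, 1:] * r" by (auto simp: poly_eq_0_iff_dvd dvd_def)
  then have "p = [:- t, 1:] ^ 2 * r" using q by (simp only: power2_eq_square mult.assoc)
  then show "[:- t, 1:] ^ 2 dvd p" by simp
qed

text \<open>The pencil member vanishing at t is b(t) a - a(t) b. Its derivative at t is minus the
  Wronskian, so its zero is double exactly when the Wronskian vanishes.\<close>

lemma crit_finite_iff:
  assumes "fst w = homog 5 a" "snd w = homog 5 b" "degree a \<le> 5" "degree b \<le> 5" "hform w"
  shows "crit w (1, t) \<longleftrightarrow> poly (wronsk a b) t = 0"
proof
  assume "crit w (1, t)"
  then obtain l n h where ln: "l \<noteq> 0 \<or> n \<noteq> 0" and h: "bform 3 h"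
    and e: "\<And>x y. l * fst w x y + n * snd w x y = (t * x - y) ^ 2 * h x y"
    by (auto simp: crit_def)
  obtain q where q: "degree q \<le> 3" "h = homog 3 q"
    using h by (auto simp: bform_def)
  have eq: "smult l a + smult n b = [:- t, 1:] ^ 2 * q"
  proof (rule poly_eqI_fun)
    fix y show "poly (smult l a + smult n b) y = poly ([:- t, 1:] ^ 2 * q) y"
      using e[of 1 y] assms q by (simp add: homog_one_left power2_commute)
  qed
  then have "[:- t, 1:] ^ 2 dvd smult l a + smult n b" by simp
  then have z: "l * poly a t + n * poly b t = 0" "l * poly (pderiv a) t + n * poly (pderiv b) t = 0"
    unfolding double_root_iff by (simp_all add: pderiv_add pderiv_smult)
  have "l * poly (wronsk a b) t = (l * poly a t + n * poly b t) * poly (pderiv b) t - (l * poly (pderiv a) t + n * poly (pderiv b) t) * poly b t"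
    "n * poly (wronsk a b) t = (l * poly (pderiv a) t + n * poly (pderiv b) t) * poly a t - (l * poly a t + n * poly b t) * poly (pderiv a) t"
    by (simp_all add: wronsk_def algebra_simps)
  then show "poly (wronsk a b) t = 0" using z ln by auto
next
  assume W: "poly (wronsk a b) t = 0"
  define l where "l = poly b t"
  define n where "n = - poly a t"
  have "fst w 1 t = poly a t" "snd w 1 t = poly b t"
    using assms by (simp_all add: homog_one_left)
  moreover have "\<not> (fst w 1 t = 0 \<and> snd w 1 t = 0)"
    using \<open>hform w\<close> unfolding hform_def by (metis zero_neq_one)
  ultimately have ln: "l \<noteq> 0 \<or> n \<noteq> 0"
    unfolding l_def n_def by auto
  have "[:- t, 1:] ^ 2 dvd smult l a + smult n b"
  proof -
    have "l * poly a t + n * poly b t = 0"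
      by (simp add: l_def n_def)
    moreover have "l * poly (pderiv a) t + n * poly (pderiv b) t = - poly (wronsk a b) t"
      by (simp add: l_def n_def wronsk_def)
    ultimately show ?thesis
      unfolding double_root_iff using W by (simp add: pderiv_add pderiv_smult)
  qed
  then obtain q where q: "smult l a + smult n b = [:- t, 1:] ^ 2 * q"
    by (rule dvdE)
  have dq: "degree q \<le> 3"
  proof (cases "q = 0")
    case False
    have "degree (smult l a + smult n b) \<le> 5"
      using assms by (intro degree_add_le) (auto intro: order_trans[OF degree_smult_le])
    moreover have "degree (smult l a + smult n b) = 2 + degree q"
      unfolding q using False by (subst degree_mult_eq) (auto simp: degree_linear_power)
    ultimately show ?thesis by simp
  qed simp
  have "l * fst w x y + n * snd w x y = (t * x - y) ^ 2 * homog 3 q x y" for x y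
  proof -
    have "l * fst w x y + n * snd w x y = homog 5 (smult l a + smult n b) x y"
      by (simp add: assms homog_add homog_smult)
    also have "\<dots> = homog (2 + 3) ([:- t, 1:] ^ 2 * q) x y"
      unfolding q by simp
    also have "\<dots> = (y - t * x) ^ 2 * homog 3 q x y"
      using dq by (subst homog_mult) (simp_all only: degree_linear_power homog_linear_power order_refl)
    finally show ?thesis by (simp add: power2_commute)
  qed
  then show "crit w (1, t)"
    unfolding crit_def using ln bform_homog[OF dq] by auto
qed

lemma homog_5: "homog 5 p x y = coeff p 0 * x ^ 5 + coeff p 1 * x ^ 4 * y + coeff p 2 * x ^ 3 * y ^ 2 +
    coeff p 3 * x ^ 2 * y ^ 3 + coeff p 4 * x * y ^ 4 + coeff p 5 * y ^ 5"
  by (simp add: homog_def eval_nat_numeral)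

text \<open>The hypothesis on coefficients is the vanishing of the coefficient of t^8 in the
  Wronskian: a critical point at infinity is a drop of its degree.\<close>

lemma crit_infinity:
  assumes "fst w = homog 5 a" "snd w = homog 5 b" "hform w" "coeff a 4 * coeff b 5 = coeff a 5 * coeff b 4"
  shows "crit w (0, 1)"
proof -
  define l where "l = coeff b 5"
  define n where "n = - coeff a 5"
  have ab: "fst w 0 1 = coeff a 5" "snd w 0 1 = coeff b 5"
    by (simp_all add: assms homog_zero_left)
  moreover have "\<not> (fst w 0 1 = 0 \<and> snd w 0 1 = 0)"
    using \<open>hform w\<close> unfolding hform_def by (metis zero_neq_one)
  ultimately have ln: "l \<noteq> 0 \<or> n \<noteq> 0"
    unfolding l_def n_def by auto
  define h where "h = (\<lambda>k. l * coeff a k + n * coeff b k)"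
  have z: "h 5 = 0" "h 4 = 0"
    using assms(4) unfolding l_def n_def h_def by (simp_all add: mult.commute)
  have "l * fst w x y + n * snd w x y = (1 * x - 0 * y) ^ 2 * homog 3 [:h 0, h 1, h 2, h 3:] x y" for x y
  proof -
    have "l * fst w x y + n * snd w x y = h 0 * x ^ 5 + h 1 * x ^ 4 * y + h 2 * x ^ 3 * y ^ 2 + h 3 * x ^ 2 * y ^ 3 + h 4 * x * y ^ 4 + h 5 * y ^ 5"
      unfolding assms(1,2) homog_5 h_def by (simp add: algebra_simps)
    also have "\<dots> = x ^ 2 * (h 0 * x ^ 3 + h 1 * x ^ 2 * y + h 2 * x * y ^ 2 + h 3 * y ^ 3)"
      unfolding z by (simp add: algebra_simps eval_nat_numeral)
    also have "h 0 * x ^ 3 + h 1 * x ^ 2 * y + h 2 * x * y ^ 2 + h 3 * y ^ 3 = homog 3 [:h 0, h 1, h 2, h 3:] x y"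
      by (simp add: homog_def eval_nat_numeral)
    finally show ?thesis by simp
  qed
  moreover have "bform 3 (homog 3 [:h 0, h 1, h 2, h 3:])"
    by (intro bform_homog) simp
  ultimately show ?thesis unfolding crit_def fst_conv snd_conv using ln by blast
qed

text \<open>The fundamental theorem of algebra on the projective line: if the degree of the
  polynomial is below n, the missing zero is (0, 1).\<close>

lemma bform_has_zero:
  assumes "bform n G" "n \<ge> 1"
  obtains x y where "x \<noteq> 0 \<or> y \<noteq> 0" "G x y = 0"
proof -
  obtain g where g: "degree g \<le> n" "G = homog n g"
    using assms(1) by (auto simp: bform_def)
  show ?thesis
  proof (cases "degree g = n")
    case True
    then have "\<not> constant (poly g)"
      using assms(2) by (simp add: constant_degree)
    then obtain t where "poly g t = 0"
      using fundamental_theorem_of_algebra by blast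
    then show ?thesis using that[of 1 t] g by (simp add: homog_one_left)
  next
    case False
    then have "coeff g n = 0" using g(1) by (simp add: coeff_eq_0)
    then show ?thesis using that[of 0 1] g by (simp add: homog_zero_left)
  qed
qed

lemma hform_obtain:
  assumes "hform w"
  obtains a b where "fst w = homog 5 a" "snd w = homog 5 b" "degree a \<le> 5" "degree b \<le> 5"
  using assms unfolding hform_def bform_def by blast

lemma hform_nonzero:
  assumes "hform w" "x \<noteq> 0 \<or> y \<noteq> 0"
  shows "fst w x y \<noteq> 0 \<or> snd w x y \<noteq> 0"
  using assms unfolding hform_def by blast

text \<open>A relation with l nonzero would turn every zero direction of B into one of A, and B has
  a zero direction; likewise with the roles exchanged.\<close>

lemma hform_not_proportional:
  assumes "hform w" "\<And>x y. l * fst w x y + n * snd w x y = 0"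
  shows "l = 0 \<and> n = 0"
proof (rule ccontr)
  assume "\<not> (l = 0 \<and> n = 0)"
  then consider "l \<noteq> 0" | "n \<noteq> 0" by auto
  then show False
  proof cases
    case 1
    have "bform 5 (snd w)" using assms(1) unfolding hform_def by blast
    then obtain x y where xy: "x \<noteq> 0 \<or> y \<noteq> 0" "snd w x y = 0"
      by (rule bform_has_zero) auto
    then show False using assms(2)[of x y] 1 hform_nonzero[OF assms(1) xy(1)] by simp
  next
    case 2
    have "bform 5 (fst w)" using assms(1) unfolding hform_def by blast
    then obtain x y where xy: "x \<noteq> 0 \<or> y \<noteq> 0" "fst w x y = 0"
      by (rule bform_has_zero) auto
    then show False using assms(2)[of x y] 2 hform_nonzero[OF assms(1) xy(1)] by simp
  qed
qed

text \<open>The Wronskian does not change when a is replaced by g = a + t b. Writing g = (u -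
  t)^(n+1) h, a factor (u - t)^n splits off, and the cofactor takes the value - (n+1) h(t) b(t) at
  t, nonzero because a and b have no common zero.\<close>

lemma order_wronsk:
  assumes w: "fst w = homog 5 a" "snd w = homog 5 b" "degree a \<le> 5" "degree b \<le> 5" "hform w"
    and fx: "poly (a + smult t b) t = 0"
  shows "wronsk a b \<noteq> 0" "order t (a + smult t b) = Suc (order t (wronsk a b))" "a + smult t b \<noteq> 0" "poly b t \<noteq> 0"
proof -
  define g where "g = a + smult t b"
  have ab: "fst w 1 t = poly a t" "snd w 1 t = poly b t"
    using w by (simp_all add: homog_one_left)
  show bt: "poly b t \<noteq> 0"
    using hform_nonzero[OF w(5), of 1 t] fx ab by auto
  have g0: "g \<noteq> 0"
  proof
    assume "g = 0"
    then have "1 * fst w x y + t * snd w x y = 0" for x y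
      using homog_add[of 5 a "smult t b" x y] by (simp add: w homog_smult g_def)
    from hform_not_proportional[OF w(5) this] show False by simp
  qed
  then show "a + smult t b \<noteq> 0" by (simp add: g_def)
  obtain h where h: "g = [:- t, 1:] ^ order t g * h" "\<not> [:- t, 1:] dvd h"
    using order_decomp[OF g0] by blast
  have "order t g \<noteq> 0"
    using fx g0 order_root[of g t] by (simp add: g_def)
  then obtain n where n: "order t g = Suc n" by (cases "order t g") auto
  have aux: "e * p * h * b' - (e * p * h' + smult c (h * p)) * b = p * (e * h * b' - e * h' * b - smult c (h * b))"
    for e p h b' h' b :: "complex poly" and c
    by (simp add: algebra_simps)
  have "wronsk a b = wronsk g b"
    by (simp add: wronsk_def g_def pderiv_add pderiv_smult algebra_simps)
  also have "\<dots> = [:- t, 1:] ^ n * ([:- t, 1:] * h * pderiv b - [:- t, 1:] * pderiv h * b - smult (of_nat (Suc n)) (h * b))"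
  proof -
    have "wronsk ([:- t, 1:] ^ Suc n * h) b = [:- t, 1:] ^ n * ([:- t, 1:] * h * pderiv b - [:- t, 1:] * pderiv h * b - smult (of_nat (Suc n)) (h * b))"
      unfolding wronsk_def lemma_order_pderiv1 unfolding power_Suc by (rule aux)
    then show ?thesis using h(1) n by simp
  qed
  finally have W: "wronsk a b = [:- t, 1:] ^ n * ([:- t, 1:] * h * pderiv b - [:- t, 1:] * pderiv h * b - smult (of_nat (Suc n)) (h * b))" (is "_ = _ * ?k") .
  have "poly h t \<noteq> 0"
    using h(2) by (simp only: poly_eq_0_iff_dvd not_False_eq_True)
  then have k: "poly ?k t \<noteq> 0"
    using bt by (simp del: of_nat_Suc)
  then have k0: "?k \<noteq> 0" by (metis poly_0)
  show "wronsk a b \<noteq> 0" unfolding W using k0 by simp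
  have "order t (wronsk a b) = n"
  proof -
    have "[:- t, 1:] ^ n * ?k \<noteq> 0" using k0 by simp
    then have "order t ([:- t, 1:] ^ n * ?k) = order t ([:- t, 1:] ^ n) + order t ?k"
      by (rule order_mult)
    also have "\<dots> = n" using order_0I[OF k] by (simp only: order_power_n_n)
    finally show ?thesis unfolding W .
  qed
  then show "order t (a + smult t b) = Suc (order t (wronsk a b))"
    using n by (simp add: g_def)
qed

lemma fixmult_order:
  assumes w: "fst w = homog 5 a" "snd w = homog 5 b" "degree a \<le> 5" "degree b \<le> 5" "hform w"
    and m: "m \<ge> 1"
  shows "fixmult m w (1, t) \<longleftrightarrow> poly (a + smult t b) t = 0 \<and> m \<le> order t (wronsk a b)"
proof
  assume F: "fixmult m w (1, t)"
  then have d: "[:- t, 1:] ^ (m + 1) dvd a + smult t b"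
    using fixmult_finite_iff[OF w(1-4)] by blast
  then have "[:- t, 1:] dvd a + smult t b"
    by (meson dvd_power dvd_trans zero_less_one trans_less_add2)
  then have z: "poly (a + smult t b) t = 0" by (simp only: poly_eq_0_iff_dvd)
  from order_wronsk[OF w z] d show "poly (a + smult t b) t = 0 \<and> m \<le> order t (wronsk a b)"
    using z by (simp add: order_divides del: power_Suc)
next
  assume *: "poly (a + smult t b) t = 0 \<and> m \<le> order t (wronsk a b)"
  note o = order_wronsk[OF w conjunct1[OF *]]
  have d: "degree (a + smult t b) \<le> 5"
    using w by (intro degree_add_le) (auto intro: order_trans[OF degree_smult_le])
  have "order t (a + smult t b) \<le> degree (a + smult t b)"
    using o by (intro order_degree) auto
  then have "m \<le> 4" using o d * by linarith
  moreover have "[:- t, 1:] ^ (m + 1) dvd a + smult t b"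
    using o * by (simp add: order_divides del: power_Suc)
  ultimately show "fixmult m w (1, t)"
    using fixmult_finite_iff[OF w(1-4)] by blast
qed

lemma sum_order_complex:
  assumes "(p :: complex poly) \<noteq> 0"
  shows "(\<Sum>x | poly p x = 0. order x p) = degree p"
proof -
  have "size (proots p) = (\<Sum>x | poly p x = 0. order x p)"
    using assms by (simp add: size_multiset_overloaded_eq)
  then show ?thesis by (simp add: size_proots_complex)
qed

lemma degree_le_5_poly: "degree (p :: complex poly) \<le> 5 \<Longrightarrow> p = [:coeff p 0, coeff p 1, coeff p 2, coeff p 3, coeff p 4, coeff p 5:]"
proof (rule poly_eqI)
  fix n assume "degree p \<le> 5"
  then show "coeff p n = coeff [:coeff p 0, coeff p 1, coeff p 2, coeff p 3, coeff p 4, coeff p 5:] n"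
    by (cases "n \<le> 5") (auto simp: le_Suc_eq eval_nat_numeral coeff_pCons coeff_eq_0 split: nat.split)
qed

text \<open>Both products may have degree 9, but their terms of degree 9 are 5 a5 b5 each and
  cancel.\<close>

lemma wronsk_degree:
  assumes "degree a \<le> 5" "degree b \<le> 5"
  shows "degree (wronsk a b) \<le> 8" "coeff (wronsk a b) 8 = coeff a 4 * coeff b 5 - coeff a 5 * coeff b 4"
proof -
  obtain a0 a1 a2 a3 a4 a5 where a: "a = [:a0, a1, a2, a3, a4, a5:]"
    using degree_le_5_poly[OF assms(1)] by blast
  obtain b0 b1 b2 b3 b4 b5 where b: "b = [:b0, b1, b2, b3, b4, b5:]"
    using degree_le_5_poly[OF assms(2)] by blast
  have "coeff (wronsk a b) n = 0" if "n > 8" for n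
  proof (cases "n = 9")
    case True
    then show ?thesis by (simp add: a b wronsk_def pderiv_pCons eval_nat_numeral)
  next
    case False
    have "degree (pderiv a) \<le> 4" "degree (pderiv b) \<le> 4"
      using assms by (simp_all add: degree_pderiv)
    then have "degree (a * pderiv b) \<le> 9" "degree (pderiv a * b) \<le> 9"
      using assms by (auto intro!: order_trans[OF degree_mult_le])
    then show ?thesis using that False by (simp add: wronsk_def coeff_eq_0)
  qed
  then show "degree (wronsk a b) \<le> 8" by (intro degree_le) auto
  show "coeff (wronsk a b) 8 = coeff a 4 * coeff b 5 - coeff a 5 * coeff b 4"
    by (simp add: a b wronsk_def pderiv_pCons eval_nat_numeral algebra_simps)
qed

section \<open>Complete lists of critical directions\<close>

text \<open>Entries are pairs of a multiplicity and a direction, and nonzero \<open>cross\<close>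
  makes the directions distinct in the projective line. The total 8 = 2 * 5 - 2 is the number of
  critical points of a rational map of degree 5, so a list with this sum is exhaustive; see
  \<open>cdata_complete\<close>.\<close>

definition cdata :: "form2 \<Rightarrow> (nat \<times> complex \<times> complex) list \<Rightarrow> bool" where
  "cdata w L \<longleftrightarrow> (\<forall>(m, v) \<in> set L. 1 \<le> m \<and> v \<noteq> (0, 0) \<and> fixmult m w v) \<and>
     sorted_wrt (\<lambda>x y. cross (snd x) (snd y) \<noteq> 0) L \<and> sum_list (map fst L) = 8"

lemma cdata_pulls:
  assumes P: "pulls p q r s k w' w" and L: "cdata w L"
  shows "cdata w' (map (\<lambda>(m, v). (m, p * fst v + q * snd v, r * fst v + s * snd v)) L)"
proof -
  define d where "d = p * s - q * r"
  have d0: "d \<noteq> 0" using P by (simp add: pulls_def d_def)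
  have c: "cross (p * fst v + q * snd v, r * fst v + s * snd v) (p * fst u + q * snd u, r * fst u + s * snd u) = d * cross v u" for u v
    by (simp add: cross_def d_def algebra_simps)
  have nz: "(p * fst v + q * snd v, r * fst v + s * snd v) \<noteq> (0, 0)" if "v \<noteq> (0, 0)" for v
  proof
    assume *: "(p * fst v + q * snd v, r * fst v + s * snd v) = (0, 0)"
    have "d * fst v = s * (p * fst v + q * snd v) - q * (r * fst v + s * snd v)"
      "d * snd v = p * (r * fst v + s * snd v) - r * (p * fst v + q * snd v)"
      by (simp_all add: d_def algebra_simps)
    then show False using * d0 that by (auto simp: prod_eq_iff)
  qed
  let ?L = "map (\<lambda>(m, v). (m, p * fst v + q * snd v, r * fst v + s * snd v)) L"
  have "map fst ?L = map fst L" by auto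
  then have "sum_list (map fst ?L) = sum_list (map fst L)" by (rule arg_cong)
  also have "\<dots> = 8" using L by (simp add: cdata_def)
  finally have "sum_list (map fst ?L) = 8" .
  moreover have "1 \<le> m \<and> u \<noteq> (0, 0) \<and> fixmult m w' u" if mem: "(m, u) \<in> set ?L" for m u
  proof -
    obtain v where v: "(m, v) \<in> set L" "u = (p * fst v + q * snd v, r * fst v + s * snd v)"
      using mem by auto
    then have "1 \<le> m" "v \<noteq> (0, 0)" "fixmult m w v" using L by (auto simp: cdata_def)
    then show ?thesis using nz[of v] fixmult_pulls[OF P, of m "fst v" "snd v"] v(2) by simp
  qed
  moreover have "sorted_wrt (\<lambda>x y. cross (snd x) (snd y) \<noteq> 0) (map (\<lambda>(m, v). (m, p * fst v + q * snd v, r * fst v + s * snd v)) L)"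
    unfolding sorted_wrt_map
    by (rule sorted_wrt_mono_rel[of _ "\<lambda>x y. cross (snd x) (snd y) \<noteq> 0"])
       (use L d0 c in \<open>auto simp: cdata_def case_prod_beta\<close>)
  ultimately show ?thesis
    unfolding cdata_def by blast
qed

lemma fixmult_scale_iff: "c \<noteq> 0 \<Longrightarrow> fixmult m w (c * v1, c * v2) \<longleftrightarrow> fixmult m w (v1, v2)"
  using fixmult_scale[of c m w v1 v2] fixmult_scale[of "1 / c" m w "c * v1" "c * v2"] by auto

lemma crit_scale:
  assumes "c \<noteq> 0" "crit w (c * v1, c * v2)"
  shows "crit w (v1, v2)"
proof -
  obtain l n h where h: "l \<noteq> 0 \<or> n \<noteq> 0" "bform 3 h"
    and e: "\<And>x y. l * fst w x y + n * snd w x y = (c * v2 * x - c * v1 * y) ^ 2 * h x y"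
    using assms(2) by (auto simp: crit_def)
  have "l * fst w x y + n * snd w x y = (v2 * x - v1 * y) ^ 2 * (c ^ 2 * h x y)" for x y
    unfolding e by (simp add: power2_eq_square algebra_simps)
  then show ?thesis unfolding crit_def fst_conv snd_conv using h bform_scale by blast
qed

lemma sorted_wrt_neq_distinct: "sorted_wrt (\<lambda>x y. x \<noteq> y) xs \<Longrightarrow> distinct xs"
  by (induction xs) auto

lemma exists_not_in_finite: "finite (S :: complex set) \<Longrightarrow> \<exists>t. t \<notin> S"
  by (metis ex_new_if_finite infinite_UNIV_char_0)

text \<open>The direction (1, \<open>\<tau>\<close>) is sent to infinity; only the finitely many
  slopes of V are forbidden for it.\<close>

lemma chart_finite:
  assumes "finite V" "\<And>v. v \<in> V \<Longrightarrow> v \<noteq> (0 :: complex, 0 :: complex)"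
  obtains p q r s where "p * s - q * r \<noteq> (0 :: complex)" "\<And>v. v \<in> V \<Longrightarrow> \<exists>c t. c \<noteq> 0 \<and> v = (c * (p + q * t), c * (r + s * t))"
proof -
  obtain \<tau> where \<tau>: "\<tau> \<notin> (\<lambda>v. snd v / fst v) ` V"
    using exists_not_in_finite[of "(\<lambda>v. snd v / fst v) ` V"] assms(1) by blast
  have "\<exists>c t. c \<noteq> 0 \<and> v = (c * (0 + 1 * t), c * (1 + \<tau> * t))" if "v \<in> V" for v
  proof -
    define c where "c = snd v - \<tau> * fst v"
    have "c \<noteq> 0"
    proof
      assume "c = 0"
      then have "fst v \<noteq> 0" using assms(2)[OF that] by (auto simp: c_def prod_eq_iff)
      then have "\<tau> = snd v / fst v" using \<open>c = 0\<close> by (simp add: c_def field_simps)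
      then show False using \<tau> that by blast
    qed
    then have "v = (c * (0 + 1 * (fst v / c)), c * (1 + \<tau> * (fst v / c)))"
    proof -
      have "c * (1 + \<tau> * (fst v / c)) = c + \<tau> * fst v"
        using \<open>c \<noteq> 0\<close> by (simp add: field_simps)
      then show ?thesis using \<open>c \<noteq> 0\<close> by (simp add: prod_eq_iff c_def)
    qed
    then show ?thesis using \<open>c \<noteq> 0\<close> by blast
  qed
  then show ?thesis using that[of 0 \<tau> 1 1] by simp
qed

text \<open>The Wronskian has degree at most 8 and the listed slopes already account for order 8, so
  there is no further root and every listed multiplicity is exact.\<close>

lemma cdata_complete_finite:
  assumes w: "fst w = homog 5 a" "snd w = homog 5 b" "degree a \<le> 5" "degree b \<le> 5" "hform w"
    and L: "\<And>m t. (m, t) \<in> set L \<Longrightarrow> 1 \<le> m \<and> fixmult m w (1, t)"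
    and distinct: "distinct (map snd L)" and sum: "sum_list (map fst L) = 8"
    and t: "poly (wronsk a b) t = 0"
  shows "\<exists>m. (m, t) \<in> set L \<and> order t (wronsk a b) = m"
proof -
  let ?W = "wronsk a b"
  have dL: "distinct L" using distinct by (simp add: distinct_map)
  have fx: "poly (a + smult s b) s = 0 \<and> m \<le> order s ?W" "1 \<le> m" if "(m, s) \<in> set L" for m s
    using L[OF that] fixmult_order[OF w, of m s] by auto
  have "L \<noteq> []" using sum by auto
  then obtain m0 s0 where "(m0, s0) \<in> set L" by (cases L) auto
  then have W0: "?W \<noteq> 0" using fx(1) order_wronsk(1)[OF w] by blast
  have sum8: "(\<Sum>x\<in>set L. fst x) = 8"
    using sum dL by (simp add: sum_list_distinct_conv_sum_set)
  have inj: "inj_on snd (set L)" using distinct by (simp add: distinct_map)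
  have fin: "finite {x. poly ?W x = 0}" using W0 by (rule poly_roots_finite)
  have sub: "snd ` set L \<subseteq> {x. poly ?W x = 0}"
  proof
    fix s assume "s \<in> snd ` set L"
    then obtain m where "(m, s) \<in> set L" by auto
    then have "order s ?W \<noteq> 0" using fx by fastforce
    then show "s \<in> {x. poly ?W x = 0}" using W0 by (simp add: order_root)
  qed
  have le8: "(\<Sum>x | poly ?W x = 0. order x ?W) \<le> 8"
    using sum_order_complex[OF W0] wronsk_degree(1)[OF w(3,4)] by simp
  have im: "(\<Sum>x\<in>snd ` set L. order x ?W) = (\<Sum>x\<in>set L. order (snd x) ?W)"
    using inj by (simp add: sum.reindex)
  have ge: "(\<Sum>x\<in>set L. order (snd x) ?W) \<ge> 8"
    unfolding sum8[symmetric] using fx by (intro sum_mono) auto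
  have "t \<in> snd ` set L"
  proof (rule ccontr)
    assume nt: "t \<notin> snd ` set L"
    have "(\<Sum>x\<in>insert t (snd ` set L). order x ?W) \<le> (\<Sum>x | poly ?W x = 0. order x ?W)"
      using fin sub t by (intro sum_mono2) auto
    moreover have "order t ?W \<noteq> 0" using t W0 by (simp add: order_root)
    ultimately show False using nt im ge le8 by simp
  qed
  then obtain m where m: "(m, t) \<in> set L" by auto
  moreover have "order t ?W = m"
  proof (rule ccontr)
    assume "order t ?W \<noteq> m"
    then have "m < order t ?W" using fx[OF m] by simp
    then have "(\<Sum>x\<in>set L. fst x) < (\<Sum>x\<in>set L. order (snd x) ?W)"
      using fx m by (intro sum_strict_mono_ex1) force+
    moreover have "(\<Sum>x\<in>snd ` set L. order x ?W) \<le> (\<Sum>x | poly ?W x = 0. order x ?W)"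
      using fin sub by (intro sum_mono2) auto
    ultimately show False using sum8 im le8 by simp
  qed
  ultimately show ?thesis by blast
qed

text \<open>One chart gives finite slope to v and to all listed directions, and there the count of
  roots applies. The second claim makes the listed multiplicities maximal, which later lets them
  serve as invariants.\<close>

lemma cdata_complete:
  assumes w: "hform w" and L: "cdata w L" and v: "v \<noteq> (0, 0)"
  shows "crit w v \<Longrightarrow> \<exists>(m', v') \<in> set L. cross v v' = 0"
    and "fixmult m w v \<Longrightarrow> 1 \<le> m \<Longrightarrow> \<exists>(m', v') \<in> set L. cross v v' = 0 \<and> m \<le> m'"
proof -
  obtain p q r s where d: "p * s - q * r \<noteq> (0 :: complex)"
    and ct: "\<And>u. u \<in> insert v (snd ` set L) \<Longrightarrow> \<exists>c t. c \<noteq> 0 \<and> u = (c * (p + q * t), c * (r + s * t))"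
    by (rule chart_finite[of "insert v (snd ` set L)"]) (use L v in \<open>auto simp: cdata_def\<close>)
  obtain w1 where P: "pulls p q r s 1 w w1" using pulls_exists[OF d] by blast
  have w1: "hform w1" by (rule hform_pulls[OF P w])
  obtain a b where ab: "fst w1 = homog 5 a" "snd w1 = homog 5 b" "degree a \<le> 5" "degree b \<le> 5"
    using hform_obtain[OF w1] .
  have "\<exists>f. \<forall>u\<in>insert v (snd ` set L). fst (f u) \<noteq> 0 \<and> u = (fst (f u) * (p + q * snd (f u)), fst (f u) * (r + s * snd (f u)))"
    by (rule bchoice) (use ct in force)
  then obtain f where f: "\<And>u. u \<in> insert v (snd ` set L) \<Longrightarrow> fst (f u) \<noteq> 0 \<and> u = (fst (f u) * (p + q * snd (f u)), fst (f u) * (r + s * snd (f u)))"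
    by blast
  define \<phi> where "\<phi> u = snd (f u)" for u
  have fm: "fixmult m w u \<longleftrightarrow> fixmult m w1 (1, \<phi> u)"
    if "u \<in> insert v (snd ` set L)" for u m
  proof -
    have u: "fst (f u) \<noteq> 0" "u = (fst (f u) * (p + q * \<phi> u), fst (f u) * (r + s * \<phi> u))"
      using f[OF that] by (auto simp: \<phi>_def)
    have "fixmult m w u \<longleftrightarrow> fixmult m w (p + q * \<phi> u, r + s * \<phi> u)"
      using fixmult_scale_iff[OF u(1), of m w "p + q * \<phi> u" "r + s * \<phi> u"] u(2) by simp
    then show "fixmult m w u \<longleftrightarrow> fixmult m w1 (1, \<phi> u)"
      using fixmult_pulls[OF P, of m 1 "\<phi> u"] by simp
  qed
  have cross: "cross u u' = 0 \<longleftrightarrow> \<phi> u = \<phi> u'" if "u \<in> insert v (snd ` set L)" "u' \<in> insert v (snd ` set L)" for u u'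
  proof -
    have "cross u u' = fst (f u) * fst (f u') * ((p * s - q * r) * (\<phi> u' - \<phi> u))"
      unfolding cross_def by (subst (1 2) f[THEN conjunct2, OF that(1)], subst (1 2) f[THEN conjunct2, OF that(2)]) (simp add: \<phi>_def algebra_simps)
    then show ?thesis using f[OF that(1)] f[OF that(2)] d by auto
  qed
  define L1 where "L1 = map (\<lambda>(m, u). (m, \<phi> u)) L"
  have memL1: "(m, t) \<in> set L1 \<longleftrightarrow> (\<exists>u. (m, u) \<in> set L \<and> t = \<phi> u)" for m t
    by (force simp: L1_def image_iff)
  have L1: "1 \<le> m \<and> fixmult m w1 (1, t)" if "(m, t) \<in> set L1" for m t
  proof -
    from memL1[THEN iffD1, OF that] obtain u where u: "(m, u) \<in> set L" "t = \<phi> u" by (elim exE conjE)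
    then have "1 \<le> m" "fixmult m w u" using L by (auto simp: cdata_def)
    moreover have "u \<in> insert v (snd ` set L)" using u(1) by force
    ultimately show ?thesis using fm[of u m] unfolding u(2) by simp
  qed
  have "sorted_wrt (\<lambda>x y. \<phi> (snd x) \<noteq> \<phi> (snd y)) L"
  proof (rule sorted_wrt_mono_rel[of _ "\<lambda>x y. cross (snd x) (snd y) \<noteq> 0"])
    show "sorted_wrt (\<lambda>x y. cross (snd x) (snd y) \<noteq> 0) L" using L by (simp add: cdata_def)
    fix x y assume xy: "x \<in> set L" "y \<in> set L" "cross (snd x) (snd y) \<noteq> 0"
    then have "snd x \<in> insert v (snd ` set L)" "snd y \<in> insert v (snd ` set L)" by auto
    from cross[OF this] xy(3) show "\<phi> (snd x) \<noteq> \<phi> (snd y)" by metis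
  qed
  then have dist: "distinct (map snd L1)"
    by (intro sorted_wrt_neq_distinct) (simp add: L1_def sorted_wrt_map case_prod_beta)
  have "map fst L1 = map fst L" by (auto simp: L1_def)
  then have sum: "sum_list (map fst L1) = 8" using L by (simp add: cdata_def)
  have complete: "\<exists>m. (m, t) \<in> set L1 \<and> order t (wronsk a b) = m" if "poly (wronsk a b) t = 0" for t
    by (rule cdata_complete_finite[OF ab w1 _ dist sum that]) (rule L1)
  have main: "\<exists>m' u. (m', u) \<in> set L \<and> cross v u = 0 \<and> order (\<phi> v) (wronsk a b) = m'"
    if "poly (wronsk a b) (\<phi> v) = 0"
  proof -
    from complete[OF that] obtain m' where m': "(m', \<phi> v) \<in> set L1" "order (\<phi> v) (wronsk a b) = m'"
      by (elim exE conjE)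
    from memL1[THEN iffD1, OF m'(1)] obtain u where u: "(m', u) \<in> set L" "\<phi> v = \<phi> u" by (elim exE conjE)
    then have "u \<in> insert v (snd ` set L)" by force
    then have "cross v u = 0" using cross[of v u] u(2) by simp
    then show ?thesis using u(1) m'(2) by blast
  qed
  { assume c: "crit w v"
    obtain c t where v': "c \<noteq> 0" "v = (c * (p + q * t), c * (r + s * t))" and t: "t = \<phi> v"
      using f[of v] unfolding \<phi>_def by blast
    have "crit w1 (c * 1, c * t)"
      using crit_pulls[OF P, of "c * 1" "c * t"] c unfolding v'(2) by (simp add: algebra_simps)
    then have "crit w1 (1, \<phi> v)"
      using crit_scale[OF v'(1), of w1 1 t] unfolding t by simp
    then show "\<exists>(m', v') \<in> set L. cross v v' = 0"
      using main[OF iffD1[OF crit_finite_iff[OF ab w1]]] by blast }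
  { assume F: "fixmult m w v" and m: "1 \<le> m"
    then have "poly (a + smult (\<phi> v) b) (\<phi> v) = 0" "m \<le> order (\<phi> v) (wronsk a b)"
      using fm[of v m] fixmult_order[OF ab w1 m, of "\<phi> v"] by simp_all
    moreover from this have "poly (wronsk a b) (\<phi> v) = 0"
      using m order_wronsk(1)[OF ab w1] order_root[of "wronsk a b" "\<phi> v"] by auto
    ultimately show "\<exists>(m', v') \<in> set L. cross v v' = 0 \<and> m \<le> m'"
      using main by blast }
qed

text \<open>If every direction were fixed, then a = - t b. A zero of b would be a common zero, so b
  is constant, and the pair then vanishes at (0, 1).\<close>

lemma exists_nonfixed:
  assumes w: "hform w"
  obtains v where "v \<noteq> (0, 0)" "tang w v \<noteq> 0"
proof (rule ccontr)
  assume "\<not> thesis"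
  then have *: "\<forall>v. v \<noteq> (0, 0) \<longrightarrow> tang w v = 0" using that by blast
  obtain a b where ab: "fst w = homog 5 a" "snd w = homog 5 b" "degree a \<le> 5" "degree b \<le> 5"
    using hform_obtain[OF w] .
  have fx: "poly a t + t * poly b t = 0" for t
    using *[rule_format, of "(1, t)"] ab by (simp add: tang_def homog_one_left)
  then have "poly b t \<noteq> 0" for t
    using order_wronsk(4)[OF ab w, of t] by simp
  then have "degree b = 0"
    using fundamental_theorem_of_algebra[of b] constant_degree[of b] by blast
  then obtain k where b: "b = [:k:]" by (rule degree_eq_zeroE)
  have "a = [:0, - k:]"
  proof (rule poly_eqI_fun)
    fix t show "poly a t = poly [:0, - k:] t"
      using fx[of t] by (simp add: b add_eq_0_iff2)
  qed
  then have "fst w 0 1 = 0" "snd w 0 1 = 0"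
    by (simp_all add: ab b homog_zero_left eval_nat_numeral)
  then show False using hform_nonzero[OF w, of 0 1] by simp
qed

text \<open>A nonzero b5 means that (0, 1) is not fixed, hence not critical either. All six fixed
  directions, the roots of c = a + t b, and all eight critical points are then visible at finite
  slope.\<close>

lemma cdata_exists_chart:
  assumes w: "fst w = homog 5 a" "snd w = homog 5 b" "degree a \<le> 5" "degree b \<le> 5" "hform w"
    and inf: "coeff b 5 \<noteq> 0"
    and cvx: "\<And>v. v \<noteq> (0, 0) \<Longrightarrow> crit w v \<Longrightarrow> tang w v = 0"
  obtains L where "cdata w L" "sorted_wrt (\<ge>) (map fst L)" "length L \<le> 5" "\<And>m v. (m, v) \<in> set L \<Longrightarrow> m \<le> 4"
    "length L = 5 \<Longrightarrow> \<exists>u. u \<noteq> (0, 0) \<and> tang w u = 0 \<and> (\<forall>v \<in> snd ` set L. cross u v \<noteq> 0)"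
proof -
  let ?W = "wronsk a b"
  define c where "c = a + [:0, 1:] * b"
  have cf: "poly c t = poly (a + smult t b) t" for t
    by (simp add: c_def)
  have "snd w 0 1 \<noteq> 0" using inf w by (simp add: homog_zero_left)
  then have "\<not> crit w (0, 1)" using cvx[of "(0, 1)"] by (auto simp: tang_def)
  then have "coeff ?W 8 \<noteq> 0"
    using crit_infinity[OF w(1,2,5)] wronsk_degree(2)[OF w(3,4)] by auto
  then have degW: "degree ?W = 8" and W0: "?W \<noteq> 0"
    using wronsk_degree(1)[OF w(3,4)] le_degree by (force intro: antisym, auto)
  define S where "S = {t. poly ?W t = 0}"
  have fS: "finite S" unfolding S_def using W0 by (rule poly_roots_finite)
  have fx: "poly (a + smult t b) t = 0" if "t \<in> S" for t
  proof -
    have "crit w (1, t)" using that crit_finite_iff[OF w] by (simp add: S_def)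
    then have "tang w (1, t) = 0" using cvx by simp
    then show ?thesis using w by (simp add: tang_def homog_one_left)
  qed
  \<comment> \<open>At a critical fixed slope a' + t b' vanishes, so the derivative of a + t b
    reduces to b.\<close>
  have c': "poly (pderiv c) t = poly b t" "poly b t \<noteq> 0" if "t \<in> S" for t
  proof -
    show bt: "poly b t \<noteq> 0" using order_wronsk(4)[OF w fx[OF that]] .
    have "poly a t = - t * poly b t" using fx[OF that] by (simp add: add_eq_0_iff2)
    then have "poly ?W t = - poly b t * (poly (pderiv a) t + t * poly (pderiv b) t)"
      by (simp add: wronsk_def algebra_simps)
    then have "poly (pderiv a) t + t * poly (pderiv b) t = 0"
      using that bt by (simp add: S_def)
    then show "poly (pderiv c) t = poly b t"
      by (simp add: c_def pderiv_add pderiv_pCons algebra_simps)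
  qed
  have cc: "coeff c 6 = coeff b 5" "coeff c 5 = coeff a 5 + coeff b 4" "degree c \<le> 6"
  proof -
    show "coeff c 6 = coeff b 5" "coeff c 5 = coeff a 5 + coeff b 4"
      using w by (simp_all add: c_def coeff_pCons eval_nat_numeral coeff_eq_0)
    have "degree ([:0, 1:] * b) \<le> 6" using w(4) degree_mult_le[of "[:0, 1:]" b] by simp
    then show "degree c \<le> 6" unfolding c_def using w(3) by (intro degree_add_le) auto
  qed
  then have degc: "degree c = 6" and c0: "c \<noteq> 0"
    using inf le_degree[of c 6] by auto
  have Sc: "S \<subseteq> {t. poly c t = 0}" using fx cf by auto
  have fc: "finite {t. poly c t = 0}" using c0 by (rule poly_roots_finite)
  \<comment> \<open>Six critical slopes would be six zeros of b - c', of degree at most 5, hence b =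
    c'; but the coefficients of t^5 are b5 and 6 b5.\<close>
  have cardS: "card S \<le> 5"
  proof (rule ccontr)
    assume "\<not> card S \<le> 5"
    then have S6: "card S \<ge> 6" by simp
    have "b - pderiv c = 0"
    proof (rule ccontr)
      assume nz: "b - pderiv c \<noteq> 0"
      have "degree (b - pderiv c) \<le> 5"
        using w(4) degc by (intro degree_diff_le) (auto simp: degree_pderiv)
      moreover have "card S \<le> card {t. poly (b - pderiv c) t = 0}"
        using c' poly_roots_finite[OF nz] by (intro card_mono) auto
      moreover have "card {t. poly (b - pderiv c) t = 0} \<le> degree (b - pderiv c)"
        using nz by (rule card_poly_roots_bound)
      ultimately show False using S6 by simp
    qed
    then have "coeff b 5 = coeff (pderiv c) 5" by simp
    then show False using inf cc(1) by (simp add: coeff_pderiv)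
  qed
  obtain xs where xs: "set xs = S" "distinct xs" using finite_distinct_list[OF fS] by blast
  define ys where "ys = rev (sort_key (\<lambda>t. order t ?W) xs)"
  have ys: "set ys = S" "distinct ys" "length ys = card S"
    using xs distinct_card[OF xs(2)] by (simp_all add: ys_def)
  have sys: "sorted_wrt (\<lambda>s t. order s ?W \<ge> order t ?W) ys"
    unfolding ys_def sorted_wrt_rev using sorted_sort_key[of "\<lambda>t. order t ?W" xs] by (simp add: sorted_map)
  define L where "L = map (\<lambda>t. (order t ?W, (1 :: complex, t))) ys"
  have fm: "1 \<le> order t ?W" "fixmult (order t ?W) w (1, t)" if "t \<in> S" for t
  proof -
    have "order t ?W \<noteq> 0" using that W0 by (simp add: S_def order_root)
    then show "1 \<le> order t ?W" by simp
    then show "fixmult (order t ?W) w (1, t)" using fixmult_order[OF w] fx[OF that] by blast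
  qed
  show thesis
  proof
    have "sum_list (map fst L) = (\<Sum>t\<in>S. order t ?W)"
      using ys by (simp add: L_def comp_def sum_list_distinct_conv_sum_set)
    also have "\<dots> = 8" unfolding S_def using sum_order_complex[OF W0] degW by simp
    finally have sum: "sum_list (map fst L) = 8" .
    have "sorted_wrt (\<lambda>x y. cross (snd x) (snd y) \<noteq> 0) L"
      using ys(2) unfolding L_def sorted_wrt_map
      by (induction ys) (auto simp: cross_def)
    then show "cdata w L"
      unfolding cdata_def using sum fm ys(1) by (auto simp: L_def)
    show "sorted_wrt (\<ge>) (map fst L)"
      using sys by (simp add: L_def sorted_wrt_map)
    show "length L \<le> 5" using cardS ys by (simp add: L_def)
    show "m \<le> 4" if "(m, v) \<in> set L" for m v
      using that fm ys(1) by (auto simp: L_def fixmult_def)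
    assume "length L = 5"
    then have card5: "card S = 5" using ys by (simp add: L_def)
    \<comment> \<open>The five critical slopes are simple roots of c, so a sixth root is left
      over.\<close>
    have o1: "order t c = 1" if "t \<in> S" for t
    proof -
      have "poly c t = 0" using fx[OF that] cf by simp
      then have "order t c = Suc (order t (pderiv c))" using order_pderiv[OF c0] by blast
      moreover have "order t (pderiv c) = 0" using c'[OF that] by (intro order_0I) simp
      ultimately show ?thesis by simp
    qed
    have "S \<noteq> {t. poly c t = 0}"
    proof
      assume *: "S = {t. poly c t = 0}"
      have "(\<Sum>t\<in>S. order t c) = 6" unfolding * using sum_order_complex[OF c0] degc by simp
      then show False using o1 card5 by simp
    qed
    then obtain q where q: "poly c q = 0" "q \<notin> S" using Sc by auto
    have "tang w (1, q) = 0" using q(1) w cf by (simp add: tang_def homog_one_left)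
    moreover have "\<forall>v \<in> snd ` set L. cross (1, q) v \<noteq> 0"
      using q(2) ys(1) by (auto simp: L_def cross_def)
    ultimately show "\<exists>u. u \<noteq> (0, 0) \<and> tang w u = 0 \<and> (\<forall>v \<in> snd ` set L. cross u v \<noteq> 0)"
      by (intro exI[of _ "(1, q)"]) simp
  qed
qed

lemma cdata_exists:
  assumes w: "hform w" and cvx: "\<And>v. v \<noteq> (0, 0) \<Longrightarrow> crit w v \<Longrightarrow> tang w v = 0"
  obtains L where "cdata w L" "sorted_wrt (\<ge>) (map fst L)" "length L \<le> 5" "\<And>m v. (m, v) \<in> set L \<Longrightarrow> m \<le> 4"
    "length L = 5 \<Longrightarrow> \<exists>u. u \<noteq> (0, 0) \<and> tang w u = 0 \<and> (\<forall>v \<in> snd ` set L. cross u v \<noteq> 0)"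
proof -
  obtain v0 where v0: "v0 \<noteq> (0, 0)" "tang w v0 \<noteq> 0" using exists_nonfixed[OF w] .
  obtain p r where d: "p * snd v0 - fst v0 * r \<noteq> 0"
  proof (cases "snd v0 = 0")
    case True
    then show ?thesis using that[of 0 1] v0 by (auto simp: prod_eq_iff)
  next
    case False
    then show ?thesis using that[of 1 0] by simp
  qed
  \<comment> \<open>The nonfixed direction becomes the second column of the map, that is, the image
    of (0, 1).\<close>
  define q s where "q = fst v0" and "s = snd v0"
  have d': "p * s - q * r \<noteq> 0" using d by (simp add: q_def s_def)
  obtain w1 where P: "pulls p q r s 1 w w1" using pulls_exists[OF d'] by blast
  have w1: "hform w1" by (rule hform_pulls[OF P w])
  obtain a b where ab: "fst w1 = homog 5 a" "snd w1 = homog 5 b" "degree a \<le> 5" "degree b \<le> 5"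
    using hform_obtain[OF w1] .
  have inf: "coeff b 5 \<noteq> 0"
  proof -
    have "tang w1 (0, 1) \<noteq> 0"
      using tang_pulls[OF P, of "(0, 1)"] v0 by (simp add: q_def s_def)
    then show ?thesis using ab by (simp add: tang_def homog_zero_left)
  qed
  have nz: "(p * fst v + q * snd v, r * fst v + s * snd v) \<noteq> (0, 0)" if "v \<noteq> (0, 0)" for v
  proof
    assume *: "(p * fst v + q * snd v, r * fst v + s * snd v) = (0, 0)"
    have "(p * s - q * r) * fst v = s * (p * fst v + q * snd v) - q * (r * fst v + s * snd v)"
      "(p * s - q * r) * snd v = p * (r * fst v + s * snd v) - r * (p * fst v + q * snd v)"
      by (simp_all add: algebra_simps)
    then show False using * d' that by (auto simp: prod_eq_iff)
  qed
  have cvx1: "tang w1 v = 0" if "v \<noteq> (0, 0)" "crit w1 v" for v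
  proof -
    have "crit w (p * fst v + q * snd v, r * fst v + s * snd v)"
      using crit_pulls[OF P, of "fst v" "snd v"] that by simp
    then show ?thesis using cvx[OF nz[OF that(1)]] tang_pulls[OF P, of v] by simp
  qed
  obtain L where L: "cdata w1 L" "sorted_wrt (\<ge>) (map fst L)" "length L \<le> 5" "\<And>m v. (m, v) \<in> set L \<Longrightarrow> m \<le> 4"
    "length L = 5 \<Longrightarrow> \<exists>u. u \<noteq> (0, 0) \<and> tang w1 u = 0 \<and> (\<forall>v \<in> snd ` set L. cross u v \<noteq> 0)"
    by (rule cdata_exists_chart[OF ab w1 inf cvx1]) blast+
  let ?g = "\<lambda>v. (p * fst v + q * snd v, r * fst v + s * snd v)"
  let ?L = "map (\<lambda>(m, v). (m, p * fst v + q * snd v, r * fst v + s * snd v)) L"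
  have mL: "map fst ?L = map fst L" by auto
  have snd: "snd ` set ?L = ?g ` snd ` set L" by force
  show thesis
  proof
    show "cdata w ?L" by (rule cdata_pulls[OF P L(1)])
    show "sorted_wrt (\<ge>) (map fst ?L)" unfolding mL by (rule L(2))
    show "length ?L \<le> 5" using L(3) by simp
    show "m \<le> 4" if "(m, v) \<in> set ?L" for m v using that L(4) by auto
    assume "length ?L = 5"
    then obtain u where u: "u \<noteq> (0, 0)" "tang w1 u = 0" "\<forall>v \<in> snd ` set L. cross u v \<noteq> 0"
      using L(5) by auto
    have "cross (?g u) (?g v) = (p * s - q * r) * cross u v" for v
      by (simp add: cross_def algebra_simps)
    then have "\<forall>v \<in> snd ` set ?L. cross (?g u) v \<noteq> 0"
      unfolding snd using u(3) d' by auto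
    then show "\<exists>u. u \<noteq> (0, 0) \<and> tang w u = 0 \<and> (\<forall>v \<in> snd ` set ?L. cross u v \<noteq> 0)"
      using nz[OF u(1)] tang_pulls[OF P, of u] u(2) by (intro exI[of _ "?g u"]) simp
  qed
qed

section \<open>Normal forms\<close>

text \<open>In characteristic 0, a root of order n + 1 of p is a root of order n of its
  derivative.\<close>

lemma linear_power_dvd_iff:
  "[:- t, 1:] ^ n dvd (p :: complex poly) \<longleftrightarrow> (\<forall>j<n. poly ((pderiv ^^ j) p) t = 0)"
proof (induction n arbitrary: p)
  case (Suc n)
  have "[:- t, 1:] ^ Suc n dvd p \<longleftrightarrow> poly p t = 0 \<and> [:- t, 1:] ^ n dvd pderiv p"
  proof (cases "p = 0")
    case False
    show ?thesis
    proof (cases "poly p t = 0")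
      case True
      have "order t p = Suc (order t (pderiv p))"
        using order_pderiv[OF False True] .
      moreover have "pderiv p \<noteq> 0"
      proof
        assume "pderiv p = 0"
        then obtain h where "p = [:h:]" using pderiv_iszero by blast
        then show False using True False by simp
      qed
      ultimately show ?thesis using True False by (simp add: order_divides del: power_Suc)
    next
      case no: False
      then have "order t p = 0" by (rule order_0I)
      then show ?thesis using no False by (simp add: order_divides del: power_Suc)
    qed
  qed simp
  also have "\<dots> \<longleftrightarrow> poly p t = 0 \<and> (\<forall>j<n. poly ((pderiv ^^ Suc j) p) t = 0)"
    unfolding Suc.IH by (simp add: funpow_swap1)
  also have "\<dots> \<longleftrightarrow> (\<forall>j<Suc n. poly ((pderiv ^^ j) p) t = 0)"
    unfolding All_less_Suc2 by simp
  finally show ?case .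
qed simp

lemma degree_le_5I: "degree [:a0, a1, a2, a3, a4, a5 :: complex:] \<le> 5"
  by simp

lemma homog_5_pCons:
  "homog 5 [:a0, a1, a2, a3, a4, a5:] x y = a0 * x ^ 5 + a1 * x ^ 4 * y + a2 * x ^ 3 * y ^ 2 + a3 * x ^ 2 * y ^ 3 + a4 * x * y ^ 4 + a5 * y ^ 5"
  unfolding homog_5 by (simp add: eval_nat_numeral)

lemma hform_coeffs:
  assumes "hform w"
  obtains a0 a1 a2 a3 a4 a5 b0 b1 b2 b3 b4 b5
  where "w = (homog 5 [:a0, a1, a2, a3, a4, a5:], homog 5 [:b0, b1, b2, b3, b4, b5:])"
proof -
  obtain a b where "fst w = homog 5 a" "snd w = homog 5 b" "degree a \<le> 5" "degree b \<le> 5"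
    using hform_obtain[OF assms] .
  then show ?thesis
    using that degree_le_5_poly[of a] degree_le_5_poly[of b] by (metis prod.collapse)
qed

context
  fixes w a0 a1 a2 a3 a4 a5 b0 b1 b2 b3 b4 b5 and g :: "complex \<Rightarrow> nat \<Rightarrow> complex"
  assumes w: "w = (homog 5 [:a0, a1, a2, a3, a4, a5:], homog 5 [:b0, b1, b2, b3, b4, b5:])"
begin

text \<open>The number t plays two roles: it is frozen in the polynomial A + t B, whose derivatives
  are then evaluated at the same t.\<close>

lemma fixmult_coeffs:
  "fixmult 1 w (1, t) \<longleftrightarrow>
    (a0 + t * b0) + (a1 + t * b1) * t + (a2 + t * b2) * t ^ 2 + (a3 + t * b3) * t ^ 3 + (a4 + t * b4) * t ^ 4 + (a5 + t * b5) * t ^ 5 = 0 \<and>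
    (a1 + t * b1) + 2 * (a2 + t * b2) * t + 3 * (a3 + t * b3) * t ^ 2 + 4 * (a4 + t * b4) * t ^ 3 + 5 * (a5 + t * b5) * t ^ 4 = 0" (is ?th1)
  "fixmult 2 w (1, t) \<longleftrightarrow> fixmult 1 w (1, t) \<and>
    2 * (a2 + t * b2) + 6 * (a3 + t * b3) * t + 12 * (a4 + t * b4) * t ^ 2 + 20 * (a5 + t * b5) * t ^ 3 = 0" (is ?th2)
  "fixmult 3 w (1, t) \<longleftrightarrow> fixmult 2 w (1, t) \<and>
    6 * (a3 + t * b3) + 24 * (a4 + t * b4) * t + 60 * (a5 + t * b5) * t ^ 2 = 0" (is ?th3)
  "fixmult 4 w (1, t) \<longleftrightarrow> fixmult 3 w (1, t) \<and> 24 * (a4 + t * b4) + 120 * (a5 + t * b5) * t = 0" (is ?th4)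
proof -
  let ?g = "[:a0 + t * b0, a1 + t * b1, a2 + t * b2, a3 + t * b3, a4 + t * b4, a5 + t * b5:]"
  have F: "fixmult m w (1, t) \<longleftrightarrow> m \<le> 4 \<and> (\<forall>j<m + 1. poly ((pderiv ^^ j) ?g) t = 0)" for m
    unfolding linear_power_dvd_iff[symmetric]
    using fixmult_finite_iff[of w "[:a0, a1, a2, a3, a4, a5:]" "[:b0, b1, b2, b3, b4, b5:]" m t] by (simp add: w)
  have Q: "(\<forall>j<1 + 1. Q j) \<longleftrightarrow> Q 0 \<and> Q 1" "(\<forall>j<2 + 1. Q j) \<longleftrightarrow> (Q 0 \<and> Q 1) \<and> Q 2"
    "(\<forall>j<3 + 1. Q j) \<longleftrightarrow> ((Q 0 \<and> Q 1) \<and> Q 2) \<and> Q 3" "(\<forall>j<4 + 1. Q j) \<longleftrightarrow> (((Q 0 \<and> Q 1) \<and> Q 2) \<and> Q 3) \<and> Q 4"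
    for Q :: "nat \<Rightarrow> bool"
    by (auto simp: less_Suc_eq eval_nat_numeral)
  have D: "(pderiv ^^ 0) p = p" "(pderiv ^^ 1) p = pderiv p" "(pderiv ^^ 2) p = pderiv (pderiv p)"
    "(pderiv ^^ 3) p = pderiv (pderiv (pderiv p))" "(pderiv ^^ 4) p = pderiv (pderiv (pderiv (pderiv p)))" for p :: "complex poly"
    by (simp_all add: eval_nat_numeral)
  have e: "poly ?g t = (a0 + t * b0) + (a1 + t * b1) * t + (a2 + t * b2) * t ^ 2 + (a3 + t * b3) * t ^ 3 + (a4 + t * b4) * t ^ 4 + (a5 + t * b5) * t ^ 5"
    "poly (pderiv ?g) t = (a1 + t * b1) + 2 * (a2 + t * b2) * t + 3 * (a3 + t * b3) * t ^ 2 + 4 * (a4 + t * b4) * t ^ 3 + 5 * (a5 + t * b5) * t ^ 4"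
    "poly (pderiv (pderiv ?g)) t = 2 * (a2 + t * b2) + 6 * (a3 + t * b3) * t + 12 * (a4 + t * b4) * t ^ 2 + 20 * (a5 + t * b5) * t ^ 3"
    "poly (pderiv (pderiv (pderiv ?g))) t = 6 * (a3 + t * b3) + 24 * (a4 + t * b4) * t + 60 * (a5 + t * b5) * t ^ 2"
    "poly (pderiv (pderiv (pderiv (pderiv ?g)))) t = 24 * (a4 + t * b4) + 120 * (a5 + t * b5) * t"
    by (simp_all add: pderiv_pCons) (simp_all add: algebra_simps eval_nat_numeral)
  show ?th1 ?th2 ?th3 ?th4
    unfolding F Q D e by simp_all
qed

lemma fixmult_zero:
  "fixmult 1 w (1, 0) \<longleftrightarrow> a0 = 0 \<and> a1 = 0"
  "fixmult 2 w (1, 0) \<longleftrightarrow> a0 = 0 \<and> a1 = 0 \<and> a2 = 0"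
  "fixmult 3 w (1, 0) \<longleftrightarrow> a0 = 0 \<and> a1 = 0 \<and> a2 = 0 \<and> a3 = 0"
  "fixmult 4 w (1, 0) \<longleftrightarrow> a0 = 0 \<and> a1 = 0 \<and> a2 = 0 \<and> a3 = 0 \<and> a4 = 0"
  unfolding fixmult_coeffs by auto

lemma fixmult_infinity:
  "fixmult 1 w (0, 1) \<longleftrightarrow> b5 = 0 \<and> b4 = 0"
  "fixmult 2 w (0, 1) \<longleftrightarrow> b5 = 0 \<and> b4 = 0 \<and> b3 = 0"
  "fixmult 3 w (0, 1) \<longleftrightarrow> b5 = 0 \<and> b4 = 0 \<and> b3 = 0 \<and> b2 = 0"
  "fixmult 4 w (0, 1) \<longleftrightarrow> b5 = 0 \<and> b4 = 0 \<and> b3 = 0 \<and> b2 = 0 \<and> b1 = 0"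
proof -
  have F: "fixmult m w (0, 1) \<longleftrightarrow> m \<le> 4 \<and> degree [:b0, b1, b2, b3, b4, b5:] \<le> 4 - m" for m
    using fixmult_infinity_iff[of w "[:b0, b1, b2, b3, b4, b5:]" m] by (simp add: w)
  show "fixmult 1 w (0, 1) \<longleftrightarrow> b5 = 0 \<and> b4 = 0"
  "fixmult 2 w (0, 1) \<longleftrightarrow> b5 = 0 \<and> b4 = 0 \<and> b3 = 0"
  "fixmult 3 w (0, 1) \<longleftrightarrow> b5 = 0 \<and> b4 = 0 \<and> b3 = 0 \<and> b2 = 0"
  "fixmult 4 w (0, 1) \<longleftrightarrow> b5 = 0 \<and> b4 = 0 \<and> b3 = 0 \<and> b2 = 0 \<and> b1 = 0"
    unfolding F by auto
qed

lemma hform_infinity: "hform w \<Longrightarrow> a5 \<noteq> 0 \<or> b5 \<noteq> 0"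
  using hform_nonzero[of w 0 1] by (simp add: w homog_5_pCons)

lemma hform_finite: "hform w \<Longrightarrow>
    a0 + a1 * t + a2 * t ^ 2 + a3 * t ^ 3 + a4 * t ^ 4 + a5 * t ^ 5 \<noteq> 0 \<or>
    b0 + b1 * t + b2 * t ^ 2 + b3 * t ^ 3 + b4 * t ^ 4 + b5 * t ^ 5 \<noteq> 0"
  using hform_nonzero[of w 1 t] by (simp add: w homog_5_pCons)

end

text \<open>The map (x, y) -> (x, s y) multiplies the coefficient of x^(5-j) y^j by s^j in A and by
  s^(j+1) in B, the additional s coming from dy.\<close>

lemma lconj_diag:
  assumes "k \<noteq> 0" "s \<noteq> 0"
    "w = (homog 5 [:a0, a1, a2, a3, a4, a5:], homog 5 [:b0, b1, b2, b3, b4, b5:])"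
    "k * a0 = A0" "k * a1 = A1 * s" "k * a2 = A2 * s ^ 2" "k * a3 = A3 * s ^ 3" "k * a4 = A4 * s ^ 4" "k * a5 = A5 * s ^ 5"
    "k * b0 = B0 * s" "k * b1 = B1 * s ^ 2" "k * b2 = B2 * s ^ 3" "k * b3 = B3 * s ^ 4" "k * b4 = B4 * s ^ 5" "k * b5 = B5 * s ^ 6"
  shows "lconj w (homog 5 [:A0, A1, A2, A3, A4, A5:], homog 5 [:B0, B1, B2, B3, B4, B5:])"
proof -
  have "pulls 1 0 0 s k (homog 5 [:A0, A1, A2, A3, A4, A5:], homog 5 [:B0, B1, B2, B3, B4, B5:]) w"
    unfolding pulls_def
  proof (intro conjI allI)
    fix x y
    have "k * fst w x y = (k * a0) * x ^ 5 + (k * a1) * x ^ 4 * y + (k * a2) * x ^ 3 * y ^ 2 + (k * a3) * x ^ 2 * y ^ 3 + (k * a4) * x * y ^ 4 + (k * a5) * y ^ 5"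
      "k * snd w x y = (k * b0) * x ^ 5 + (k * b1) * x ^ 4 * y + (k * b2) * x ^ 3 * y ^ 2 + (k * b3) * x ^ 2 * y ^ 3 + (k * b4) * x * y ^ 4 + (k * b5) * y ^ 5"
      by (simp_all add: assms(3) homog_5_pCons algebra_simps)
    note * = this[unfolded assms(4-)]
    show "1 * fst (homog 5 [:A0, A1, A2, A3, A4, A5:], homog 5 [:B0, B1, B2, B3, B4, B5:]) (1 * x + 0 * y) (0 * x + s * y) +
       0 * snd (homog 5 [:A0, A1, A2, A3, A4, A5:], homog 5 [:B0, B1, B2, B3, B4, B5:]) (1 * x + 0 * y) (0 * x + s * y) = k * fst w x y"
     "0 * fst (homog 5 [:A0, A1, A2, A3, A4, A5:], homog 5 [:B0, B1, B2, B3, B4, B5:]) (1 * x + 0 * y) (0 * x + s * y) +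
       s * snd (homog 5 [:A0, A1, A2, A3, A4, A5:], homog 5 [:B0, B1, B2, B3, B4, B5:]) (1 * x + 0 * y) (0 * x + s * y) = k * snd w x y"
      unfolding * fst_conv snd_conv homog_5_pCons by (simp_all add: power_mult_distrib algebra_simps eval_nat_numeral)
  qed (use assms in simp_all)
  then show ?thesis unfolding lconj_def by blast
qed

section \<open>Normalising three directions\<close>

text \<open>The three directions go to infinity, 0 and \<open>\<tau>\<close>. The last conclusion
  hands out slopes f for any further directions and keeps them distinct from one another and from
  the normalised ones.\<close>

lemma normalize3:
  assumes w: "hform w" and c: "cross v1 v2 \<noteq> 0" "cross v1 v3 \<noteq> 0" "cross v2 v3 \<noteq> 0" and \<tau>: "\<tau> \<noteq> 0"
  obtains w1 where "hform w1" "lconj w1 w"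
    "\<And>m. fixmult m w v1 \<Longrightarrow> fixmult m w1 (0, 1)"
    "\<And>m. fixmult m w v2 \<Longrightarrow> fixmult m w1 (1, 0)"
    "\<And>m. fixmult m w v3 \<Longrightarrow> fixmult m w1 (1, \<tau>)"
    "tang w v1 = 0 \<Longrightarrow> tang w1 (0, 1) = 0"
    "\<And>V. (\<And>v. v \<in> V \<Longrightarrow> cross v1 v \<noteq> 0) \<Longrightarrow> \<exists>f. \<forall>v\<in>V. (\<forall>m. fixmult m w v \<longrightarrow> fixmult m w1 (1, f v)) \<and>
       (\<forall>v'\<in>V. cross v v' \<noteq> 0 \<longrightarrow> f v \<noteq> f v') \<and> (cross v2 v \<noteq> 0 \<longrightarrow> f v \<noteq> 0) \<and> (cross v3 v \<noteq> 0 \<longrightarrow> f v \<noteq> \<tau>)"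
proof -
  \<comment> \<open>By Cramer's rule v3 is a combination of v1 and v2; the two constants are chosen
    so that v3 = \<open>\<alpha>\<close> v2 + \<open>\<tau>\<close> \<open>\<beta>\<close>
    v1.\<close>
  define \<alpha> where "\<alpha> = cross v1 v3 / cross v1 v2"
  define \<beta> where "\<beta> = - cross v2 v3 / (\<tau> * cross v1 v2)"
  have ab: "\<alpha> \<noteq> 0" "\<beta> \<noteq> 0" using c \<tau> by (simp_all add: \<alpha>_def \<beta>_def)
  define p q r s where "p = \<alpha> * fst v2" "q = \<beta> * fst v1" "r = \<alpha> * snd v2" "s = \<beta> * snd v1"
  note pqrs = this
  have d: "p * s - q * r = - \<alpha> * \<beta> * cross v1 v2"
    by (simp add: pqrs cross_def algebra_simps)
  then have d0: "p * s - q * r \<noteq> 0" using ab c by simp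
  obtain w1 where P: "pulls p q r s 1 w w1" using pulls_exists[OF d0] by blast
  have v3: "(p + q * \<tau>, r + s * \<tau>) = v3"
  proof -
    have "fst v3 * cross v1 v2 = cross v1 v3 * fst v2 - cross v2 v3 * fst v1"
      "snd v3 * cross v1 v2 = cross v1 v3 * snd v2 - cross v2 v3 * snd v1"
      by (simp_all add: cross_def algebra_simps)
    then show ?thesis
      using c \<tau> by (simp add: pqrs \<alpha>_def \<beta>_def prod_eq_iff field_simps)
  qed
  show thesis
  proof (rule that)
    show "hform w1" by (rule hform_pulls[OF P w])
    show "lconj w1 w" unfolding lconj_def using P by blast
    show "fixmult m w1 (0, 1)" if "fixmult m w v1" for m
      unfolding fixmult_pulls[OF P] using fixmult_scale[OF ab(2), of m w "fst v1" "snd v1"] that by (simp add: pqrs)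
    show "fixmult m w1 (1, 0)" if "fixmult m w v2" for m
      unfolding fixmult_pulls[OF P] using fixmult_scale[OF ab(1), of m w "fst v2" "snd v2"] that by (simp add: pqrs)
    show "fixmult m w1 (1, \<tau>)" if "fixmult m w v3" for m
      unfolding fixmult_pulls[OF P] using that v3 by simp
    show "tang w1 (0, 1) = 0" if "tang w v1 = 0"
    proof -
      have "tang w (\<beta> * fst v1, \<beta> * snd v1) = 0"
      proof -
        have "bform 5 (fst w)" "bform 5 (snd w)" using w by (simp_all add: hform_def)
        note this[THEN bform_scale_args, of \<beta> "fst v1" "snd v1"]
        then have "tang w (\<beta> * fst v1, \<beta> * snd v1) = \<beta> ^ 6 * tang w v1"
          by (simp add: tang_def algebra_simps eval_nat_numeral)
        then show ?thesis using that by simp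
      qed
      then show ?thesis using tang_pulls[OF P, of "(0, 1)"] by (simp add: pqrs)
    qed
    fix V assume V: "\<And>v. v \<in> V \<Longrightarrow> cross v1 v \<noteq> 0"
    \<comment> \<open>X and Y are the coordinates of v in the basis \<open>\<alpha>\<close> v2,
      \<open>\<beta>\<close> v1, so their quotient f is the slope in the new chart.\<close>
    define X where "X v = cross v1 v / (\<alpha> * cross v1 v2)" for v
    define Y where "Y v = - cross v2 v / (\<beta> * cross v1 v2)" for v
    define f where "f v = Y v / X v" for v
    have v: "v = (X v * (p * 1 + q * f v), X v * (r * 1 + s * f v))" "X v \<noteq> 0" if "v \<in> V" for v
    proof -
      show X: "X v \<noteq> 0" using V[OF that] ab c by (simp add: X_def)
      have e: "fst v * cross v1 v2 = cross v1 v * fst v2 - cross v2 v * fst v1"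
        "snd v * cross v1 v2 = cross v1 v * snd v2 - cross v2 v * snd v1"
        by (simp_all add: cross_def algebra_simps)
      have "X v * (p * 1 + q * f v) = X v * p + q * Y v" "X v * (r * 1 + s * f v) = X v * r + s * Y v"
        using X by (simp_all add: f_def field_simps)
      moreover have "X v * p + q * Y v = fst v" "X v * r + s * Y v = snd v"
      proof -
        have "X v * p = cross v1 v * fst v2 / cross v1 v2" "q * Y v = - (cross v2 v * fst v1) / cross v1 v2"
          "X v * r = cross v1 v * snd v2 / cross v1 v2" "s * Y v = - (cross v2 v * snd v1) / cross v1 v2"
          using ab by (simp_all add: X_def Y_def pqrs)
        then have "X v * p + q * Y v = (fst v * cross v1 v2) / cross v1 v2" "X v * r + s * Y v = (snd v * cross v1 v2) / cross v1 v2"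
          unfolding e by (simp_all add: diff_divide_distrib)
        then show "X v * p + q * Y v = fst v" "X v * r + s * Y v = snd v" using c by simp_all
      qed
      ultimately show "v = (X v * (p * 1 + q * f v), X v * (r * 1 + s * f v))" by simp
    qed
    have "fixmult m w1 (1, f v)" if "v \<in> V" "fixmult m w v" for m v
    proof -
      have "fixmult m w (X v * (p * 1 + q * f v), X v * (r * 1 + s * f v))"
        using that(2) v(1)[OF that(1)] by (rule back_subst)
      then show ?thesis
        unfolding fixmult_pulls[OF P] fixmult_scale_iff[OF v(2)[OF that(1)]] .
    qed
    moreover have "f v \<noteq> f v'" if "v \<in> V" "v' \<in> V" "cross v v' \<noteq> 0" for v v'
    proof
      assume "f v = f v'"
      obtain t where t: "f v = t" by blast
      have "v = (X v * (p * 1 + q * t), X v * (r * 1 + s * t))" "v' = (X v' * (p * 1 + q * t), X v' * (r * 1 + s * t))"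
        using v(1)[OF that(1)] v(1)[OF that(2)] \<open>f v = f v'\<close> unfolding t[symmetric] by (simp_all only:)
      then have "cross v v' = cross (X v * (p * 1 + q * t), X v * (r * 1 + s * t)) (X v' * (p * 1 + q * t), X v' * (r * 1 + s * t))"
        by (rule arg_cong2)
      also have "\<dots> = 0" by (simp add: cross_def algebra_simps)
      finally show False using that(3) by simp
    qed
    moreover have "f v \<noteq> 0" if "v \<in> V" "cross v2 v \<noteq> 0" for v
      using that v(2)[OF that(1)] ab c by (simp add: f_def Y_def)
    moreover have "f v \<noteq> \<tau>" if "v \<in> V" "cross v3 v \<noteq> 0" for v
    proof
      assume "f v = \<tau>"
      have "v = (X v * (p * 1 + q * \<tau>), X v * (r * 1 + s * \<tau>))"
        using v(1)[OF that(1)] unfolding \<open>f v = \<tau>\<close> .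
      then have "v = (X v * fst v3, X v * snd v3)" unfolding v3[symmetric] by simp
      then have "cross v3 v = cross v3 (X v * fst v3, X v * snd v3)"
        by (rule arg_cong)
      also have "\<dots> = 0" by (simp add: cross_def algebra_simps)
      finally show False using that(2) by simp
    qed
    ultimately show "\<exists>f. \<forall>v\<in>V. (\<forall>m. fixmult m w v \<longrightarrow> fixmult m w1 (1, f v)) \<and>
       (\<forall>v'\<in>V. cross v v' \<noteq> 0 \<longrightarrow> f v \<noteq> f v') \<and> (cross v2 v \<noteq> 0 \<longrightarrow> f v \<noteq> 0) \<and> (cross v3 v \<noteq> 0 \<longrightarrow> f v \<noteq> \<tau>)"
      by blast
  qed
qed

lemma omega_homog:
  "omega 1 = (homog 5 [:0, 0, 0, 0, 0, 1:], homog 5 [:- 1, 0, 0, 0, 0, 0:])"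
  "omega 2 = (homog 5 [:0, 0, 10, 10, 5, 1:], homog 5 [:- 1, - 5, 0, 0, 0, 0:])"
  "omega 3 = (homog 5 [:0, 0, 0, 10, 5, 1:], homog 5 [:- 1, - 5, - 10, 0, 0, 0:])"
  "omega 4 = (homog 5 [:0, 0, 0, 0, 5, - 3:], homog 5 [:3, - 5, 0, 0, 0, 0:])"
  "omega 5 = (homog 5 [:0, 0, 0, 5, 0, - 3:], homog 5 [:- 2, 0, 0, 0, 0, 0:])"
  "omega 6 = (homog 5 [:0, 0, 0, 220, - 165, 36:], homog 5 [:- 121, 0, 0, 0, 0, 0:])"
  "omega 7 = (homog 5 [:0, 0, 0, 0, 5 - sqrt5, - 2:], homog 5 [:7 - 3 * sqrt5, - 2 * (5 - 2 * sqrt5), 0, 0, 0, 0:])"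
  "omega 8 = (homog 5 [:0, 0, 0, 0, 5 * (3 - sqrt21), 6:], homog 5 [:3 * (23 - 5 * sqrt21), - 10 * (9 - 2 * sqrt21), 0, 0, 0, 0:])"
  "omega 9 = (homog 5 [:0, 0, 0, 2 * (5 + a_const), - (15 + a_const), 6:], homog 5 [:- (1 - a_const), - 2 * a_const, 0, 0, 0, 0:])"
  "omega 10 = (homog 5 [:0, 0, 0, 2 * (5 + \<i> * b_const), - (15 + \<i> * b_const), 6:], homog 5 [:- (1 - \<i> * b_const), - 2 * (\<i> * b_const), 0, 0, 0, 0:])"
  "omega 11 = (homog 5 [:0, 0, 0, 5, 0, - 1:], homog 5 [:1, 0, - 5, 0, 0, 0:])"
  "omega 12 = (homog 5 [:0, 0, 0, 20, - 5, - 1:], homog 5 [:1, 5, - 20, 0, 0, 0:])"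
  "omega 13 = (homog 5 [:0, 0, 5, - 10, 10, - 4:], homog 5 [:- 1, 0, 0, 0, 0, 0:])"
  "omega 14 = (homog 5 [:0, 0, 0, u_pol sigma, v_pol sigma, w_pol sigma:],
     homog 5 [:2 * sigma^2 * (sigma^2 - sigma + 1), - sigma * (sigma + 1) * (3 * sigma^2 - 5 * sigma + 3), 0, 0, 0, 0:])"
  unfolding prod_eq_iff fun_eq_iff homog_5_pCons fst_conv snd_conv
  by (simp_all add: omega_def omega_list_def algebra_simps power_numeral_reduce)

lemma lconj_multiple:
  assumes "k \<noteq> 0" "w = (homog 5 [:a0, a1, a2, a3, a4, a5:], homog 5 [:b0, b1, b2, b3, b4, b5:])"
    "a0 = k * A0" "a1 = k * A1" "a2 = k * A2" "a3 = k * A3" "a4 = k * A4" "a5 = k * A5"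
    "b0 = k * B0" "b1 = k * B1" "b2 = k * B2" "b3 = k * B3" "b4 = k * B4" "b5 = k * B5"
  shows "lconj w (homog 5 [:A0, A1, A2, A3, A4, A5:], homog 5 [:B0, B1, B2, B3, B4, B5:])"
  by (rule lconj_diag[of "1 / k" 1, OF _ _ assms(2)]) (use assms(1) in \<open>simp_all add: assms(3-)\<close>)

section \<open>Types with at most four critical directions\<close>

lemma mult_zeroD: "c * x = 0 \<Longrightarrow> c \<noteq> 0 \<Longrightarrow> x = (0 :: complex)"
  by simp

text \<open>Only a5 and b0 survive, and a fourth root supplies the scaling that makes them 1 and - 1
  up to a common factor.\<close>

lemma normal_44:
  assumes h: "hform w" and "fixmult 4 w (0, 1)" "fixmult 4 w (1, 0)"
  shows "lconj w (omega 1)"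
proof -
  obtain a0 a1 a2 a3 a4 a5 b0 b1 b2 b3 b4 b5
    where w: "w = (homog 5 [:a0, a1, a2, a3, a4, a5:], homog 5 [:b0, b1, b2, b3, b4, b5:])"
    using hform_coeffs[OF h] .
  have b: "b5 = 0" "b4 = 0" "b3 = 0" "b2 = 0" "b1 = 0"
    using assms(2) by (auto simp: fixmult_infinity[OF w])
  have a: "a0 = 0" "a1 = 0" "a2 = 0" "a3 = 0" "a4 = 0"
    using assms(3) by (auto simp: fixmult_zero[OF w])
  have nz: "a5 \<noteq> 0" "b0 \<noteq> 0"
    using hform_infinity[OF w h] hform_finite[OF w h, of 0] a b by simp_all
  obtain s where s: "s ^ 4 = - a5 / b0"
    using exists_complex_root[of 4] by (metis zero_neq_numeral)
  then have s0: "s \<noteq> 0" using nz by auto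
  have a5: "a5 = - (b0 * s ^ 4)" using s nz by (simp add: field_simps)
  show ?thesis unfolding omega_homog
    using nz s0 by (intro lconj_diag[OF _ _ w, of "- s / b0" s]) (simp_all add: a b a5 eval_nat_numeral)
qed

text \<open>The conditions are linear in the remaining coefficients and have a one-dimensional
  solution space, parametrised by a5. The third slope is - 1 because the solution is then literally
  a multiple of \<open>omega 2\<close>.\<close>

lemma normal_431:
  assumes h: "hform w" and "fixmult 3 w (0, 1)" "fixmult 1 w (1, 0)" "fixmult 4 w (1, - 1)"
  shows "lconj w (omega 2)"
proof -
  obtain a0 a1 a2 a3 a4 a5 b0 b1 b2 b3 b4 b5
    where w: "w = (homog 5 [:a0, a1, a2, a3, a4, a5:], homog 5 [:b0, b1, b2, b3, b4, b5:])"
    using hform_coeffs[OF h] .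
  have b: "b5 = 0" "b4 = 0" "b3 = 0" "b2 = 0"
    using assms(2) by (auto simp: fixmult_infinity[OF w])
  have a: "a0 = 0" "a1 = 0"
    using assms(3) by (auto simp: fixmult_zero[OF w] simp del: One_nat_def)
  have nz: "a5 \<noteq> 0"
    using hform_infinity[OF w h] b by simp
  note e = assms(4)[unfolded fixmult_coeffs[OF w] a b]
  have "a4 = a5 * 5" "a3 = a5 * 10" "a2 = a5 * 10" "b1 = a5 * - 5" "b0 = a5 * - 1"
    by (insert e, (elim conjE, algebra)+)
  then show ?thesis unfolding omega_homog
    using nz by (intro lconj_multiple[OF _ w, of a5]) (simp_all add: a b)
qed

lemma normal_422:
  assumes h: "hform w" and "fixmult 2 w (0, 1)" "fixmult 2 w (1, 0)" "fixmult 4 w (1, - 1)"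
  shows "lconj w (omega 3)"
proof -
  obtain a0 a1 a2 a3 a4 a5 b0 b1 b2 b3 b4 b5
    where w: "w = (homog 5 [:a0, a1, a2, a3, a4, a5:], homog 5 [:b0, b1, b2, b3, b4, b5:])"
    using hform_coeffs[OF h] .
  have b: "b5 = 0" "b4 = 0" "b3 = 0"
    using assms(2) by (auto simp: fixmult_infinity[OF w])
  have a: "a0 = 0" "a1 = 0" "a2 = 0"
    using assms(3) by (auto simp: fixmult_zero[OF w])
  have nz: "a5 \<noteq> 0"
    using hform_infinity[OF w h] b by simp
  note e = assms(4)[unfolded fixmult_coeffs[OF w] a b]
  have "a4 = a5 * 5" "a3 = a5 * 10" "b2 = a5 * - 10" "b1 = a5 * - 5" "b0 = a5 * - 1"
    by (insert e, (elim conjE, algebra)+)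
  then show ?thesis unfolding omega_homog
    using nz by (intro lconj_multiple[OF _ w, of a5]) (simp_all add: a b)
qed

lemma normal_332:
  assumes h: "hform w" and "fixmult 3 w (0, 1)" "fixmult 3 w (1, 0)" "fixmult 2 w (1, 1)"
  shows "lconj w (omega 4)"
proof -
  obtain a0 a1 a2 a3 a4 a5 b0 b1 b2 b3 b4 b5
    where w: "w = (homog 5 [:a0, a1, a2, a3, a4, a5:], homog 5 [:b0, b1, b2, b3, b4, b5:])"
    using hform_coeffs[OF h] .
  have b: "b5 = 0" "b4 = 0" "b3 = 0" "b2 = 0"
    using assms(2) by (auto simp: fixmult_infinity[OF w])
  have a: "a0 = 0" "a1 = 0" "a2 = 0" "a3 = 0"
    using assms(3) by (auto simp: fixmult_zero[OF w])
  have nz: "a5 \<noteq> 0"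
    using hform_infinity[OF w h] b by simp
  define k where "k = - a5 / 3"
  have k: "a5 = - 3 * k" by (simp add: k_def)
  note e = assms(4)[unfolded fixmult_coeffs[OF w] a b k power_one mult_1_left mult_1_right]
  have "a4 = k * 5" "b1 = k * - 5" "b0 = k * 3"
    by (insert e, (elim conjE, algebra)+)
  then show ?thesis unfolding omega_homog
    using nz by (intro lconj_multiple[OF _ w, of k]) (simp_all add: a b k)
qed

text \<open>Eliminating a3, a4 and b0 leaves (s + 1)(3 s^2 - 5 s + 3) = 0 for the position s of the
  fourth direction. The root - 1 gives \<open>omega 5\<close>; both roots of the quadratic factor
  can be scaled to \<open>omega 6\<close>.\<close>

lemma normal_4211:
  assumes h: "hform w" and "fixmult 4 w (0, 1)" "fixmult 2 w (1, 0)" "fixmult 1 w (1, 1)" "fixmult 1 w (1, s)"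
    and s: "s \<noteq> 0" "s \<noteq> 1"
  shows "lconj w (omega 5) \<or> lconj w (omega 6)"
proof -
  obtain a0 a1 a2 a3 a4 a5 b0 b1 b2 b3 b4 b5
    where w: "w = (homog 5 [:a0, a1, a2, a3, a4, a5:], homog 5 [:b0, b1, b2, b3, b4, b5:])"
    using hform_coeffs[OF h] .
  have b: "b5 = 0" "b4 = 0" "b3 = 0" "b2 = 0" "b1 = 0"
    using assms(2) by (auto simp: fixmult_infinity[OF w])
  have a: "a0 = 0" "a1 = 0" "a2 = 0"
    using assms(3) by (auto simp: fixmult_zero[OF w])
  have nz: "a5 \<noteq> 0"
    using hform_infinity[OF w h] b by simp
  \<comment> \<open>The factor 12 clears the denominators in a3, a4 and b0.\<close>
  define k where "k = a5 / 12"
  have k: "a5 = 12 * k" "k \<noteq> 0" using nz by (simp_all add: k_def)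
  note e = assms(4)[unfolded fixmult_coeffs[OF w] a b k power_one mult_1_left mult_1_right]
  note f = assms(5)[unfolded fixmult_coeffs[OF w] a b k]
  have "s ^ 2 * (3 * a3 + 4 * a4 * s + 60 * k * s ^ 2) = 0" "s * (a3 * s ^ 2 + a4 * s ^ 3 + 12 * k * s ^ 4 + b0) = 0"
    by (insert f, (elim conjE, algebra)+)
  then have f': "3 * a3 + 4 * a4 * s + 60 * k * s ^ 2 = 0" "a3 * s ^ 2 + a4 * s ^ 3 + 12 * k * s ^ 4 + b0 = 0"
    using s by simp_all
  have e': "3 * a3 + 4 * a4 + 60 * k = 0" "a3 + a4 + 12 * k + b0 = 0"
    by (insert e, (elim conjE, algebra)+)
  have "(s - 1) * (a4 + 15 * k * (s + 1)) = 0"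
    using e' f' by algebra
  then have "a4 + 15 * k * (s + 1) = 0" using s by simp
  then have a4: "a4 = k * (- 15 * (s + 1))" by algebra
  have a3: "a3 = k * (20 * s)" using e'(1) a4 by algebra
  have b0: "b0 = k * (3 - 5 * s)" using e'(2) a3 a4 by algebra
  have "k * ((s - 1) * (s + 1) * (3 * s ^ 2 - 5 * s + 3)) = 0"
    using f'(2) a3 a4 b0 by algebra
  then consider "s = - 1" | "3 * s ^ 2 - 5 * s + 3 = 0" using s k by (auto simp: add_eq_0_iff2)
  then show ?thesis
  proof cases
    case 1
    have "lconj w (omega 5)" unfolding omega_homog
      using k by (intro lconj_multiple[OF _ w, of "- 4 * k"]) (simp_all add: a b a3 a4 b0 1)
    then show ?thesis ..
  next
    case 2
    have s1: "1 + s \<noteq> 0"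
    proof
      assume "1 + s = 0"
      then have "s = - 1" by (simp add: add_eq_0_iff)
      then show False using 2 by simp
    qed
    \<comment> \<open>The scaling S = 11 / D of y is the one that turns the ratio a4 : a5 into the
      ratio - 165 : 36 of \<open>omega 6\<close>.\<close>
    define D where "D = 3 * (1 + s)"
    have D: "D \<noteq> 0" unfolding D_def using s1 by (metis mult_eq_0_iff zero_neq_numeral)
    define S where "S = 11 / D"
    have "S \<noteq> 0" "S * D = 11" using D by (simp_all add: S_def)
    then have S: "S \<noteq> 0" "3 * S * (1 + s) = 11" unfolding D_def by (simp_all add: algebra_simps)
    have "3 * (1 + s) ^ 2 = 11 * s" using 2 by algebra
    moreover have "(3 * S * (1 + s)) ^ 2 = 121" unfolding S(2) by simp
    ultimately have "11 * (3 * s * S ^ 2) = 11 * 11" by algebra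
    then have S2: "3 * s * S ^ 2 = 11" by (simp add: mult.assoc)
    have "3 * (5 * s - 3) * S ^ 4 = (3 * s * S ^ 2) ^ 2" using 2 by algebra
    then have S4: "3 * (5 * s - 3) * S ^ 4 = 121" unfolding S2 by simp
    have "lconj w (omega 6)" unfolding omega_homog
    proof (rule lconj_diag[OF _ S(1) w, of "3 * S ^ 5 / k"])
      show "3 * S ^ 5 / k * a3 = 220 * S ^ 3" using k a3 S2 by simp algebra
      show "3 * S ^ 5 / k * a4 = - 165 * S ^ 4" using k a4 S(2) by simp algebra
      show "3 * S ^ 5 / k * a5 = 36 * S ^ 5" using k by simp
      show "3 * S ^ 5 / k * b0 = - 121 * S" using k b0 S4 by simp algebra
    qed (use k S(1) in \<open>simp_all add: a b\<close>)
    then show ?thesis ..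
  qed
qed

text \<open>The double zeros at 1 and s leave (s^2 - 3 s + 1)(s^2 + 5 s + 1) = 0; the discriminants
  5 and 21 are the origin of \<open>sqrt5\<close> and \<open>sqrt21\<close>. Within each factor the
  two roots are reciprocal, and a scaling of y that exchanges the roles of 1 and s identifies
  them.\<close>

lemma normal_3311:
  assumes h: "hform w" and "fixmult 3 w (0, 1)" "fixmult 3 w (1, 0)" "fixmult 1 w (1, 1)" "fixmult 1 w (1, s)"
    and s: "s \<noteq> 0" "s \<noteq> 1"
  shows "lconj w (omega 7) \<or> lconj w (omega 8)"
proof -
  obtain a0 a1 a2 a3 a4 a5 b0 b1 b2 b3 b4 b5
    where w: "w = (homog 5 [:a0, a1, a2, a3, a4, a5:], homog 5 [:b0, b1, b2, b3, b4, b5:])"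
    using hform_coeffs[OF h] .
  have b: "b5 = 0" "b4 = 0" "b3 = 0" "b2 = 0"
    using assms(2) by (auto simp: fixmult_infinity[OF w])
  have a: "a0 = 0" "a1 = 0" "a2 = 0" "a3 = 0"
    using assms(3) by (auto simp: fixmult_zero[OF w])
  have nz: "a5 \<noteq> 0"
    using hform_infinity[OF w h] b by simp
  note e = assms(4)[unfolded fixmult_coeffs[OF w] a b power_one mult_1_left mult_1_right]
  note f = assms(5)[unfolded fixmult_coeffs[OF w] a b]
  have "s * (a4 * s ^ 3 + a5 * s ^ 4 + b0 + b1 * s) = 0" "s * (4 * a4 * s ^ 2 + 5 * a5 * s ^ 3 + b1) = 0"
    by (insert f, (elim conjE, algebra)+)
  then have f': "a4 * s ^ 3 + a5 * s ^ 4 + b0 + b1 * s = 0" "4 * a4 * s ^ 2 + 5 * a5 * s ^ 3 + b1 = 0"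
    using s by simp_all
  have e': "a4 + a5 + b0 + b1 = 0" "4 * a4 + 5 * a5 + b1 = 0"
    by (insert e, (elim conjE, algebra)+)
  have "(s - 1) * (4 * a4 * (s + 1) + 5 * a5 * (s ^ 2 + s + 1)) = 0"
    using e' f' by algebra
  then have r1: "4 * a4 * (s + 1) + 5 * a5 * (s ^ 2 + s + 1) = 0" using s by simp
  have "(s - 1) * (a4 * (s ^ 2 + s - 3) + a5 * (s ^ 3 + s ^ 2 + s - 4)) = 0"
    using e' f' by algebra
  then have r2: "a4 * (s ^ 2 + s - 3) + a5 * (s ^ 3 + s ^ 2 + s - 4) = 0" using s by simp
  have s1: "s + 1 \<noteq> 0"
  proof
    assume "s + 1 = 0"
    then have "a5 = 0" using r1 by algebra
    then show False using nz by simp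
  qed
  then have s4: "4 * (s + 1) \<noteq> 0" by (metis mult_eq_0_iff zero_neq_numeral)
  define k where "k = a5 / (4 * (s + 1))"
  have k: "a5 = 4 * (s + 1) * k" "k \<noteq> 0"
    using nz s4 unfolding k_def by (simp_all only: times_divide_eq_right nonzero_mult_div_cancel_left divide_eq_0_iff not_False_eq_True de_Morgan_disj)
  define Y where "Y = 2 * (s + 1) * k"
  have Y: "Y \<noteq> 0" unfolding Y_def using k(2) s1 by (metis mult_eq_0_iff zero_neq_numeral)
  have "4 * (s + 1) * (a4 + 5 * (s ^ 2 + s + 1) * k) = 0" using r1 k(1) by algebra
  then have "a4 + 5 * (s ^ 2 + s + 1) * k = 0" by (rule mult_zeroD) (rule s4)
  then have a4: "a4 = - 5 * (s ^ 2 + s + 1) * k" by algebra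
  have b1: "b1 = 20 * s ^ 2 * k" using e'(2) a4 k(1) by algebra
  have b0: "b0 = (- 15 * s ^ 2 + s + 1) * k" using e'(1) a4 b1 k(1) by algebra
  have "k * ((s ^ 2 + 5 * s + 1) * (s ^ 2 - 3 * s + 1)) = 0" using r2 a4 k(1) by algebra
  then consider "s ^ 2 - 3 * s + 1 = 0" | "s ^ 2 + 5 * s + 1 = 0" using k by auto
  then show ?thesis
  proof cases
    case 1
    have q: "sqrt5 ^ 2 = 5" unfolding sqrt5_def by (simp flip: of_real_power)
    have "(2 * s - (3 - sqrt5)) * (2 * s - (3 + sqrt5)) = 0" using 1 q by algebra
    then consider "2 * s = 3 - sqrt5" | "2 * s = 3 + sqrt5" unfolding mult_eq_0_iff right_minus_eq by blast
    then have "lconj w (omega 7)"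
    proof cases
      case 1
      define K where "K = - Y"
      have K: "K \<noteq> 0" using Y by (simp add: K_def)
      show ?thesis unfolding omega_homog
      proof (rule lconj_multiple[OF K w])
        show "a4 = K * (5 - sqrt5)" "a5 = K * - 2" "b0 = K * (7 - 3 * sqrt5)" "b1 = K * (- 2 * (5 - 2 * sqrt5))"
          using a4 k(1) b0 b1 1 q K_def Y_def by algebra+
      qed (simp_all add: a b)
    next
      case 2
      \<comment> \<open>The other root, equal to 1 / s: scaling y by it moves the direction s to 1
        and the direction 1 to 1 / s.\<close>
      define S where "S = (3 - sqrt5) / 2"
      have S: "2 * S = 3 - sqrt5" "s * S = 1" using 2 q by (simp_all add: S_def) algebra
      define K where "K = - (S ^ 5) / Y"
      have K: "K * Y = - (S ^ 5)" "K \<noteq> 0" using Y S(2) by (auto simp: K_def)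
      \<comment> \<open>Multiplication by Y, the denominator of K, turns the required equalities
        into polynomial consequences of the relations.\<close>
      have z: "Y * (K * a4 - (5 - sqrt5) * S ^ 4) = 0" "Y * (K * a5 - - 2 * S ^ 5) = 0"
        "Y * (K * b0 - (7 - 3 * sqrt5) * S) = 0" "Y * (K * b1 - (- 2 * (5 - 2 * sqrt5)) * S ^ 2) = 0"
        using a4 k(1) b0 b1 2 q K(1) S Y_def by algebra+
      show ?thesis unfolding omega_homog
      proof (rule lconj_diag[OF K(2) _ w, of S])
        show "K * a4 = (5 - sqrt5) * S ^ 4" "K * a5 = - 2 * S ^ 5" "K * b0 = (7 - 3 * sqrt5) * S" "K * b1 = (- 2 * (5 - 2 * sqrt5)) * S ^ 2"
          using z Y by (simp_all add: eq_neg_iff_add_eq_0)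
      qed (use S in \<open>auto simp: a b\<close>)
    qed
    then show ?thesis ..
  next
    case 2
    have q: "sqrt21 ^ 2 = 21" unfolding sqrt21_def by (simp flip: of_real_power)
    have "(2 * s - (sqrt21 - 5)) * (2 * s - (- sqrt21 - 5)) = 0" using 2 q by algebra
    then consider "2 * s = sqrt21 - 5" | "2 * s = - sqrt21 - 5" unfolding mult_eq_0_iff right_minus_eq by blast
    then have "lconj w (omega 8)"
    proof cases
      case 1
      define K where "K = Y / 3"
      have K: "K \<noteq> 0" "3 * K = Y" using Y by (simp_all add: K_def)
      show ?thesis unfolding omega_homog
      proof (rule lconj_multiple[OF K(1) w])
        show "a4 = K * (5 * (3 - sqrt21))" "a5 = K * 6" "b0 = K * (3 * (23 - 5 * sqrt21))" "b1 = K * (- 10 * (9 - 2 * sqrt21))"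
          using a4 k(1) b0 b1 1 q K(2) Y_def by algebra+
      qed (simp_all add: a b)
    next
      case 2
      define S where "S = (sqrt21 - 5) / 2"
      have S: "2 * S = sqrt21 - 5" "s * S = 1" using 2 q by (simp_all add: S_def) algebra
      define K where "K = 3 * S ^ 5 / Y"
      have K: "K * Y = 3 * S ^ 5" "K \<noteq> 0" using Y S(2) by (auto simp: K_def)
      have z: "Y * (K * a4 - (5 * (3 - sqrt21)) * S ^ 4) = 0" "Y * (K * a5 - 6 * S ^ 5) = 0"
        "Y * (K * b0 - (3 * (23 - 5 * sqrt21)) * S) = 0" "Y * (K * b1 - (- 10 * (9 - 2 * sqrt21)) * S ^ 2) = 0"
        using a4 k(1) b0 b1 2 q K(1) S Y_def by algebra+
      show ?thesis unfolding omega_homog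
      proof (rule lconj_diag[OF K(2) _ w, of S])
        show "K * a4 = (5 * (3 - sqrt21)) * S ^ 4" "K * a5 = 6 * S ^ 5" "K * b0 = (3 * (23 - 5 * sqrt21)) * S" "K * b1 = (- 10 * (9 - 2 * sqrt21)) * S ^ 2"
          using z Y by (simp_all add: eq_neg_iff_add_eq_0)
      qed (use S in \<open>auto simp: a b\<close>)
    qed
    then show ?thesis ..
  qed
qed

text \<open>Up to a factor, the pairs with multiplicities 3, 2, 2 at infinity, 0 and 1;
  \<open>\<alpha>\<close> is the parameter left before the eighth critical point is required to be
  fixed.\<close>

definition form9 :: "complex \<Rightarrow> form2" where
  "form9 \<alpha> = (homog 5 [:0, 0, 0, 2 * (5 + \<alpha>), - (15 + \<alpha>), 6:], homog 5 [:- (1 - \<alpha>), - 2 * \<alpha>, 0, 0, 0, 0:])"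

text \<open>The substitution y -> x - y exchanges the directions 0 and 1, which have the same
  multiplicity.\<close>

lemma form9_uminus: "lconj (form9 (- \<alpha>)) (form9 \<alpha>)"
proof -
  have "pulls 1 0 1 (- 1) (- 1) (form9 \<alpha>) (form9 (- \<alpha>))"
    unfolding pulls_def form9_def fst_conv snd_conv homog_5_pCons
  proof (intro conjI allI)
    fix x y
    let ?A = "0 * (1 * x + 0 * y) ^ 5 + 0 * (1 * x + 0 * y) ^ 4 * (1 * x + - 1 * y) + 0 * (1 * x + 0 * y) ^ 3 * (1 * x + - 1 * y) ^ 2 +
      2 * (5 + \<alpha>) * (1 * x + 0 * y) ^ 2 * (1 * x + - 1 * y) ^ 3 + - (15 + \<alpha>) * (1 * x + 0 * y) * (1 * x + - 1 * y) ^ 4 + 6 * (1 * x + - 1 * y) ^ 5"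
    let ?B = "- (1 - \<alpha>) * (1 * x + 0 * y) ^ 5 + - 2 * \<alpha> * (1 * x + 0 * y) ^ 4 * (1 * x + - 1 * y) + 0 * (1 * x + 0 * y) ^ 3 * (1 * x + - 1 * y) ^ 2 +
      0 * (1 * x + 0 * y) ^ 2 * (1 * x + - 1 * y) ^ 3 + 0 * (1 * x + 0 * y) * (1 * x + - 1 * y) ^ 4 + 0 * (1 * x + - 1 * y) ^ 5"
    show "1 * ?A + 1 * ?B = - 1 * (0 * x ^ 5 + 0 * x ^ 4 * y + 0 * x ^ 3 * y ^ 2 + 2 * (5 + - \<alpha>) * x ^ 2 * y ^ 3 + - (15 + - \<alpha>) * x * y ^ 4 + 6 * y ^ 5)"
      by (simp add: algebra_simps) algebra
    show "0 * ?A + - 1 * ?B = - 1 * (- (1 - - \<alpha>) * x ^ 5 + - 2 * - \<alpha> * x ^ 4 * y + 0 * x ^ 3 * y ^ 2 + 0 * x ^ 2 * y ^ 3 + 0 * x * y ^ 4 + 0 * y ^ 5)"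
      by (simp add: algebra_simps) algebra
  qed simp_all
  then show ?thesis unfolding lconj_def by blast
qed

lemma a_const_b_const: "a_const ^ 2 = 5 * (4 * complex_of_real (sqrt 61) - 31)" "(\<i> * b_const) ^ 2 = - 5 * (4 * complex_of_real (sqrt 61) + 31)"
proof -
  \<comment> \<open>The radicand of \<open>a_const\<close> is nonnegative since 16 * 61 = 976
    exceeds 31^2 = 961; otherwise its square would not be the stated number.\<close>
  have "(4 * sqrt 61) ^ 2 \<ge> 31 ^ 2" by simp
  then have "4 * sqrt 61 \<ge> 31" by (simp add: power2_le_imp_le)
  then show "a_const ^ 2 = 5 * (4 * complex_of_real (sqrt 61) - 31)"
    by (simp add: a_const_def flip: of_real_power)
  show "(\<i> * b_const) ^ 2 = - 5 * (4 * complex_of_real (sqrt 61) + 31)"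
    by (simp add: b_const_def power_mult_distrib flip: of_real_power)
qed

text \<open>Eliminating s leaves \<open>\<alpha>\<close> ^ 4 + 310 \<open>\<alpha>\<close> ^ 2 - 375
  = 0, so \<open>\<alpha>\<close> ^ 2 is - 155 + 20 sqrt 61 or - 155 - 20 sqrt 61. The four roots
  are \<open>a_const\<close>, \<open>\<i> * b_const\<close> and their negatives, and
  \<open>form9_uminus\<close> identifies opposite ones.\<close>

lemma normal_3221:
  assumes h: "hform w" and "fixmult 3 w (0, 1)" "fixmult 2 w (1, 0)" "fixmult 2 w (1, 1)" "fixmult 1 w (1, s)"
    and s: "s \<noteq> 0" "s \<noteq> 1"
  shows "lconj w (omega 9) \<or> lconj w (omega 10)"
proof -
  obtain a0 a1 a2 a3 a4 a5 b0 b1 b2 b3 b4 b5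
    where w: "w = (homog 5 [:a0, a1, a2, a3, a4, a5:], homog 5 [:b0, b1, b2, b3, b4, b5:])"
    using hform_coeffs[OF h] .
  have b: "b5 = 0" "b4 = 0" "b3 = 0" "b2 = 0"
    using assms(2) by (auto simp: fixmult_infinity[OF w])
  have a: "a0 = 0" "a1 = 0" "a2 = 0"
    using assms(3) by (auto simp: fixmult_zero[OF w])
  have nz: "a5 \<noteq> 0"
    using hform_infinity[OF w h] b by simp
  define k where "k = a5 / 6"
  have k: "a5 = 6 * k" "k \<noteq> 0" using nz by (simp_all add: k_def)
  define \<alpha> where "\<alpha> = - b1 / (2 * k)"
  have b1: "b1 = - 2 * \<alpha> * k" using k by (simp add: \<alpha>_def)
  note e = assms(4)[unfolded fixmult_coeffs[OF w] a b k(1) b1 power_one mult_1_left mult_1_right]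
  note f = assms(5)[unfolded fixmult_coeffs[OF w] a b k(1) b1]
  have r: "a4 = - (15 + \<alpha>) * k" "a3 = 2 * (5 + \<alpha>) * k" "b0 = - (1 - \<alpha>) * k"
    by (insert e, (elim conjE, algebra)+)
  have "k * s * (s - 1) * (15 * s * (s - 1) - \<alpha> * (2 * s - 1)) = 0"
    "k * s * (s - 1) * (6 * s ^ 3 - 9 * s ^ 2 + s + 1 - \<alpha> * (s ^ 2 - s + 1)) = 0"
    by (insert f r, (elim conjE, algebra)+)
  then have r1: "15 * s * (s - 1) - \<alpha> * (2 * s - 1) = 0" "6 * s ^ 3 - 9 * s ^ 2 + s + 1 - \<alpha> * (s ^ 2 - s + 1) = 0"
    using s k by simp_all
  have q: "\<alpha> ^ 4 + 310 * \<alpha> ^ 2 - 375 = 0"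
  proof -
    \<comment> \<open>The exchange of 0 and 1 acts as z -> - z together with a change of sign of
      \<open>\<alpha>\<close>; in this coordinate the eliminant is even.\<close>
    define z where "z = 2 * s - 1"
    have z1: "15 * (z ^ 2 - 1) = 4 * \<alpha> * z" "3 * z ^ 3 - 7 * z = \<alpha> * (z ^ 2 + 3)"
      using r1 z_def by algebra+
    then have z2: "3 * z ^ 4 + 58 * z ^ 2 - 45 = 0" by algebra
    have "16 * (z ^ 2 * (\<alpha> ^ 2 + 300) - 225) = 0" using z1 z2 by algebra
    then have u: "z ^ 2 * (\<alpha> ^ 2 + 300) = 225" by simp
    have "3 * (z ^ 2 * (\<alpha> ^ 2 + 300)) ^ 2 + 58 * (z ^ 2 * (\<alpha> ^ 2 + 300)) * (\<alpha> ^ 2 + 300) - 45 * (\<alpha> ^ 2 + 300) ^ 2 = 0"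
      using z2 by algebra
    then have "45 * (\<alpha> ^ 4 + 310 * \<alpha> ^ 2 - 375) = 0" unfolding u by algebra
    then show ?thesis by (rule mult_zeroD) simp
  qed
  define z where "z = complex_of_real (sqrt 61)"
  have z: "z ^ 2 = 61" by (simp add: z_def flip: of_real_power)
  have "(\<alpha> - a_const) * (\<alpha> + a_const) * ((\<alpha> - \<i> * b_const) * (\<alpha> + \<i> * b_const)) = 0"
    using q z a_const_b_const[folded z_def] by algebra
  then consider "\<alpha> = a_const" | "\<alpha> = - a_const" | "\<alpha> = \<i> * b_const" | "\<alpha> = - (\<i> * b_const)"
    by (auto simp: add_eq_0_iff2)
  moreover have "lconj w (form9 \<alpha>)" unfolding form9_def
    using k by (intro lconj_multiple[OF _ w, of k]) (simp_all add: a b r b1 algebra_simps)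
  moreover have "omega 9 = form9 a_const" "omega 10 = form9 (\<i> * b_const)"
    unfolding form9_def omega_homog by simp_all
  ultimately show ?thesis
    using form9_uminus[of a_const] form9_uminus[of "\<i> * b_const"] lconj_trans by cases (metis+)
qed

text \<open>The remaining condition (s + 1)(2 s - 1)(s - 2) = 0 says that the four directions are
  harmonic. The three values of s are permuted by the projective maps preserving the set of 0, 1 and
  infinity, so they give one class.\<close>

lemma normal_2222:
  assumes h: "hform w" and "fixmult 2 w (0, 1)" "fixmult 2 w (1, 0)" "fixmult 2 w (1, 1)" "fixmult 2 w (1, s)"
    and s: "s \<noteq> 0" "s \<noteq> 1"
  shows "lconj w (omega 11)"
proof -
  obtain a0 a1 a2 a3 a4 a5 b0 b1 b2 b3 b4 b5
    where w: "w = (homog 5 [:a0, a1, a2, a3, a4, a5:], homog 5 [:b0, b1, b2, b3, b4, b5:])"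
    using hform_coeffs[OF h] .
  have b: "b5 = 0" "b4 = 0" "b3 = 0"
    using assms(2) by (auto simp: fixmult_infinity[OF w])
  have a: "a0 = 0" "a1 = 0" "a2 = 0"
    using assms(3) by (auto simp: fixmult_zero[OF w])
  have nz: "a5 \<noteq> 0"
    using hform_infinity[OF w h] b by simp
  define k where "k = a5 / 9"
  have k: "a5 = 9 * k" "k \<noteq> 0" using nz by (simp_all add: k_def)
  note e = assms(4)[unfolded fixmult_coeffs[OF w] a b k(1) power_one mult_1_left mult_1_right]
  note f = assms(5)[unfolded fixmult_coeffs[OF w] a b k(1)]
  have e': "b2 = - (3 * a3 + 6 * a4 + 90 * k)" "b1 = 3 * a3 + 8 * a4 + 135 * k" "b0 = - (a3 + 3 * a4 + 54 * k)"
    by (insert e, (elim conjE, algebra)+)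
  have "2 * (s * (3 * a3 + 6 * a4 * s + 90 * k * s ^ 2 + b2)) = 0" "s * (3 * a3 * s + 4 * a4 * s ^ 2 + 45 * k * s ^ 3 + b1 + 2 * b2 * s) = 0"
    "s * (a3 * s ^ 2 + a4 * s ^ 3 + 9 * k * s ^ 4 + b0 + b1 * s + b2 * s ^ 2) = 0"
    by (insert f, (elim conjE, algebra)+)
  then have f': "3 * a3 + 6 * a4 * s + 90 * k * s ^ 2 + b2 = 0" "3 * a3 * s + 4 * a4 * s ^ 2 + 45 * k * s ^ 3 + b1 + 2 * b2 * s = 0"
    "a3 * s ^ 2 + a4 * s ^ 3 + 9 * k * s ^ 4 + b0 + b1 * s + b2 * s ^ 2 = 0"
    using s by simp_all
  have "6 * ((s - 1) * (a4 + 15 * k * (s + 1))) = 0" using e' f'(1) by algebra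
  then have "a4 + 15 * k * (s + 1) = 0" using s by simp
  then have a4: "a4 = k * (- 15 * (s + 1))" by algebra
  have "3 * ((s - 1) * (a3 - k * (- 5 * s ^ 2 + 35 * s - 5))) = 0" using e' f'(2) a4 by algebra
  then have "a3 - k * (- 5 * s ^ 2 + 35 * s - 5) = 0" using s by simp
  then have a3: "a3 = k * (- 5 * s ^ 2 + 35 * s - 5)" by algebra
  have "2 * k * (s - 1) ^ 2 * ((s + 1) * (2 * s - 1) * (s - 2)) = 0" using e' f'(3) a3 a4 by algebra
  then have "(s + 1) * (2 * s - 1) * (s - 2) = 0" by (rule mult_zeroD) (use s k in simp)
  then have "(s - - 1) * (s - 1 / 2) * (s - 2) = 0" by algebra
  then consider "s = - 1" | "s = 2" | "s = 1 / 2" unfolding mult_eq_0_iff right_minus_eq by blast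
  then show ?thesis
  proof cases
    case 1
    show ?thesis unfolding omega_homog
      using k by (intro lconj_multiple[OF _ w, of "- 9 * k"]) (simp_all add: a b a3 a4 e' 1)
  next
    case 2
    have c: "a3 = 45 * k" "a4 = - 45 * k" "b2 = 45 * k" "b1 = - 90 * k" "b0 = 36 * k"
      unfolding e' a3 a4 2 by simp_all
    \<comment> \<open>On slopes this is t -> 1 - t, which sends the directions 0, 1, - 1 of
      \<open>omega 11\<close> to 1, 0, 2.\<close>
    have "pulls 1 0 1 (- 1) (9 * k) w (omega 11)"
      unfolding omega_homog pulls_def w fst_conv snd_conv homog_5_pCons a b k(1) c
    proof (intro conjI allI)
      show "9 * k \<noteq> 0" using k(2) by simp
    qed (simp, algebra+)
    then show ?thesis using lconj_def lconj_sym by blast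
  next
    case 3
    have c: "a3 = 45 / 4 * k" "a4 = - (45 / 2) * k" "b2 = 45 / 4 * k" "b1 = - (45 / 4) * k" "b0 = 9 / 4 * k"
      unfolding e' a3 a4 3 by (simp_all add: power2_eq_square)
    define l where "l = k / 4"
    have l: "k = 4 * l" by (simp add: l_def)
    have c': "a3 = 45 * l" "a4 = - 90 * l" "b2 = 45 * l" "b1 = - 45 * l" "b0 = 9 * l"
      unfolding c l by simp_all
    \<comment> \<open>On slopes this is t -> (1 - t) / 2, which sends the directions 1, - 1, 0 of
      \<open>omega 11\<close> to 0, 1, 1 / 2.\<close>
    have "pulls 2 0 1 (- 1) (72 * l) w (omega 11)"
      unfolding omega_homog pulls_def w fst_conv snd_conv homog_5_pCons a b k(1) c' l
    proof (intro conjI allI)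
      show "72 * l \<noteq> 0" using k(2) l by simp
    qed (simp, algebra+)
    then show ?thesis using lconj_def lconj_sym by blast
  qed
qed

section \<open>Five critical directions and Newton maps\<close>

text \<open>With C(t) = c0 + c1 t + ... + c5 t^5 the pair is (C - t C', C'), so the slope map is the
  Newton map t - C / C'. The last two conclusions say that C vanishes on S and that multiplicity 2
  at a slope makes C'' vanish there.\<close>

lemma newton_form:
  assumes h: "hform w" and inf: "tang w (0, 1) = 0" and S: "finite S" "card S = 5" "\<And>t. t \<in> S \<Longrightarrow> fixmult 1 w (1, t)"
  obtains c0 c1 c2 c3 c4 c5 where "c5 \<noteq> 0"
    "w = (homog 5 [:c0, 0, - c2, - 2 * c3, - 3 * c4, - 4 * c5:], homog 5 [:c1, 2 * c2, 3 * c3, 4 * c4, 5 * c5, 0:])"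
    "\<And>t. t \<in> S \<Longrightarrow> c0 + c1 * t + c2 * t ^ 2 + c3 * t ^ 3 + c4 * t ^ 4 + c5 * t ^ 5 = 0"
    "\<And>t. fixmult 2 w (1, t) \<Longrightarrow> c2 + 3 * c3 * t + 6 * c4 * t ^ 2 + 10 * c5 * t ^ 3 = 0"
proof -
  obtain a0 a1 a2 a3 a4 a5 b0 b1 b2 b3 b4 b5
    where w: "w = (homog 5 [:a0, a1, a2, a3, a4, a5:], homog 5 [:b0, b1, b2, b3, b4, b5:])"
    using hform_coeffs[OF h] .
  have b5: "b5 = 0" using inf by (simp add: w tang_def homog_5_pCons)
  \<comment> \<open>This is b - c' for c = a + t b. It vanishes at every critical fixed slope and
    has degree at most 4 because b5 = 0, so five such slopes force b = c'.\<close>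
  define d where "d = [:b0 - (a1 + b0), b1 - 2 * (a2 + b1), b2 - 3 * (a3 + b2), b3 - 4 * (a4 + b3), b4 - 5 * (a5 + b4):]"
  have "poly d t = 0" if "t \<in> S" for t
  proof -
    note e = S(3)[OF that, unfolded fixmult_coeffs[OF w] b5]
    show ?thesis unfolding d_def using e
      by (elim conjE) (simp add: algebra_simps, algebra)
  qed
  then have sub: "S \<subseteq> {t. poly d t = 0}" by auto
  have "d = 0"
  proof (rule ccontr)
    assume d: "d \<noteq> 0"
    have "card S \<le> card {t. poly d t = 0}"
      using sub poly_roots_finite[OF d] by (intro card_mono)
    also have "\<dots> \<le> degree d" by (rule card_poly_roots_bound[OF d])
    also have "degree d \<le> 4" by (simp add: d_def)
    finally show False using S by simp
  qed
  then have e: "a1 = 0" "b1 = - 2 * a2" "2 * b2 = - 3 * a3" "3 * b3 = - 4 * a4" "4 * b4 = - 5 * a5"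
    unfolding d_def pCons_eq_0_iff by algebra+
  define c2 c3 c4 c5 where "c2 = - a2" and "c3 = - a3 / 2" and "c4 = - a4 / 3" and "c5 = - a5 / 4"
  have a: "a2 = - c2" "a3 = - 2 * c3" "a4 = - 3 * c4" "a5 = - 4 * c5"
    by (simp_all add: c2_def c3_def c4_def c5_def)
  have b: "b1 = 2 * c2" "b2 = 3 * c3" "b3 = 4 * c4" "b4 = 5 * c5"
    using e a by simp_all
  have w': "w = (homog 5 [:a0, 0, - c2, - 2 * c3, - 3 * c4, - 4 * c5:], homog 5 [:b0, 2 * c2, 3 * c3, 4 * c4, 5 * c5, 0:])"
    unfolding w e(1) a b b5 ..
  show thesis
  proof (rule that[OF _ w'])
    show "c5 \<noteq> 0" using hform_infinity[OF w' h] by simp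
    show "a0 + b0 * t + c2 * t ^ 2 + c3 * t ^ 3 + c4 * t ^ 4 + c5 * t ^ 5 = 0" if "t \<in> S" for t
      using S(3)[OF that, unfolded fixmult_coeffs[OF w']] by (elim conjE) algebra
    show "c2 + 3 * c3 * t + 6 * c4 * t ^ 2 + 10 * c5 * t ^ 3 = 0" if "fixmult 2 w (1, t)" for t
    proof -
      have "2 * (c2 + 3 * c3 * t + 6 * c4 * t ^ 2 + 10 * c5 * t ^ 3) = 0"
        using that[unfolded fixmult_coeffs[OF w']] by (elim conjE) algebra
      then show ?thesis by (rule mult_zeroD) simp
    qed
  qed
qed

text \<open>The left side is the Newton map of t^5 - t. The slope change t -> (1 + t) / (2 t) moves
  its direction 0, of multiplicity 4, to infinity.\<close>

lemma omega_13_newton: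
  "lconj (homog 5 [:0, 0, 0, 0, 0, - 4:], homog 5 [:- 1, 0, 0, 0, 5, 0:]) (omega 13)"
proof -
  have "pulls 0 2 1 1 8 (omega 13) (homog 5 [:0, 0, 0, 0, 0, - 4:], homog 5 [:- 1, 0, 0, 0, 5, 0:])"
    unfolding omega_homog pulls_def fst_conv snd_conv homog_5_pCons
    by (intro conjI allI) (simp, simp, algebra+)
  then show ?thesis unfolding lconj_def by blast
qed

text \<open>The left side is the Newton map of 3 t^5 - 10 t^3 + 7 t, with 0, 1, - 1 of multiplicity
  2; the slope change t -> (1 - t) / (1 + t) sends them to 1, 0 and infinity.\<close>

lemma omega_12_newton:
  "lconj (homog 5 [:0, 0, 0, 20, 0, - 12:], homog 5 [:7, 0, - 30, 0, 15, 0:]) (omega 12)"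
proof -
  have "pulls 1 1 1 (- 1) 4 (omega 12) (homog 5 [:0, 0, 0, 20, 0, - 12:], homog 5 [:7, 0, - 30, 0, 15, 0:])"
    unfolding omega_homog pulls_def fst_conv snd_conv homog_5_pCons
    by (intro conjI allI) (simp, simp, algebra+)
  then show ?thesis unfolding lconj_def by blast
qed

section \<open>The number sigma\<close>

text \<open>The difference quotient of the cubic is a sum of squares plus 64 / 3, so the cubic is
  strictly increasing.\<close>

lemma rho_unique: "\<exists>!r :: real. 8 * r ^ 3 - 52 * r ^ 2 + 134 * r - 15 = 0"
proof (rule ex_ex1I)
  have "\<exists>r. 0 \<le> r \<and> r \<le> 1 \<and> (\<lambda>r :: real. 8 * r ^ 3 - 52 * r ^ 2 + 134 * r - 15) r = 0"
    by (rule IVT') (auto intro!: continuous_intros)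
  then show "\<exists>r :: real. 8 * r ^ 3 - 52 * r ^ 2 + 134 * r - 15 = 0" by blast
next
  fix r s :: real
  assume rs: "8 * r ^ 3 - 52 * r ^ 2 + 134 * r - 15 = 0" "8 * s ^ 3 - 52 * s ^ 2 + 134 * s - 15 = 0"
  have "(r - s) * (8 * (r ^ 2 + r * s + s ^ 2) - 52 * (r + s) + 134) = 0"
    using rs by algebra
  moreover have "8 * (r ^ 2 + r * s + s ^ 2) - 52 * (r + s) + 134 = 2 * (r - s) ^ 2 + 6 * (r + s - 13 / 3) ^ 2 + 64 / 3"
    by (simp add: power2_eq_square algebra_simps)
  moreover have "2 * (r - s) ^ 2 + 6 * (r + s - 13 / 3) ^ 2 + 64 / 3 > 0"
    by (intro add_nonneg_pos) auto
  ultimately show "r = s" by simp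
qed

lemma rho_root: "8 * rho ^ 3 - 52 * rho ^ 2 + 134 * rho - 15 = 0"
  unfolding rho_def by (rule theI'[OF rho_unique])

text \<open>The upper bound is just strong enough to keep the radicand in \<open>sigma\<close>
  nonnegative, so that the imaginary part of \<open>sigma\<close> squares to it.\<close>

lemma rho_bounds: "0 < rho" "rho < 3 / 25"
proof -
  have mono: "8 * r ^ 3 - 52 * r ^ 2 + 134 * r - 15 \<le> 8 * s ^ 3 - 52 * s ^ 2 + 134 * s - 15" if "r \<le> s" for r s :: real
  proof -
    have "(8 * s ^ 3 - 52 * s ^ 2 + 134 * s - 15) - (8 * r ^ 3 - 52 * r ^ 2 + 134 * r - 15) = (s - r) * (2 * (r - s) ^ 2 + 6 * (r + s - 13 / 3) ^ 2 + 64 / 3)"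
      by (simp add: power2_eq_square power3_eq_cube algebra_simps)
    also have "\<dots> \<ge> 0" using that by (intro mult_nonneg_nonneg add_nonneg_nonneg) auto
    finally show ?thesis by simp
  qed
  show "0 < rho" using mono[of rho 0] rho_root by (cases "rho \<le> 0") auto
  show "rho < 3 / 25" using mono[of "3 / 25" rho] rho_root by (cases "3 / 25 \<le> rho") (auto simp: field_simps power2_eq_square power3_eq_cube)
qed

text \<open>The palindromic sextic has as roots the six quotients of two distinct roots of 2 y^3 - 8
  y^2 + 12 y - 3, the simple critical slopes of the pair \<open>?M\<close> in
  \<open>omega_14_newton\<close>. Here it is obtained by eliminating \<open>rho\<close> between its
  cubic and the real quadratic equation of \<open>sigma\<close>.\<close>

lemma sigma_root: "3 * sigma ^ 6 - 39 * sigma ^ 5 + 194 * sigma ^ 4 - 203 * sigma ^ 3 + 194 * sigma ^ 2 - 39 * sigma + 3 = 0"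
proof -
  define r where "r = complex_of_real rho"
  define t where "t = complex_of_real (sqrt (1/6 - 4/3 * rho - 1/3 * rho ^ 2))"
  have "rho ^ 2 \<le> (3 / 25) ^ 2" using rho_bounds by (intro power_mono) auto
  then have "1/6 - 4/3 * rho - 1/3 * rho ^ 2 \<ge> 0" using rho_bounds by (simp add: power2_eq_square)
  then have "t ^ 2 = 1/6 - 4/3 * r - 1/3 * r ^ 2"
    unfolding t_def r_def of_real_power[symmetric] by simp
  then have t: "6 * t ^ 2 = 1 - 8 * r - 2 * r ^ 2" by (simp add: algebra_simps)
  have "complex_of_real (8 * rho ^ 3 - 52 * rho ^ 2 + 134 * rho - 15) = 0"
    unfolding rho_root by simp
  then have g: "8 * r ^ 3 - 52 * r ^ 2 + 134 * r - 15 = 0" by (simp add: r_def)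
  have "sigma = r + \<i> * t" by (simp add: sigma_def r_def t_def)
  moreover have "\<i> ^ 2 = (- 1 :: complex)" by simp
  ultimately have f: "6 * sigma ^ 2 - 12 * r * sigma + 4 * r ^ 2 + 1 - 8 * r = 0" using t by algebra
  \<comment> \<open>A combination of f and g that is linear in r: it gives r = N / (10 E), which is
    then substituted into f.\<close>
  have "6 * (10 * (sigma ^ 2 - sigma + 1) * r - (6 * sigma ^ 3 - 9 * sigma ^ 2 + sigma + 1)) = 0"
    using f g by algebra
  then have R: "10 * (sigma ^ 2 - sigma + 1) * r - (6 * sigma ^ 3 - 9 * sigma ^ 2 + sigma + 1) = 0" by (rule mult_zeroD) simp
  define E where "E = sigma ^ 2 - sigma + 1"
  define N where "N = 6 * sigma ^ 3 - 9 * sigma ^ 2 + sigma + 1"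
  have R': "10 * E * r = N" using R by (simp add: E_def N_def)
  have "4 * (10 * E * r) ^ 2 - (12 * sigma + 8) * 10 * E * (10 * E * r) + (6 * sigma ^ 2 + 1) * 100 * E ^ 2 = 0"
    using f by algebra
  then have "4 * N ^ 2 - (12 * sigma + 8) * 10 * E * N + (6 * sigma ^ 2 + 1) * 100 * E ^ 2 = 0"
    unfolding R' .
  then have "8 * (3 * sigma ^ 6 - 39 * sigma ^ 5 + 194 * sigma ^ 4 - 203 * sigma ^ 3 + 194 * sigma ^ 2 - 39 * sigma + 3) = 0"
    unfolding E_def N_def by algebra
  then show ?thesis by (rule mult_zeroD) simp
qed

text \<open>The left side is the Newton map of 3 t^5 - 5 t^4 + 2 t. In \<open>?M\<close> the
  directions of multiplicity 3 and 2 are moved to infinity and 0; \<open>omega 14\<close> differs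
  from \<open>?M\<close> by the scaling that puts one simple critical slope at 1 and another at
  \<open>sigma\<close>.\<close>

lemma omega_14_newton:
  "lconj (homog 5 [:0, 0, 0, 0, 15, - 12:], homog 5 [:2, 0, 0, - 20, 15, 0:]) (omega 14)"
proof -
  let ?M = "(homog 5 [:0, 0, 0, - 20, 10, - 2:], homog 5 [:- 3, 15, 0, 0, 0, 0:])"
  have "pulls 1 (- 1) 1 0 1 (homog 5 [:0, 0, 0, 0, 15, - 12:], homog 5 [:2, 0, 0, - 20, 15, 0:]) ?M"
    unfolding pulls_def fst_conv snd_conv homog_5_pCons
    by (intro conjI allI) (simp, simp, algebra+)
  then have 1: "lconj (homog 5 [:0, 0, 0, 0, 15, - 12:], homog 5 [:2, 0, 0, - 20, 15, 0:]) ?M"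
    using lconj_def lconj_sym by blast
  note m6 = sigma_root
  define E where "E = sigma ^ 2 - sigma + 1"
  define N where "N = (sigma + 1) * (3 * sigma ^ 2 - 5 * sigma + 3)"
  have E0: "E \<noteq> 0"
  proof
    assume "E = 0"
    then have "(1 :: complex) = 0" using m6 unfolding E_def by algebra
    then show False by simp
  qed
  have N0: "N \<noteq> 0"
  proof
    assume "N = 0"
    then have "(1 :: complex) = 0" using m6 unfolding N_def by algebra
    then show False by simp
  qed
  have s0: "sigma \<noteq> 0" using m6 by auto
  \<comment> \<open>These three identities hold modulo the sextic. They are the matching conditions
    for the coefficients of y^3, y^4 and y^5 after elimination of S and k.\<close>
  have u: "2 * N ^ 2 = 15 * u_pol sigma * E" using m6 unfolding N_def E_def u_pol_def by algebra
  have v: "N ^ 3 = - 150 * v_pol sigma * sigma * E ^ 2" using m6 unfolding N_def E_def v_pol_def by algebra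
  have w: "N ^ 4 = 7500 * w_pol sigma * sigma ^ 2 * E ^ 3" using m6 unfolding N_def E_def w_pol_def by algebra
  \<comment> \<open>S and k are forced by matching the two nonzero coefficients of the second
    form.\<close>
  define S where "S = 10 * sigma * E / N"
  have S: "S * N = 10 * sigma * E" "S \<noteq> 0" using E0 N0 s0 by (simp_all add: S_def)
  define k where "k = - (2 * sigma ^ 2 * E) * S / 3"
  have k: "3 * k = - (2 * sigma ^ 2 * E) * S" "k \<noteq> 0" using S(2) E0 s0 by (simp_all add: k_def)
  have "lconj ?M (omega 14)" unfolding omega_homog
  proof (rule lconj_diag[OF k(2) S(2) refl])
    have "3 * N ^ 2 * (k * - 20 - u_pol sigma * S ^ 3) = 0" using k(1) S(1) u by algebra
    then show "k * - 20 = u_pol sigma * S ^ 3" using N0 by simp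
    have "3 * N ^ 3 * (k * 10 - v_pol sigma * S ^ 4) = 0" using k(1) S(1) v by algebra
    then show "k * 10 = v_pol sigma * S ^ 4" using N0 by simp
    have "3 * N ^ 4 * (k * - 2 - w_pol sigma * S ^ 5) = 0" using k(1) S(1) w by algebra
    then show "k * - 2 = w_pol sigma * S ^ 5" using N0 by simp
    show "k * - 3 = 2 * sigma\<^sup>2 * (sigma\<^sup>2 - sigma + 1) * S" using k(1) unfolding E_def by algebra
    show "k * 15 = - sigma * (sigma + 1) * (3 * sigma\<^sup>2 - 5 * sigma + 3) * S ^ 2"
      using k(1) S(1) unfolding E_def N_def by algebra
  qed simp_all
  with 1 show ?thesis by (rule lconj_trans)
qed

section \<open>Classification by the multiplicities of critical directions\<close>

text \<open>Multiplicity 4 at 0 reduces C to c1 t + c5 t^5, and the root 1 fixes the ratio.\<close>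

lemma newton_41111:
  assumes h: "hform w" and inf: "tang w (0, 1) = 0" and S: "finite S" "card S = 5" "\<And>t. t \<in> S \<Longrightarrow> fixmult 1 w (1, t)"
    and "fixmult 4 w (1, 0)" "1 \<in> S"
  shows "lconj w (omega 13)"
proof (rule newton_form[OF h inf S])
  fix c0 c1 c2 c3 c4 c5
  assume c5: "c5 \<noteq> 0"
    and w: "w = (homog 5 [:c0, 0, - c2, - 2 * c3, - 3 * c4, - 4 * c5:], homog 5 [:c1, 2 * c2, 3 * c3, 4 * c4, 5 * c5, 0:])"
    and r: "\<And>t. t \<in> S \<Longrightarrow> c0 + c1 * t + c2 * t ^ 2 + c3 * t ^ 3 + c4 * t ^ 4 + c5 * t ^ 5 = 0"
  have c: "c0 = 0" "c2 = 0" "c3 = 0" "c4 = 0"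
    using assms(6) by (auto simp: fixmult_zero[OF w])
  have c1: "c1 = - c5" using r[OF assms(7)] c by (simp add: add_eq_0_iff2)
  have "lconj w (homog 5 [:0, 0, 0, 0, 0, - 4:], homog 5 [:- 1, 0, 0, 0, 5, 0:])"
    using c5 by (intro lconj_multiple[OF _ w, of c5]) (simp_all add: c c1)
  then show ?thesis using omega_13_newton lconj_trans by blast
qed

text \<open>Only t, t^4 and t^5 survive in C, and C(1) = C''(1) = 0 determines C up to a
  factor.\<close>

lemma newton_32111:
  assumes h: "hform w" and inf: "tang w (0, 1) = 0" and S: "finite S" "card S = 5" "\<And>t. t \<in> S \<Longrightarrow> fixmult 1 w (1, t)"
    and "fixmult 3 w (1, 0)" "1 \<in> S" "fixmult 2 w (1, 1)"
  shows "lconj w (omega 14)"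
proof (rule newton_form[OF h inf S])
  fix c0 c1 c2 c3 c4 c5
  assume c5: "c5 \<noteq> 0"
    and w: "w = (homog 5 [:c0, 0, - c2, - 2 * c3, - 3 * c4, - 4 * c5:], homog 5 [:c1, 2 * c2, 3 * c3, 4 * c4, 5 * c5, 0:])"
    and r: "\<And>t. t \<in> S \<Longrightarrow> c0 + c1 * t + c2 * t ^ 2 + c3 * t ^ 3 + c4 * t ^ 4 + c5 * t ^ 5 = 0"
    and d: "\<And>t. fixmult 2 w (1, t) \<Longrightarrow> c2 + 3 * c3 * t + 6 * c4 * t ^ 2 + 10 * c5 * t ^ 3 = 0"
  have c: "c0 = 0" "c2 = 0" "c3 = 0"
    using assms(6) by (auto simp: fixmult_zero[OF w])
  define k where "k = c5 / 3"
  have k: "c5 = 3 * k" "k \<noteq> 0" using c5 by (simp_all add: k_def)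
  have c': "c4 = - 5 * k" "c1 = 2 * k"
    using d[OF assms(8), unfolded c k(1) power_one mult_1_right] r[OF assms(7), unfolded c k(1) power_one mult_1_right] by algebra+
  have "lconj w (homog 5 [:0, 0, 0, 0, 15, - 12:], homog 5 [:2, 0, 0, - 20, 15, 0:])"
    using k by (intro lconj_multiple[OF _ w, of k]) (simp_all add: c c')
  then show ?thesis using omega_14_newton lconj_trans by blast
qed

text \<open>C and C'' vanish together at 0, 1 and s, which forces s to be - 1, 2 or 1 / 2. Affine
  changes of the slope, which keep infinity fixed, identify the three cases.\<close>

lemma newton_22211:
  assumes h: "hform w" and inf: "tang w (0, 1) = 0" and S: "finite S" "card S = 5" "\<And>t. t \<in> S \<Longrightarrow> fixmult 1 w (1, t)"
    and "fixmult 2 w (1, 0)" "1 \<in> S" "fixmult 2 w (1, 1)" "s \<in> S" "fixmult 2 w (1, s)" and s: "s \<noteq> 0" "s \<noteq> 1"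
  shows "lconj w (omega 12)"
proof (rule newton_form[OF h inf S])
  fix c0 c1 c2 c3 c4 c5
  assume c5: "c5 \<noteq> 0"
    and w: "w = (homog 5 [:c0, 0, - c2, - 2 * c3, - 3 * c4, - 4 * c5:], homog 5 [:c1, 2 * c2, 3 * c3, 4 * c4, 5 * c5, 0:])"
    and r: "\<And>t. t \<in> S \<Longrightarrow> c0 + c1 * t + c2 * t ^ 2 + c3 * t ^ 3 + c4 * t ^ 4 + c5 * t ^ 5 = 0"
    and d: "\<And>t. fixmult 2 w (1, t) \<Longrightarrow> c2 + 3 * c3 * t + 6 * c4 * t ^ 2 + 10 * c5 * t ^ 3 = 0"
  have c: "c0 = 0" "c2 = 0"
    using assms(6) by (auto simp: fixmult_zero[OF w])
  define k where "k = c5 / 6"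
  have k: "c5 = 6 * k" "k \<noteq> 0" using c5 by (simp_all add: k_def)
  have 1: "c3 + 2 * c4 + 20 * k = 0" "c1 + c3 + c4 + 6 * k = 0"
  proof -
    have "3 * (c3 + 2 * c4 + 20 * k) = 0"
      using d[OF assms(8), unfolded c k(1) power_one mult_1_right] by algebra
    then show "c3 + 2 * c4 + 20 * k = 0" by (rule mult_zeroD) simp
    show "c1 + c3 + c4 + 6 * k = 0"
      using r[OF assms(7), unfolded c k(1) power_one mult_1_right] by algebra
  qed
  have "3 * s * (c3 + 2 * c4 * s + 20 * k * s ^ 2) = 0"
    using d[OF assms(10), unfolded c k(1)] by algebra
  then have 2: "c3 + 2 * c4 * s + 20 * k * s ^ 2 = 0" using s by simp
  have "s * (c1 + c3 * s ^ 2 + c4 * s ^ 3 + 6 * k * s ^ 4) = 0"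
    using r[OF assms(9), unfolded c k(1)] by algebra
  then have 3: "c1 + c3 * s ^ 2 + c4 * s ^ 3 + 6 * k * s ^ 4 = 0" using s by simp
  have "2 * (s - 1) * (c4 + 10 * k * (s + 1)) = 0" using 1(1) 2 by algebra
  then have "c4 + 10 * k * (s + 1) = 0" by (rule mult_zeroD) (use s in simp)
  then have c4: "c4 = k * (- 10 * (s + 1))" by algebra
  have c3: "c3 = k * (20 * s)" using 1(1) c4 by algebra
  have c1: "c1 = k * (4 - 10 * s)" using 1(2) c3 c4 by algebra
  have "2 * k * (s - 1) * ((s + 1) * (2 * s - 1) * (s - 2)) = 0" using 3 c3 c4 c1 by algebra
  then have "(s + 1) * (2 * s - 1) * (s - 2) = 0" by (rule mult_zeroD) (use s k in simp)
  then have "(s - - 1) * (s - 1 / 2) * (s - 2) = 0" by algebra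
  then consider "s = - 1" | "s = 2" | "s = 1 / 2" unfolding mult_eq_0_iff right_minus_eq by blast
  then have "lconj w (homog 5 [:0, 0, 0, 20, 0, - 12:], homog 5 [:7, 0, - 30, 0, 15, 0:])"
  proof cases
    case 1
    then show ?thesis
      using k by (intro lconj_multiple[OF _ w, of "2 * k"]) (simp_all add: c c1 c3 c4)
  next
    case 2
    have c': "c3 = 40 * k" "c4 = - 30 * k" "c1 = - 16 * k"
      unfolding c1 c3 c4 2 by simp_all
    have "pulls 1 0 1 (- 1) (- 2 * k) w (homog 5 [:0, 0, 0, 20, 0, - 12:], homog 5 [:7, 0, - 30, 0, 15, 0:])"
      unfolding pulls_def w fst_conv snd_conv homog_5_pCons c c' k(1)
    proof (intro conjI allI)
      show "- 2 * k \<noteq> 0" using k(2) by simp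
    qed (simp, algebra+)
    then show ?thesis using lconj_def lconj_sym by blast
  next
    case 3
    have c': "c3 = 10 * k" "c4 = - 15 * k" "c1 = - 1 * k"
      unfolding c1 c3 c4 3 by simp_all
    have "pulls 2 0 1 (- 1) (- 4 * k) w (homog 5 [:0, 0, 0, 20, 0, - 12:], homog 5 [:7, 0, - 30, 0, 15, 0:])"
      unfolding pulls_def w fst_conv snd_conv homog_5_pCons c c' k(1)
    proof (intro conjI allI)
      show "- 4 * k \<noteq> 0" using k(2) by simp
    qed (simp, algebra+)
    then show ?thesis using lconj_def lconj_sym by blast
  qed
  then show ?thesis using omega_12_newton lconj_trans by blast
qed

lemma partitions_of_8:
  assumes "sorted_wrt (\<ge>) ms" "length ms \<le> 5" "\<And>m. m \<in> set ms \<Longrightarrow> 1 \<le> m \<and> m \<le> 4" "sum_list ms = (8 :: nat)"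
  shows "ms \<in> {[4, 4], [4, 3, 1], [4, 2, 2], [3, 3, 2], [4, 2, 1, 1], [3, 3, 1, 1], [3, 2, 2, 1], [2, 2, 2, 2],
    [4, 1, 1, 1, 1], [3, 2, 1, 1, 1], [2, 2, 2, 1, 1]}"
proof -
  consider "ms = []" | a where "ms = [a]" | a b where "ms = [a, b]" | a b c where "ms = [a, b, c]"
    | a b c d where "ms = [a, b, c, d]" | a b c d e where "ms = [a, b, c, d, e]"
    using assms(2) by (cases ms rule: list.exhaust, simp) (auto simp: le_Suc_eq length_Suc_conv eval_nat_numeral)
  then show ?thesis
  proof cases
    case 1 then show ?thesis using assms by simp
  next
    case 2 then show ?thesis using assms by simp
  next
    case 3 then have "a = 4 \<and> b = 4" using assms(3)[of a] assms(3)[of b] assms(4) by simp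
    then show ?thesis using 3 by simp
  next
    case 4
    have "1 \<le> a \<and> a \<le> 4" "1 \<le> b \<and> b \<le> 4" "1 \<le> c \<and> c \<le> 4" using assms(3) 4 by auto
    moreover have "a \<ge> b" "b \<ge> c" "a + b + c = 8" using assms(1,4) 4 by auto
    ultimately have "a = 4 \<and> b = 3 \<and> c = 1 \<or> a = 4 \<and> b = 2 \<and> c = 2 \<or> a = 3 \<and> b = 3 \<and> c = 2" by presburger
    then show ?thesis using 4 by auto
  next
    case 5
    have "1 \<le> a \<and> a \<le> 4" "1 \<le> b \<and> b \<le> 4" "1 \<le> c \<and> c \<le> 4" "1 \<le> d \<and> d \<le> 4" using assms(3) 5 by auto
    moreover have "a \<ge> b" "b \<ge> c" "c \<ge> d" "a + b + c + d = 8" using assms(1,4) 5 by auto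
    ultimately have "d = 1 \<or> d = 2" "c = 1 \<or> c = 2" "b = 1 \<or> b = 2 \<or> b = 3" "a = 8 - b - c - d" "a \<le> 4" "a \<ge> b" "b \<ge> c" "c \<ge> d"
      by linarith+
    then have "a = 4 \<and> b = 2 \<and> c = 1 \<and> d = 1 \<or> a = 3 \<and> b = 3 \<and> c = 1 \<and> d = 1 \<or> a = 3 \<and> b = 2 \<and> c = 2 \<and> d = 1 \<or> a = 2 \<and> b = 2 \<and> c = 2 \<and> d = 2"
      by (elim disjE) simp_all
    then show ?thesis using 5 by auto
  next
    case 6
    have "1 \<le> a \<and> a \<le> 4" "1 \<le> b \<and> b \<le> 4" "1 \<le> c \<and> c \<le> 4" "1 \<le> d \<and> d \<le> 4" "1 \<le> e \<and> e \<le> 4" using assms(3) 6 by auto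
    moreover have "a \<ge> b" "b \<ge> c" "c \<ge> d" "d \<ge> e" "a + b + c + d + e = 8" using assms(1,4) 6 by auto
    ultimately have "e = 1" "d = 1" "c = 1 \<or> c = 2" "b = 1 \<or> b = 2 \<or> b = 3" "a = 8 - b - c - d - e" "a \<le> 4" "a \<ge> b" "b \<ge> c"
      by linarith+
    then have "a = 4 \<and> b = 1 \<and> c = 1 \<and> d = 1 \<and> e = 1 \<or> a = 3 \<and> b = 2 \<and> c = 1 \<and> d = 1 \<and> e = 1 \<or> a = 2 \<and> b = 2 \<and> c = 2 \<and> d = 1 \<and> e = 1"
      by (elim disjE) simp_all
    then show ?thesis using 6 by auto
  qed
qed

lemma cross_commute: "cross v u \<noteq> 0 \<Longrightarrow> cross u v \<noteq> 0"
  by (auto simp: cross_def mult.commute)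

lemma fixmult_mono:
  assumes "fixmult m w v" "n \<le> m"
  shows "fixmult n w v"
proof -
  obtain h where h: "bform (4 - m) h" "m \<le> 4" "\<And>x y. fst v * fst w x y + snd v * snd w x y = (snd v * x - fst v * y) ^ (m + 1) * h x y"
    using assms by (auto simp: fixmult_def)
  have "bform ((m - n) * 1 + (4 - m)) (\<lambda>x y. (snd v * x + - fst v * y) ^ (m - n) * h x y)"
    by (intro bform_mult bform_power bform_linear h)
  moreover have "(m - n) * 1 + (4 - m) = 4 - n" using assms(2) h(2) by simp
  moreover have "(snd v * x - fst v * y) ^ (m + 1) * h x y = (snd v * x - fst v * y) ^ (n + 1) * ((snd v * x + - fst v * y) ^ (m - n) * h x y)" for x y
    using assms(2) by (simp flip: power_add mult.assoc)
  ultimately show ?thesis unfolding fixmult_def using h assms(2) by (intro conjI exI[of _ "\<lambda>x y. (snd v * x + - fst v * y) ^ (m - n) * h x y"]) auto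
qed

lemma classify_4:
  assumes w: "hform w" and c: "cross v1 v2 \<noteq> 0" "cross v1 v3 \<noteq> 0" "cross v2 v3 \<noteq> 0"
    "cross v1 v4 \<noteq> 0" "cross v2 v4 \<noteq> 0" "cross v3 v4 \<noteq> 0"
    and f: "fixmult m1 w v1" "fixmult m2 w v2" "fixmult m3 w v3" "fixmult m4 w v4"
    and conc: "\<And>w s. hform w \<Longrightarrow> fixmult m1 w (0, 1) \<Longrightarrow> fixmult m2 w (1, 0) \<Longrightarrow> fixmult m3 w (1, 1) \<Longrightarrow> fixmult m4 w (1, s) \<Longrightarrow>
       s \<noteq> 0 \<Longrightarrow> s \<noteq> 1 \<Longrightarrow> \<exists>i\<in>I. lconj w (omega i)"
  shows "\<exists>i\<in>I. lconj w (omega i)"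
proof (rule normalize3[OF w c(1-3), of 1])
  fix w1 assume w1: "hform w1" "lconj w1 w" "\<And>m. fixmult m w v1 \<Longrightarrow> fixmult m w1 (0, 1)"
    "\<And>m. fixmult m w v2 \<Longrightarrow> fixmult m w1 (1, 0)"
    "\<And>m. fixmult m w v3 \<Longrightarrow> fixmult m w1 (1, 1)"
    and V: "\<And>V. (\<And>v. v \<in> V \<Longrightarrow> cross v1 v \<noteq> 0) \<Longrightarrow> \<exists>f. \<forall>v\<in>V. (\<forall>m. fixmult m w v \<longrightarrow> fixmult m w1 (1, f v)) \<and>
       (\<forall>v'\<in>V. cross v v' \<noteq> 0 \<longrightarrow> f v \<noteq> f v') \<and> (cross v2 v \<noteq> 0 \<longrightarrow> f v \<noteq> 0) \<and> (cross v3 v \<noteq> 0 \<longrightarrow> f v \<noteq> 1)"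
  obtain f where "fixmult m4 w1 (1, f v4)" "f v4 \<noteq> 0" "f v4 \<noteq> 1"
    using V[of "{v4}"] c f by auto
  then have "\<exists>i\<in>I. lconj w1 (omega i)" using conc[OF w1(1) w1(3)[OF f(1)] w1(4)[OF f(2)] w1(5)[OF f(3)]] by blast
  then show ?thesis using w1(2) lconj_sym lconj_trans by blast
qed simp

text \<open>The value m3 = 0 makes the third direction a dummy, normalised but subject to no
  condition; the partition 4 + 4 needs this.\<close>

lemma classify_3:
  assumes w: "hform w" and c: "cross v1 v2 \<noteq> 0" "cross v1 v3 \<noteq> 0" "cross v2 v3 \<noteq> 0" and t: "t \<noteq> 0"
    and f: "fixmult m1 w v1" "fixmult m2 w v2" "m3 > 0 \<Longrightarrow> fixmult m3 w v3"
    and conc: "\<And>w. hform w \<Longrightarrow> fixmult m1 w (0, 1) \<Longrightarrow> fixmult m2 w (1, 0) \<Longrightarrow> (m3 > 0 \<Longrightarrow> fixmult m3 w (1, t)) \<Longrightarrow> lconj w (omega i)"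
  shows "lconj w (omega i)"
proof (rule normalize3[OF w c t])
  fix w1 assume w1: "hform w1" "lconj w1 w" "\<And>m. fixmult m w v1 \<Longrightarrow> fixmult m w1 (0, 1)"
    "\<And>m. fixmult m w v2 \<Longrightarrow> fixmult m w1 (1, 0)"
    "\<And>m. fixmult m w v3 \<Longrightarrow> fixmult m w1 (1, t)"
  have "lconj w1 (omega i)" using conc[OF w1(1) w1(3)[OF f(1)] w1(4)[OF f(2)] w1(5)[OF f(3)]] .
  then show ?thesis using w1(2) lconj_sym lconj_trans by blast
qed

text \<open>The noncritical fixed direction u goes to infinity and v1, v2 go to 0 and 1, which is
  the setting of \<open>newton_form\<close>.\<close>

lemma classify_5:
  assumes w: "hform w" and u: "tang w u = 0" "cross u v1 \<noteq> 0" "cross u v2 \<noteq> 0" "cross u v3 \<noteq> 0" "cross u v4 \<noteq> 0" "cross u v5 \<noteq> 0"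
    and s: "sorted_wrt (\<lambda>x y. cross x y \<noteq> 0) [v1, v2, v3, v4, v5]"
    and f: "fixmult m1 w v1" "fixmult m2 w v2" "fixmult m3 w v3" "fixmult 1 w v4" "fixmult 1 w v5"
    and m: "1 \<le> m1" "1 \<le> m2" "1 \<le> m3"
    and conc: "\<And>w S s. hform w \<Longrightarrow> tang w (0, 1) = 0 \<Longrightarrow> finite S \<Longrightarrow> card S = 5 \<Longrightarrow> (\<And>t. t \<in> S \<Longrightarrow> fixmult 1 w (1, t)) \<Longrightarrow>
      fixmult m1 w (1, 0) \<Longrightarrow> 1 \<in> S \<Longrightarrow> fixmult m2 w (1, 1) \<Longrightarrow> s \<in> S \<Longrightarrow> fixmult m3 w (1, s) \<Longrightarrow> s \<noteq> 0 \<Longrightarrow> s \<noteq> 1 \<Longrightarrow> lconj w (omega i)"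
  shows "lconj w (omega i)"
proof (rule normalize3[OF w u(2,3), of 1])
  show "cross v1 v2 \<noteq> 0" using s by simp
  fix w1 assume w1: "hform w1" "lconj w1 w"
    "\<And>m. fixmult m w v1 \<Longrightarrow> fixmult m w1 (1, 0)"
    "\<And>m. fixmult m w v2 \<Longrightarrow> fixmult m w1 (1, 1)"
    and t: "tang w u = 0 \<Longrightarrow> tang w1 (0, 1) = 0"
    and V: "\<And>V. (\<And>v. v \<in> V \<Longrightarrow> cross u v \<noteq> 0) \<Longrightarrow> \<exists>f. \<forall>v\<in>V. (\<forall>m. fixmult m w v \<longrightarrow> fixmult m w1 (1, f v)) \<and>
       (\<forall>v'\<in>V. cross v v' \<noteq> 0 \<longrightarrow> f v \<noteq> f v') \<and> (cross v1 v \<noteq> 0 \<longrightarrow> f v \<noteq> 0) \<and> (cross v2 v \<noteq> 0 \<longrightarrow> f v \<noteq> 1)"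
  have "\<And>v. v \<in> {v3, v4, v5} \<Longrightarrow> cross u v \<noteq> 0" using u by auto
  from V[OF this] obtain f where fv: "\<forall>v\<in>{v3, v4, v5}. (\<forall>m. fixmult m w v \<longrightarrow> fixmult m w1 (1, f v)) \<and>
       (\<forall>v'\<in>{v3, v4, v5}. cross v v' \<noteq> 0 \<longrightarrow> f v \<noteq> f v') \<and> (cross v1 v \<noteq> 0 \<longrightarrow> f v \<noteq> 0) \<and> (cross v2 v \<noteq> 0 \<longrightarrow> f v \<noteq> 1)"
    by blast
  define S where "S = {0, 1, f v3, f v4, f v5}"
  have ne: "f v3 \<noteq> f v4" "f v3 \<noteq> f v5" "f v4 \<noteq> f v5" "f v3 \<noteq> 0" "f v4 \<noteq> 0" "f v5 \<noteq> 0" "f v3 \<noteq> 1" "f v4 \<noteq> 1" "f v5 \<noteq> 1"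
    using fv s by auto
  have fm: "fixmult m3 w1 (1, f v3)" "fixmult 1 w1 (1, f v4)" "fixmult 1 w1 (1, f v5)"
    using fv f by blast+
  have "fixmult 1 w1 (1, t)" if "t \<in> S" for t
    using that fm f w1(3,4) m fixmult_mono[of m1 w1 "(1, 0)" 1] fixmult_mono[of m2 w1 "(1, 1)" 1] fixmult_mono[of m3 w1 "(1, f v3)" 1]
    unfolding S_def by blast
  moreover have "finite S" "card S = 5" "1 \<in> S" "f v3 \<in> S" using ne by (auto simp: S_def)
  ultimately have "lconj w1 (omega i)"
    using conc[OF w1(1) t[OF u(1)], of S "f v3"] w1(3)[OF f(1)] w1(4)[OF f(2)] fm(1) ne by blast
  then show ?thesis using w1(2) lconj_sym lconj_trans by blast
qed simp

theorem classification:
  assumes w: "hform w" and cvx: "\<And>v. v \<noteq> (0, 0) \<Longrightarrow> crit w v \<Longrightarrow> tang w v = 0"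
  shows "\<exists>i\<in>{1..14}. lconj w (omega i)"
proof (rule cdata_exists[OF w cvx])
  fix L assume L: "cdata w L" "sorted_wrt (\<ge>) (map fst L)" "length L \<le> 5" "\<And>m v. (m, v) \<in> set L \<Longrightarrow> m \<le> 4"
    "length L = 5 \<Longrightarrow> \<exists>u. u \<noteq> (0, 0) \<and> tang w u = 0 \<and> (\<forall>v \<in> snd ` set L. cross u v \<noteq> 0)"
  define ms vs where "ms = map fst L" and "vs = map snd L"
  have Lz: "zip ms vs = L" "length ms = length vs" by (simp_all add: ms_def vs_def zip_map_fst_snd)
  have "ms \<in> {[4, 4], [4, 3, 1], [4, 2, 2], [3, 3, 2], [4, 2, 1, 1], [3, 3, 1, 1], [3, 2, 2, 1], [2, 2, 2, 2],
    [4, 1, 1, 1, 1], [3, 2, 1, 1, 1], [2, 2, 2, 1, 1]}"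
    by (rule partitions_of_8) (use L in \<open>auto simp: ms_def cdata_def\<close>)
  have vx: "sorted_wrt (\<lambda>x y. cross x y \<noteq> 0) vs" "\<forall>(m, v) \<in> set (zip ms vs). v \<noteq> (0, 0) \<and> fixmult m w v"
    using L(1) unfolding Lz(1) cdata_def sorted_wrt_map[symmetric] vs_def[symmetric] by (auto simp: vs_def sorted_wrt_map)
  have five: "\<exists>u. u \<noteq> (0, 0) \<and> tang w u = 0 \<and> (\<forall>v \<in> set vs. cross u v \<noteq> 0)" if "length ms = 5"
    using L(5) that by (simp add: ms_def vs_def)
  have l2: "\<exists>v1 v2. vs = [v1, v2]" if "length ms = 2"
    using that Lz(2) by (auto simp: length_Suc_conv eval_nat_numeral)
  have l3: "\<exists>v1 v2 v3. vs = [v1, v2, v3]" if "length ms = 3"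
    using that Lz(2) by (auto simp: length_Suc_conv eval_nat_numeral)
  have l4: "\<exists>v1 v2 v3 v4. vs = [v1, v2, v3, v4]" if "length ms = 4"
    using that Lz(2) by (auto simp: length_Suc_conv eval_nat_numeral)
  have l5: "\<exists>v1 v2 v3 v4 v5. vs = [v1, v2, v3, v4, v5]" if "length ms = 5"
    using that Lz(2) by (auto simp: length_Suc_conv eval_nat_numeral)
  from \<open>ms \<in> _\<close> consider "ms = [4, 4]" | "ms = [4, 3, 1]" | "ms = [4, 2, 2]" | "ms = [3, 3, 2]" | "ms = [4, 2, 1, 1]"
    | "ms = [3, 3, 1, 1]" | "ms = [3, 2, 2, 1]" | "ms = [2, 2, 2, 2]" | "ms = [4, 1, 1, 1, 1]" | "ms = [3, 2, 1, 1, 1]" | "ms = [2, 2, 2, 1, 1]"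
    by blast
  then show ?thesis
  proof cases
    case 1
    then obtain v1 v2 where v: "vs = [v1, v2]" using l2 by auto
    \<comment> \<open>An auxiliary direction distinct from v1 and v2; it merely completes the
      frame.\<close>
    define v3 where "v3 = (fst v1 + fst v2, snd v1 + snd v2)"
    have "cross v1 v2 \<noteq> 0" using vx v by simp
    moreover have "cross v1 v3 = cross v1 v2" "cross v2 v3 = - cross v1 v2"
      by (simp_all add: cross_def v3_def algebra_simps)
    ultimately have "lconj w (omega 1)"
      using vx v 1 normal_44 by (intro classify_3[OF w, of v1 v2 v3 1 4 4 0]) auto
    then show ?thesis by force
  next
    case 2
    then obtain v1 v2 v3 where v: "vs = [v1, v2, v3]" using l3 by auto
    \<comment> \<open>The directions are taken out of order: \<open>normal_431\<close> expects
      multiplicity 4 at - 1.\<close>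
    have "lconj w (omega 2)"
      using vx v 2 normal_431 cross_commute by (intro classify_3[OF w, of v2 v3 v1 "- 1" 3 1 4]) auto
    then show ?thesis by force
  next
    case 3
    then obtain v1 v2 v3 where v: "vs = [v1, v2, v3]" using l3 by auto
    have "lconj w (omega 3)"
      using vx v 3 normal_422 cross_commute by (intro classify_3[OF w, of v2 v3 v1 "- 1" 2 2 4]) auto
    then show ?thesis by force
  next
    case 4
    then obtain v1 v2 v3 where v: "vs = [v1, v2, v3]" using l3 by auto
    have "lconj w (omega 4)"
      using vx v 4 normal_332 by (intro classify_3[OF w, of v1 v2 v3 1 3 3 2]) auto
    then show ?thesis by force
  next
    case 5
    then obtain v1 v2 v3 v4 where v: "vs = [v1, v2, v3, v4]" using l4 by auto
    have "\<exists>i\<in>{5, 6}. lconj w (omega i)"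
    proof (rule classify_4[OF w, of v1 v2 v3 v4 4 2 1 1])
      show "cross v1 v2 \<noteq> 0" "cross v1 v3 \<noteq> 0" "cross v2 v3 \<noteq> 0" "cross v1 v4 \<noteq> 0" "cross v2 v4 \<noteq> 0" "cross v3 v4 \<noteq> 0"
        using vx(1) v by simp_all
      show "fixmult 4 w v1" "fixmult 2 w v2" "fixmult 1 w v3" "fixmult 1 w v4"
        using vx(2) v 5 by simp_all
    qed (use normal_4211 in blast)
    then show ?thesis by force
  next
    case 6
    then obtain v1 v2 v3 v4 where v: "vs = [v1, v2, v3, v4]" using l4 by auto
    have "\<exists>i\<in>{7, 8}. lconj w (omega i)"
    proof (rule classify_4[OF w, of v1 v2 v3 v4 3 3 1 1])
      show "cross v1 v2 \<noteq> 0" "cross v1 v3 \<noteq> 0" "cross v2 v3 \<noteq> 0" "cross v1 v4 \<noteq> 0" "cross v2 v4 \<noteq> 0" "cross v3 v4 \<noteq> 0"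
        using vx(1) v by simp_all
      show "fixmult 3 w v1" "fixmult 3 w v2" "fixmult 1 w v3" "fixmult 1 w v4"
        using vx(2) v 6 by simp_all
    qed (use normal_3311 in blast)
    then show ?thesis by force
  next
    case 7
    then obtain v1 v2 v3 v4 where v: "vs = [v1, v2, v3, v4]" using l4 by auto
    have "\<exists>i\<in>{9, 10}. lconj w (omega i)"
    proof (rule classify_4[OF w, of v1 v2 v3 v4 3 2 2 1])
      show "cross v1 v2 \<noteq> 0" "cross v1 v3 \<noteq> 0" "cross v2 v3 \<noteq> 0" "cross v1 v4 \<noteq> 0" "cross v2 v4 \<noteq> 0" "cross v3 v4 \<noteq> 0"
        using vx(1) v by simp_all
      show "fixmult 3 w v1" "fixmult 2 w v2" "fixmult 2 w v3" "fixmult 1 w v4"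
        using vx(2) v 7 by simp_all
    qed (use normal_3221 in blast)
    then show ?thesis by force
  next
    case 8
    then obtain v1 v2 v3 v4 where v: "vs = [v1, v2, v3, v4]" using l4 by auto
    have "\<exists>i\<in>{11}. lconj w (omega i)"
    proof (rule classify_4[OF w, of v1 v2 v3 v4 2 2 2 2])
      show "cross v1 v2 \<noteq> 0" "cross v1 v3 \<noteq> 0" "cross v2 v3 \<noteq> 0" "cross v1 v4 \<noteq> 0" "cross v2 v4 \<noteq> 0" "cross v3 v4 \<noteq> 0"
        using vx(1) v by simp_all
      show "fixmult 2 w v1" "fixmult 2 w v2" "fixmult 2 w v3" "fixmult 2 w v4"
        using vx(2) v 8 by simp_all
      fix w' s
      assume "hform w'" "fixmult 2 w' (0, 1)" "fixmult 2 w' (1, 0)" "fixmult 2 w' (1, 1)" "fixmult 2 w' (1, s)" "s \<noteq> 0" "s \<noteq> 1"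
      then have "lconj w' (omega 11)" by (rule normal_2222)
      then show "\<exists>i\<in>{11}. lconj w' (omega i)" by simp
    qed
    then show ?thesis by force
  next
    case 9
    then obtain v1 v2 v3 v4 v5 where v: "vs = [v1, v2, v3, v4, v5]" using l5 by auto
    have "length ms = 5" using 9 by simp
    from five[OF this] obtain u where u: "tang w u = 0" "\<forall>v \<in> set vs. cross u v \<noteq> 0" by (elim exE conjE)
    have "lconj w (omega 13)"
    proof (rule classify_5[OF w u(1), of v1 v2 v3 v4 v5 4 1 1])
      show "cross u v1 \<noteq> 0" "cross u v2 \<noteq> 0" "cross u v3 \<noteq> 0" "cross u v4 \<noteq> 0" "cross u v5 \<noteq> 0"
        using u(2) v by simp_all
      show "sorted_wrt (\<lambda>x y. cross x y \<noteq> 0) [v1, v2, v3, v4, v5]"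
        using vx(1) v by simp
      show "fixmult 4 w v1" "fixmult 1 w v2" "fixmult 1 w v3" "fixmult 1 w v4" "fixmult 1 w v5"
        using vx(2) v 9 by simp_all
      fix w' S s
      assume h: "hform w'" "tang w' (0, 1) = 0" "finite S" "card S = 5" "\<And>t. t \<in> S \<Longrightarrow> fixmult 1 w' (1, t)"
        "fixmult 4 w' (1, 0)" "1 \<in> S" "fixmult 1 w' (1, 1)" "s \<in> S" "fixmult 1 w' (1, s)" "s \<noteq> 0" "s \<noteq> 1"
      show "lconj w' (omega 13)" by (rule newton_41111[OF h(1-6,7)])
    qed simp_all
    then show ?thesis by force
  next
    case 10
    then obtain v1 v2 v3 v4 v5 where v: "vs = [v1, v2, v3, v4, v5]" using l5 by auto
    have "length ms = 5" using 10 by simp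
    from five[OF this] obtain u where u: "tang w u = 0" "\<forall>v \<in> set vs. cross u v \<noteq> 0" by (elim exE conjE)
    have "lconj w (omega 14)"
    proof (rule classify_5[OF w u(1), of v1 v2 v3 v4 v5 3 2 1])
      show "cross u v1 \<noteq> 0" "cross u v2 \<noteq> 0" "cross u v3 \<noteq> 0" "cross u v4 \<noteq> 0" "cross u v5 \<noteq> 0"
        using u(2) v by simp_all
      show "sorted_wrt (\<lambda>x y. cross x y \<noteq> 0) [v1, v2, v3, v4, v5]"
        using vx(1) v by simp
      show "fixmult 3 w v1" "fixmult 2 w v2" "fixmult 1 w v3" "fixmult 1 w v4" "fixmult 1 w v5"
        using vx(2) v 10 by simp_all
      fix w' S s
      assume h: "hform w'" "tang w' (0, 1) = 0" "finite S" "card S = 5" "\<And>t. t \<in> S \<Longrightarrow> fixmult 1 w' (1, t)"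
        "fixmult 3 w' (1, 0)" "1 \<in> S" "fixmult 2 w' (1, 1)" "s \<in> S" "fixmult 1 w' (1, s)" "s \<noteq> 0" "s \<noteq> 1"
      show "lconj w' (omega 14)" by (rule newton_32111[OF h(1-6,7,8)])
    qed simp_all
    then show ?thesis by force
  next
    case 11
    then obtain v1 v2 v3 v4 v5 where v: "vs = [v1, v2, v3, v4, v5]" using l5 by auto
    have "length ms = 5" using 11 by simp
    from five[OF this] obtain u where u: "tang w u = 0" "\<forall>v \<in> set vs. cross u v \<noteq> 0" by (elim exE conjE)
    have "lconj w (omega 12)"
    proof (rule classify_5[OF w u(1), of v1 v2 v3 v4 v5 2 2 2])
      show "cross u v1 \<noteq> 0" "cross u v2 \<noteq> 0" "cross u v3 \<noteq> 0" "cross u v4 \<noteq> 0" "cross u v5 \<noteq> 0"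
        using u(2) v by simp_all
      show "sorted_wrt (\<lambda>x y. cross x y \<noteq> 0) [v1, v2, v3, v4, v5]"
        using vx(1) v by simp
      show "fixmult 2 w v1" "fixmult 2 w v2" "fixmult 2 w v3" "fixmult 1 w v4" "fixmult 1 w v5"
        using vx(2) v 11 by simp_all
      fix w' S s
      assume h: "hform w'" "tang w' (0, 1) = 0" "finite S" "card S = 5" "\<And>t. t \<in> S \<Longrightarrow> fixmult 1 w' (1, t)"
        "fixmult 2 w' (1, 0)" "1 \<in> S" "fixmult 2 w' (1, 1)" "s \<in> S" "fixmult 2 w' (1, s)" "s \<noteq> 0" "s \<noteq> 1"
      show "lconj w' (omega 12)" by (rule newton_22211[OF h])
    qed simp_all
    then show ?thesis by force
  qed
qed

section \<open>The foliation defined by a pair of forms\<close>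

no_notation fps_nth (infixl "$" 75)

lemma pair_3: "pair w v = w $ 1 * v $ 1 + w $ 2 * v $ 2 + w $ 3 * v $ 3"
  by (simp add: pair_def sum_3)

lemma pair_linear: "pair X (a *s p + b *s q) = a * pair X p + b * pair X q"
  by (simp add: pair_3 algebra_simps)

lemma vector_3_eq: "vector [p $ 1, p $ 2, p $ 3] = (p :: complex^3)"
  by (simp add: vec_eq_iff forall_3)

text \<open>Homogenisation z A dx + z B dy - (x A + y B) dz of degree 6; the last coefficient is
  forced by the Euler condition.\<close>

definition hom_form :: "form2 \<Rightarrow> form" where
  "hom_form w p = vector [p $ 3 * fst w (p $ 1) (p $ 2), p $ 3 * snd w (p $ 1) (p $ 2),
     - (p $ 1 * fst w (p $ 1) (p $ 2) + p $ 2 * snd w (p $ 1) (p $ 2))]"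

lemma hom_form_nth [simp]:
  "hom_form w p $ 1 = p $ 3 * fst w (p $ 1) (p $ 2)"
  "hom_form w p $ 2 = p $ 3 * snd w (p $ 1) (p $ 2)"
  "hom_form w p $ 3 = - (p $ 1 * fst w (p $ 1) (p $ 2) + p $ 2 * snd w (p $ 1) (p $ 2))"
  by (simp_all add: hom_form_def)

lemma pair_hom_form:
  "pair (hom_form w p) v = p $ 3 * (fst w (p $ 1) (p $ 2) * v $ 1 + snd w (p $ 1) (p $ 2) * v $ 2) -
     (p $ 1 * fst w (p $ 1) (p $ 2) + p $ 2 * snd w (p $ 1) (p $ 2)) * v $ 3"
  by (simp add: pair_3 algebra_simps)

lemma euler_hom_form: "pair (hom_form w p) p = 0"
  by (simp add: pair_hom_form algebra_simps)

lemma hom_form_eq_0: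
  assumes "hform w"
  shows "hom_form w p = 0 \<longleftrightarrow> (p $ 1 = 0 \<and> p $ 2 = 0) \<or> (p $ 3 = 0 \<and> tang w (p $ 1, p $ 2) = 0)"
proof -
  have z: "fst w 0 0 = 0" "snd w 0 0 = 0"
  proof -
    have "bform 5 (fst w)" "bform 5 (snd w)" using assms by (simp_all add: hform_def)
    from this[THEN bform_scale_args, of 0 0 0] show "fst w 0 0 = 0" "snd w 0 0 = 0" by simp_all
  qed
  have nz: "fst w (p $ 1) (p $ 2) = 0 \<and> snd w (p $ 1) (p $ 2) = 0 \<longleftrightarrow> p $ 1 = 0 \<and> p $ 2 = 0"
    using hform_nonzero[OF assms, of "p $ 1" "p $ 2"] z by metis
  have "hom_form w p = 0 \<longleftrightarrow> p $ 3 * fst w (p $ 1) (p $ 2) = 0 \<and> p $ 3 * snd w (p $ 1) (p $ 2) = 0 \<and> tang w (p $ 1, p $ 2) = 0"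
    unfolding vec_eq_iff forall_3 tang_def hom_form_nth fst_conv snd_conv zero_index neg_equal_0_iff_equal ..
  moreover have "tang w (p $ 1, p $ 2) = 0" if "p $ 1 = 0 \<and> p $ 2 = 0"
    using that by (simp add: tang_def)
  ultimately show ?thesis using nz by (metis mult_eq_0_iff)
qed

text \<open>\<open>hom_poly3\<close> asks for a sum over all monomials of degree n + m; coefficients
  supported on the diagonal i + j = n select those divisible by exactly z^m.\<close>

lemma homog_diag_sum:
  fixes x y z :: complex
  shows "(\<Sum>i\<le>n + m. \<Sum>j\<le>n + m - i. (if i + j = n then c i j else 0) * x ^ i * y ^ j * z ^ (n + m - i - j)) =
    z ^ m * (\<Sum>j\<le>n. c (n - j) j * x ^ (n - j) * y ^ j)"
proof -
  have "(\<Sum>j\<le>n + m - i. (if i + j = n then c i j else 0) * x ^ i * y ^ j * z ^ (n + m - i - j)) =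
      (if i \<le> n then c i (n - i) * x ^ i * y ^ (n - i) * z ^ m else 0)" if "i \<le> n + m" for i
  proof (cases "i \<le> n")
    case True
    have "(\<Sum>j\<le>n + m - i. (if i + j = n then c i j else 0) * x ^ i * y ^ j * z ^ (n + m - i - j)) =
      (\<Sum>j\<in>{n - i}. (if i + j = n then c i j else 0) * x ^ i * y ^ j * z ^ (n + m - i - j))"
      by (rule sum.mono_neutral_right) (use True in auto)
    then show ?thesis using True by simp
  next
    case False
    then show ?thesis by (intro trans[OF sum.neutral]) auto
  qed
  then have "(\<Sum>i\<le>n + m. \<Sum>j\<le>n + m - i. (if i + j = n then c i j else 0) * x ^ i * y ^ j * z ^ (n + m - i - j)) =
    (\<Sum>i\<le>n + m. if i \<le> n then c i (n - i) * x ^ i * y ^ (n - i) * z ^ m else 0)"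
    by (intro sum.cong) auto
  also have "\<dots> = (\<Sum>i\<le>n. c i (n - i) * x ^ i * y ^ (n - i) * z ^ m)"
    by (rule sum.mono_neutral_cong_right) auto
  also have "\<dots> = (\<Sum>j\<le>n. c (n - j) j * x ^ (n - j) * y ^ j * z ^ m)"
    by (rule sum.reindex_bij_witness[of _ "\<lambda>j. n - j" "\<lambda>j. n - j"]) auto
  finally show ?thesis by (simp add: sum_distrib_left algebra_simps)
qed

lemma hom_poly3_bform:
  assumes "bform n G"
  shows "hom_poly3 (n + m) (\<lambda>p. p $ 3 ^ m * G (p $ 1) (p $ 2))"
proof -
  obtain g where g: "G = homog n g" using assms by (auto simp: bform_def)
  show ?thesis
    unfolding hom_poly3_def
  proof (intro exI allI)
    fix p :: "complex^3"
    show "p $ 3 ^ m * G (p $ 1) (p $ 2) = (\<Sum>i\<le>n + m. \<Sum>j\<le>n + m - i.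
        (if i + j = n then coeff g j else 0) * (p $ 1) ^ i * (p $ 2) ^ j * (p $ 3) ^ (n + m - i - j))"
      unfolding homog_diag_sum g homog_def ..
  qed
qed

lemma bform_tang: "hform w \<Longrightarrow> bform 6 (\<lambda>x y. tang w (x, y))"
proof -
  assume w: "hform w"
  then have "bform 5 (fst w)" "bform 5 (snd w)" by (auto simp: hform_def)
  then have "bform (1 + 5) (\<lambda>x y. (1 * x + 0 * y) * fst w x y)" "bform (1 + 5) (\<lambda>x y. (0 * x + 1 * y) * snd w x y)"
    by (intro bform_mult bform_linear; simp)+
  then have "bform 6 (\<lambda>x y. x * fst w x y)" "bform 6 (\<lambda>x y. y * snd w x y)"
    by simp_all
  then show ?thesis unfolding tang_def fst_conv snd_conv by (rule bform_add)
qed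

lemma proj_point_eqI: "c \<noteq> 0 \<Longrightarrow> q = c *s p \<Longrightarrow> proj_point q = proj_point p"
proof -
  assume c: "c \<noteq> 0" "q = c *s p"
  show "proj_point q = proj_point p"
  proof (intro set_eqI iffI)
    fix x assume "x \<in> proj_point q"
    then obtain d where "d \<noteq> 0" "x = d *s q" by (auto simp: proj_point_def)
    then have "d * c \<noteq> 0" "x = (d * c) *s p" using c by (simp_all add: vector_smult_assoc)
    then show "x \<in> proj_point p" unfolding proj_point_def by blast
  next
    fix x assume "x \<in> proj_point p"
    then obtain d where "d \<noteq> 0" "x = d *s p" by (auto simp: proj_point_def)
    then have "d / c \<noteq> 0" "x = (d / c) *s q" using c by (simp_all add: vector_smult_assoc)
    then show "x \<in> proj_point q" unfolding proj_point_def by blast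
  qed
qed

lemma foliation_hom_form:
  assumes w: "hform w"
  shows "foliation (hom_form w)"
  unfolding foliation_def
proof (intro conjI allI)
  have f: "bform 5 (fst w)" "bform 5 (snd w)" using w by (auto simp: hform_def)
  show "\<exists>n. \<forall>i. hom_poly3 n (\<lambda>p. hom_form w p $ i)"
  proof (intro exI[of _ 6], unfold forall_3, intro conjI)
    show "hom_poly3 6 (\<lambda>p. hom_form w p $ 1)" "hom_poly3 6 (\<lambda>p. hom_form w p $ 2)"
      using hom_poly3_bform[OF f(1), of 1] hom_poly3_bform[OF f(2), of 1] by simp_all
    have "bform 6 (\<lambda>x y. - 1 * tang w (x, y))" by (intro bform_scale bform_tang w)
    from hom_poly3_bform[OF this, of 0] show "hom_poly3 6 (\<lambda>p. hom_form w p $ 3)" by (simp add: tang_def)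
  qed
  show "pair (hom_form w p) p = 0" for p by (rule euler_hom_form)
  obtain c where c: "degree c \<le> 6" "(\<lambda>x y. tang w (x, y)) = homog 6 c"
    using bform_tang[OF w] by (auto simp: bform_def)
  have c0: "c \<noteq> 0"
  proof
    assume "c = 0"
    then have "tang w (x, y) = 0" for x y using c(2) by (metis homog_0)
    then show False using exists_nonfixed[OF w] by (metis prod.collapse)
  qed
  let ?T = "{vector [0, 0, 1], vector [0, 1, 0]} \<union> (\<lambda>t. vector [1, t, 0]) ` {t. poly c t = 0} :: (complex^3) set"
  have "proj_point p \<in> proj_point ` ?T" if p: "p \<noteq> 0" "hom_form w p = 0" for p
  proof -
    consider "p $ 1 = 0" "p $ 2 = 0" | "p $ 3 = 0" "p $ 1 = 0" | "p $ 3 = 0" "p $ 1 \<noteq> 0" "tang w (p $ 1, p $ 2) = 0"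
      using p(2) hom_form_eq_0[OF w] by blast
    then show ?thesis
    proof cases
      case 1
      then have "p $ 3 \<noteq> 0" "p = (p $ 3) *s vector [0, 0, 1]" using p(1) by (auto simp: vec_eq_iff forall_3)
      then show ?thesis using proj_point_eqI by blast
    next
      case 2
      then have "p $ 2 \<noteq> 0" "p = (p $ 2) *s vector [0, 1, 0]" using p(1) by (auto simp: vec_eq_iff forall_3)
      then show ?thesis using proj_point_eqI by blast
    next
      case 3
      have "homog 6 c (p $ 1) (p $ 2) = 0" using 3 c(2) by metis
      then have "poly c (p $ 2 / p $ 1) = 0" using 3 c(1) by (simp add: homog_nonzero_left)
      moreover have "p = (p $ 1) *s vector [1, p $ 2 / p $ 1, 0]" using 3 by (auto simp: vec_eq_iff forall_3)
      ultimately show ?thesis using proj_point_eqI[OF 3(2)] by blast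
    qed
  qed
  then have "proj_point ` {p. p \<noteq> 0 \<and> hom_form w p = 0} \<subseteq> proj_point ` ?T" by blast
  moreover have "finite ?T" using poly_roots_finite[OF c0] by simp
  ultimately show "finite (proj_point ` {p. p \<noteq> 0 \<and> hom_form w p = 0})"
    by (meson finite_imageI finite_subset)
qed

section \<open>The degree of the foliation\<close>

lemma zorder_poly:
  assumes "(F :: complex poly) \<noteq> 0"
  shows "zorder (\<lambda>s. poly F (s0 + s)) 0 = int (order s0 F)"
proof -
  obtain g where g: "F = [:- s0, 1:] ^ order s0 F * g" "\<not> [:- s0, 1:] dvd g"
    using order_decomp[OF assms] by blast
  show ?thesis
  proof (rule zorder_eqI[of UNIV _ "\<lambda>s. poly g (s0 + s)"])
    show "poly g (s0 + 0) \<noteq> 0" using g(2) by (simp add: poly_eq_0_iff_dvd)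
    show "poly F (s0 + s) = poly g (s0 + s) * (s - 0) powi int (order s0 F)" if "s \<in> UNIV" "s \<noteq> 0" for s
      by (subst g(1)) (simp add: power_int_of_nat)
  qed (auto intro!: holomorphic_intros)
qed

text \<open>Behaviour at the point of the line missed by the parameter: s^n F(1 / s) is the
  reflected polynomial, nonzero at 0, times s^(n - degree F).\<close>

lemma zorder_reflect:
  assumes "(F :: complex poly) \<noteq> 0" "degree F \<le> n"
    and f: "\<And>s. s \<noteq> 0 \<Longrightarrow> f s = - (s ^ n * poly F (1 / s))"
  shows "zorder f 0 = int (n - degree F)"
proof (rule zorder_eqI[of UNIV _ "\<lambda>s. - poly (reflect_poly F) s"])
  show "- poly (reflect_poly F) 0 \<noteq> 0" using assms(1) by simp
  show "f s = - poly (reflect_poly F) s * (s - 0) powi int (n - degree F)" if "s \<in> UNIV" "s \<noteq> 0" for s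
  proof -
    have "s ^ n = s ^ degree F * s ^ (n - degree F)" using assms(2) by (simp flip: power_add)
    then show ?thesis using f[of s] that(2) by (simp add: poly_reflect_poly_nz inverse_eq_divide power_int_of_nat)
  qed
qed (auto intro!: holomorphic_intros)

text \<open>Restricted to the line, the form is F(s) ds with F of degree at most 5. The finite
  tangencies contribute the degree of F, and the remaining point q contributes the defect 5 - degree
  F.\<close>

lemma has_degree_hom_form:
  assumes w: "hform w"
  shows "has_degree (hom_form w) 5"
  unfolding has_degree_def
proof (intro exI conjI allI impI)
  have G: "(\<lambda>x y. x) = (\<lambda>x y. 1 * x + 0 * y :: complex)" by simp
  have "bform 1 (\<lambda>x y. x)" unfolding G by (rule bform_linear)
  \<comment> \<open>A nonzero l3 keeps the line away from the singular point [0 : 0 : 1], and a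
    nonzero l1 excludes the line at infinity; every other line is shown below not to be
    invariant.\<close>
  from hom_poly3_bform[OF this, of 1] show "hom_poly3 2 (\<lambda>l. l $ 3 * l $ 1)" by (simp add: numeral_2_eq_2)
  show "(vector [1, 0, 1] :: complex^3) $ 3 * (vector [1, 0, 1] :: complex^3) $ 1 \<noteq> 0" by simp
  fix l p q :: "complex^3"
  assume *: "l \<noteq> 0 \<and> l $ 3 * l $ 1 \<noteq> 0 \<and> pair l p = 0 \<and> pair l q = 0 \<and> indep p q"
  then have l: "l $ 1 \<noteq> 0" "l $ 3 \<noteq> 0" and lp: "pair l p = 0" and lq: "pair l q = 0" and ind: "indep p q" by auto
  define \<Phi> where "\<Phi> \<sigma> s = pair (hom_form w (\<sigma> *s p + s *s q)) q" for \<sigma> s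
  define \<Psi> where "\<Psi> \<sigma> s = pair (hom_form w (\<sigma> *s p + s *s q)) p" for \<sigma> s
  have f: "bform 5 (fst w)" "bform 5 (snd w)" using w by (auto simp: hform_def)
  have bf: "bform 6 (\<lambda>\<sigma> s. pair (hom_form w (\<sigma> *s p + s *s q)) v)" for v
  proof -
    define A where "A \<sigma> s = fst w (p $ 1 * \<sigma> + q $ 1 * s) (p $ 2 * \<sigma> + q $ 2 * s)" for \<sigma> s
    define B where "B \<sigma> s = snd w (p $ 1 * \<sigma> + q $ 1 * s) (p $ 2 * \<sigma> + q $ 2 * s)" for \<sigma> s
    define L where "L i \<sigma> s = p $ i * \<sigma> + q $ i * s" for i \<sigma> s
    have bA: "bform 5 A" "bform 5 B"
      unfolding A_def B_def by (intro bform_subst f)+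
    have bL: "bform 1 (L i)" for i
      unfolding L_def by (rule bform_linear)
    note b = bA[THEN bform_scale]
    have 1: "bform (1 + 5) (\<lambda>\<sigma> s. L 3 \<sigma> s * (v $ 1 * A \<sigma> s + v $ 2 * B \<sigma> s))"
      by (rule bform_mult[OF bL bform_add[OF b]])
    have 2: "bform (1 + 5) (\<lambda>\<sigma> s. L 1 \<sigma> s * (- v $ 3 * A \<sigma> s))" "bform (1 + 5) (\<lambda>\<sigma> s. L 2 \<sigma> s * (- v $ 3 * B \<sigma> s))"
      by (rule bform_mult[OF bL b(1)], rule bform_mult[OF bL b(2)])
    have "pair (hom_form w (\<sigma> *s p + s *s q)) v =
      L 3 \<sigma> s * (v $ 1 * A \<sigma> s + v $ 2 * B \<sigma> s) + (L 1 \<sigma> s * (- v $ 3 * A \<sigma> s) + L 2 \<sigma> s * (- v $ 3 * B \<sigma> s))" for \<sigma> s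
    proof -
      have arg: "(\<sigma> *s p + s *s q) $ i = L i \<sigma> s" for i by (simp add: L_def mult.commute)
      have A: "A \<sigma> s = fst w (L 1 \<sigma> s) (L 2 \<sigma> s)" "B \<sigma> s = snd w (L 1 \<sigma> s) (L 2 \<sigma> s)"
        by (simp_all add: A_def B_def L_def)
      show ?thesis unfolding pair_hom_form arg A[symmetric] by algebra
    qed
    then show ?thesis using bform_add[OF 1 bform_add[OF 2]] by simp
  qed
  \<comment> \<open>Since l3 is nonzero, the plane over the line is a graph over the first two
    coordinates, and Cramer's rule applies there.\<close>
  have comb: "\<exists>\<sigma> s. m = \<sigma> *s p + s *s q" if m: "pair l m = 0" for m
  proof -
    have third: "l $ 3 * v $ 3 = - (l $ 1 * v $ 1 + l $ 2 * v $ 2)" if "pair l v = 0" for v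
      using that unfolding pair_3 by algebra
    define d where "d = p $ 1 * q $ 2 - p $ 2 * q $ 1"
    have "d \<noteq> 0"
    proof
      assume d0: "d = 0"
      have comb0: "a *s p + b *s q = 0" if "a * p $ 1 + b * q $ 1 = 0" "a * p $ 2 + b * q $ 2 = 0" for a b
      proof -
        have "l $ 3 * (a * p $ 3 + b * q $ 3) = 0"
          using third[OF lp] third[OF lq] that by algebra
        then show ?thesis using that l by (simp add: vec_eq_iff forall_3)
      qed
      have c: "q $ 1 *s p + (- p $ 1) *s q = 0" "q $ 2 *s p + (- p $ 2) *s q = 0"
        using d0 by (intro comb0; simp add: d_def algebra_simps)+
      have "q $ 1 = 0" "- p $ 1 = 0" "q $ 2 = 0" "- p $ 2 = 0"
        using ind[unfolded indep_def, rule_format, OF c(1)] ind[unfolded indep_def, rule_format, OF c(2)] by blast+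
      then have "1 *s p + 0 *s q = 0" by (intro comb0) auto
      from ind[unfolded indep_def, rule_format, OF this] show False by simp
    qed
    define \<sigma> s where "\<sigma> = (m $ 1 * q $ 2 - m $ 2 * q $ 1) / d" and "s = (p $ 1 * m $ 2 - p $ 2 * m $ 1) / d"
    have \<sigma>s: "\<sigma> * d = m $ 1 * q $ 2 - m $ 2 * q $ 1" "s * d = p $ 1 * m $ 2 - p $ 2 * m $ 1"
      using \<open>d \<noteq> 0\<close> by (simp_all add: \<sigma>_def s_def)
    have "d * (m $ 1 - (\<sigma> * p $ 1 + s * q $ 1)) = 0" "d * (m $ 2 - (\<sigma> * p $ 2 + s * q $ 2)) = 0"
      using \<sigma>s d_def by algebra+
    then have 1: "m $ 1 = \<sigma> * p $ 1 + s * q $ 1" and 2: "m $ 2 = \<sigma> * p $ 2 + s * q $ 2"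
      using \<open>d \<noteq> 0\<close> by simp_all
    have "l $ 3 * (m $ 3 - (\<sigma> * p $ 3 + s * q $ 3)) = 0"
      using third[OF m] third[OF lp] third[OF lq] 1 2 by algebra
    then have "m $ 3 = \<sigma> * p $ 3 + s * q $ 3" using l by simp
    then have "m = \<sigma> *s p + s *s q" using 1 2 by (simp add: vec_eq_iff forall_3)
    then show ?thesis by blast
  qed
  obtain F where F: "degree F \<le> 6" "\<Phi> = homog 6 F"
    using bf[of q] unfolding \<Phi>_def bform_def by blast
  \<comment> \<open>The point is q itself here, so the Euler condition kills the coefficient of
    degree 6 and leaves degree at most 5.\<close>
  have "\<Phi> 0 1 = 0" by (simp add: \<Phi>_def euler_hom_form)
  then have "coeff F 6 = 0" by (simp add: F(2) homog_zero_left)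
  then have "degree F \<noteq> 6" by (metis degree_0 leading_coeff_0_iff zero_neq_numeral)
  then have dF: "degree F \<le> 5" using F(1) by simp
  \<comment> \<open>The Euler condition relates the two directional values and so yields the local
    expression at q from F.\<close>
  have eu: "\<sigma> * \<Psi> \<sigma> s + s * \<Phi> \<sigma> s = 0" for \<sigma> s
  proof -
    show ?thesis using euler_hom_form[of w "\<sigma> *s p + s *s q"] unfolding pair_linear \<Phi>_def \<Psi>_def .
  qed
  have \<Phi>1: "pair (hom_form w (p + s *s q)) q = poly F s" for s
  proof -
    have "\<Phi> 1 s = poly F s" unfolding F(2) by (rule homog_one_left[OF F(1)])
    then show ?thesis by (simp add: \<Phi>_def)
  qed
  have \<Psi>1: "pair (hom_form w (q + s *s p)) p = - (s ^ 5 * poly F (1 / s))" if "s \<noteq> 0" for s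
  proof -
    have "s * \<Psi> s 1 + \<Phi> s 1 = 0" using eu[of s 1] by simp
    moreover have "\<Phi> s 1 = s ^ 6 * poly F (1 / s)" using F that by (simp add: homog_nonzero_left)
    ultimately have "s * (\<Psi> s 1 + s ^ 5 * poly F (1 / s)) = 0" by (simp add: algebra_simps eval_nat_numeral)
    then have "\<Psi> s 1 = - (s ^ 5 * poly F (1 / s))" using that by (simp add: add_eq_0_iff2)
    then show ?thesis by (simp add: \<Psi>_def add.commute)
  qed
  \<comment> \<open>If F were 0 the line would be invariant; evaluating on its tangent vector (l2, -
    l1, 0) would make l2 A - l1 B vanish identically.\<close>
  have F0: "F \<noteq> 0"
  proof
    assume "F = 0"
    then have \<Phi>0: "\<Phi> \<sigma> s = 0" for \<sigma> s using F(2) by simp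
    have p3: "l $ 2 * fst w x y + - l $ 1 * snd w x y = 0" if xy: "l $ 1 * x + l $ 2 * y \<noteq> 0" for x y
    proof -
      define m :: "complex^3" where "m = vector [x, y, - (l $ 1 * x + l $ 2 * y) / l $ 3]"
      have m: "m $ 1 = x" "m $ 2 = y" "l $ 3 * m $ 3 = - (l $ 1 * x + l $ 2 * y)"
        using l by (simp_all add: m_def)
      have m3: "m $ 3 \<noteq> 0" using m(3) xy by (metis mult_zero_right neg_equal_0_iff_equal)
      have lm: "pair l m = 0" unfolding pair_3 m by simp
      obtain \<sigma> s where ms: "m = \<sigma> *s p + s *s q" using comb[OF lm] by blast
      have kill: "pair (hom_form w m) u = 0" if u0: "pair l u = 0" for u
      proof -
        obtain \<alpha> \<beta> where u: "u = \<alpha> *s p + \<beta> *s q" using comb[OF u0] by blast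
        have pu: "pair (hom_form w (a *s p + b *s q)) u = \<alpha> * \<Psi> a b + \<beta> * \<Phi> a b" for a b
          unfolding u pair_linear \<Phi>_def \<Psi>_def ..
        have "\<Psi> a b = 0" if "a \<noteq> 0" for a b using eu[of a b] \<Phi>0 that by simp
        moreover have "\<Psi> 0 b = 0" for b
        proof -
          obtain H where H: "degree H \<le> 6" "\<Psi> = homog 6 H"
            using bf[of p] unfolding \<Psi>_def bform_def by blast
          have "H = 0"
          proof (rule poly_eqI_fun)
            fix x show "poly H x = poly 0 x"
              using H \<open>\<And>a b. a \<noteq> 0 \<Longrightarrow> \<Psi> a b = 0\<close>[of 1 x] by (simp add: homog_one_left)
          qed
          then show ?thesis using H by simp
        qed
        ultimately have "\<Psi> a b = 0" for a b by (cases "a = 0") auto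
        then show ?thesis unfolding ms pu \<Phi>0 by simp
      qed
      have "pair l (vector [l $ 2, - l $ 1, 0]) = 0" by (simp add: pair_3)
      from kill[OF this] have "pair (hom_form w m) (vector [l $ 2, - l $ 1, 0]) = 0" .
      moreover have "pair (hom_form w m) (vector [l $ 2, - l $ 1, 0]) = m $ 3 * (l $ 2 * fst w x y + - l $ 1 * snd w x y)"
        by (simp add: pair_hom_form m(1,2) mult.commute)
      ultimately have "m $ 3 * (l $ 2 * fst w x y + - l $ 1 * snd w x y) = 0" by simp
      then show ?thesis using m3 by simp
    qed
    have "bform 5 (\<lambda>x y. l $ 2 * fst w x y + - l $ 1 * snd w x y)"
      by (intro bform_add bform_scale f)
    then obtain K where K: "degree K \<le> 5" "(\<lambda>x y. l $ 2 * fst w x y + - l $ 1 * snd w x y) = homog 5 K"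
      unfolding bform_def by blast
    have K': "l $ 2 * fst w x y + - l $ 1 * snd w x y = homog 5 K x y" for x y
      by (rule fun_cong[OF fun_cong[OF K(2)]])
    have "[:l $ 1, l $ 2:] * K = 0"
    proof (rule poly_eqI_fun)
      fix t show "poly ([:l $ 1, l $ 2:] * K) t = poly 0 t"
      proof (cases "l $ 1 + l $ 2 * t = 0")
        case True
        then have "poly [:l $ 1, l $ 2:] t = 0" by (simp add: mult.commute)
        then show ?thesis unfolding poly_mult by simp
      next
        case False
        have "poly K t = l $ 2 * fst w 1 t + - l $ 1 * snd w 1 t" unfolding K' by (rule homog_one_left[OF K(1), symmetric])
        also have "\<dots> = 0" using p3[of 1 t] False by simp
        finally show ?thesis by simp
      qed
    qed
    moreover have "[:l $ 1, l $ 2:] \<noteq> 0" using l(1) by simp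
    ultimately have "K = 0" by (metis mult_eq_0_iff)
    then have "l $ 2 * fst w x y + - l $ 1 * snd w x y = 0" for x y unfolding K' by simp
    from hform_not_proportional[OF w this] show False using l(1) by simp
  qed
  have zs: "{s. pair (hom_form w (p + s *s q)) q = 0} = {s. poly F s = 0}" unfolding \<Phi>1 ..
  show "finite {s. pair (hom_form w (p + s *s q)) q = 0}" unfolding zs using F0 by (rule poly_roots_finite)
  have "tang_order (hom_form w) (p + s *s q) q = int (order s F)" for s
  proof -
    have e: "p + s *s q + u *s q = p + (s + u) *s q" for u by (simp add: vec_eq_iff algebra_simps)
    show ?thesis unfolding tang_order_def e \<Phi>1 by (rule zorder_poly[OF F0])
  qed
  moreover have "tang_order (hom_form w) q p = int (5 - degree F)"
    unfolding tang_order_def by (rule zorder_reflect[OF F0 dF]) (rule \<Psi>1)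
  ultimately have "num_tangencies (hom_form w) p q = (\<Sum>s | poly F s = 0. int (order s F)) + int (5 - degree F)"
    unfolding num_tangencies_def zs by simp
  also have "\<dots> = int (degree F) + int (5 - degree F)"
    using sum_order_complex[OF F0] by (metis of_nat_sum)
  finally show "num_tangencies (hom_form w) p q = int 5" using dF by simp
qed

section \<open>Foliations given by coprime homogeneous polynomials\<close>

lemma poly_poly_const: "poly (poly P q) x = poly (poly P [:poly q x:]) x"
  for P :: "complex poly poly"
  by (induction P) simp_all

lemma poly_eval2: "poly (poly P q) x = eval2 P x (poly q x)"
  unfolding eval2_def by (rule poly_poly_const)

lemma hom_poly2_coeff:
  assumes "hom_poly2 5 P"
  shows "coeff P i = (if i \<le> 5 then monom (coeff (coeff P i) (5 - i)) (5 - i) else 0)"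
proof (rule poly_eqI)
  fix j
  show "coeff (coeff P i) j = coeff (if i \<le> 5 then monom (coeff (coeff P i) (5 - i)) (5 - i) else 0) j"
  proof (cases "i + j = 5")
    case True
    then have "i \<le> 5" "j = 5 - i" by simp_all
    then show ?thesis by simp
  next
    case False
    then have "coeff (coeff P i) j = 0" using assms unfolding hom_poly2_def by blast
    moreover have "\<not> (i \<le> 5 \<and> 5 - i = j)" using False by auto
    ultimately show ?thesis by (auto simp: coeff_monom)
  qed
qed

lemma eval2_homog:
  assumes P: "hom_poly2 5 P"
  shows "eval2 P = homog 5 [:coeff (coeff P 0) 5, coeff (coeff P 1) 4, coeff (coeff P 2) 3, coeff (coeff P 3) 2, coeff (coeff P 4) 1, coeff (coeff P 5) 0:]"
proof (intro ext)
  fix x y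
  have "degree P \<le> 5" by (rule degree_le) (metis hom_poly2_coeff[OF P] not_less)
  have "poly P [:y:] = (\<Sum>i\<le>degree P. coeff P i * [:y:] ^ i)" by (rule poly_altdef)
  also have "\<dots> = (\<Sum>i\<le>5. coeff P i * [:y:] ^ i)"
    using \<open>degree P \<le> 5\<close> by (intro sum.mono_neutral_left) (auto simp: coeff_eq_0)
  finally have "eval2 P x y = (\<Sum>i\<le>5. poly (coeff P i) x * y ^ i)"
    by (simp add: eval2_def poly_sum)
  also have "\<dots> = (\<Sum>i\<le>5. coeff (coeff P i) (5 - i) * x ^ (5 - i) * y ^ i)"
  proof (intro sum.cong refl)
    fix i :: nat assume "i \<in> {..5}"
    then have "poly (coeff P i) x = coeff (coeff P i) (5 - i) * x ^ (5 - i)"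
      by (subst hom_poly2_coeff[OF P]) (simp add: poly_monom)
    then show "poly (coeff P i) x * y ^ i = coeff (coeff P i) (5 - i) * x ^ (5 - i) * y ^ i" by simp
  qed
  finally show "eval2 P x y = homog 5 [:coeff (coeff P 0) 5, coeff (coeff P 1) 4, coeff (coeff P 2) 3, coeff (coeff P 3) 2, coeff (coeff P 4) 1, coeff (coeff P 5) 0:] x y"
    unfolding homog_5_pCons by (simp add: eval_nat_numeral)
qed

text \<open>By homogeneity a common zero with x nonzero and slope t gives the common factor y - t x,
  and one with x = 0 gives the common factor x; neither is a unit.\<close>

lemma hform_eval2:
  assumes A: "hom_poly2 5 A" and B: "hom_poly2 5 B" and cop: "coprime A B"
  shows "hform (eval2 A, eval2 B)"
proof -
  have bA: "bform 5 (eval2 P)" if "hom_poly2 5 P" for P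
    unfolding eval2_homog[OF that] by (rule bform_homog[OF degree_le_5I])
  have "x = 0 \<and> y = 0" if z: "eval2 A x y = 0" "eval2 B x y = 0" for x y
  proof (rule ccontr)
    assume xy: "\<not> (x = 0 \<and> y = 0)"
    show False
    proof (cases "x = 0")
      case False
      define t where "t = y / x"
      have dvd: "[:- [:0, t:], 1:] dvd P" if P: "hom_poly2 5 P" "eval2 P x y = 0" for P
      proof -
        have "poly P [:0, t:] = 0"
        proof (rule poly_eqI_fun)
          fix u
          have "x ^ 5 * eval2 P u (t * u) = u ^ 5 * eval2 P x y"
          proof -
            have "eval2 P (x * u) (x * (t * u)) = x ^ 5 * eval2 P u (t * u)"
              "eval2 P (u * x) (u * y) = u ^ 5 * eval2 P x y"
              by (rule bform_scale_args[OF bA[OF P(1)]])+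
            moreover have "x * (t * u) = u * y" "x * u = u * x" using False by (simp_all add: t_def)
            ultimately show ?thesis by simp
          qed
          then have "eval2 P u (t * u) = 0" using P(2) False by simp
          then show "poly (poly P [:0, t:]) u = poly 0 u" unfolding poly_eval2 by (simp add: mult.commute)
        qed
        then show ?thesis by (simp only: poly_eq_0_iff_dvd)
      qed
      have "is_unit [:- [:0, t:], 1:]"
        using coprime_common_divisor[OF cop dvd[OF A z(1)] dvd[OF B z(2)]] .
      then have "degree [:- [:0, t:], 1:] = 0" by (rule is_unit_poly_iff[THEN iffD1, THEN exE]) auto
      then show False by simp
    next
      case True
      then have y: "y \<noteq> 0" using xy by simp
      have dvd: "[:[:0, 1:]:] dvd P" if P: "hom_poly2 5 P" "eval2 P x y = 0" for P
      proof -
        have c5: "coeff (coeff P 5) 0 = 0"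
          using P(2) y True unfolding eval2_homog[OF P(1)] homog_5_pCons by simp
        have "[:0, 1:] dvd coeff P i" for i
        proof -
          have "coeff (coeff P i) 0 = 0"
          proof (cases "i = 5")
            case False
            then have "i + 0 \<noteq> 5" by simp
            then show ?thesis using P(1) unfolding hom_poly2_def by blast
          qed (simp add: c5)
          then have "poly (coeff P i) 0 = 0" by (simp add: poly_0_coeff_0)
          then show ?thesis using poly_eq_0_iff_dvd[of "coeff P i" 0] by simp
        qed
        then show ?thesis unfolding const_poly_dvd_iff by blast
      qed
      have "is_unit [:[:0, 1 :: complex:]:]"
        using coprime_common_divisor[OF cop dvd[OF A z(1)] dvd[OF B z(2)]] .
      then have "is_unit [:0, 1 :: complex:]" unfolding is_unit_const_poly_iff .
      then have "degree [:0, 1 :: complex:] = 0" by (rule is_unit_poly_iff[THEN iffD1, THEN exE]) auto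
      then show False by simp
    qed
  qed
  then show ?thesis unfolding hform_def fst_conv snd_conv using bA[OF A] bA[OF B] by blast
qed

lemma hom_poly3_scale:
  assumes "hom_poly3 n f"
  shows "f (t *s p) = t ^ n * f p"
proof -
  obtain c where c: "\<And>p. f p = (\<Sum>i\<le>n. \<Sum>j\<le>n-i. c i j * (p $ 1) ^ i * (p $ 2) ^ j * (p $ 3) ^ (n - i - j))"
    using assms unfolding hom_poly3_def by blast
  have "c i j * (t * x) ^ i * (t * y) ^ j * (t * z) ^ (n - i - j) = t ^ n * (c i j * x ^ i * y ^ j * z ^ (n - i - j))"
    if "i \<le> n" "j \<le> n - i" for i j x y z
  proof -
    have "t ^ n = t ^ i * t ^ j * t ^ (n - i - j)" using that by (simp flip: power_add)
    then show ?thesis by (simp add: power_mult_distrib)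
  qed
  then show ?thesis unfolding c sum_distrib_left by (intro sum.cong) auto
qed

lemma hom_poly3_isCont:
  assumes "hom_poly3 n f"
  shows "isCont (\<lambda>s. f (p + s *s q)) a"
proof -
  obtain c where c: "\<And>p. f p = (\<Sum>i\<le>n. \<Sum>j\<le>n-i. c i j * (p $ 1) ^ i * (p $ 2) ^ j * (p $ 3) ^ (n - i - j))"
    using assms unfolding hom_poly3_def by blast
  show ?thesis unfolding c vector_add_component vector_smult_component by (intro continuous_intros)
qed

text \<open>This extends identities obtained after division by powers of z to the line z =
  0.\<close>

lemma isCont_eq_at_0:
  fixes f g :: "complex \<Rightarrow> complex"
  assumes "isCont f 0" "isCont g 0" "\<And>z. z \<noteq> 0 \<Longrightarrow> f z = g z"
  shows "f 0 = g 0"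
proof -
  have "f \<midarrow>0\<rightarrow> f 0" "g \<midarrow>0\<rightarrow> g 0" using assms(1,2) by (simp_all add: isCont_def)
  moreover have "f \<midarrow>0\<rightarrow> g 0"
    using \<open>g \<midarrow>0\<rightarrow> g 0\<close> by (rule Lim_transform_eventually) (simp add: eventually_at_filter assms(3))
  ultimately show ?thesis using tendsto_unique[of "at 0" f "f 0" "g 0"] by simp
qed

lemma vector_3_sum: "(vector [x, y, z] :: complex^3) = vector [x, y, 0] + z *s vector [0, 0, 1]"
  "(vector [x, y, z] :: complex^3) = x *s vector [1, 0, 0] + (y *s vector [0, 1, 0] + z *s vector [0, 0, 1])"
  by (simp_all add: vec_eq_iff forall_3)

lemma matrix_vector_simps:
  fixes M :: "complex^3^3"
  shows "M *v (p + q) = M *v p + M *v q" "M *v (c *s p) = c *s (M *v p)"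
  by (simp_all add: matrix_vector_right_distrib vector_scalar_commute)

lemma invertible_obtain:
  assumes "invertible (M :: complex^3^3)"
  obtains N where "\<And>p. M *v (N *v p) = p" "\<And>p. N *v (M *v p) = p" "invertible N"
proof -
  obtain N where N: "M ** N = mat 1" "N ** M = mat 1" using assms by (auto simp: invertible_def)
  then have "invertible N" by (auto simp: invertible_def)
  moreover have "M *v (N *v p) = p" "N *v (M *v p) = p" for p
    using N by (simp_all add: matrix_vector_mul_assoc)
  ultimately show ?thesis using that by blast
qed

lemma proj_point_self: "p \<in> proj_point p"
  unfolding proj_point_def by (rule CollectI, rule exI[of _ 1]) simp

text \<open>The chart determines the form off the line at infinity, and homogeneity then determines
  it up to the factor z^(n - 6). Polynomial coefficients exclude n < 6 and isolated singularities
  exclude n > 6.\<close>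

lemma homogeneous_foliation_hom_form:
  assumes "homogeneous_foliation 5 \<Omega>"
  obtains w where "hform w" "conjugate (hom_form w) \<Omega>"
proof -
  obtain M A B where M: "invertible M" and A: "hom_poly2 5 A" and B: "hom_poly2 5 B" and cop: "coprime A B"
    and chart: "given_in_chart M \<Omega> (eval2 A, eval2 B)" and fol: "foliation \<Omega>"
    using assms unfolding homogeneous_foliation_def by blast
  define w where "w = (eval2 A, eval2 B)"
  have w: "hform w" unfolding w_def by (rule hform_eval2[OF A B cop])
  have f: "bform 5 (fst w)" "bform 5 (snd w)" using w by (simp_all add: hform_def)
  obtain c where c: "c \<noteq> 0"
    "\<And>x y. pair (\<Omega> (M *v vector [x, y, 1])) (M *v vector [1, 0, 0]) = c * fst w x y"
    "\<And>x y. pair (\<Omega> (M *v vector [x, y, 1])) (M *v vector [0, 1, 0]) = c * snd w x y"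
    using chart unfolding given_in_chart_def w_def by blast
  obtain n where n: "\<And>i. hom_poly3 n (\<lambda>p. \<Omega> p $ i)"
    using fol unfolding foliation_def by blast
  have euler: "pair (\<Omega> p) p = 0" for p using fol unfolding foliation_def by blast
  have fin: "finite (proj_point ` {p. p \<noteq> 0 \<and> \<Omega> p = 0})" using fol unfolding foliation_def by blast
  define \<Theta> where "\<Theta> p v = pair (\<Omega> (M *v p)) (M *v v)" for p v
  have sc: "\<Theta> (t *s p) v = t ^ n * \<Theta> p v" for t p v
    unfolding \<Theta>_def pair_3 matrix_vector_simps hom_poly3_scale[OF n] by (simp add: algebra_simps)
  have cont: "isCont (\<lambda>z. \<Theta> (vector [x, y, z]) v) 0" for x y v
  proof -
    have "(\<lambda>z. \<Theta> (vector [x, y, z]) v) = (\<lambda>z. \<Theta> (vector [x, y, 0] + z *s vector [0, 0, 1]) v)"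
      by (rule ext, rule arg_cong[of _ _ "\<lambda>u. \<Theta> u v"], rule vector_3_sum(1))
    moreover have "isCont (\<lambda>z. \<Theta> (vector [x, y, 0] + z *s vector [0, 0, 1]) v) 0"
      unfolding \<Theta>_def pair_3 matrix_vector_simps by (intro continuous_intros hom_poly3_isCont[OF n])
    ultimately show ?thesis by (simp only:)
  qed
  let ?e1 = "vector [1, 0, 0] :: complex^3" and ?e2 = "vector [0, 1, 0] :: complex^3" and ?e3 = "vector [0, 0, 1] :: complex^3"
  have lin: "\<Theta> p (vector [a, b, d]) = a * \<Theta> p ?e1 + b * \<Theta> p ?e2 + d * \<Theta> p ?e3" for p a b d
    unfolding \<Theta>_def vector_3_sum(2)[of a b d] matrix_vector_simps by (simp add: pair_3 algebra_simps)
  have e12: "z ^ 5 * \<Theta> (vector [x, y, z]) ?e1 = z ^ n * (c * fst w x y)" "z ^ 5 * \<Theta> (vector [x, y, z]) ?e2 = z ^ n * (c * snd w x y)"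
    if z: "z \<noteq> 0" for x y z
  proof -
    have v: "vector [x, y, z] = z *s (vector [x / z, y / z, 1] :: complex^3)"
      using z by (simp add: vec_eq_iff forall_3)
    have "z ^ 5 * fst w (x / z) (y / z) = fst w x y" "z ^ 5 * snd w (x / z) (y / z) = snd w x y"
      using bform_scale_args[OF f(1), of z "x / z" "y / z"] bform_scale_args[OF f(2), of z "x / z" "y / z"] z by simp_all
    then show "z ^ 5 * \<Theta> (vector [x, y, z]) ?e1 = z ^ n * (c * fst w x y)" "z ^ 5 * \<Theta> (vector [x, y, z]) ?e2 = z ^ n * (c * snd w x y)"
      unfolding v sc by (simp_all add: \<Theta>_def c(2,3) algebra_simps)
  qed
  have e3: "z ^ 6 * \<Theta> (vector [x, y, z]) ?e3 = - (z ^ n * (c * tang w (x, y)))" if z: "z \<noteq> 0" for x y z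
  proof -
    have "x * \<Theta> (vector [x, y, z]) ?e1 + y * \<Theta> (vector [x, y, z]) ?e2 + z * \<Theta> (vector [x, y, z]) ?e3 = 0"
      using euler[of "M *v vector [x, y, z]"] unfolding lin[symmetric] by (simp add: \<Theta>_def)
    then have "z ^ 6 * \<Theta> (vector [x, y, z]) ?e3 = - (x * (z ^ 5 * \<Theta> (vector [x, y, z]) ?e1) + y * (z ^ 5 * \<Theta> (vector [x, y, z]) ?e2))"
      by algebra
    then show ?thesis unfolding e12[OF z] by (simp add: tang_def algebra_simps)
  qed
  \<comment> \<open>For n < 6, letting z tend to 0 gives \<open>tang\<close> = 0 in a direction
    where it is nonzero. For n > 6 the form vanishes on the whole line at infinity, so the singular
    points are infinitely many.\<close>
  have n6: "n = 6"
  proof (rule ccontr)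
    assume "n \<noteq> 6"
    then consider "n < 6" | "n > 6" by linarith
    then show False
    proof cases
      case 1
      obtain v where v: "tang w v \<noteq> 0" using exists_nonfixed[OF w] by blast
      have "(\<lambda>z. z ^ (6 - n) * \<Theta> (vector [fst v, snd v, z]) ?e3) 0 = (\<lambda>z. - (c * tang w v)) 0"
      proof (rule isCont_eq_at_0[where f = "\<lambda>z. z ^ (6 - n) * \<Theta> (vector [fst v, snd v, z]) ?e3" and g = "\<lambda>z. - (c * tang w v)"])
        show "isCont (\<lambda>z. z ^ (6 - n) * \<Theta> (vector [fst v, snd v, z]) ?e3) 0"
          by (intro continuous_intros cont)
        fix z :: complex assume z: "z \<noteq> 0"
        have "z ^ 6 = z ^ n * z ^ (6 - n)" using 1 by (simp flip: power_add)
        then have "z ^ n * (z ^ (6 - n) * \<Theta> (vector [fst v, snd v, z]) ?e3 - - (c * tang w v)) = 0"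
          using e3[OF z, of "fst v" "snd v"] by (simp add: algebra_simps)
        then show "z ^ (6 - n) * \<Theta> (vector [fst v, snd v, z]) ?e3 = - (c * tang w v)" using z by (simp add: eq_neg_iff_add_eq_0)
      qed (intro continuous_intros)
      then show False using v c(1) 1 by (simp add: power_0_left)
    next
      case 2
      have zero: "\<Theta> (vector [x, y, 0]) v = 0" for x y v
      proof -
        have "(\<lambda>z. \<Theta> (vector [x, y, z]) ?e1) 0 = (\<lambda>z. z ^ (n - 5) * (c * fst w x y)) 0"
        proof (rule isCont_eq_at_0[where f = "\<lambda>z. \<Theta> (vector [x, y, z]) ?e1" and g = "\<lambda>z. z ^ (n - 5) * (c * fst w x y)", OF cont])
          fix z :: complex assume z: "z \<noteq> 0"
          have "z ^ n = z ^ 5 * z ^ (n - 5)" using 2 by (simp flip: power_add)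
          then show "\<Theta> (vector [x, y, z]) ?e1 = z ^ (n - 5) * (c * fst w x y)" using e12(1)[OF z, of x y] z by simp
        qed (intro continuous_intros)
        moreover have "(\<lambda>z. \<Theta> (vector [x, y, z]) ?e2) 0 = (\<lambda>z. z ^ (n - 5) * (c * snd w x y)) 0"
        proof (rule isCont_eq_at_0[where f = "\<lambda>z. \<Theta> (vector [x, y, z]) ?e2" and g = "\<lambda>z. z ^ (n - 5) * (c * snd w x y)", OF cont])
          fix z :: complex assume z: "z \<noteq> 0"
          have "z ^ n = z ^ 5 * z ^ (n - 5)" using 2 by (simp flip: power_add)
          then show "\<Theta> (vector [x, y, z]) ?e2 = z ^ (n - 5) * (c * snd w x y)" using e12(2)[OF z, of x y] z by simp
        qed (intro continuous_intros)
        moreover have "(\<lambda>z. \<Theta> (vector [x, y, z]) ?e3) 0 = (\<lambda>z. - (z ^ (n - 6) * (c * tang w (x, y)))) 0"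
        proof (rule isCont_eq_at_0[where f = "\<lambda>z. \<Theta> (vector [x, y, z]) ?e3" and g = "\<lambda>z. - (z ^ (n - 6) * (c * tang w (x, y)))", OF cont])
          fix z :: complex assume z: "z \<noteq> 0"
          have "z ^ n = z ^ 6 * z ^ (n - 6)" using 2 by (simp flip: power_add)
          then have "z ^ 6 * (\<Theta> (vector [x, y, z]) ?e3 - - (z ^ (n - 6) * (c * tang w (x, y)))) = 0"
            using e3[OF z, of x y] by (simp add: algebra_simps)
          then show "\<Theta> (vector [x, y, z]) ?e3 = - (z ^ (n - 6) * (c * tang w (x, y)))" using z by (simp add: eq_neg_iff_add_eq_0)
        qed (intro continuous_intros)
        ultimately have "\<Theta> (vector [x, y, 0]) ?e1 = 0" "\<Theta> (vector [x, y, 0]) ?e2 = 0" "\<Theta> (vector [x, y, 0]) ?e3 = 0"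
          using 2 by (simp_all add: power_0_left)
        then show ?thesis using lin[of "vector [x, y, 0]" "v $ 1" "v $ 2" "v $ 3"] by (simp add: vector_3_eq)
      qed
      obtain N where N: "\<And>p. M *v (N *v p) = p" "\<And>p. N *v (M *v p) = p" using invertible_obtain[OF M] by metis
      define P where "P t = M *v vector [1, t, 0]" for t :: complex
      have P0: "P t \<noteq> 0" "\<Omega> (P t) = 0" for t
      proof -
        have "N *v P t = vector [1, t, 0]" by (simp add: P_def N)
        then have "(N *v P t) $ 1 = 1" by simp
        then show "P t \<noteq> 0" by (metis matrix_vector_mult_0_right zero_index zero_neq_one)
        have "pair (\<Omega> (P t)) u = 0" for u
          using zero[of 1 t "N *v u"] by (simp add: \<Theta>_def N P_def)
        from this[of "vector [1, 0, 0]"] this[of "vector [0, 1, 0]"] this[of "vector [0, 0, 1]"]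
        show "\<Omega> (P t) = 0" by (simp add: pair_3 vec_eq_iff forall_3)
      qed
      have "inj (\<lambda>t. proj_point (P t))"
      proof (rule injI)
        fix s t assume "proj_point (P s) = proj_point (P t)"
        then have "P s \<in> proj_point (P t)" using proj_point_self by metis
        then obtain d where "P s = d *s P t" unfolding proj_point_def by blast
        then have "N *v P s = d *s (N *v P t)" by (simp add: matrix_vector_simps)
        then have "vector [1, s, 0] = d *s (vector [1, t, 0] :: complex^3)" by (simp add: P_def N)
        then show "s = t" by (simp add: vec_eq_iff forall_3)
      qed
      moreover have "range (\<lambda>t. proj_point (P t)) \<subseteq> proj_point ` {p. p \<noteq> 0 \<and> \<Omega> p = 0}" using P0 by blast
      ultimately have "finite (UNIV :: complex set)" using fin by (meson finite_imageD finite_subset)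
      then show False using infinite_UNIV_char_0 by blast
    qed
  qed
  have main: "\<Theta> p v = c * pair (hom_form w p) v" for p v
  proof -
    define x y z where "x = p $ 1" and "y = p $ 2" and "z = p $ 3"
    have nz: "\<Theta> (vector [x, y, z]) ?e1 = z * (c * fst w x y)" "\<Theta> (vector [x, y, z]) ?e2 = z * (c * snd w x y)"
      "\<Theta> (vector [x, y, z]) ?e3 = - (c * tang w (x, y))" if z: "z \<noteq> 0" for z
    proof -
      have "z ^ 5 * (\<Theta> (vector [x, y, z]) ?e1 - z * (c * fst w x y)) = 0" "z ^ 5 * (\<Theta> (vector [x, y, z]) ?e2 - z * (c * snd w x y)) = 0"
        "z ^ 6 * (\<Theta> (vector [x, y, z]) ?e3 - - (c * tang w (x, y))) = 0"
        using e12[OF z, of x y] e3[OF z, of x y] unfolding n6 by algebra+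
      then show "\<Theta> (vector [x, y, z]) ?e1 = z * (c * fst w x y)" "\<Theta> (vector [x, y, z]) ?e2 = z * (c * snd w x y)"
        "\<Theta> (vector [x, y, z]) ?e3 = - (c * tang w (x, y))" using z by (simp_all add: eq_neg_iff_add_eq_0)
    qed
    have "\<Theta> (vector [x, y, z]) ?e1 = z * (c * fst w x y) \<and> \<Theta> (vector [x, y, z]) ?e2 = z * (c * snd w x y) \<and>
      \<Theta> (vector [x, y, z]) ?e3 = - (c * tang w (x, y))"
    proof (cases "z = 0")
      case True
      have "(\<lambda>z. \<Theta> (vector [x, y, z]) ?e1) 0 = (\<lambda>z. z * (c * fst w x y)) 0"
        by (rule isCont_eq_at_0[where f = "\<lambda>z. \<Theta> (vector [x, y, z]) ?e1" and g = "\<lambda>z. z * (c * fst w x y)", OF cont _ nz(1)]) (intro continuous_intros, simp)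
      moreover have "(\<lambda>z. \<Theta> (vector [x, y, z]) ?e2) 0 = (\<lambda>z. z * (c * snd w x y)) 0"
        by (rule isCont_eq_at_0[where f = "\<lambda>z. \<Theta> (vector [x, y, z]) ?e2" and g = "\<lambda>z. z * (c * snd w x y)", OF cont _ nz(2)]) (intro continuous_intros, simp)
      moreover have "(\<lambda>z. \<Theta> (vector [x, y, z]) ?e3) 0 = (\<lambda>z. - (c * tang w (x, y))) 0"
        by (rule isCont_eq_at_0[where f = "\<lambda>z. \<Theta> (vector [x, y, z]) ?e3" and g = "\<lambda>z. - (c * tang w (x, y))", OF cont _ nz(3)]) (intro continuous_intros, simp)
      ultimately show ?thesis using True by simp
    qed (use nz in blast)
    then have h: "\<Theta> p ?e1 = p $ 3 * (c * fst w (p $ 1) (p $ 2))" "\<Theta> p ?e2 = p $ 3 * (c * snd w (p $ 1) (p $ 2))"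
      "\<Theta> p ?e3 = - (c * tang w (p $ 1, p $ 2))"
      unfolding x_def y_def z_def vector_3_eq by blast+
    have "\<Theta> p v = v $ 1 * \<Theta> p ?e1 + v $ 2 * \<Theta> p ?e2 + v $ 3 * \<Theta> p ?e3"
      using lin[of p "v $ 1" "v $ 2" "v $ 3"] unfolding vector_3_eq .
    then show ?thesis
      unfolding h pair_hom_form tang_def fst_conv snd_conv by algebra
  qed
  have "conjugate (hom_form w) \<Omega>"
    unfolding conjugate_def using M c(1) main[unfolded \<Theta>_def] by blast
  then show thesis using that w by blast
qed

section \<open>Projective conjugacy and linear equivalence\<close>

lemma conjugate_sym:
  assumes "conjugate \<Omega> \<Omega>'"
  shows "conjugate \<Omega>' \<Omega>"
proof -
  obtain M c where M: "invertible M" "c \<noteq> 0" "\<And>p v. pair (\<Omega>' (M *v p)) (M *v v) = c * pair (\<Omega> p) v"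
    using assms unfolding conjugate_def by blast
  obtain N where N: "\<And>p. M *v (N *v p) = p" "invertible N" using invertible_obtain[OF M(1)] by metis
  have "pair (\<Omega> (N *v p)) (N *v v) = 1 / c * pair (\<Omega>' p) v" for p v
    using M(3)[of "N *v p" "N *v v"] M(2) unfolding N by simp
  then show ?thesis unfolding conjugate_def using N(2) M(2) by (metis divide_eq_0_iff zero_neq_one)
qed

lemma conjugate_trans:
  assumes "conjugate \<Omega> \<Omega>'" "conjugate \<Omega>' \<Omega>''"
  shows "conjugate \<Omega> \<Omega>''"
proof -
  obtain M c where M: "invertible M" "c \<noteq> 0" "\<And>p v. pair (\<Omega>' (M *v p)) (M *v v) = c * pair (\<Omega> p) v"
    using assms(1) unfolding conjugate_def by blast
  obtain N d where N: "invertible N" "d \<noteq> 0" "\<And>p v. pair (\<Omega>'' (N *v p)) (N *v v) = d * pair (\<Omega>' p) v"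
    using assms(2) unfolding conjugate_def by blast
  have "pair (\<Omega>'' ((N ** M) *v p)) ((N ** M) *v v) = d * c * pair (\<Omega> p) v" for p v
    using N(3)[of "M *v p" "M *v v"] M(3)[of p v] by (simp add: matrix_vector_mul_assoc)
  moreover have "d * c \<noteq> 0" using M N by simp
  ultimately show ?thesis unfolding conjugate_def using invertible_mult[OF N(1) M(1)] by blast
qed

lemma lconj_conjugate:
  assumes "lconj w w'"
  shows "conjugate (hom_form w) (hom_form w')"
proof -
  obtain p q r s k where P: "pulls p q r s k w' w" using assms unfolding lconj_def by blast
  define M :: "complex^3^3" where "M = vector [vector [p, q, 0], vector [r, s, 0], vector [0, 0, 1]]"
  have Mv: "(M *v v) $ 1 = p * v $ 1 + q * v $ 2" "(M *v v) $ 2 = r * v $ 1 + s * v $ 2" "(M *v v) $ 3 = v $ 3" for v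
    by (simp_all add: M_def matrix_vector_mult_def sum_3)
  have "det M = p * s - q * r" by (simp add: M_def det_3)
  then have "invertible M" using P by (simp add: invertible_det_nz pulls_def)
  moreover have "pair (hom_form w' (M *v u)) (M *v v) = k * pair (hom_form w u) v" for u v
  proof -
    have "k * pair (hom_form w u) v = u $ 3 * ((k * fst w (u $ 1) (u $ 2)) * v $ 1 + (k * snd w (u $ 1) (u $ 2)) * v $ 2) -
       (u $ 1 * (k * fst w (u $ 1) (u $ 2)) + u $ 2 * (k * snd w (u $ 1) (u $ 2))) * v $ 3"
      by (simp add: pair_hom_form algebra_simps)
    then show ?thesis unfolding pullsD[OF P] pair_hom_form Mv by algebra
  qed
  ultimately show ?thesis unfolding conjugate_def using P by (auto simp: pulls_def)
qed

lemma pair_eq_0_iff: "(\<forall>v. pair l v = 0) \<longleftrightarrow> l = 0"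
proof
  assume *: "\<forall>v. pair l v = 0"
  from *[rule_format, of "vector [1, 0, 0]"] *[rule_format, of "vector [0, 1, 0]"] *[rule_format, of "vector [0, 0, 1]"]
  show "l = 0" by (simp add: pair_3 vec_eq_iff forall_3)
qed (simp add: pair_3)

lemma pair_transpose: "pair (transpose N *v l) u = pair l (N *v u)"
  by (simp add: pair_3 matrix_vector_mult_def sum_3 transpose_def algebra_simps)

text \<open>A conjugacy must fix [0 : 0 : 1]: there the form vanishes to order 5, whereas at a
  singular point on the line at infinity it vanishes only to first order in a transverse direction.
  The upper left block of M is then the linear equivalence.\<close>

lemma conjugate_lconj:
  assumes w: "hform w" "hform w'" and conj: "conjugate (hom_form w) (hom_form w')"
  shows "lconj w w'"
proof -
  obtain M c where M: "invertible M" "c \<noteq> 0"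
    "\<And>p v. pair (hom_form w' (M *v p)) (M *v v) = c * pair (hom_form w p) v"
    using conj unfolding conjugate_def by blast
  obtain N where N: "\<And>p. M *v (N *v p) = p" "\<And>p. N *v (M *v p) = p" using invertible_obtain[OF M(1)] by metis
  have M': "pair (hom_form w' (M *v p)) v = c * pair (hom_form w p) (N *v v)" for p v
    using M(3)[of p "N *v v"] unfolding N .
  define e3 :: "complex^3" where "e3 = vector [0, 0, 1]"
  have e3: "e3 $ 1 = 0" "e3 $ 2 = 0" "e3 $ 3 = 1" by (simp_all add: e3_def)
  define m where "m = M *v e3"
  have me3: "m $ i = M $ i $ 3" for i
    by (simp add: m_def matrix_vector_mult_def sum_3 e3)
  have "m $ 1 = 0 \<and> m $ 2 = 0"
  proof (rule ccontr)
    assume ne: "\<not> (m $ 1 = 0 \<and> m $ 2 = 0)"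
    have "hom_form w e3 = 0" unfolding hom_form_eq_0[OF w(1)] using e3 by simp
    then have "pair (hom_form w' m) v = 0" for v
      unfolding m_def M' by (simp add: pair_3)
    then have "hom_form w' m = 0" using pair_eq_0_iff by blast
    then have m3: "m $ 3 = 0" "tang w' (m $ 1, m $ 2) = 0"
      unfolding hom_form_eq_0[OF w(2)] using ne by blast+
    \<comment> \<open>The direction carried to e3, so that the line e3 + s u goes to m + s e3,
      transverse to the line at infinity at m.\<close>
    define u where "u = N *v e3"
    have Mu: "M *v (e3 + s *s u) = m + s *s e3" for s
      unfolding matrix_vector_simps u_def N m_def ..
    have zero: "fst w' (m $ 1) (m $ 2) * v $ 1 + snd w' (m $ 1) (m $ 2) * v $ 2 = 0" for v :: "complex^3"
    proof -
      let ?K = "fst w' (m $ 1) (m $ 2) * v $ 1 + snd w' (m $ 1) (m $ 2) * v $ 2"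
      let ?x = "u $ 1" and ?y = "u $ 2" and ?v = "N *v v"
      let ?g = "\<lambda>s. c * (s ^ 4 * ((1 + s * u $ 3) * (fst w ?x ?y * ?v $ 1 + snd w ?x ?y * ?v $ 2) - s * tang w (?x, ?y) * ?v $ 3))"
      \<comment> \<open>After division by s the target side is the constant K, while the source side
        still has the factor s^4.\<close>
      have "(\<lambda>s. ?K) 0 = ?g 0"
      proof (rule isCont_eq_at_0[where f = "\<lambda>s. ?K" and g = ?g])
        fix s :: complex assume s: "s \<noteq> 0"
        have b: "bform 5 (fst w)" "bform 5 (snd w)" using w(1) unfolding hform_def by blast+
        have f: "fst w (s * ?x) (s * ?y) = s ^ 5 * fst w ?x ?y" "snd w (s * ?x) (s * ?y) = s ^ 5 * snd w ?x ?y"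
          using b[THEN bform_scale_args] by blast+
        have q: "(e3 + s *s u) $ 1 = s * ?x" "(e3 + s *s u) $ 2 = s * ?y" "(e3 + s *s u) $ 3 = 1 + s * u $ 3"
          "(m + s *s e3) $ 1 = m $ 1" "(m + s *s e3) $ 2 = m $ 2" "(m + s *s e3) $ 3 = s"
          using e3 m3(1) by simp_all
        have t: "m $ 1 * fst w' (m $ 1) (m $ 2) + m $ 2 * snd w' (m $ 1) (m $ 2) = 0"
          using m3(2) by (simp add: tang_def)
        have "s * ?K = pair (hom_form w' (m + s *s e3)) v"
          unfolding pair_hom_form q t by simp
        also have "\<dots> = c * pair (hom_form w (e3 + s *s u)) ?v"
          using M'[of "e3 + s *s u" v] unfolding Mu .
        also have "\<dots> = s * ?g s"
          unfolding pair_hom_form q f tang_def fst_conv snd_conv by algebra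
        finally show "?K = ?g s" using s by simp
      qed (intro continuous_intros)+
      then show ?thesis by simp
    qed
    have "fst w' (m $ 1) (m $ 2) = 0" "snd w' (m $ 1) (m $ 2) = 0"
      using zero[of "vector [1, 0, 0]"] zero[of "vector [0, 1, 0]"] by simp_all
    then show False using hform_nonzero[OF w(2)] ne by blast
  qed
  then have M3: "M $ 1 $ 3 = 0" "M $ 2 $ 3 = 0" unfolding me3 by simp_all
  define p q r s \<mu> where "p = M $ 1 $ 1" and "q = M $ 1 $ 2" and "r = M $ 2 $ 1" and "s = M $ 2 $ 2" and "\<mu> = M $ 3 $ 3"
  note defs = this
  have "det M = \<mu> * (p * s - q * r)"
    unfolding det_3 M3 defs by algebra
  moreover have "det M \<noteq> 0" using M(1) invertible_det_nz by blast
  ultimately have nz: "\<mu> \<noteq> 0" "p * s - q * r \<noteq> 0" by simp_all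
  have Mv: "(M *v v) $ 1 = p * v $ 1 + q * v $ 2" "(M *v v) $ 2 = r * v $ 1 + s * v $ 2"
    "(M *v v) $ 3 = M $ 3 $ 1 * v $ 1 + M $ 3 $ 2 * v $ 2 + \<mu> * v $ 3" for v
    by (simp_all add: matrix_vector_mult_def sum_3 M3 defs)
  have "pulls p q r s (c / \<mu>) w' w"
    unfolding pulls_def
  proof (intro conjI allI)
    fix x y
    let ?A = "fst w' (p * x + q * y) (r * x + s * y)" and ?B = "snd w' (p * x + q * y) (r * x + s * y)"
    have v: "(vector [a, b, d] :: complex^3) $ 1 = a" "(vector [a, b, d] :: complex^3) $ 2 = b" "(vector [a, b, d] :: complex^3) $ 3 = d" for a b d
      by simp_all
    \<comment> \<open>Subtracting the equation at (x, y, 0) from the one at (x, y, 1) removes the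
      terms with the entries M31 and M32.\<close>
    have eqs: "\<mu> * (p * ?A + r * ?B) = c * fst w x y"
      using M(3)[of "vector [x, y, 1]" "vector [1, 0, 0]"] M(3)[of "vector [x, y, 0]" "vector [1, 0, 0]"]
      unfolding pair_hom_form Mv v by algebra
    have eqs': "\<mu> * (q * ?A + s * ?B) = c * snd w x y"
      using M(3)[of "vector [x, y, 1]" "vector [0, 1, 0]"] M(3)[of "vector [x, y, 0]" "vector [0, 1, 0]"]
      unfolding pair_hom_form Mv v by algebra
    show "p * ?A + r * ?B = c / \<mu> * fst w x y" "q * ?A + s * ?B = c / \<mu> * snd w x y"
      using nz(1) by (simp_all add: eqs[symmetric] eqs'[symmetric])
  qed (use nz M(2) in simp_all)
  then show ?thesis unfolding lconj_def by blast
qed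

section \<open>Transport of leaves, lines and inflection points\<close>

lemma bounded_linear_matrix: "bounded_linear (\<lambda>x. (M :: complex^3^3) *v x)"
proof -
  have "linear (\<lambda>x. M *v x)"
    by (rule linearI) (simp_all add: matrix_vector_right_distrib vec_eq_iff matrix_vector_mult_def sum_3 algebra_simps)
  then show ?thesis by (simp add: linear_conv_bounded_linear)
qed

text \<open>A conjugacy together with the inverse matrix; it is instantiated twice, with M and N
  exchanged, so each transport lemma serves in both directions.\<close>

locale conj_forms =
  fixes \<Omega> \<Omega>' :: form and M N :: "complex^3^3" and c :: complex
  assumes MN: "\<And>p. M *v (N *v p) = p" "\<And>p. N *v (M *v p) = p" and c: "c \<noteq> 0"
    and conj: "\<And>p v. pair (\<Omega>' (M *v p)) (M *v v) = c * pair (\<Omega> p) v"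
begin

lemma regular_transport:
  assumes "regular_point \<Omega> p"
  shows "regular_point \<Omega>' (M *v p)"
proof -
  have "M *v p \<noteq> 0"
  proof
    assume "M *v p = 0"
    then have "N *v (M *v p) = 0" by simp
    then show False using assms MN by (simp add: regular_point_def)
  qed
  moreover have "\<Omega>' (M *v p) \<noteq> 0"
  proof
    assume "\<Omega>' (M *v p) = 0"
    then have "c * pair (\<Omega> p) v = 0" for v unfolding conj[symmetric] by (simp add: pair_3)
    then have "\<forall>v. pair (\<Omega> p) v = 0" using c by simp
    then have "\<Omega> p = 0" using pair_eq_0_iff by blast
    then show False using assms by (simp add: regular_point_def)
  qed
  ultimately show ?thesis by (simp add: regular_point_def)
qed

lemma leaf_transport:
  assumes "q \<in> leaf \<Omega> p"
  shows "M *v q \<in> leaf \<Omega>' (M *v p)"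
proof -
  obtain g where g: "valid_path g" "pathstart g = p" "pathfinish g = q"
    "\<And>t. t \<in> {0..1} \<Longrightarrow> regular_point \<Omega> (g t)"
    "\<And>t v. t \<in> {0..1} \<Longrightarrow> (g has_vector_derivative v) (at t within {0..1}) \<Longrightarrow> pair (\<Omega> (g t)) v = 0"
    using assms unfolding leaf_def by blast
  let ?h = "\<lambda>t. M *v g t"
  have "valid_path ?h"
  proof -
    obtain S D where S: "continuous_on {0..1} g" "finite S"
      "\<And>x. x \<in> {0..1} - S \<Longrightarrow> (g has_vector_derivative D x) (at x)" "continuous_on ({0..1} - S) D"
      using g(1) unfolding valid_path_def piecewise_C1_differentiable_on_def C1_differentiable_on_def by blast
    have "continuous_on {0..1} ?h" "continuous_on ({0..1} - S) (\<lambda>x. M *v D x)"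
      using bounded_linear.continuous_on[OF bounded_linear_matrix] S(1,4) by blast+
    moreover have "\<forall>x\<in>{0..1} - S. (?h has_vector_derivative M *v D x) (at x)"
      using bounded_linear.has_vector_derivative[OF bounded_linear_matrix S(3)] by blast
    ultimately show ?thesis
      using S(2) unfolding valid_path_def piecewise_C1_differentiable_on_def C1_differentiable_on_def
      by (intro conjI exI[of _ S] exI[of _ "\<lambda>x. M *v D x"])
  qed
  moreover have "pathstart ?h = M *v p" "pathfinish ?h = M *v q"
    using g(2,3) by (simp_all add: pathstart_def pathfinish_def)
  moreover have "pair (\<Omega>' (?h t)) v = 0" if "t \<in> {0..1}" "(?h has_vector_derivative v) (at t within {0..1})" for t v
  proof -
    have "((\<lambda>t. N *v ?h t) has_vector_derivative N *v v) (at t within {0..1})"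
      using bounded_linear.has_vector_derivative[OF bounded_linear_matrix that(2)] .
    then have "pair (\<Omega> (g t)) (N *v v) = 0" using g(5)[OF that(1)] by (simp add: MN)
    then show ?thesis using conj[of "g t" "N *v v"] by (simp add: MN)
  qed
  ultimately show ?thesis
    unfolding leaf_def mem_Collect_eq using regular_transport[OF g(4)]
    by (intro exI[of _ ?h] conjI ballI allI impI)
qed

text \<open>Dual coordinates move by the transpose of the inverse matrix.\<close>

lemma line_transport:
  assumes "in_straight_line S"
  shows "in_straight_line ((\<lambda>p. M *v p) ` S)"
proof -
  obtain l where l: "l \<noteq> 0" "\<And>q. q \<in> S \<Longrightarrow> pair l q = 0" using assms unfolding in_straight_line_def by blast
  have "transpose N *v l \<noteq> 0"
  proof
    assume "transpose N *v l = 0"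
    then have "pair l (N *v u) = 0" for u unfolding pair_transpose[symmetric] by (simp add: pair_3)
    then have "pair l u = 0" for u by (metis MN(2))
    then show False using pair_eq_0_iff l(1) by blast
  qed
  moreover have "pair (transpose N *v l) (M *v q) = 0" if "q \<in> S" for q
    unfolding pair_transpose MN using l(2)[OF that] .
  ultimately show ?thesis unfolding in_straight_line_def by blast
qed

text \<open>Pairing the image line with the image curve gives the same function of t as before, so
  the order of contact is unchanged.\<close>

lemma inflection_transport:
  assumes "inflection_point \<Omega> q"
  shows "inflection_point \<Omega>' (M *v q)"
proof -
  obtain \<gamma> l where reg: "regular_point \<Omega> q" and par: "leaf_param \<Omega> q \<gamma>" and l: "l \<noteq> 0"
    "\<And>k. k < 3 \<Longrightarrow> (deriv ^^ k) (\<lambda>t. pair l (\<gamma> t)) 0 = 0"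
    using assms unfolding inflection_point_def by blast
  obtain r where r: "r > 0" "\<And>i. (\<lambda>t. \<gamma> t $ i) holomorphic_on ball 0 r"
    "\<And>t. t \<in> ball 0 r \<Longrightarrow> pair (\<Omega> (\<gamma> t)) (deriv_vec \<gamma> t) = 0" and g0: "\<gamma> 0 = q" and ind: "indep (\<gamma> 0) (deriv_vec \<gamma> 0)"
    using par unfolding leaf_param_def by blast
  let ?h = "\<lambda>t. M *v \<gamma> t"
  have comp: "?h t $ i = M $ i $ 1 * \<gamma> t $ 1 + M $ i $ 2 * \<gamma> t $ 2 + M $ i $ 3 * \<gamma> t $ 3" for t i
    by (simp add: matrix_vector_mult_def sum_3)
  have hol: "(\<lambda>t. ?h t $ i) holomorphic_on ball 0 r" for i
    unfolding comp by (intro holomorphic_intros r(2))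
  have dv: "deriv_vec ?h t = M *v deriv_vec \<gamma> t" if t: "t \<in> ball 0 r" for t
  proof -
    have d: "((\<lambda>u. \<gamma> u $ i) has_field_derivative deriv (\<lambda>u. \<gamma> u $ i) t) (at t)" for i
      using holomorphic_derivI[OF r(2) open_ball t] .
    have "deriv (\<lambda>u. ?h u $ i) t = M $ i $ 1 * deriv (\<lambda>u. \<gamma> u $ 1) t + M $ i $ 2 * deriv (\<lambda>u. \<gamma> u $ 2) t + M $ i $ 3 * deriv (\<lambda>u. \<gamma> u $ 3) t" for i
      unfolding comp by (rule DERIV_imp_deriv) (intro derivative_intros DERIV_cmult d)
    then show ?thesis by (simp add: vec_eq_iff deriv_vec_def matrix_vector_mult_def sum_3)
  qed
  have "indep (?h 0) (deriv_vec ?h 0)"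
    unfolding indep_def
  proof (intro allI impI)
    fix a b assume "a *s ?h 0 + b *s deriv_vec ?h 0 = 0"
    then have "M *v (a *s \<gamma> 0 + b *s deriv_vec \<gamma> 0) = 0"
      using dv[of 0] r(1) by (simp add: matrix_vector_simps)
    then have "N *v (M *v (a *s \<gamma> 0 + b *s deriv_vec \<gamma> 0)) = 0" by simp
    then show "a = 0 \<and> b = 0" using ind unfolding indep_def MN by blast
  qed
  moreover have "pair (\<Omega>' (?h t)) (deriv_vec ?h t) = 0" if "t \<in> ball 0 r" for t
    unfolding dv[OF that] conj using r(3)[OF that] by simp
  ultimately have "leaf_param \<Omega>' (M *v q) ?h"
    unfolding leaf_param_def using g0 r(1) hol by blast
  moreover have "pair (transpose N *v l) (?h t) = pair l (\<gamma> t)" for t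
    unfolding pair_transpose MN ..
  moreover have "transpose N *v l \<noteq> 0"
  proof
    assume "transpose N *v l = 0"
    then have "pair l (N *v u) = 0" for u unfolding pair_transpose[symmetric] by (simp add: pair_3)
    then have "pair l u = 0" for u by (metis MN(2))
    then show False using pair_eq_0_iff l(1) by blast
  qed
  ultimately show ?thesis
    unfolding inflection_point_def using regular_transport[OF reg] l(2) by (intro conjI exI[of _ ?h] exI[of _ "transpose N *v l"]) simp_all
qed

end

lemma conj_formsE:
  assumes "conjugate \<Omega> \<Omega>'"
  obtains M N c where "conj_forms \<Omega> \<Omega>' M N c" "conj_forms \<Omega>' \<Omega> N M (1 / c)"
proof -
  obtain M c where M: "invertible M" "c \<noteq> 0" "\<And>p v. pair (\<Omega>' (M *v p)) (M *v v) = c * pair (\<Omega> p) v"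
    using assms unfolding conjugate_def by blast
  obtain N where N: "\<And>p. M *v (N *v p) = p" "\<And>p. N *v (M *v p) = p" using invertible_obtain[OF M(1)] by metis
  have "pair (\<Omega> (N *v p)) (N *v v) = 1 / c * pair (\<Omega>' p) v" for p v
    using M(3)[of "N *v p" "N *v v"] M(2) unfolding N by simp
  then show thesis using that M(2,3) N unfolding conj_forms_def by (metis divide_eq_0_iff zero_neq_one)
qed

lemma convex_conjugate:
  assumes "conjugate \<Omega> \<Omega>'" "convex_foliation \<Omega>" "foliation \<Omega>'"
  shows "convex_foliation \<Omega>'"
proof -
  obtain M N c where MN: "conj_forms \<Omega> \<Omega>' M N c" and NM: "conj_forms \<Omega>' \<Omega> N M (1 / c)"
    using conj_formsE[OF assms(1)] by blast
  interpret A: conj_forms \<Omega> \<Omega>' M N c by (rule MN)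
  interpret B: conj_forms \<Omega>' \<Omega> N M "1 / c" by (rule NM)
  show ?thesis
    unfolding convex_foliation_def
  proof (intro conjI allI impI ballI notI assms(3))
    fix p q assume p: "regular_point \<Omega>' p \<and> \<not> in_straight_line (leaf \<Omega>' p)" and q: "q \<in> leaf \<Omega>' p" "inflection_point \<Omega>' q"
    have "\<not> in_straight_line (leaf \<Omega> (N *v p))"
    proof
      assume "in_straight_line (leaf \<Omega> (N *v p))"
      then have "in_straight_line ((\<lambda>p. M *v p) ` leaf \<Omega> (N *v p))" by (rule A.line_transport)
      moreover have "leaf \<Omega>' p \<subseteq> (\<lambda>p. M *v p) ` leaf \<Omega> (N *v p)"
      proof
        fix x assume "x \<in> leaf \<Omega>' p"
        then have "N *v x \<in> leaf \<Omega> (N *v p)" by (rule B.leaf_transport)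
        then show "x \<in> (\<lambda>p. M *v p) ` leaf \<Omega> (N *v p)" using A.MN(1)[of x] by (metis imageI)
      qed
      ultimately have "in_straight_line (leaf \<Omega>' p)" unfolding in_straight_line_def by blast
      then show False using p by blast
    qed
    moreover have "regular_point \<Omega> (N *v p)" using B.regular_transport p by blast
    moreover have "N *v q \<in> leaf \<Omega> (N *v p)" "inflection_point \<Omega> (N *v q)"
      using B.leaf_transport[OF q(1)] B.inflection_transport[OF q(2)] by blast+
    ultimately show False using assms(2) unfolding convex_foliation_def by blast
  qed
qed

section \<open>Critical directions of convex foliations\<close>

lemma poly_eq_0_on_ball:
  fixes p :: "complex poly"
  assumes "r > 0" "\<And>t. t \<in> ball 0 r \<Longrightarrow> poly p t = 0"
  shows "p = 0"
proof (rule ccontr)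
  assume "p \<noteq> 0"
  then have "finite {t. poly p t = 0}" by (rule poly_roots_finite)
  then have "finite (ball (0 :: complex) r)" by (rule rev_finite_subset) (use assms(2) in blast)
  then have "ball (0 :: complex) r = {}" using finite_imp_not_open open_ball by blast
  then show False using assms(1) by simp
qed

lemma bounded_linear_smult: "bounded_linear (\<lambda>z. z *s (v :: complex^3))"
proof -
  have "linear (\<lambda>z. z *s v)"
    by (rule linearI) (simp_all add: vec_eq_iff algebra_simps)
  then show ?thesis by (simp add: linear_conv_bounded_linear)
qed

lemma primitive_ball:
  assumes "f holomorphic_on ball z r"
  obtains g where "\<And>t. t \<in> ball z r \<Longrightarrow> (g has_field_derivative f t) (at t)" "g z = (0 :: complex)"
proof -
  obtain g where g: "\<And>t. t \<in> ball z r \<Longrightarrow> (g has_field_derivative f t) (at t within ball z r)"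
    using holomorphic_convex_primitive'[OF convex_ball open_ball assms(1)] by blast
  have "((\<lambda>t. g t - g z) has_field_derivative f t) (at t)" if t: "t \<in> ball z r" for t
  proof -
    have "(g has_field_derivative f t) (at t)" using g[OF t] at_within_open[OF t open_ball] by simp
    then have "((\<lambda>t. g t - g z) has_field_derivative (f t - 0)) (at t)" by (intro derivative_intros)
    then show ?thesis by simp
  qed
  then show thesis using that[of "\<lambda>t. g t - g z"] by simp
qed

lemma nonzero_ball:
  assumes "poly p z \<noteq> (0 :: complex)"
  obtains r where "r > 0" "\<And>t. t \<in> ball z r \<Longrightarrow> poly p t \<noteq> 0"
proof -
  have "continuous (at z) (poly p)" by simp
  from continuous_at_avoid[OF this assms] show thesis using that by (auto simp: ball_def)
qed

lemma tangent_slope_aux: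
  fixes m1 m2 a b X c :: complex
  assumes "m1 * - (X * b / c) + m2 * (X * a / c) + 0 = 0" "X \<noteq> 0" "c \<noteq> 0"
  shows "- m2 * a + m1 * b = 0"
proof -
  have "m1 * - (X * b / c) + m2 * (X * a / c) + 0 = X / c * (m2 * a - m1 * b)"
    using assms(3) by (simp add: field_simps)
  then have "m2 * a - m1 * b = 0" using assms by simp
  then show ?thesis by algebra
qed

text \<open>If the critical direction were not fixed, the leaf through (1, 0, 1) would be
  parametrised by the slope t as (X(t), t X(t), 1). This curve has an inflection at t = 0 and lies
  in no line, which contradicts convexity.\<close>

lemma convex_crit_at_0:
  assumes w: "hform w" and conv: "convex_foliation (hom_form w)" and cr: "crit w (1, 0)"
  shows "tang w (1, 0) = 0"
proof (rule ccontr)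
  assume nf: "tang w (1, 0) \<noteq> 0"
  obtain a b where ab: "fst w = homog 5 a" "snd w = homog 5 b" "degree a \<le> 5" "degree b \<le> 5"
    using hform_obtain[OF w] .
  define c where "c = a + [:0, 1:] * b"
  have ct: "poly c t = poly a t + t * poly b t" for t by (simp add: c_def)
  have "poly c 0 \<noteq> 0" using nf ab by (simp add: ct tang_def homog_one_left)
  then obtain r where r: "r > 0" "\<And>t. t \<in> ball 0 r \<Longrightarrow> poly c t \<noteq> 0" using nonzero_ball by blast
  obtain l n h where ln: "l \<noteq> 0 \<or> n \<noteq> 0" and h: "bform 3 h" and e: "\<And>x y. l * fst w x y + n * snd w x y = (0 * x - 1 * y) ^ 2 * h x y"
    using cr unfolding crit_def fst_conv snd_conv by blast
  obtain q where q: "degree q \<le> 3" "h = homog 3 q" using h unfolding bform_def by blast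
  have lnq: "l * poly a t + n * poly b t = t ^ 2 * poly q t" for t
    using e[of 1 t] ab q by (simp add: homog_one_left)
  have "(\<lambda>t. poly b t / poly c t) holomorphic_on ball 0 r"
    using r(2) by (intro holomorphic_intros) auto
  then obtain \<Phi> where \<Phi>: "\<And>t. t \<in> ball 0 r \<Longrightarrow> (\<Phi> has_field_derivative poly b t / poly c t) (at t)" "\<Phi> 0 = 0"
    using primitive_ball by blast
  \<comment> \<open>Substituting y = t x into A dx + B dy = 0 gives dx / x = - (b / c) dt.\<close>
  define X where "X t = exp (- \<Phi> t)" for t
  have X0: "X t \<noteq> 0" "X 0 = 1" for t by (simp_all add: X_def \<Phi>)
  have dX: "(X has_field_derivative - (X t * poly b t / poly c t)) (at t)" if "t \<in> ball 0 r" for t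
    unfolding X_def by (rule derivative_eq_intros \<Phi>(1)[OF that] refl)+ simp
  have dY: "((\<lambda>t. t * X t) has_field_derivative X t * poly a t / poly c t) (at t)" if t: "t \<in> ball 0 r" for t
  proof -
    have "((\<lambda>t. t * X t) has_field_derivative 1 * X t + - (X t * poly b t / poly c t) * t) (at t)"
      by (rule DERIV_mult[OF DERIV_ident dX[OF t]])
    moreover have "1 * X t + - (X t * poly b t / poly c t) * t = X t * poly a t / poly c t"
    proof -
      have "X t * poly c t - X t * poly b t * t = X t * poly a t" unfolding ct by algebra
      moreover have "1 * X t + - (X t * poly b t / poly c t) * t = (X t * poly c t - X t * poly b t * t) / poly c t"
        using r(2)[OF t] by (simp add: field_simps)
      ultimately show ?thesis by simp
    qed
    ultimately show ?thesis by simp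
  qed
  have hX: "X holomorphic_on ball 0 r"
    using dX by (intro holomorphic_onI) (meson field_differentiable_at_within field_differentiable_def)
  define \<gamma> :: "complex \<Rightarrow> complex^3" where "\<gamma> t = vector [X t, t * X t, 1]" for t
  have \<gamma>: "\<gamma> t $ 1 = X t" "\<gamma> t $ 2 = t * X t" "\<gamma> t $ 3 = 1" for t by (simp_all add: \<gamma>_def)
  define \<delta> :: "complex \<Rightarrow> complex^3" where "\<delta> t = vector [- (X t * poly b t / poly c t), X t * poly a t / poly c t, 0]" for t
  have \<delta>: "\<delta> t $ 1 = - (X t * poly b t / poly c t)" "\<delta> t $ 2 = X t * poly a t / poly c t" "\<delta> t $ 3 = 0" for t by (simp_all add: \<delta>_def)
  have A: "fst w (X t) (t * X t) = X t ^ 5 * poly a t" "snd w (X t) (t * X t) = X t ^ 5 * poly b t" for t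
    using ab X0 by (simp_all add: homog_nonzero_left)
  have tan: "pair (hom_form w (\<gamma> t)) (\<delta> t) = 0" for t
    unfolding pair_hom_form \<gamma> \<delta> A by (simp add: field_simps)
  have reg: "regular_point (hom_form w) (\<gamma> t)" for t
  proof -
    have "\<gamma> t \<noteq> 0" using \<gamma>(3)[of t] by (metis zero_index zero_neq_one)
    moreover have "hom_form w (\<gamma> t) \<noteq> 0" unfolding hom_form_eq_0[OF w] \<gamma> using X0 by simp
    ultimately show ?thesis by (simp add: regular_point_def)
  qed
  have dv: "deriv_vec \<gamma> t = \<delta> t" if t: "t \<in> ball 0 r" for t
  proof -
    have "deriv (\<lambda>u. \<gamma> u $ 1) t = \<delta> t $ 1" "deriv (\<lambda>u. \<gamma> u $ 2) t = \<delta> t $ 2" "deriv (\<lambda>u. \<gamma> u $ 3) t = \<delta> t $ 3"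
      unfolding \<gamma> \<delta> using DERIV_imp_deriv[OF dX[OF t]] DERIV_imp_deriv[OF dY[OF t]] by simp_all
    then show ?thesis by (simp add: deriv_vec_def vec_eq_iff forall_3)
  qed
  \<comment> \<open>The path s -> \<open>\<gamma>\<close> (s t1) stays in the disc and joins the two
    points inside the leaf.\<close>
  have in_leaf: "\<gamma> t1 \<in> leaf (hom_form w) (\<gamma> 0)" if t1: "t1 \<in> ball 0 r" for t1
  proof -
    define g where "g s = \<gamma> (of_real s * t1)" for s :: real
    have ball: "of_real s * t1 \<in> ball 0 r" if "s \<in> {0..1}" for s :: real
    proof -
      have "norm (of_real s * t1) \<le> 1 * norm t1"
        unfolding norm_mult using that by (intro mult_right_mono) auto
      then show ?thesis using t1 by simp
    qed
    have gsum: "g = (\<lambda>s. X (of_real s * t1) *s vector [1, 0, 0] + ((of_real s * t1 * X (of_real s * t1)) *s vector [0, 1, 0] + vector [0, 0, 1]))"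
      by (intro ext) (simp add: g_def vec_eq_iff forall_3 \<gamma>)
    have ds: "((\<lambda>s. of_real s * t1) has_vector_derivative t1) (at s)" for s :: real
    proof -
      have "((\<lambda>s. of_real s * t1) has_vector_derivative of_real s * 0 + of_real 1 * t1) (at s)"
        by (intro derivative_intros) 
      then show ?thesis by simp
    qed
    have dg: "(g has_vector_derivative t1 *s \<delta> (of_real s * t1)) (at s)" if s: "s \<in> {0..1}" for s
    proof -
      have "((\<lambda>s. X (of_real s * t1)) has_vector_derivative t1 * \<delta> (of_real s * t1) $ 1) (at s)"
        "((\<lambda>s. of_real s * t1 * X (of_real s * t1)) has_vector_derivative t1 * \<delta> (of_real s * t1) $ 2) (at s)"
        using field_vector_diff_chain_at[OF ds dX[OF ball[OF s]]] field_vector_diff_chain_at[OF ds dY[OF ball[OF s]]]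
        unfolding comp_def \<delta> by simp_all
      note this[THEN bounded_linear.has_vector_derivative[OF bounded_linear_smult]]
      then have "(g has_vector_derivative (t1 * \<delta> (of_real s * t1) $ 1) *s vector [1, 0, 0] + ((t1 * \<delta> (of_real s * t1) $ 2) *s vector [0, 1, 0] + 0)) (at s)"
        unfolding gsum by (intro has_vector_derivative_add has_vector_derivative_const)
      moreover have "(t1 * \<delta> u $ 1) *s vector [1, 0, 0] + ((t1 * \<delta> u $ 2) *s vector [0, 1, 0] + 0) = t1 *s \<delta> u" for u
        by (simp add: vec_eq_iff forall_3 \<delta>)
      ultimately show ?thesis by simp
    qed
    have cX: "continuous_on {0..1} (\<lambda>s. X (of_real s * t1))"
    proof (rule continuous_at_imp_continuous_on, rule ballI)
      fix s :: real assume s: "s \<in> {0..1}"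
      show "isCont (\<lambda>s. X (of_real s * t1)) s"
        using field_vector_diff_chain_at[OF ds dX[OF ball[OF s]]] unfolding comp_def by (rule has_vector_derivative_continuous)
    qed
    have "continuous_on {0..1} (\<lambda>s. t1 *s \<delta> (of_real s * t1))"
    proof -
      have "t1 *s \<delta> u = (t1 * \<delta> u $ 1) *s vector [1, 0, 0] + (t1 * \<delta> u $ 2) *s vector [0, 1, 0]" for u
        by (simp add: vec_eq_iff forall_3 \<delta>(3))
      then have eq: "(\<lambda>s. t1 *s \<delta> (of_real s * t1)) =
          (\<lambda>s. (t1 * \<delta> (of_real s * t1) $ 1) *s vector [1, 0, 0] + (t1 * \<delta> (of_real s * t1) $ 2) *s vector [0, 1, 0])"
        by (rule ext)
      have cp: "continuous_on {0..1} (\<lambda>s. poly p (of_real s * t1))" for p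
        by (intro continuous_on_poly continuous_on_mult continuous_on_of_real continuous_on_id continuous_on_const)
      have "continuous_on {0..1} (\<lambda>s. t1 * \<delta> (of_real s * t1) $ 1)" "continuous_on {0..1} (\<lambda>s. t1 * \<delta> (of_real s * t1) $ 2)"
        unfolding \<delta>
        by (intro continuous_on_mult continuous_on_const continuous_on_minus continuous_on_divide cX cp ballI r(2)[OF ball], assumption)+
      note this[THEN bounded_linear.continuous_on[OF bounded_linear_smult]]
      then show ?thesis unfolding eq by (intro continuous_on_add)
    qed
    then have "g C1_differentiable_on {0..1}"
      unfolding C1_differentiable_on_def
      by (intro exI[of _ "\<lambda>s. t1 *s \<delta> (of_real s * t1)"] conjI ballI dg)
    then have "valid_path g" unfolding valid_path_def by (rule C1_differentiable_imp_piecewise)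
    moreover have "pathstart g = \<gamma> 0" "pathfinish g = \<gamma> t1" by (simp_all add: pathstart_def pathfinish_def g_def)
    moreover have "pair (hom_form w (g s)) v = 0" if s: "s \<in> {0..1}" and v: "(g has_vector_derivative v) (at s within {0..1})" for s v
    proof -
      have "v = t1 *s \<delta> (of_real s * t1)"
        by (rule vector_derivative_unique_within_closed_interval[unfolded cbox_interval, OF _ _ v has_vector_derivative_at_within[OF dg[OF s]]])
          (use s in simp_all)
      moreover have "pair (hom_form w (g s)) (t1 *s \<delta> (of_real s * t1)) = t1 * pair (hom_form w (g s)) (\<delta> (of_real s * t1))"
        by (simp add: pair_3 algebra_simps)
      ultimately show ?thesis unfolding g_def tan by simp
    qed
    ultimately show ?thesis
      unfolding leaf_def mem_Collect_eq by (intro exI[of _ g] conjI ballI allI impI) (simp_all only: g_def reg)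
  qed
  \<comment> \<open>The tangent line at (1, 0, 1), built from the pencil member l a + n b: along the
    curve the derivative of its equation is a multiple of that member, which has a double zero at
    0.\<close>
  define l' :: "complex^3" where "l' = vector [n, - l, - n]"
  have infl: "inflection_point (hom_form w) (\<gamma> 0)"
    unfolding inflection_point_def
  proof (intro conjI exI allI impI)
    show "regular_point (hom_form w) (\<gamma> 0)" by (rule reg)
    show "leaf_param (hom_form w) (\<gamma> 0) \<gamma>"
      unfolding leaf_param_def
    proof (intro conjI exI allI ballI)
      show "indep (\<gamma> 0) (deriv_vec \<gamma> 0)"
        unfolding indep_def
      proof (intro allI impI)
        fix x y assume *: "x *s \<gamma> 0 + y *s deriv_vec \<gamma> 0 = 0"
        have d0: "deriv_vec \<gamma> 0 = \<delta> 0" using r(1) by (intro dv) simp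
        have "(x *s \<gamma> 0 + y *s \<delta> 0) $ 3 = 0" "(x *s \<gamma> 0 + y *s \<delta> 0) $ 2 = 0"
          using *[unfolded d0] by simp_all
        then have "x = 0" "y * (poly a 0 / poly c 0) = 0" by (simp_all add: \<gamma> \<delta> X0)
        moreover have "poly a 0 = poly c 0" by (simp add: ct)
        ultimately show "x = 0 \<and> y = 0" using \<open>poly c 0 \<noteq> 0\<close> by simp_all
      qed
      show "0 < r" by (rule r(1))
      show "(\<lambda>t. \<gamma> t $ i) holomorphic_on ball 0 r" for i
      proof -
        have "\<forall>i. (\<lambda>t. \<gamma> t $ i) holomorphic_on ball 0 r"
          unfolding forall_3 \<gamma> by (intro conjI hX holomorphic_intros)
        then show ?thesis by blast
      qed
      show "pair (hom_form w (\<gamma> t)) (deriv_vec \<gamma> t) = 0" if "t \<in> ball 0 r" for t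
        unfolding dv[OF that] by (rule tan)
    qed simp
    show "l' \<noteq> 0" using ln by (auto simp: l'_def vec_eq_iff forall_3)
    fix k :: nat assume "k < 3"
    define f where "f = (\<lambda>t. pair l' (\<gamma> t))"
    have f: "f t = n * X t - l * (t * X t) - n" for t
      by (simp add: f_def pair_3 \<gamma> l'_def)
    define K where "K t = - (X t / poly c t * poly q t)" for t
    have df: "(f has_field_derivative t * (t * K t)) (at t)" if t: "t \<in> ball 0 r" for t
    proof -
      have "(f has_field_derivative n * - (X t * poly b t / poly c t) - l * (X t * poly a t / poly c t) - 0) (at t)"
        unfolding f by (intro derivative_intros DERIV_cmult dX[OF t] dY[OF t])
      moreover have "n * - (X t * poly b t / poly c t) - l * (X t * poly a t / poly c t) - 0 = - (X t / poly c t * (l * poly a t + n * poly b t))"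
        using r(2)[OF t] by (simp add: field_simps)
      moreover have "- (X t / poly c t * (t ^ 2 * poly q t)) = t * (t * K t)" unfolding K_def by algebra
      ultimately show ?thesis unfolding lnq by simp
    qed
    have ddf: "(deriv f has_field_derivative 0) (at 0)"
    proof (rule has_field_derivative_transform_within_open[OF _ open_ball])
      have "K holomorphic_on ball 0 r"
      proof -
        show ?thesis unfolding K_def using r(2) by (intro holomorphic_intros hX) auto
      qed
      then have "(K has_field_derivative deriv K 0) (at 0)" using r(1) by (intro holomorphic_derivI) auto
      then have "((\<lambda>t. t * (t * K t)) has_field_derivative 1 * (0 * K 0) + (1 * K 0 + deriv K 0 * 0) * 0) (at 0)"
        by (intro DERIV_mult DERIV_ident)
      then show "((\<lambda>t. t * (t * K t)) has_field_derivative 0) (at 0)" by simp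
      show "0 \<in> ball (0 :: complex) r" using r(1) by simp
      show "t * (t * K t) = deriv f t" if "t \<in> ball 0 r" for t
        using DERIV_imp_deriv[OF df[OF that]] by simp
    qed
    have "f 0 = 0" by (simp add: f X0)
    moreover have "deriv f 0 = 0" using DERIV_imp_deriv[OF df[of 0]] r(1) by simp
    moreover have "deriv (deriv f) 0 = 0" using DERIV_imp_deriv[OF ddf] .
    moreover have "k = 0 \<or> k = 1 \<or> k = 2" using \<open>k < 3\<close> by auto
    ultimately have "(deriv ^^ k) f 0 = 0" by (auto simp: numeral_2_eq_2)
    then show "(deriv ^^ k) (\<lambda>t. pair l' (\<gamma> t)) 0 = 0" unfolding f_def .
  qed
  \<comment> \<open>Differentiating a linear equation satisfied by the curve gives a linear relation
    between a and b.\<close>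
  have "\<not> in_straight_line (leaf (hom_form w) (\<gamma> 0))"
  proof
    assume "in_straight_line (leaf (hom_form w) (\<gamma> 0))"
    then obtain m where m: "m \<noteq> 0" "\<And>p. p \<in> leaf (hom_form w) (\<gamma> 0) \<Longrightarrow> pair m p = 0"
      unfolding in_straight_line_def by blast
    have z: "m $ 1 * X t + m $ 2 * (t * X t) + m $ 3 = 0" if "t \<in> ball 0 r" for t
      using m(2)[OF in_leaf[OF that]] by (simp add: pair_3 \<gamma>)
    have "smult (- m $ 2) a + smult (m $ 1) b = 0"
    proof (rule poly_eq_0_on_ball[OF r(1)])
      fix t assume t: "t \<in> ball (0 :: complex) r"
      have "((\<lambda>t. m $ 1 * X t + m $ 2 * (t * X t) + m $ 3) has_field_derivative m $ 1 * - (X t * poly b t / poly c t) + m $ 2 * (X t * poly a t / poly c t) + 0) (at t)"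
        by (intro DERIV_add DERIV_const DERIV_cmult dX[OF t] dY[OF t])
      moreover have "((\<lambda>t. m $ 1 * X t + m $ 2 * (t * X t) + m $ 3) has_field_derivative 0) (at t)"
        by (rule has_field_derivative_transform_within_open[OF DERIV_const[of 0] open_ball t]) (rule z[symmetric])
      ultimately have "m $ 1 * - (X t * poly b t / poly c t) + m $ 2 * (X t * poly a t / poly c t) + 0 = 0"
        by (rule DERIV_unique)
      then have "- m $ 2 * poly a t + m $ 1 * poly b t = 0" using X0(1) r(2)[OF t] by (rule tangent_slope_aux)
      then show "poly (smult (- m $ 2) a + smult (m $ 1) b) t = 0" by (simp only: poly_add poly_smult)
    qed
    then have "- m $ 2 * fst w x y + m $ 1 * snd w x y = 0" for x y
      unfolding ab homog_smult[symmetric] homog_add[symmetric] by simp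
    from hform_not_proportional[OF w this] have m0: "m $ 1 = 0" "m $ 2 = 0" by auto
    then have "m $ 3 = 0" using z[of 0] r(1) by simp
    then show False using m(1) m0 by (simp add: vec_eq_iff forall_3)
  qed
  moreover have "\<gamma> 0 \<in> leaf (hom_form w) (\<gamma> 0)" using in_leaf[of 0] r(1) by simp
  ultimately show False using conv reg[of 0] infl unfolding convex_foliation_def by blast
qed

lemma det_complete:
  assumes "v \<noteq> (0, 0)"
  obtains q s where "fst v * s - q * snd v \<noteq> (0 :: complex)"
proof (cases "fst v = 0")
  case True
  then have "snd v \<noteq> 0" using assms by (auto simp: prod_eq_iff)
  then show thesis using that[of 0 1] by simp
next
  case False
  then show thesis using that[of 1 0] by simp
qed

theorem convex_crit_fixed:
  assumes w: "hform w" and conv: "convex_foliation (hom_form w)" and v: "v \<noteq> (0, 0)" "crit w v"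
  shows "tang w v = 0"
proof -
  obtain q s where d: "fst v * s - q * snd v \<noteq> 0" using det_complete[OF v(1)] .
  obtain w1 where P: "pulls (fst v) q (snd v) s 1 w w1" using pulls_exists[OF d] by blast
  have w1: "hform w1" by (rule hform_pulls[OF P w])
  have "lconj w1 w" using P lconj_def by blast
  then have "conjugate (hom_form w) (hom_form w1)" using lconj_conjugate conjugate_sym by blast
  then have "convex_foliation (hom_form w1)" using conv foliation_hom_form[OF w1] by (rule convex_conjugate)
  moreover have "crit w1 (1, 0)" using crit_pulls[OF P, of 1 0] v(2) by simp
  ultimately have "tang w1 (1, 0) = 0" by (rule convex_crit_at_0[OF w1])
  then show ?thesis using tang_pulls[OF P, of "(1, 0)"] by simp
qed

section \<open>Local first integrals\<close>

text \<open>The zero set is closed by continuity and open by the local hypothesis, and the interval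
  is connected.\<close>

lemma zero_set_interval:
  fixes Z :: "real \<Rightarrow> complex"
  assumes cont: "continuous_on {0..1} Z" and t1: "t1 \<in> {0..1}" "Z t1 = 0"
    and loc: "\<And>t0. t0 \<in> {0..1} \<Longrightarrow> Z t0 = 0 \<Longrightarrow> \<exists>\<delta>>0. \<forall>s\<in>{0..1}. dist s t0 < \<delta> \<longrightarrow> Z s = 0"
    and t: "t \<in> {0..1}"
  shows "Z t = 0"
proof -
  define K where "K = {s \<in> {0..1}. Z s = 0}"
  have "closedin (top_of_set {0..1}) K"
    unfolding K_def by (rule continuous_closedin_preimage_constant[OF cont])
  moreover have "openin (top_of_set {0..1}) K"
    unfolding openin_euclidean_subtopology_iff
  proof (intro conjI ballI)
    show "K \<subseteq> {0..1}" unfolding K_def by blast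
    fix s assume s: "s \<in> K"
    then have "s \<in> {0..1}" "Z s = 0" unfolding K_def by blast+
    from loc[OF this] obtain \<delta> where "\<delta> > 0" "\<forall>s'\<in>{0..1}. dist s' s < \<delta> \<longrightarrow> Z s' = 0" by blast
    then show "\<exists>e>0. \<forall>x'\<in>{0..1}. dist x' s < e \<longrightarrow> x' \<in> K" unfolding K_def by blast
  qed
  moreover have "connected {0..1 :: real}" by simp
  ultimately have "K = {} \<or> K = {0..1}" unfolding connected_clopen by blast
  moreover have "t1 \<in> K" unfolding K_def using t1 by blast
  ultimately have "t \<in> K" using t by blast
  then show ?thesis unfolding K_def by blast
qed

text \<open>S is the finite set of corners of a piecewise smooth path: the derivative is only known
  off S, and continuity bridges the gaps.\<close>

lemma locally_constant_zero:
  fixes J :: "real \<Rightarrow> complex"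
  assumes S: "finite S" and t0: "t0 \<in> {0..1}" "J t0 = 0"
    and cont: "\<And>s. s \<in> {0..1} \<Longrightarrow> dist s t0 < \<delta> \<Longrightarrow> (J \<longlongrightarrow> J s) (at s within {0..1})"
    and der: "\<And>s. s \<in> {0..1} - S \<Longrightarrow> dist s t0 < \<delta> \<Longrightarrow> (J has_vector_derivative 0) (at s)"
    and s: "s \<in> {0..1}" "dist s t0 < \<delta>"
  shows "J s = 0"
proof -
  define I where "I = {min s t0..max s t0}"
  have I: "u \<in> {0..1}" "dist u t0 < \<delta>" if "u \<in> I" for u
    using that s t0 unfolding I_def by (cases "s \<le> t0"; force simp: dist_real_def)+
  have c: "continuous_on {min s t0..max s t0} J"
    unfolding continuous_on_def
  proof (rule ballI)
    fix u assume "u \<in> {min s t0..max s t0}"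
    then have u: "u \<in> I" by (simp add: I_def)
    have "{min s t0..max s t0} \<subseteq> {0..1}" using I(1) unfolding I_def by blast
    then show "(J \<longlongrightarrow> J u) (at u within {min s t0..max s t0})"
      by (rule tendsto_within_subset[OF cont[OF I[OF u]]])
  qed
  have d: "(J has_derivative (\<lambda>h. 0)) (at u within {min s t0..max s t0})" if "u \<in> {min s t0..max s t0} - S" for u
  proof -
    have "u \<in> I" using that by (simp add: I_def)
    then have "(J has_vector_derivative 0) (at u)" using der[of u] I that by blast
    then show ?thesis unfolding has_vector_derivative_def scaleR_zero_right by (rule has_derivative_at_withinI)
  qed
  have e: "J u = J (min s t0)" if "u \<in> {min s t0..max s t0}" for u
    by (rule has_derivative_zero_unique_strong_interval[OF S c refl d that])
  show ?thesis by (rule trans[OF e[of s] trans[OF e[of t0, symmetric] t0(2)]]) simp_all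
qed

lemma quotient_rule_aux:
  fixes f f' g g' :: complex
  assumes "g \<noteq> 0"
  shows "f * (g' * - (inverse g ^ Suc (Suc 0))) + f' * inverse g = (f' * g - f * g') / (g * g)"
proof -
  define i where "i = inverse g"
  have i: "i * g = 1" using assms by (simp add: i_def)
  have "(f' * g - f * g') / (g * g) = (f' * g - f * g') * (i * i)" by (simp add: i_def divide_inverse)
  also have "\<dots> = f * (g' * - (i * i)) + f' * i" using i by algebra
  finally show ?thesis by (simp add: i_def)
qed
lemma has_vector_derivative_quotient:
  fixes f g :: "real \<Rightarrow> complex"
  assumes "(f has_vector_derivative f') (at s)" "(g has_vector_derivative g') (at s)" "g s \<noteq> 0"
  shows "((\<lambda>s. f s / g s) has_vector_derivative (f' * g s - f s * g') / (g s * g s)) (at s)"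
proof -
  have "(inverse has_field_derivative - (inverse (g s) ^ Suc (Suc 0))) (at (g s))"
    by (rule DERIV_inverse[OF assms(3)])
  from field_vector_diff_chain_at[OF assms(2) this]
  have "((\<lambda>s. inverse (g s)) has_vector_derivative g' * - (inverse (g s) ^ Suc (Suc 0))) (at s)"
    unfolding comp_def .
  from has_vector_derivative_mult[OF assms(1) this]
  have "((\<lambda>s. f s * inverse (g s)) has_vector_derivative f s * (g' * - (inverse (g s) ^ Suc (Suc 0))) + f' * inverse (g s)) (at s)" .
  moreover have "f s * (g' * - (inverse (g s) ^ Suc (Suc 0))) + f' * inverse (g s) = (f' * g s - f s * g') / (g s * g s)"
    by (rule quotient_rule_aux[OF assms(3)])
  ultimately show ?thesis by (simp only: divide_inverse)
qed

lemma has_vector_derivative_chain: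
  fixes f :: "real \<Rightarrow> complex"
  assumes "(g has_field_derivative g') (at (f s))" "(f has_vector_derivative f') (at s)"
  shows "((\<lambda>s. g (f s)) has_vector_derivative f' * g') (at s)"
  using field_vector_diff_chain_at[OF assms(2,1)] unfolding comp_def .

text \<open>In the coordinates t = Y / X and Z / X the tangency is the separated equation (Z / X)' /
  (Z / X) = (b / c)(t) t', stated here with denominators cleared.\<close>

lemma first_integral_aux:
  fixes X Y Z X' Y' Z' a b c t :: complex
  assumes "X \<noteq> 0" "Y = t * X" "a + t * b = c" "Z * (X ^ 5 * a * X' + X ^ 5 * b * Y') = X ^ 6 * c * Z'"
  shows "c * X * (Z' * X - Z * X') = Z * b * (Y' * X - Y * X')"
proof -
  have a: "a = c - t * b" using assms(3) by (simp add: eq_diff_eq)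
  have "X ^ 5 * (c * X * (Z' * X - Z * X') - Z * b * (Y' * X - (t * X) * X')) =
      X * (X ^ 6 * c * Z' - Z * (X ^ 5 * (c - t * b) * X' + X ^ 5 * b * Y'))" by algebra
  also have "\<dots> = 0" using assms(4) unfolding a by (simp only: diff_self mult_zero_right)
  finally show ?thesis unfolding assms(2) using assms(1) by simp
qed

text \<open>Tangency to \<open>hom_form w\<close> written in components at a point of
  differentiability. It is symmetric in the first two coordinates
  (\<open>tangent_along_swap\<close>), which makes both charts of the line at infinity
  available.\<close>

definition tangent_along :: "form2 \<Rightarrow> (real \<Rightarrow> complex) \<Rightarrow> (real \<Rightarrow> complex) \<Rightarrow> (real \<Rightarrow> complex) \<Rightarrow> real \<Rightarrow> bool" where
  "tangent_along w X Y Z s \<longleftrightarrow> (\<exists>X' Y' Z'. (X has_vector_derivative X') (at s) \<and> (Y has_vector_derivative Y') (at s) \<and>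
     (Z has_vector_derivative Z') (at s) \<and> Z s * (fst w (X s) (Y s) * X' + snd w (X s) (Y s) * Y') = tang w (X s, Y s) * Z')"

lemma tang_homog:
  assumes "fst w = homog 5 a" "snd w = homog 5 b" "degree a \<le> 5" "degree b \<le> 5" "x \<noteq> 0"
  shows "tang w (x, y) = x ^ 6 * poly (a + [:0, 1:] * b) (y / x)"
proof -
  have e: "homog 5 a x y = x ^ 5 * poly a (y / x)" "homog 5 b x y = x ^ 5 * poly b (y / x)"
    using assms(3-5) by (simp_all add: homog_nonzero_left)
  have "x * (x ^ 5 * A) + y * (x ^ 5 * B) = x ^ 6 * (A + y / x * B)" for A B
  proof -
    define z where "z = y / x"
    have y: "y = z * x" using assms(5) by (simp add: z_def)
    show ?thesis unfolding z_def[symmetric] unfolding y by algebra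
  qed
  then show ?thesis unfolding tang_def assms fst_conv snd_conv e by simp
qed

lemma tangent_alongE:
  assumes "tangent_along w X Y Z s" "X s \<noteq> 0"
    and ab: "fst w = homog 5 a" "snd w = homog 5 b" "degree a \<le> 5" "degree b \<le> 5"
  obtains X' Y' Z' where "(X has_vector_derivative X') (at s)" "(Y has_vector_derivative Y') (at s)"
    "(Z has_vector_derivative Z') (at s)"
    "poly (a + [:0, 1:] * b) (Y s / X s) * X s * (Z' * X s - Z s * X') = Z s * poly b (Y s / X s) * (Y' * X s - Y s * X')"
proof -
  obtain X' Y' Z' where d: "(X has_vector_derivative X') (at s)" "(Y has_vector_derivative Y') (at s)"
    "(Z has_vector_derivative Z') (at s)" "Z s * (fst w (X s) (Y s) * X' + snd w (X s) (Y s) * Y') = tang w (X s, Y s) * Z'"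
    using assms(1) unfolding tangent_along_def by blast
  have A: "fst w (X s) (Y s) = X s ^ 5 * poly a (Y s / X s)" "snd w (X s) (Y s) = X s ^ 5 * poly b (Y s / X s)"
    using ab assms(2) by (simp_all add: homog_nonzero_left)
  have Y: "Y s = Y s / X s * X s" using assms(2) by simp
  have c: "poly a (Y s / X s) + Y s / X s * poly b (Y s / X s) = poly (a + [:0, 1:] * b) (Y s / X s)" by simp
  show thesis
    by (rule that[OF d(1-3) first_integral_aux[OF assms(2) Y c d(4)[unfolded A tang_homog[OF ab assms(2)]]]])
qed

lemma local_infinity_aux:
  fixes X Y Z X' Y' Z' b c e :: complex
  assumes "X \<noteq> 0" "c \<noteq> 0" "c * X * (Z' * X - Z * X') = Z * b * (Y' * X - Y * X')"
  shows "Z / X * ((Y' * X - Y * X') / (X * X) * (e * - (b / c))) + (Z' * X - Z * X') / (X * X) * e = 0"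
proof -
  define i k where "i = inverse X" and "k = inverse c"
  have n: "i * X = 1" "k * c = 1" using assms by (simp_all add: i_def k_def)
  have "Z * i * ((Y' * X - Y * X') * (i * i) * (e * - (b * k))) + (Z' * X - Z * X') * (i * i) * e = 0"
    using n assms(3) by algebra
  then show ?thesis by (simp only: i_def k_def divide_inverse inverse_mult_distrib)
qed

text \<open>The first integral is (Z / X) exp(- \<open>\<Phi>\<close> (Y / X)), where
  \<open>\<Phi>\<close> is a primitive of b / c. It exists because the direction at t0 is not fixed,
  and it vanishes exactly where Z does.\<close>

lemma local_infinity:
  assumes cont: "\<And>s. s \<in> {0..1} \<Longrightarrow> (X \<longlongrightarrow> X s) (at s within {0..1})" "\<And>s. s \<in> {0..1} \<Longrightarrow> (Y \<longlongrightarrow> Y s) (at s within {0..1})"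
      "\<And>s. s \<in> {0..1} \<Longrightarrow> (Z \<longlongrightarrow> Z s) (at s within {0..1})"
    and S: "finite S" "\<And>s. s \<in> {0..1} - S \<Longrightarrow> tangent_along w X Y Z s"
    and w: "bform 5 (fst w)" "bform 5 (snd w)"
    and t0: "t0 \<in> {0..1}" "Z t0 = 0" "X t0 \<noteq> 0" "tang w (X t0, Y t0) \<noteq> 0"
  shows "\<exists>\<delta>>0. \<forall>s\<in>{0..1}. dist s t0 < \<delta> \<longrightarrow> Z s = 0"
proof -
  obtain a b where ab: "fst w = homog 5 a" "snd w = homog 5 b" "degree a \<le> 5" "degree b \<le> 5"
    using w unfolding bform_def by blast
  define c where "c = a + [:0, 1:] * b"
  define \<tau> where "\<tau> = (\<lambda>s. Y s / X s)"
  have "poly c (\<tau> t0) \<noteq> 0" using t0(4) tang_homog[OF ab t0(3)] by (simp add: c_def \<tau>_def)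
  then obtain \<rho> where \<rho>: "\<rho> > 0" "\<And>t. t \<in> ball (\<tau> t0) \<rho> \<Longrightarrow> poly c t \<noteq> 0" using nonzero_ball by blast
  have "(\<lambda>t. poly b t / poly c t) holomorphic_on ball (\<tau> t0) \<rho>"
    using \<rho>(2) by (intro holomorphic_intros) auto
  then obtain \<Phi> where \<Phi>: "\<And>t. t \<in> ball (\<tau> t0) \<rho> \<Longrightarrow> (\<Phi> has_field_derivative poly b t / poly c t) (at t)"
    using primitive_ball by blast
  have \<tau>c: "(\<tau> \<longlongrightarrow> \<tau> s) (at s within {0..1})" if "s \<in> {0..1}" "X s \<noteq> 0" for s
    unfolding \<tau>_def by (rule tendsto_divide[OF cont(2,1)]; rule that)
  have "\<forall>\<^sub>F s in at t0 within {0..1}. X s \<noteq> 0" by (rule tendsto_imp_eventually_ne[OF cont(1)[OF t0(1)] t0(3)])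
  moreover have "\<forall>\<^sub>F s in at t0 within {0..1}. \<tau> s \<in> ball (\<tau> t0) \<rho>"
    using \<rho>(1) by (intro topological_tendstoD[OF \<tau>c[OF t0(1,3)] open_ball]) simp
  ultimately have "\<forall>\<^sub>F s in at t0 within {0..1}. X s \<noteq> 0 \<and> \<tau> s \<in> ball (\<tau> t0) \<rho>" by (rule eventually_conj)
  then obtain \<delta> where \<delta>: "\<delta> > 0" "\<And>s. s \<in> {0..1} \<Longrightarrow> s \<noteq> t0 \<Longrightarrow> dist s t0 < \<delta> \<Longrightarrow> X s \<noteq> 0 \<and> \<tau> s \<in> ball (\<tau> t0) \<rho>"
    unfolding eventually_at by blast
  have in0: "\<tau> t0 \<in> ball (\<tau> t0) \<rho>" using \<rho>(1) by simp
  have near: "X s \<noteq> 0" "\<tau> s \<in> ball (\<tau> t0) \<rho>" if "s \<in> {0..1}" "dist s t0 < \<delta>" for s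
    using \<delta>(2)[OF that(1) _ that(2)] t0(3) in0 by metis+
  have E: "((\<lambda>t. exp (- \<Phi> t)) has_field_derivative exp (- \<Phi> t) * - (poly b t / poly c t)) (at t)"
    if t: "t \<in> ball (\<tau> t0) \<rho>" for t
    by (rule DERIV_chain2[OF DERIV_exp DERIV_minus[OF \<Phi>[OF t]]])
  define J where "J = (\<lambda>s. Z s / X s * exp (- \<Phi> (\<tau> s)))"
  have J0: "J s = 0" if s: "s \<in> {0..1}" "dist s t0 < \<delta>" for s
  proof (rule locally_constant_zero[OF S(1) t0(1) _ _ _ s])
    show "J t0 = 0" using t0(2) by (simp add: J_def)
    show "(J \<longlongrightarrow> J s) (at s within {0..1})" if s: "s \<in> {0..1}" "dist s t0 < \<delta>" for s
      unfolding J_def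
      by (intro tendsto_mult tendsto_divide cont s near(1)[OF s]
          isCont_tendsto_compose[OF DERIV_isCont[OF E[OF near(2)[OF s]]] \<tau>c])
    show "(J has_vector_derivative 0) (at s)" if s: "s \<in> {0..1} - S" "dist s t0 < \<delta>" for s
    proof -
      have s': "s \<in> {0..1}" using s by blast
      note n = near[OF s' s(2)]
      obtain X' Y' Z' where d: "(X has_vector_derivative X') (at s)" "(Y has_vector_derivative Y') (at s)"
        "(Z has_vector_derivative Z') (at s)"
        "poly c (\<tau> s) * X s * (Z' * X s - Z s * X') = Z s * poly b (\<tau> s) * (Y' * X s - Y s * X')"
        using tangent_alongE[OF S(2)[OF s(1)] n(1) ab] unfolding c_def \<tau>_def by blast
      have "(\<tau> has_vector_derivative (Y' * X s - Y s * X') / (X s * X s)) (at s)"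
        unfolding \<tau>_def by (rule has_vector_derivative_quotient[OF d(2,1) n(1)])
      from has_vector_derivative_mult[OF has_vector_derivative_quotient[OF d(3,1) n(1)] has_vector_derivative_chain[OF E[OF n(2)] this]]
      show ?thesis unfolding J_def local_infinity_aux[OF n(1) \<rho>(2)[OF n(2)] d(4)] .
    qed
  qed
  have Z0: "Z s = 0" if "s \<in> {0..1}" "dist s t0 < \<delta>" for s
    using J0[OF that] near(1)[OF that] by (simp add: J_def)
  show ?thesis by (intro exI[of _ \<delta>] conjI ballI impI \<delta>(1) Z0)
qed

lemma local_line_aux:
  fixes X Y Z X' Y' Z' b c d e r t F :: complex
  assumes nz: "X \<noteq> 0" "Z \<noteq> 0" "d \<noteq> 0" "r \<noteq> 0"
    and c: "c = t * d" and e: "b - r * d = t * e"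
    and rel: "c * X * (Z' * X - Z * X') = Z * b * (Y' * X - Y * X')"
  shows "t * (((X' * Z - X * Z') / (Z * Z) * (1 / (X / Z)) + (Y' * X - Y * X') / (X * X) * (e / d)) * (1 / r) * F) +
      (Y' * X - Y * X') / (X * X) * F = 0"
proof -
  define i j k l where "i = inverse X" and "j = inverse Z" and "k = inverse d" and "l = inverse r"
  have n: "i * X = 1" "j * Z = 1" "k * d = 1" "l * r = 1" using nz by (simp_all add: i_def j_def k_def l_def)
  have "t * (((X' * Z - X * Z') * (j * j) * (i * Z) + (Y' * X - Y * X') * (i * i) * (e * k)) * l * F) +
      (Y' * X - Y * X') * (i * i) * F = 0"
    using n e c rel by algebra
  then show ?thesis by (simp add: i_def j_def k_def l_def divide_inverse)
qed

text \<open>With c = t d and b = r d + t e the separated equation has the first integral t (X /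
  Z)^(1 / r) exp(H / r), H a primitive of e / d, which vanishes exactly where Y does. The hypothesis
  on a1 + b0 makes 0 a simple root of c, so that r is finite; b(0) nonzero makes r nonzero.\<close>

lemma local_line:
  assumes cont: "\<And>s. s \<in> {0..1} \<Longrightarrow> (X \<longlongrightarrow> X s) (at s within {0..1})" "\<And>s. s \<in> {0..1} \<Longrightarrow> (Y \<longlongrightarrow> Y s) (at s within {0..1})"
      "\<And>s. s \<in> {0..1} \<Longrightarrow> (Z \<longlongrightarrow> Z s) (at s within {0..1})"
    and S: "finite S" "\<And>s. s \<in> {0..1} - S \<Longrightarrow> tangent_along w X Y Z s"
    and ab: "fst w = homog 5 a" "snd w = homog 5 b" "degree a \<le> 5" "degree b \<le> 5"
    and nz: "poly a 0 = 0" "poly b 0 \<noteq> 0" "coeff a 1 + coeff b 0 \<noteq> 0"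
    and t0: "t0 \<in> {0..1}" "Y t0 = 0" "X t0 \<noteq> 0" "Z t0 \<noteq> 0"
  shows "\<exists>\<delta>>0. \<forall>s\<in>{0..1}. dist s t0 < \<delta> \<longrightarrow> Y s = 0"
proof -
  define c where "c = a + [:0, 1:] * b"
  obtain a1 where a1: "a = [:0, 1:] * a1" using nz(1) poly_eq_0_iff_dvd[of a 0] by (auto simp: dvd_def)
  define d where "d = a1 + b"
  have cd: "poly c t = t * poly d t" for t by (simp add: c_def d_def a1 algebra_simps)
  have "coeff a 1 = coeff a1 0" by (simp add: a1 coeff_pCons)
  then have d0: "poly d 0 \<noteq> 0" using nz(3) by (simp add: d_def poly_0_coeff_0)
  \<comment> \<open>The residue of b / c at the slope 0.\<close>
  define r where "r = poly b 0 / poly d 0"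
  have r0: "r \<noteq> 0" using nz(2) d0 by (simp add: r_def)
  have "poly (b - smult r d) 0 = 0" using d0 by (simp add: r_def)
  then obtain e where e: "b - smult r d = [:0, 1:] * e" using poly_eq_0_iff_dvd[of "b - smult r d" 0] by (auto simp: dvd_def)
  have et: "poly b t - r * poly d t = t * poly e t" for t
    using arg_cong[OF e, of "\<lambda>p. poly p t"] by simp
  define \<tau> where "\<tau> = (\<lambda>s. Y s / X s)"
  define \<xi> where "\<xi> = (\<lambda>s. X s / Z s)"
  have \<tau>0: "\<tau> t0 = 0" using t0 by (simp add: \<tau>_def)
  have \<xi>0: "\<xi> t0 \<noteq> 0" using t0 by (simp add: \<xi>_def)
  obtain \<rho> where \<rho>: "\<rho> > 0" "\<And>t. t \<in> ball 0 \<rho> \<Longrightarrow> poly d t \<noteq> 0" using nonzero_ball[OF d0] by blast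
  have "(\<lambda>t. poly e t / poly d t) holomorphic_on ball 0 \<rho>"
    using \<rho>(2) by (intro holomorphic_intros) auto
  then obtain H where H: "\<And>t. t \<in> ball 0 \<rho> \<Longrightarrow> (H has_field_derivative poly e t / poly d t) (at t)"
    using primitive_ball by blast
  \<comment> \<open>L is a branch of the logarithm up to a constant, on the largest disc around
    \<open>\<xi>\<close> t0 that avoids 0.\<close>
  have "(\<lambda>z. 1 / z) holomorphic_on ball (\<xi> t0) (norm (\<xi> t0))"
    by (intro holomorphic_intros) (auto simp: dist_norm)
  then obtain L where L: "\<And>z. z \<in> ball (\<xi> t0) (norm (\<xi> t0)) \<Longrightarrow> (L has_field_derivative 1 / z) (at z)"
    using primitive_ball by blast
  have \<tau>c: "(\<tau> \<longlongrightarrow> \<tau> s) (at s within {0..1})" if "s \<in> {0..1}" "X s \<noteq> 0" for s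
    unfolding \<tau>_def by (rule tendsto_divide[OF cont(2,1)]; rule that)
  have \<xi>c: "(\<xi> \<longlongrightarrow> \<xi> s) (at s within {0..1})" if "s \<in> {0..1}" "Z s \<noteq> 0" for s
    unfolding \<xi>_def by (rule tendsto_divide[OF cont(1,3)]; rule that)
  define N where "N s \<longleftrightarrow> X s \<noteq> 0 \<and> Z s \<noteq> 0 \<and> \<tau> s \<in> ball 0 \<rho> \<and> \<xi> s \<in> ball (\<xi> t0) (norm (\<xi> t0))" for s
  have "\<forall>\<^sub>F s in at t0 within {0..1}. N s"
    unfolding N_def
  proof (intro eventually_conj)
    show "\<forall>\<^sub>F s in at t0 within {0..1}. X s \<noteq> 0" by (rule tendsto_imp_eventually_ne[OF cont(1)[OF t0(1)] t0(3)])
    show "\<forall>\<^sub>F s in at t0 within {0..1}. Z s \<noteq> 0" by (rule tendsto_imp_eventually_ne[OF cont(3)[OF t0(1)] t0(4)])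
    show "\<forall>\<^sub>F s in at t0 within {0..1}. \<tau> s \<in> ball 0 \<rho>"
      using \<rho>(1) \<tau>0 by (intro topological_tendstoD[OF \<tau>c[OF t0(1,3)] open_ball]) simp
    show "\<forall>\<^sub>F s in at t0 within {0..1}. \<xi> s \<in> ball (\<xi> t0) (norm (\<xi> t0))"
      using \<xi>0 by (intro topological_tendstoD[OF \<xi>c[OF t0(1,4)] open_ball]) simp
  qed
  then obtain \<delta> where \<delta>: "\<delta> > 0" "\<And>s. s \<in> {0..1} \<Longrightarrow> s \<noteq> t0 \<Longrightarrow> dist s t0 < \<delta> \<Longrightarrow> N s"
    unfolding eventually_at by blast
  have "N t0" using t0 \<rho>(1) \<tau>0 \<xi>0 by (simp add: N_def)
  then have near: "N s" if "s \<in> {0..1}" "dist s t0 < \<delta>" for s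
    using \<delta>(2)[OF that(1) _ that(2)] by metis
  define J where "J = (\<lambda>s. \<tau> s * exp ((L (\<xi> s) + H (\<tau> s)) * (1 / r)))"
  have J0: "J s = 0" if s: "s \<in> {0..1}" "dist s t0 < \<delta>" for s
  proof (rule locally_constant_zero[OF S(1) t0(1) _ _ _ s])
    show "J t0 = 0" by (simp add: J_def \<tau>0)
    show "(J \<longlongrightarrow> J s) (at s within {0..1})" if s: "s \<in> {0..1}" "dist s t0 < \<delta>" for s
    proof -
      have n: "X s \<noteq> 0" "Z s \<noteq> 0" "\<tau> s \<in> ball 0 \<rho>" "\<xi> s \<in> ball (\<xi> t0) (norm (\<xi> t0))" using near[OF s] by (auto simp only: N_def)
      show ?thesis unfolding J_def
        by (intro tendsto_mult tendsto_exp tendsto_add tendsto_const \<tau>c \<xi>c s n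
          isCont_tendsto_compose[OF DERIV_isCont[OF H[OF n(3)]]] isCont_tendsto_compose[OF DERIV_isCont[OF L[OF n(4)]]])
    qed
    show "(J has_vector_derivative 0) (at s)" if s: "s \<in> {0..1} - S" "dist s t0 < \<delta>" for s
    proof -
      have s': "s \<in> {0..1}" using s by blast
      have n: "X s \<noteq> 0" "Z s \<noteq> 0" "\<tau> s \<in> ball 0 \<rho>" "\<xi> s \<in> ball (\<xi> t0) (norm (\<xi> t0))" using near[OF s' s(2)] by (auto simp only: N_def)
      obtain X' Y' Z' where D: "(X has_vector_derivative X') (at s)" "(Y has_vector_derivative Y') (at s)"
        "(Z has_vector_derivative Z') (at s)"
        "poly c (\<tau> s) * X s * (Z' * X s - Z s * X') = Z s * poly b (\<tau> s) * (Y' * X s - Y s * X')"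
        using tangent_alongE[OF S(2)[OF s(1)] n(1) ab] unfolding c_def \<tau>_def by blast
      have T: "(\<tau> has_vector_derivative (Y' * X s - Y s * X') / (X s * X s)) (at s)"
        unfolding \<tau>_def by (rule has_vector_derivative_quotient[OF D(2,1) n(1)])
      have X: "(\<xi> has_vector_derivative (X' * Z s - X s * Z') / (Z s * Z s)) (at s)"
        unfolding \<xi>_def by (rule has_vector_derivative_quotient[OF D(1,3) n(2)])
      have "((\<lambda>s. (L (\<xi> s) + H (\<tau> s)) * (1 / r)) has_vector_derivative
          ((X' * Z s - X s * Z') / (Z s * Z s) * (1 / \<xi> s) + (Y' * X s - Y s * X') / (X s * X s) * (poly e (\<tau> s) / poly d (\<tau> s))) * (1 / r)) (at s)"
        by (rule has_vector_derivative_mult_left has_vector_derivative_add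
            has_vector_derivative_chain[OF L[OF n(4)] X] has_vector_derivative_chain[OF H[OF n(3)] T])+
      from has_vector_derivative_mult[OF T has_vector_derivative_chain[OF DERIV_exp this]]
      show ?thesis unfolding J_def \<xi>_def
        using local_line_aux[OF n(1,2) \<rho>(2)[OF n(3)] r0 cd et D(4), of "exp ((L (X s / Z s) + H (\<tau> s)) * (1 / r))"]
        by (simp only: J_def \<xi>_def \<tau>_def simp_thms)
    qed
  qed
  have Y0: "Y s = 0" if "s \<in> {0..1}" "dist s t0 < \<delta>" for s
  proof -
    have "X s \<noteq> 0" using near[OF that] unfolding N_def by (rule conjunct1)
    then show ?thesis using J0[OF that] by (simp add: J_def \<tau>_def)
  qed
  show ?thesis by (intro exI[of _ \<delta>] conjI ballI impI \<delta>(1) Y0)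
qed

definition tangent_path :: "form \<Rightarrow> (real \<Rightarrow> complex^3) \<Rightarrow> bool" where
  "tangent_path \<Omega> g \<longleftrightarrow> valid_path g \<and> (\<forall>t\<in>{0..1}. regular_point \<Omega> (g t) \<and>
     (\<forall>v. (g has_vector_derivative v) (at t within {0..1}) \<longrightarrow> pair (\<Omega> (g t)) v = 0))"

lemma leaf_tangent_path: "leaf \<Omega> p = {q. \<exists>g. tangent_path \<Omega> g \<and> pathstart g = p \<and> pathfinish g = q}"
  unfolding leaf_def tangent_path_def by blast

lemma tangent_path_components:
  assumes "tangent_path (hom_form w) g"
  obtains S where "finite S" "\<And>s i. s \<in> {0..1} \<Longrightarrow> ((\<lambda>s. g s $ i) \<longlongrightarrow> g s $ i) (at s within {0..1})"
    "\<And>s. s \<in> {0..1} - S \<Longrightarrow> tangent_along w (\<lambda>s. g s $ 1) (\<lambda>s. g s $ 2) (\<lambda>s. g s $ 3) s"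
proof -
  have tan: "pair (hom_form w (g s)) v = 0" if "s \<in> {0..1}" "(g has_vector_derivative v) (at s within {0..1})" for s v
    using assms that unfolding tangent_path_def by blast
  have "valid_path g" using assms unfolding tangent_path_def by blast
  then obtain S where c: "continuous_on {0..1} g" and S: "finite S" "g C1_differentiable_on ({0..1} - S)"
    unfolding valid_path_def piecewise_C1_differentiable_on_def by blast
  obtain D where D: "\<And>s. s \<in> {0..1} - S \<Longrightarrow> (g has_vector_derivative D s) (at s)"
    using S(2) unfolding C1_differentiable_on_def by blast
  show thesis
  proof (rule that[OF S(1)])
    fix s :: real and i assume "s \<in> {0..1}"
    then have "(g \<longlongrightarrow> g s) (at s within {0..1})" using c unfolding continuous_on_def by blast
    then show "((\<lambda>s. g s $ i) \<longlongrightarrow> g s $ i) (at s within {0..1})" by (rule tendsto_vec_nth)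
  next
    fix s assume s: "s \<in> {0..1} - S"
    have d: "((\<lambda>s. g s $ i) has_vector_derivative D s $ i) (at s)" for i
      by (rule bounded_linear.has_vector_derivative[OF bounded_linear_vec_nth D[OF s]])
    have "pair (hom_form w (g s)) (D s) = 0"
      using s by (intro tan has_vector_derivative_at_within[OF D[OF s]]) blast
    then have "g s $ 3 * (fst w (g s $ 1) (g s $ 2) * D s $ 1 + snd w (g s $ 1) (g s $ 2) * D s $ 2) = tang w (g s $ 1, g s $ 2) * D s $ 3"
      unfolding pair_hom_form tang_def fst_conv snd_conv by (rule iffD1[OF right_minus_eq])
    then show "tangent_along w (\<lambda>s. g s $ 1) (\<lambda>s. g s $ 2) (\<lambda>s. g s $ 3) s"
      unfolding tangent_along_def using d by blast
  qed
qed

lemma tangent_along_swap: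
  assumes "tangent_along w X Y Z s"
  shows "tangent_along (\<lambda>x y. snd w y x, \<lambda>x y. fst w y x) Y X Z s"
proof -
  obtain X' Y' Z' where *: "(X has_vector_derivative X') (at s)" "(Y has_vector_derivative Y') (at s)"
     "(Z has_vector_derivative Z') (at s)" "Z s * (fst w (X s) (Y s) * X' + snd w (X s) (Y s) * Y') = tang w (X s, Y s) * Z'"
    using assms unfolding tangent_along_def by blast
  have "Z s * (snd w (X s) (Y s) * Y' + fst w (X s) (Y s) * X') = (Y s * snd w (X s) (Y s) + X s * fst w (X s) (Y s)) * Z'"
    using *(4) unfolding tang_def fst_conv snd_conv by (simp only: add.commute)
  then show ?thesis unfolding tangent_along_def tang_def fst_conv snd_conv using *(1-3) by blast
qed

text \<open>The singular points on the line at infinity lie in the fixed directions, and the path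
  avoids them; so \<open>local_infinity\<close> applies at each point of the path on that line, with
  x and y exchanged when x vanishes there.\<close>

lemma path_infinity:
  assumes w: "hform w" and g: "tangent_path (hom_form w) g" and t: "t1 \<in> {0..1}" "g t1 $ 3 = 0" "t \<in> {0..1}"
  shows "g t $ 3 = 0"
proof -
  obtain S where S: "finite S" "\<And>s i. s \<in> {0..1} \<Longrightarrow> ((\<lambda>s. g s $ i) \<longlongrightarrow> g s $ i) (at s within {0..1})"
    "\<And>s. s \<in> {0..1} - S \<Longrightarrow> tangent_along w (\<lambda>s. g s $ 1) (\<lambda>s. g s $ 2) (\<lambda>s. g s $ 3) s"
    using tangent_path_components[OF g] by blast
  have b: "bform 5 (fst w)" "bform 5 (snd w)" using w unfolding hform_def by blast+
  define w' where "w' = (\<lambda>x y. snd w y x, \<lambda>x y. fst w y x)"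
  have b': "bform 5 (fst w')" "bform 5 (snd w')"
    using bform_subst[OF b(2), of 0 1 1 0] bform_subst[OF b(1), of 0 1 1 0] unfolding w'_def by simp_all
  have c: "continuous_on {0..1} (\<lambda>s. g s $ 3)" unfolding continuous_on_def using S(2) by blast
  show ?thesis
  proof (rule zero_set_interval[OF c t(1,2) _ t(3)])
    fix t0 :: real assume t0: "t0 \<in> {0..1}" "g t0 $ 3 = 0"
    have "hom_form w (g t0) \<noteq> 0" using g t0(1) unfolding tangent_path_def regular_point_def by blast
    then have T: "tang w (g t0 $ 1, g t0 $ 2) \<noteq> 0" and n: "g t0 $ 1 \<noteq> 0 \<or> g t0 $ 2 \<noteq> 0"
      unfolding hom_form_eq_0[OF w] using t0(2) by blast+
    show "\<exists>\<delta>>0. \<forall>s\<in>{0..1}. dist s t0 < \<delta> \<longrightarrow> g s $ 3 = 0"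
    proof (cases "g t0 $ 1 = 0")
      case False
      show ?thesis by (rule local_infinity[OF S(2) S(2) S(2) S(1) S(3) b t0 False T])
    next
      case True
      then have n2: "g t0 $ 2 \<noteq> 0" using n by blast
      have T': "tang w' (g t0 $ 2, g t0 $ 1) \<noteq> 0"
        using T unfolding tang_def w'_def fst_conv snd_conv by (simp only: add.commute not_False_eq_True)
      show ?thesis
        by (rule local_infinity[OF S(2) S(2) S(2) S(1) tangent_along_swap[OF S(3), folded w'_def] b' t0 n2 T'])
    qed
  qed
qed

text \<open>
  At a noncritical invariant direction this excludes a saddle-node; the logarithmic first integral of
  \<open>local_line\<close> needs it.
\<close>

definition simple_tang :: "form2 \<Rightarrow> bool" where
  "simple_tang w \<longleftrightarrow> (\<forall>v h. v \<noteq> (0, 0) \<longrightarrow> bform 4 h \<longrightarrow> \<not> (\<forall>x y. tang w (x, y) = (snd v * x - fst v * y) ^ 2 * h x y))"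

lemma simple_tang_pulls:
  assumes P: "pulls p q r s k w' w" and w': "simple_tang w'"
  shows "simple_tang w"
  unfolding simple_tang_def
proof (intro allI impI notI)
  fix v h assume v: "v \<noteq> (0, 0)" and h: "bform 4 h" and e: "\<forall>x y. tang w (x, y) = (snd v * x - fst v * y) ^ 2 * h x y"
  define d where "d = p * s - q * r"
  have d: "d \<noteq> 0" using P by (simp add: pulls_def d_def)
  define i where "i = inverse d"
  have i: "i * d = 1" using d by (simp add: i_def)
  define u where "u = (p * fst v + q * snd v, r * fst v + s * snd v)"
  define h' where "h' = (\<lambda>x y. (k * i ^ 2) * h ((s * i) * x + (- q * i) * y) ((- r * i) * x + (p * i) * y))"
  have "u \<noteq> (0, 0)"
  proof
    assume "u = (0, 0)"
    then have "p * fst v + q * snd v = 0" "r * fst v + s * snd v = 0" by (simp_all add: u_def)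
    then have "d * fst v = 0" "d * snd v = 0" unfolding d_def by algebra+
    then have "fst v = 0" "snd v = 0" using d by simp_all
    then show False using v by (simp add: prod_eq_iff)
  qed
  moreover have "bform 4 h'" unfolding h'_def by (intro bform_scale bform_subst h)
  moreover have "tang w' (x, y) = (snd u * x - fst u * y) ^ 2 * h' x y" for x y
  proof -
    define X Y where "X = (s * i) * x + (- q * i) * y" and "Y = (- r * i) * x + (p * i) * y"
    have "p * X + q * Y = x" "r * X + s * Y = y" unfolding X_def Y_def using i unfolding d_def by algebra+
    then have "tang w' (x, y) = k * tang w (X, Y)" using tang_pulls[OF P, of "(X, Y)"] by (simp only: fst_conv snd_conv)
    also have "\<dots> = k * ((snd v * X - fst v * Y) ^ 2 * h X Y)" using e by simp
    also have "snd v * X - fst v * Y = i * (snd u * x - fst u * y)"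
      unfolding X_def Y_def u_def fst_conv snd_conv by algebra
    finally show ?thesis unfolding h'_def X_def[symmetric] Y_def[symmetric] by (simp only: power_mult_distrib ac_simps)
  qed
  ultimately show False using w' unfolding simple_tang_def by blast
qed

text \<open>At finite slope a double zero of \<open>tang\<close> is a double root of c. In the
  direction (0, 1) the two lowest coefficients in x are b5 and a5 + b4.\<close>

lemma simple_tangI:
  assumes ab: "fst w = homog 5 a" "snd w = homog 5 b" "degree a \<le> 5" "degree b \<le> 5"
    and fin: "\<And>t. poly (a + [:0, 1:] * b) t = 0 \<Longrightarrow> poly (pderiv (a + [:0, 1:] * b)) t \<noteq> 0"
    and inf: "coeff b 5 = 0 \<Longrightarrow> coeff a 5 + coeff b 4 \<noteq> 0"
  shows "simple_tang w"
  unfolding simple_tang_def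
proof (intro allI impI notI)
  fix v h assume v: "v \<noteq> (0, 0)" and h: "bform 4 h" and e: "\<forall>x y. tang w (x, y) = (snd v * x - fst v * y) ^ 2 * h x y"
  obtain g where g: "degree g \<le> 4" "h = homog 4 g" using h unfolding bform_def by blast
  show False
  proof (cases "fst v = 0")
    case False
    have "poly (a + [:0, 1:] * b) t = poly ([:snd v, - fst v:] * ([:snd v, - fst v:] * g)) t" for t
    proof -
      have "poly (a + [:0, 1:] * b) t = tang w (1, t)" using tang_homog[OF ab, of 1 t] by simp
      also have "\<dots> = (snd v * 1 - fst v * t) ^ 2 * h 1 t" using e by blast
      also have "h 1 t = poly g t" using g by (simp add: homog_one_left)
      also have "(snd v * 1 - fst v * t) ^ 2 * poly g t = (snd v + t * (- fst v)) * ((snd v + t * (- fst v)) * poly g t)" by algebra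
      also have "\<dots> = poly ([:snd v, - fst v:] * ([:snd v, - fst v:] * g)) t"
        by (simp only: poly_mult poly_pCons poly_0 mult_zero_right add_0_right)
      finally show ?thesis .
    qed
    then have c: "a + [:0, 1:] * b = [:snd v, - fst v:] * ([:snd v, - fst v:] * g)" by (rule poly_eqI_fun)
    have z: "poly [:snd v, - fst v:] (snd v / fst v) = 0" using False by simp
    have "poly ([:snd v, - fst v:] * ([:snd v, - fst v:] * g)) (snd v / fst v) = 0" unfolding poly_mult z by simp
    moreover have "poly (pderiv ([:snd v, - fst v:] * ([:snd v, - fst v:] * g))) (snd v / fst v) = 0"
      unfolding pderiv_mult poly_add poly_mult z by simp
    ultimately show False using fin unfolding c by blast
  next
    case True
    then have v2: "snd v \<noteq> 0" using v by (simp add: prod_eq_iff)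
    have E: "x * fst w x 1 + snd w x 1 = (snd v * x) ^ 2 * h x 1" for x
      using e True unfolding tang_def by (metis fst_conv snd_conv mult_1 mult_zero_left diff_zero)
    have b5: "coeff b 5 = 0" using E[of 0] unfolding ab homog_zero_left by simp
    \<comment> \<open>f(x) is \<open>tang\<close> at (x, 1) divided by x, which is a polynomial
      because b5 = 0.\<close>
    define f where "f = (\<lambda>x. coeff a 5 + coeff b 4 + x * (coeff a 4 + coeff b 3 + x * (coeff a 3 + coeff b 2 + x * (coeff a 2 + coeff b 1 + x * (coeff a 1 + coeff b 0 + x * coeff a 0)))))"
    have "f 0 = (\<lambda>x. snd v ^ 2 * x * h x 1) 0"
    proof (rule isCont_eq_at_0[where f = f and g = "\<lambda>x. snd v ^ 2 * x * h x 1"])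
      show "isCont f 0" unfolding f_def by (intro continuous_intros)
      show "isCont (\<lambda>x. snd v ^ 2 * x * h x 1) 0" unfolding g homog_def by (intro continuous_intros)
      fix x :: complex assume x: "x \<noteq> 0"
      have "x * f x = x * fst w x 1 + snd w x 1" unfolding ab homog_5 f_def b5 power_one by algebra
      also have "\<dots> = x * (snd v ^ 2 * x * h x 1)" unfolding E by algebra
      finally show "f x = snd v ^ 2 * x * h x 1" using x by simp
    qed
    then have "coeff a 5 + coeff b 4 = 0" by (simp add: f_def)
    then show False using inf[OF b5] by contradiction
  qed
qed

text \<open>The singular points on the invariant line y = 0 are the origin of the chart and its
  point at infinity. A path on the line avoids both, so X and Z are nonzero and
  \<open>local_line\<close> applies.\<close>

lemma path_line:
  assumes w: "hform w" "simple_tang w" "tang w (1, 0) = 0" and g: "tangent_path (hom_form w) g"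
    and t: "t1 \<in> {0..1}" "g t1 $ 2 = 0" "t \<in> {0..1}"
  shows "g t $ 2 = 0"
proof -
  obtain S where S: "finite S" "\<And>s i. s \<in> {0..1} \<Longrightarrow> ((\<lambda>s. g s $ i) \<longlongrightarrow> g s $ i) (at s within {0..1})"
    "\<And>s. s \<in> {0..1} - S \<Longrightarrow> tangent_along w (\<lambda>s. g s $ 1) (\<lambda>s. g s $ 2) (\<lambda>s. g s $ 3) s"
    using tangent_path_components[OF g] by blast
  obtain a b where ab: "fst w = homog 5 a" "snd w = homog 5 b" "degree a \<le> 5" "degree b \<le> 5"
    using hform_obtain[OF w(1)] .
  have A: "fst w 1 0 = poly a 0" "snd w 1 0 = poly b 0" unfolding ab using ab(3,4) by (simp_all add: homog_one_left)
  have a0: "poly a 0 = 0" using w(3) unfolding tang_def fst_conv snd_conv A by simp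
  have b0: "poly b 0 \<noteq> 0" using hform_nonzero[OF w(1), of 1 0] unfolding A using a0 by simp
  \<comment> \<open>Otherwise \<open>tang\<close> would be divisible by y^2 with the cofactor h,
    contrary to \<open>simple_tang\<close>.\<close>
  have c1: "coeff a 1 + coeff b 0 \<noteq> 0"
  proof
    assume c1: "coeff a 1 + coeff b 0 = 0"
    define h where "h = homog 4 [:coeff a 2 + coeff b 1, coeff a 3 + coeff b 2, coeff a 4 + coeff b 3, coeff a 5 + coeff b 4, coeff b 5:]"
    have z: "coeff a 0 = 0" using a0 by (simp add: poly_0_coeff_0)
    have b1: "coeff b 0 = - coeff a 1" using c1 by (simp add: eq_neg_iff_add_eq_0 add.commute)
    have "bform 4 h" unfolding h_def by (rule bform_homog) simp
    moreover have "tang w (x, y) = (snd (1, 0) * x - fst (1, 0) * y) ^ 2 * h x y" for x y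
    proof -
      have "h x y = (coeff a 2 + coeff b 1) * x ^ 4 + (coeff a 3 + coeff b 2) * x ^ 3 * y + (coeff a 4 + coeff b 3) * x ^ 2 * y ^ 2 + (coeff a 5 + coeff b 4) * x * y ^ 3 + coeff b 5 * y ^ 4"
        unfolding h_def homog_def by (simp add: eval_nat_numeral)
      then show ?thesis unfolding tang_def fst_conv snd_conv ab homog_5 z b1 by algebra
    qed
    ultimately show False using w(2) unfolding simple_tang_def by (metis prod.inject zero_neq_one)
  qed
  have c: "continuous_on {0..1} (\<lambda>s. g s $ 2)" unfolding continuous_on_def using S(2) by blast
  show ?thesis
  proof (rule zero_set_interval[OF c t(1,2) _ t(3)])
    fix t0 :: real assume t0: "t0 \<in> {0..1}" "g t0 $ 2 = 0"
    have "hom_form w (g t0) \<noteq> 0" using g t0(1) unfolding tangent_path_def regular_point_def by blast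
    then have n: "g t0 $ 1 \<noteq> 0" "g t0 $ 3 = 0 \<Longrightarrow> tang w (g t0 $ 1, g t0 $ 2) \<noteq> 0"
      unfolding hom_form_eq_0[OF w(1)] using t0(2) by blast+
    have "tang w (g t0 $ 1, g t0 $ 2) = 0" unfolding t0(2) tang_homog[OF ab n(1)] using a0 by simp
    then have n3: "g t0 $ 3 \<noteq> 0" using n(2) by blast
    show "\<exists>\<delta>>0. \<forall>s\<in>{0..1}. dist s t0 < \<delta> \<longrightarrow> g s $ 2 = 0"
      by (rule local_line[OF S(2) S(2) S(2) S(1) S(3) ab a0 b0 c1 t0 n(1) n3])
  qed
qed

text \<open>A path from p to q puts p on the line, and the paths starting at p then keep the whole
  leaf there.\<close>

lemma leaf_in_line:
  assumes stay: "\<And>g t1 t. tangent_path \<Omega> g \<Longrightarrow> t1 \<in> {0..1} \<Longrightarrow> g t1 $ k = 0 \<Longrightarrow> t \<in> {0..1} \<Longrightarrow> g t $ k = 0"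
    and q: "q \<in> leaf \<Omega> p" "q $ k = 0"
  shows "in_straight_line (leaf \<Omega> p)"
proof -
  obtain g where g: "tangent_path \<Omega> g" "pathstart g = p" "pathfinish g = q" using q(1) unfolding leaf_tangent_path by blast
  have p: "p $ k = 0" using stay[OF g(1), of 1 0] g(2,3) q(2) unfolding pathstart_def pathfinish_def by simp
  have "u $ k = 0" if u: "u \<in> leaf \<Omega> p" for u
  proof -
    obtain g where g: "tangent_path \<Omega> g" "pathstart g = p" "pathfinish g = u" using u unfolding leaf_tangent_path by blast
    show ?thesis using stay[OF g(1), of 0 1] g(2,3) p unfolding pathstart_def pathfinish_def by simp
  qed
  moreover have "pair (axis k 1) u = u $ k" for u
  proof -
    have "axis k (1 :: complex) $ i * u $ i = (if i = k then u $ k else 0)" for i by (simp add: axis_def)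
    then show ?thesis by (simp add: pair_def)
  qed
  moreover have "axis k (1 :: complex) \<noteq> 0" by (simp add: axis_eq_0_iff)
  ultimately show ?thesis unfolding in_straight_line_def by (intro exI[of _ "axis k 1"]) simp
qed

section \<open>Inflection points force critical or fixed directions\<close>

text \<open>As y vanishes at s, only the monomials x^5 and x^4 y contribute to the
  derivative.\<close>

lemma DERIV_homog_5:
  assumes "(x has_field_derivative x') (at s)" "(y has_field_derivative y') (at s)" "y s = 0"
  shows "((\<lambda>t. homog 5 p (x t) (y t)) has_field_derivative 5 * coeff p 0 * x s ^ 4 * x' + coeff p 1 * x s ^ 4 * y') (at s)"
proof -
  define f where "f = (\<lambda>t. coeff p 1 * x t ^ 4 + (coeff p 2 * x t ^ 3 + (coeff p 3 * x t ^ 2 + (coeff p 4 * x t + coeff p 5 * y t) * y t) * y t) * y t)"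
  have h: "(\<lambda>t. homog 5 p (x t) (y t)) = (\<lambda>t. coeff p 0 * x t ^ 5 + f t * y t)"
    by (rule ext) (unfold homog_5 f_def, algebra)
  have "f field_differentiable at s"
    unfolding f_def using assms(1,2) by (intro derivative_intros) (auto simp: field_differentiable_def)
  then obtain f' where f': "(f has_field_derivative f') (at s)" unfolding field_differentiable_def by blast
  have "((\<lambda>t. coeff p 0 * x t ^ 5) has_field_derivative coeff p 0 * (of_nat 5 * (x' * x s ^ (5 - Suc 0)))) (at s)"
    by (intro DERIV_cmult DERIV_power assms(1))
  from DERIV_add[OF this DERIV_mult[OF f' assms(2)]]
  have d: "((\<lambda>t. coeff p 0 * x t ^ 5 + f t * y t) has_field_derivative
      coeff p 0 * (of_nat 5 * (x' * x s ^ (5 - Suc 0))) + (f' * y s + y' * f s)) (at s)" .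
  have e: "coeff p 0 * (of_nat 5 * (x' * x s ^ (5 - Suc 0))) + (f' * y s + y' * f s) = 5 * coeff p 0 * x s ^ 4 * x' + coeff p 1 * x s ^ 4 * y'"
    by (simp add: f_def assms(3))
  show ?thesis using d unfolding h e .
qed

text \<open>The hypothesis \<open>t\<close> is the tangency at a point with y = 0, and
  \<open>d\<close> is its derivative along the curve. The contact equations make l proportional to
  the form at the point, so the second derivatives cancel in \<open>d\<close> and z y'^2 (a0 b1 - a1
  b0) = 0 remains.\<close>

lemma inflection_aux:
  fixes x z a0 a1 b0 b1 :: complex
  assumes nz: "x \<noteq> 0" "z \<noteq> 0" "a0 \<noteq> 0" "y' \<noteq> 0" "l1 \<noteq> 0 \<or> l2 \<noteq> 0 \<or> l3 \<noteq> 0"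
    and e: "l1 * x + l3 * z = 0" "l1 * x' + l2 * y' + l3 * z' = 0" "l1 * x'' + l2 * y'' + l3 * z'' = 0"
    and t: "z * (a0 * x' + b0 * y') = x * a0 * z'"
    and d: "z' * (x ^ 5 * a0 * x' + x ^ 5 * b0 * y') +
        z * ((5 * a0 * x ^ 4 * x' + a1 * x ^ 4 * y') * x' + x ^ 5 * a0 * x'' + ((5 * b0 * x ^ 4 * x' + b1 * x ^ 4 * y') * y' + x ^ 5 * b0 * y'')) -
        ((x' * (x ^ 5 * a0) + x * (5 * a0 * x ^ 4 * x' + a1 * x ^ 4 * y') + y' * (x ^ 5 * b0)) * z' + x * (x ^ 5 * a0) * z'') = 0"
  shows "a0 * b1 - a1 * b0 = 0"
proof -
  have l1: "l1 \<noteq> 0"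
  proof
    assume l1: "l1 = 0"
    then have "l3 = 0" using e(1) nz(2) by simp
    then have "l2 = 0" using e(2) nz(4) l1 by simp
    then show False using nz(5) l1 \<open>l3 = 0\<close> by blast
  qed
  have "z * y' * (l2 * a0 - l1 * b0) = 0" using e(1,2) t by algebra
  then have l2: "l2 * a0 - l1 * b0 = 0" using nz(2,4) by (simp only: mult_eq_0_iff simp_thms)
  have "l1 * (z * (a0 * x'' + b0 * y'') - x * a0 * z'') = 0" using e(1,3) l2 by algebra
  then have s: "z * (a0 * x'' + b0 * y'') - x * a0 * z'' = 0" using l1 by (simp only: mult_eq_0_iff simp_thms)
  define K where "K = z * (5 * a0 * x' ^ 2 + a1 * x' * y' + 5 * b0 * x' * y' + b1 * y' ^ 2) - x * z' * (5 * a0 * x' + a1 * y')"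
  have "x ^ 4 * K = x ^ 4 * K + x ^ 5 * (z * (a0 * x'' + b0 * y'') - x * a0 * z'')" unfolding s by simp
  also have "\<dots> = 0" using d unfolding K_def by algebra
  finally have K: "K = 0" using nz(1) by simp
  have "z * y' ^ 2 * (a0 * b1 - a1 * b0) = a0 * K + (z * (a0 * x' + b0 * y') - x * a0 * z') * (- (5 * a0 * x' + a1 * y'))"
    unfolding K_def by algebra
  then have "z * y' ^ 2 * (a0 * b1 - a1 * b0) = 0" unfolding K t by simp
  then show ?thesis using nz(2,4) by simp
qed

text \<open>The number a0 b1 - a1 b0 extracted by \<open>inflection_aux\<close> is the value of the
  Wronskian at slope 0.\<close>

lemma inflection_crit:
  assumes w: "hform w" and q: "inflection_point (hom_form w) q" "q $ 2 = 0" "q $ 1 \<noteq> 0" "q $ 3 \<noteq> 0"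
  shows "crit w (1, 0) \<or> tang w (1, 0) = 0"
proof (rule ccontr)
  assume neg: "\<not> (crit w (1, 0) \<or> tang w (1, 0) = 0)"
  obtain a b where ab: "fst w = homog 5 a" "snd w = homog 5 b" "degree a \<le> 5" "degree b \<le> 5"
    using hform_obtain[OF w] .
  have A1: "fst w 1 0 = coeff a 0" unfolding ab using ab(3) by (simp add: homog_one_left poly_0_coeff_0)
  have a0: "coeff a 0 \<noteq> 0" using neg unfolding tang_def fst_conv snd_conv A1 by simp
  obtain \<gamma> l where par: "leaf_param (hom_form w) q \<gamma>" and l: "l \<noteq> 0"
    "\<And>k. k < 3 \<Longrightarrow> (deriv ^^ k) (\<lambda>t. pair l (\<gamma> t)) 0 = 0"
    using q(1) unfolding inflection_point_def by blast
  obtain r where r: "r > 0" and hol: "\<And>i. (\<lambda>t. \<gamma> t $ i) holomorphic_on ball 0 r"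
    and tan: "\<And>t. t \<in> ball 0 r \<Longrightarrow> pair (hom_form w (\<gamma> t)) (deriv_vec \<gamma> t) = 0"
    and \<gamma>0: "\<gamma> 0 = q" and ind: "indep (\<gamma> 0) (deriv_vec \<gamma> 0)"
    using par unfolding leaf_param_def by blast
  define x y z where "x = (\<lambda>t. \<gamma> t $ 1)" and "y = (\<lambda>t. \<gamma> t $ 2)" and "z = (\<lambda>t. \<gamma> t $ 3)"
  have i0: "0 \<in> ball (0 :: complex) r" using r by simp
  have hx: "x holomorphic_on ball 0 r" "y holomorphic_on ball 0 r" "z holomorphic_on ball 0 r"
    unfolding x_def y_def z_def by (rule hol)+
  note D = hx[THEN holomorphic_derivI, OF open_ball]
  note DD = hx[THEN holomorphic_deriv[OF _ open_ball], THEN holomorphic_derivI, OF open_ball i0]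
  have v0: "x 0 = q $ 1" "y 0 = 0" "z 0 = q $ 3" unfolding x_def y_def z_def \<gamma>0 using q(2) by simp_all
  have dv: "deriv_vec \<gamma> t $ 1 = deriv x t" "deriv_vec \<gamma> t $ 2 = deriv y t" "deriv_vec \<gamma> t $ 3 = deriv z t" for t
    unfolding deriv_vec_def x_def y_def z_def by simp_all
  define P where "P = (\<lambda>t. pair l (\<gamma> t))"
  have Pt: "P = (\<lambda>t. l $ 1 * x t + l $ 2 * y t + l $ 3 * z t)" unfolding P_def x_def y_def z_def pair_3 ..
  have dP: "(P has_field_derivative l $ 1 * deriv x t + l $ 2 * deriv y t + l $ 3 * deriv z t) (at t)" if "t \<in> ball 0 r" for t
    unfolding Pt by (intro DERIV_add DERIV_cmult D that)
  have ddP: "(deriv P has_field_derivative l $ 1 * deriv (deriv x) 0 + l $ 2 * deriv (deriv y) 0 + l $ 3 * deriv (deriv z) 0) (at 0)"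
  proof (rule has_field_derivative_transform_within_open[OF _ open_ball i0])
    show "((\<lambda>t. l $ 1 * deriv x t + l $ 2 * deriv y t + l $ 3 * deriv z t) has_field_derivative
        l $ 1 * deriv (deriv x) 0 + l $ 2 * deriv (deriv y) 0 + l $ 3 * deriv (deriv z) 0) (at 0)"
      by (intro DERIV_add DERIV_cmult DD)
    show "l $ 1 * deriv x t + l $ 2 * deriv y t + l $ 3 * deriv z t = deriv P t" if "t \<in> ball 0 r" for t
      by (rule DERIV_imp_deriv[OF dP[OF that], symmetric])
  qed
  have "P 0 = 0" "deriv P 0 = 0" "deriv (deriv P) 0 = 0"
    using l(2)[of 0] l(2)[of 1] l(2)[of 2] unfolding P_def by (simp_all add: numeral_2_eq_2)
  then have E: "l $ 1 * x 0 + l $ 3 * z 0 = 0" "l $ 1 * deriv x 0 + l $ 2 * deriv y 0 + l $ 3 * deriv z 0 = 0"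
    "l $ 1 * deriv (deriv x) 0 + l $ 2 * deriv (deriv y) 0 + l $ 3 * deriv (deriv z) 0 = 0"
    unfolding DERIV_imp_deriv[OF ddP] DERIV_imp_deriv[OF dP[OF i0]] by (simp_all add: Pt v0(2))
  \<comment> \<open>The tangency as a function of the parameter; its vanishing derivative at 0
    supplies the last hypothesis of \<open>inflection_aux\<close>.\<close>
  define f where "f = (\<lambda>t. z t * (homog 5 a (x t) (y t) * deriv x t + homog 5 b (x t) (y t) * deriv y t) -
      (x t * homog 5 a (x t) (y t) + y t * homog 5 b (x t) (y t)) * deriv z t)"
  have f0: "f t = 0" if "t \<in> ball 0 r" for t
    using tan[OF that] unfolding pair_hom_form dv ab f_def x_def y_def z_def .
  define A' B' where "A' = 5 * coeff a 0 * x 0 ^ 4 * deriv x 0 + coeff a 1 * x 0 ^ 4 * deriv y 0"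
    and "B' = 5 * coeff b 0 * x 0 ^ 4 * deriv x 0 + coeff b 1 * x 0 ^ 4 * deriv y 0"
  have dA: "((\<lambda>t. homog 5 a (x t) (y t)) has_field_derivative A') (at 0)" "((\<lambda>t. homog 5 b (x t) (y t)) has_field_derivative B') (at 0)"
    unfolding A'_def B'_def by (rule DERIV_homog_5[OF D(1)[OF i0] D(2)[OF i0] v0(2)])+
  have AB: "homog 5 a (x 0) (y 0) = x 0 ^ 5 * coeff a 0" "homog 5 b (x 0) (y 0) = x 0 ^ 5 * coeff b 0"
    unfolding v0(2) by (simp_all add: homog_5)
  have "(f has_field_derivative deriv z 0 * (homog 5 a (x 0) (y 0) * deriv x 0 + homog 5 b (x 0) (y 0) * deriv y 0) +
      (A' * deriv x 0 + deriv (deriv x) 0 * homog 5 a (x 0) (y 0) + (B' * deriv y 0 + deriv (deriv y) 0 * homog 5 b (x 0) (y 0))) * z 0 -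
      ((deriv x 0 * homog 5 a (x 0) (y 0) + A' * x 0 + (deriv y 0 * homog 5 b (x 0) (y 0) + B' * y 0)) * deriv z 0 +
        deriv (deriv z) 0 * (x 0 * homog 5 a (x 0) (y 0) + y 0 * homog 5 b (x 0) (y 0)))) (at 0)"
    unfolding f_def by (intro DERIV_diff DERIV_mult DERIV_add D[OF i0] DD dA)
  moreover have "(f has_field_derivative 0) (at 0)"
    by (rule has_field_derivative_transform_within_open[OF DERIV_const[of 0] open_ball i0]) (rule f0[symmetric])
  ultimately have d: "deriv z 0 * (homog 5 a (x 0) (y 0) * deriv x 0 + homog 5 b (x 0) (y 0) * deriv y 0) +
      (A' * deriv x 0 + deriv (deriv x) 0 * homog 5 a (x 0) (y 0) + (B' * deriv y 0 + deriv (deriv y) 0 * homog 5 b (x 0) (y 0))) * z 0 -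
      ((deriv x 0 * homog 5 a (x 0) (y 0) + A' * x 0 + (deriv y 0 * homog 5 b (x 0) (y 0) + B' * y 0)) * deriv z 0 +
        deriv (deriv z) 0 * (x 0 * homog 5 a (x 0) (y 0) + y 0 * homog 5 b (x 0) (y 0))) = 0" by (rule DERIV_unique)
  have x0: "x 0 \<noteq> 0" "z 0 \<noteq> 0" using q(3,4) v0 by simp_all
  have "x 0 ^ 5 * (z 0 * (coeff a 0 * deriv x 0 + coeff b 0 * deriv y 0) - x 0 * coeff a 0 * deriv z 0) = 0"
    using f0[OF i0] unfolding f_def AB unfolding v0(2) by algebra
  then have t: "z 0 * (coeff a 0 * deriv x 0 + coeff b 0 * deriv y 0) = x 0 * coeff a 0 * deriv z 0" using x0(1) by simp
  \<comment> \<open>If y' vanished, the tangency would make the velocity proportional to the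
    position, so the curve would not be immersed in the projective plane.\<close>
  have y': "deriv y 0 \<noteq> 0"
  proof
    assume y': "deriv y 0 = 0"
    have "coeff a 0 * (z 0 * deriv x 0 - x 0 * deriv z 0) = 0" using t unfolding y' by algebra
    then have zx: "z 0 * deriv x 0 - x 0 * deriv z 0 = 0" using a0 by (simp only: mult_eq_0_iff simp_thms)
    have "deriv z 0 * \<gamma> 0 $ i + (- z 0) * deriv_vec \<gamma> 0 $ i = 0" for i
    proof -
      have "\<forall>i. deriv z 0 * \<gamma> 0 $ i + (- z 0) * deriv_vec \<gamma> 0 $ i = 0"
        unfolding forall_3 dv x_def[THEN fun_cong, symmetric] y_def[THEN fun_cong, symmetric] z_def[THEN fun_cong, symmetric] y' v0(2)
        using zx by (intro conjI) (algebra | simp)+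
      then show ?thesis by blast
    qed
    then have "deriv z 0 *s \<gamma> 0 + (- z 0) *s deriv_vec \<gamma> 0 = 0" by (simp add: vec_eq_iff)
    then have "- z 0 = 0" using ind unfolding indep_def by blast
    then show False using x0(2) by simp
  qed
  have l0: "l $ 1 \<noteq> 0 \<or> l $ 2 \<noteq> 0 \<or> l $ 3 \<noteq> 0" using l(1) by (simp add: vec_eq_iff forall_3)
  have "coeff a 0 * coeff b 1 - coeff a 1 * coeff b 0 = 0"
  proof (rule inflection_aux[OF x0 a0 y' l0 E t])
    show "deriv z 0 * (x 0 ^ 5 * coeff a 0 * deriv x 0 + x 0 ^ 5 * coeff b 0 * deriv y 0) +
      z 0 * ((5 * coeff a 0 * x 0 ^ 4 * deriv x 0 + coeff a 1 * x 0 ^ 4 * deriv y 0) * deriv x 0 + x 0 ^ 5 * coeff a 0 * deriv (deriv x) 0 +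
        ((5 * coeff b 0 * x 0 ^ 4 * deriv x 0 + coeff b 1 * x 0 ^ 4 * deriv y 0) * deriv y 0 + x 0 ^ 5 * coeff b 0 * deriv (deriv y) 0)) -
      ((deriv x 0 * (x 0 ^ 5 * coeff a 0) + x 0 * (5 * coeff a 0 * x 0 ^ 4 * deriv x 0 + coeff a 1 * x 0 ^ 4 * deriv y 0) + deriv y 0 * (x 0 ^ 5 * coeff b 0)) * deriv z 0 +
        x 0 * (x 0 ^ 5 * coeff a 0) * deriv (deriv z) 0) = 0"
      using d unfolding AB unfolding v0(2) A'_def[symmetric] B'_def[symmetric] by algebra
  qed
  then have "poly (wronsk a b) 0 = 0" by (simp add: wronsk_def poly_0_coeff_0 coeff_pderiv coeff_mult_0)
  then have "crit w (1, 0)" using crit_finite_iff[OF ab w, of 0] by simp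
  then show False using neg by blast
qed

text \<open>Unlike \<open>lconj_conjugate\<close> this keeps the inverse matrix and the formula for
  the second coordinate of N v, from which \<open>convexI\<close> sees that its inflection point
  moves to y = 0.\<close>

lemma pulls_conj_forms:
  assumes P: "pulls p q r s k w' w"
  obtains M N where "conj_forms (hom_form w) (hom_form w') M N k" "conj_forms (hom_form w') (hom_form w) N M (1 / k)"
    "\<And>v. (N *v v) $ 2 = (p * v $ 2 - r * v $ 1) / (p * s - q * r)"
proof
  define d where "d = p * s - q * r"
  have d: "d \<noteq> 0" and k: "k \<noteq> 0" using P by (simp_all add: pulls_def d_def)
  define i where "i = inverse d"
  have i: "i * d = 1" using d by (simp add: i_def)
  define M :: "complex^3^3" where "M = vector [vector [p, q, 0], vector [r, s, 0], vector [0, 0, 1]]"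
  define N :: "complex^3^3" where "N = vector [vector [s * i, - q * i, 0], vector [- r * i, p * i, 0], vector [0, 0, 1]]"
  have Mv: "(M *v v) $ 1 = p * v $ 1 + q * v $ 2" "(M *v v) $ 2 = r * v $ 1 + s * v $ 2" "(M *v v) $ 3 = v $ 3" for v
    by (simp_all add: M_def matrix_vector_mult_def sum_3)
  have Nv: "(N *v v) $ 1 = s * i * v $ 1 + - q * i * v $ 2" "(N *v v) $ 2 = - r * i * v $ 1 + p * i * v $ 2" "(N *v v) $ 3 = v $ 3" for v
    by (simp_all add: N_def matrix_vector_mult_def sum_3)
  have MN: "M *v (N *v v) = v" "N *v (M *v v) = v" for v
  proof -
    have "\<forall>j. (M *v (N *v v)) $ j = v $ j"
      unfolding forall_3 Mv Nv using i unfolding d_def by (intro conjI refl) algebra+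
    moreover have "\<forall>j. (N *v (M *v v)) $ j = v $ j"
      unfolding forall_3 Mv Nv using i unfolding d_def by (intro conjI refl) algebra+
    ultimately show "M *v (N *v v) = v" "N *v (M *v v) = v" by (simp_all add: vec_eq_iff)
  qed
  have c: "pair (hom_form w' (M *v u)) (M *v v) = k * pair (hom_form w u) v" for u v
  proof -
    have "k * pair (hom_form w u) v = u $ 3 * ((k * fst w (u $ 1) (u $ 2)) * v $ 1 + (k * snd w (u $ 1) (u $ 2)) * v $ 2) -
       (u $ 1 * (k * fst w (u $ 1) (u $ 2)) + u $ 2 * (k * snd w (u $ 1) (u $ 2))) * v $ 3"
      by (simp add: pair_hom_form algebra_simps)
    then show ?thesis unfolding pullsD[OF P] pair_hom_form Mv by algebra
  qed
  show "conj_forms (hom_form w) (hom_form w') M N k" by unfold_locales (rule MN k c)+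
  have c': "pair (hom_form w (N *v u)) (N *v v) = 1 / k * pair (hom_form w' u) v" for u v
    using c[of "N *v u" "N *v v"] k unfolding MN by simp
  then show "conj_forms (hom_form w') (hom_form w) N M (1 / k)" 
    by unfold_locales (rule MN c' | simp add: k)+
  show "(N *v v) $ 2 = (p * v $ 2 - r * v $ 1) / (p * s - q * r)" for v
    unfolding Nv d_def[symmetric] by (simp add: i_def divide_inverse algebra_simps)
qed

text \<open>The direction of the inflection point is turned to (1, 0). At infinity the leaf stays in
  the line at infinity; otherwise \<open>inflection_crit\<close> and the hypothesis on critical
  directions make the line y = 0 invariant, and the leaf stays in it.\<close>

theorem convexI:
  assumes w: "hform w" "simple_tang w" and crit: "\<And>v. v \<noteq> (0, 0) \<Longrightarrow> crit w v \<Longrightarrow> tang w v = 0"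
  shows "convex_foliation (hom_form w)"
  unfolding convex_foliation_def
proof (intro conjI allI impI ballI notI foliation_hom_form w)
  fix p q assume p: "regular_point (hom_form w) p \<and> \<not> in_straight_line (leaf (hom_form w) p)"
    and q: "q \<in> leaf (hom_form w) p" "inflection_point (hom_form w) q"
  have "\<not> (q $ 1 = 0 \<and> q $ 2 = 0)" using q(2) unfolding inflection_point_def regular_point_def hom_form_eq_0[OF w(1)] by blast
  then have v: "(q $ 1, q $ 2) \<noteq> (0, 0)" by simp
  obtain q' s where d: "q $ 1 * s - q' * q $ 2 \<noteq> 0" using det_complete[OF v] unfolding fst_conv snd_conv .
  obtain w1 where P: "pulls (q $ 1) q' (q $ 2) s 1 w w1" using pulls_exists[OF d] by blast
  have w1: "hform w1" "simple_tang w1" by (rule hform_pulls[OF P w(1)], rule simple_tang_pulls[OF P w(2)])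
  obtain M N where MN: "conj_forms (hom_form w1) (hom_form w) M N 1" "conj_forms (hom_form w) (hom_form w1) N M (1 / 1)"
    and N2: "\<And>v. (N *v v) $ 2 = (q $ 1 * v $ 2 - q $ 2 * v $ 1) / (q $ 1 * s - q' * q $ 2)"
    using pulls_conj_forms[OF P] by blast
  interpret A: conj_forms "hom_form w1" "hom_form w" M N 1 by (rule MN)
  interpret B: conj_forms "hom_form w" "hom_form w1" N M "1 / 1" by (rule MN)
  have l: "N *v q \<in> leaf (hom_form w1) (N *v p)" by (rule B.leaf_transport[OF q(1)])
  have i: "inflection_point (hom_form w1) (N *v q)" by (rule B.inflection_transport[OF q(2)])
  have q2: "(N *v q) $ 2 = 0" unfolding N2 by simp
  have "in_straight_line (leaf (hom_form w1) (N *v p))"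
  proof (cases "(N *v q) $ 3 = 0")
    case True
    show ?thesis by (rule leaf_in_line[OF _ l True]) (rule path_infinity[OF w1(1)])
  next
    case False
    have "(N *v q) $ 1 \<noteq> 0"
      using i q2 unfolding inflection_point_def regular_point_def hom_form_eq_0[OF w1(1)] by blast
    from inflection_crit[OF w1(1) i q2 this False] have "tang w1 (1, 0) = 0"
    proof
      assume "crit w1 (1, 0)"
      then have "crit w (q $ 1, q $ 2)" using crit_pulls[OF P, of 1 0] by simp
      then have "tang w (q $ 1, q $ 2) = 0" by (rule crit[OF v])
      then show ?thesis using tang_pulls[OF P, of "(1, 0)"] by simp
    qed
    then show ?thesis by (intro leaf_in_line[OF _ l q2]) (rule path_line[OF w1])
  qed
  then have "in_straight_line ((\<lambda>p. M *v p) ` leaf (hom_form w1) (N *v p))" by (rule A.line_transport)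
  moreover have "leaf (hom_form w) p \<subseteq> (\<lambda>p. M *v p) ` leaf (hom_form w1) (N *v p)"
  proof
    fix u assume "u \<in> leaf (hom_form w) p"
    then have "N *v u \<in> leaf (hom_form w1) (N *v p)" by (rule B.leaf_transport)
    then have "M *v (N *v u) \<in> (\<lambda>p. M *v p) ` leaf (hom_form w1) (N *v p)" by blast
    then show "u \<in> (\<lambda>p. M *v p) ` leaf (hom_form w1) (N *v p)" unfolding A.MN .
  qed
  ultimately have "in_straight_line (leaf (hom_form w) p)" unfolding in_straight_line_def by blast
  then show False using p by blast
qed

section \<open>The multiset of multiplicities as an invariant\<close>

definition has_type :: "form2 \<Rightarrow> nat list \<Rightarrow> bool" where
  "has_type w ms \<longleftrightarrow> hform w \<and> simple_tang w \<and> (\<exists>L. cdata w L \<and> map fst L = ms)"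

lemma has_type_lconj:
  assumes "lconj w w'" "has_type w ms"
  shows "has_type w' ms"
proof -
  obtain p q r s k where P1: "pulls p q r s k w' w" using assms(1) unfolding lconj_def by blast
  obtain p' q' r' s' k' where P2: "pulls p' q' r' s' k' w w'" using lconj_sym[OF assms(1)] unfolding lconj_def by blast
  obtain L where L: "hform w" "simple_tang w" "cdata w L" "map fst L = ms" using assms(2) unfolding has_type_def by blast
  have "map fst (map (\<lambda>(m, v). (m, p * fst v + q * snd v, r * fst v + s * snd v)) L) = ms"
    using L(4) by (simp add: o_def case_prod_unfold)
  then show ?thesis
    unfolding has_type_def using hform_pulls[OF P2 L(1)] simple_tang_pulls[OF P2 L(2)] cdata_pulls[OF P1 L(3)] by blast
qed

lemma cross_trans:
  assumes "cross u v = 0" "cross u' v = 0" "v \<noteq> (0, 0)"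
  shows "cross u u' = 0"
proof -
  have "fst v * cross u u' = 0" "snd v * cross u u' = 0" using assms(1,2) unfolding cross_def by algebra+
  moreover have "fst v \<noteq> 0 \<or> snd v \<noteq> 0" using assms(3) by (auto simp: prod_eq_iff)
  ultimately show ?thesis by (metis mult_eq_0_iff)
qed

text \<open>By \<open>cdata_complete\<close> each entry of L of multiplicity at least k has the
  direction of an entry of L' whose multiplicity is no smaller, and distinctness of the directions
  makes this matching injective. Counting above thresholds avoids any comparison of
  orderings.\<close>

lemma type_count_le:
  assumes w: "hform w" and L: "cdata w L" and L': "cdata w L'" and k: "1 \<le> k"
  shows "length (filter (\<lambda>m. k \<le> m) (map fst L)) \<le> length (filter (\<lambda>m. k \<le> m) (map fst L'))"
proof -
  define F F' where "F = filter (\<lambda>x. k \<le> fst x) L" and "F' = filter (\<lambda>x. k \<le> fst x) L'"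
  have entry: "fst x \<ge> 1 \<and> snd x \<noteq> (0, 0) \<and> fixmult (fst x) w (snd x)" if "x \<in> set L" for x
    using L that unfolding cdata_def by (cases x) auto
  have entry': "snd x \<noteq> (0, 0)" if "x \<in> set L'" for x
    using L' that unfolding cdata_def by (cases x) auto
  have sw: "sorted_wrt (\<lambda>x y. cross (snd x) (snd y) \<noteq> 0) L" using L unfolding cdata_def by blast
  have uniq: "x = y" if xy: "x \<in> set L" "y \<in> set L" "cross (snd x) (snd y) = 0" for x y
  proof -
    obtain i j where ij: "i < length L" "j < length L" "x = L ! i" "y = L ! j" using xy(1,2) by (metis in_set_conv_nth)
    have "\<not> i < j" using sorted_wrt_nth_less[OF sw, of i j] ij xy(3) by blast
    moreover have "\<not> j < i"
    proof
      assume "j < i"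
      then have "cross (snd y) (snd x) \<noteq> 0" using sorted_wrt_nth_less[OF sw, of j i] ij by blast
      then show False using cross_commute xy(3) by blast
    qed
    ultimately show ?thesis using ij by (metis linorder_neqE_nat)
  qed
  have dist: "distinct L"
    unfolding distinct_conv_nth
  proof (intro allI impI)
    fix i j assume ij: "i < length L" "j < length L" "i \<noteq> j"
    have c0: "cross v v = 0" for v by (simp add: cross_def)
    show "L ! i \<noteq> L ! j"
    proof (cases "i < j")
      case True
      show ?thesis using sorted_wrt_nth_less[OF sw True ij(2)] c0 by metis
    next
      case False
      then have "j < i" using ij(3) by simp
      from sorted_wrt_nth_less[OF sw this ij(1)] show ?thesis using c0 by metis
    qed
  qed
  have ex: "\<exists>z. z \<in> set F' \<and> cross (snd x) (snd z) = 0" if "x \<in> set F" for x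
  proof -
    have x: "x \<in> set L" "k \<le> fst x" using that by (auto simp: F_def)
    have e: "snd x \<noteq> (0, 0)" "fixmult (fst x) w (snd x)" "1 \<le> fst x" using entry[OF x(1)] by blast+
    from cdata_complete(2)[OF w L' e(1,2,3)] obtain m' v' where z: "(m', v') \<in> set L'" "cross (snd x) v' = 0" "fst x \<le> m'" by blast
    have "(m', v') \<in> set F'" using z(1,3) x(2) by (simp add: F'_def)
    then show ?thesis using z(2) by (intro exI[of _ "(m', v')"]) simp
  qed
  then obtain f where f: "\<And>x. x \<in> set F \<Longrightarrow> f x \<in> set F' \<and> cross (snd x) (snd (f x)) = 0" by metis
  have "inj_on f (set F)"
  proof (rule inj_onI)
    fix x y assume xy: "x \<in> set F" "y \<in> set F" "f x = f y"
    have "snd (f x) \<noteq> (0, 0)" using f[OF xy(1)] entry' by (auto simp: F'_def)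
    then have "cross (snd x) (snd y) = 0" using cross_trans[of "snd x" "snd (f x)" "snd y"] f[OF xy(1)] f[OF xy(2)] xy(3) by metis
    then show "x = y" using uniq xy(1,2) by (simp add: F_def)
  qed
  moreover have "f ` set F \<subseteq> set F'" using f by blast
  ultimately have "card (set F) \<le> card (set F')" by (intro card_inj_on_le) auto
  moreover have "card (set F) = length F" using dist by (intro distinct_card) (simp add: F_def)
  moreover have "card (set F') \<le> length F'" by (rule card_length)
  ultimately have "length F \<le> length F'" by simp
  then show ?thesis by (simp add: F_def F'_def filter_map o_def)
qed

lemma type_count:
  assumes "lconj w w'" "has_type w ms" "has_type w' ms'" "1 \<le> k"
  shows "length (filter (\<lambda>m. k \<le> m) ms) = length (filter (\<lambda>m. k \<le> m) ms')"
proof -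
  obtain L L' where L: "cdata w' L" "map fst L = ms" "hform w'" "cdata w' L'" "map fst L' = ms'"
    using has_type_lconj[OF assms(1,2)] assms(3) unfolding has_type_def by blast
  show ?thesis using type_count_le[OF L(3,1,4) assms(4)] type_count_le[OF L(3,4,1) assms(4)] unfolding L(2,5) by simp
qed

text \<open>A critical direction is proportional to a listed one by completeness, and all listed
  directions are fixed.\<close>

lemma has_type_crit_fixed:
  assumes "has_type w ms" "v \<noteq> (0, 0)" "crit w v"
  shows "tang w v = 0"
proof -
  obtain L where w: "hform w" "cdata w L" using assms(1) unfolding has_type_def by blast
  obtain m u where u: "(m, u) \<in> set L" "cross v u = 0" using cdata_complete(1)[OF w assms(2,3)] by blast
  then have "u \<noteq> (0, 0)" "fixmult m w u" using w(2) unfolding cdata_def by auto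
  then obtain h where h: "\<And>x y. fst u * fst w x y + snd u * snd w x y = (snd u * x - fst u * y) ^ (m + 1) * h x y"
    unfolding fixmult_def by blast
  have c: "snd u * fst v - fst u * snd v = 0" using u(2) unfolding cross_def by algebra
  have z: "fst u * fst w (fst v) (snd v) + snd u * snd w (fst v) (snd v) = 0" unfolding h c by simp
  have "fst u * tang w v = 0" "snd u * tang w v = 0" using z c unfolding tang_def by algebra+
  moreover have "fst u \<noteq> 0 \<or> snd u \<noteq> 0" using \<open>u \<noteq> (0, 0)\<close> by (auto simp: prod_eq_iff)
  ultimately show ?thesis by (metis mult_eq_0_iff)
qed

text \<open>With b5 = 0 the direction (0, 1) is fixed; there a5 nonzero excludes a common zero and
  a5 + b4 nonzero excludes a double zero of \<open>tang\<close>. At finite slope both are excluded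
  by \<open>common\<close> and \<open>simple\<close>, which explicit polynomial cofactors settle
  case by case.\<close>

lemma has_typeI:
  assumes w: "w = (homog 5 [:a0, a1, a2, a3, a4, a5:], homog 5 [:b0, b1, b2, b3, b4, 0:])"
    and a5: "a5 \<noteq> 0" "a5 + b4 \<noteq> 0"
    and common: "\<And>t. a0 + a1 * t + a2 * t ^ 2 + a3 * t ^ 3 + a4 * t ^ 4 + a5 * t ^ 5 = 0 \<Longrightarrow>
       b0 + b1 * t + b2 * t ^ 2 + b3 * t ^ 3 + b4 * t ^ 4 = 0 \<Longrightarrow> False"
    and simple: "\<And>t. a0 + (a1 + b0) * t + (a2 + b1) * t ^ 2 + (a3 + b2) * t ^ 3 + (a4 + b3) * t ^ 4 + (a5 + b4) * t ^ 5 = 0 \<Longrightarrow>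
       (a1 + b0) + 2 * (a2 + b1) * t + 3 * (a3 + b2) * t ^ 2 + 4 * (a4 + b3) * t ^ 3 + 5 * (a5 + b4) * t ^ 4 = 0 \<Longrightarrow> False"
    and L: "cdata w L"
  shows "has_type w (map fst L)"
proof -
  have d: "degree [:a0, a1, a2, a3, a4, a5:] \<le> 5" "degree [:b0, b1, b2, b3, b4, 0:] \<le> 5"
    by (intro degree_le_5I; simp add: coeff_pCons split: nat.splits)+
  have "x = 0 \<and> y = 0" if A: "homog 5 [:a0, a1, a2, a3, a4, a5:] x y = 0" and B: "homog 5 [:b0, b1, b2, b3, b4, 0:] x y = 0" for x y
  proof (cases "x = 0")
    case True
    then show ?thesis using A a5(1) by (simp add: homog_5_pCons)
  next
    case False
    have "poly [:a0, a1, a2, a3, a4, a5:] (y / x) = 0" "poly [:b0, b1, b2, b3, b4, 0:] (y / x) = 0"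
      using A B False unfolding homog_nonzero_left[OF d(1) False] homog_nonzero_left[OF d(2) False] by simp_all
    then have "a0 + a1 * (y / x) + a2 * (y / x) ^ 2 + a3 * (y / x) ^ 3 + a4 * (y / x) ^ 4 + a5 * (y / x) ^ 5 = 0"
       "b0 + b1 * (y / x) + b2 * (y / x) ^ 2 + b3 * (y / x) ^ 3 + b4 * (y / x) ^ 4 = 0"
      unfolding poly_pCons poly_0 by algebra+
    then show ?thesis using common by blast
  qed
  then have "hform w" unfolding hform_def w fst_conv snd_conv using bform_homog[OF d(1)] bform_homog[OF d(2)] by blast
  moreover have "simple_tang w"
  proof (rule simple_tangI[OF _ _ d])
    show "fst w = homog 5 [:a0, a1, a2, a3, a4, a5:]" "snd w = homog 5 [:b0, b1, b2, b3, b4, 0:]" by (simp_all add: w)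
    have c: "[:a0, a1, a2, a3, a4, a5:] + [:0, 1:] * [:b0, b1, b2, b3, b4, 0:] = [:a0, a1 + b0, a2 + b1, a3 + b2, a4 + b3, a5 + b4:]"
      by simp
    fix t assume z: "poly ([:a0, a1, a2, a3, a4, a5:] + [:0, 1:] * [:b0, b1, b2, b3, b4, 0:]) t = 0"
    show "poly (pderiv ([:a0, a1, a2, a3, a4, a5:] + [:0, 1:] * [:b0, b1, b2, b3, b4, 0:])) t \<noteq> 0"
    proof
      assume z': "poly (pderiv ([:a0, a1, a2, a3, a4, a5:] + [:0, 1:] * [:b0, b1, b2, b3, b4, 0:])) t = 0"
      show False
      proof (rule simple)
        show "a0 + (a1 + b0) * t + (a2 + b1) * t ^ 2 + (a3 + b2) * t ^ 3 + (a4 + b3) * t ^ 4 + (a5 + b4) * t ^ 5 = 0"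
          using z unfolding c poly_pCons poly_0 by algebra
        show "a1 + b0 + 2 * (a2 + b1) * t + 3 * (a3 + b2) * t ^ 2 + 4 * (a4 + b3) * t ^ 3 + 5 * (a5 + b4) * t ^ 4 = 0"
          using z' unfolding c pderiv_pCons pderiv_0 poly_add poly_pCons poly_0 by algebra
      qed
    qed
  next
    show "coeff [:a0, a1, a2, a3, a4, a5:] 5 + coeff [:b0, b1, b2, b3, b4, 0:] 4 \<noteq> 0"
      using a5(2) by (simp add: eval_nat_numeral)
  qed
  ultimately show ?thesis using L unfolding has_type_def by blast
qed

section \<open>The fourteen pairs of forms\<close>

lemma sqrt_consts: "sqrt5 ^ 2 = 5" "sqrt21 ^ 2 = 21"
  unfolding sqrt5_def sqrt21_def of_real_power[symmetric] by simp_all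

abbreviation (input) "pt t \<equiv> (1 :: complex, t :: complex)"

lemma cross_pt: "cross (1, s) (1, t) = 0 \<longleftrightarrow> s = t"
  by (auto simp: cross_def)

lemma cdata_1: "cdata (omega 1) [(4, 0, 1), (4, pt 0)]"
proof -
  have "fixmult 4 (omega 1) (0, 1)" "fixmult 4 (omega 1) (1, 0)"
    unfolding omega_homog fixmult_infinity[OF refl] fixmult_zero[OF refl] by simp_all
  then show ?thesis by (simp add: cdata_def cross_def)
qed

lemma cdata_2: "cdata (omega 2) [(4, pt (- 1)), (3, 0, 1), (1, pt 0)]"
proof -
  have "fixmult 4 (omega 2) (1, - 1)" "fixmult 3 (omega 2) (0, 1)" "fixmult 1 (omega 2) (1, 0)"
    unfolding omega_homog fixmult_infinity[OF refl] fixmult_zero[OF refl] fixmult_coeffs[OF refl] by simp_all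
  then show ?thesis by (simp add: cdata_def cross_def)
qed

lemma cdata_3: "cdata (omega 3) [(4, pt (- 1)), (2, 0, 1), (2, pt 0)]"
proof -
  have "fixmult 4 (omega 3) (1, - 1)" "fixmult 2 (omega 3) (0, 1)" "fixmult 2 (omega 3) (1, 0)"
    unfolding omega_homog fixmult_infinity[OF refl] fixmult_zero[OF refl] fixmult_coeffs[OF refl] by simp_all
  then show ?thesis by (simp add: cdata_def cross_def)
qed

lemma cdata_4: "cdata (omega 4) [(3, 0, 1), (3, pt 0), (2, pt 1)]"
proof -
  have "fixmult 3 (omega 4) (0, 1)" "fixmult 3 (omega 4) (1, 0)" "fixmult 2 (omega 4) (1, 1)"
    unfolding omega_homog fixmult_infinity[OF refl] fixmult_zero[OF refl] fixmult_coeffs[OF refl] by simp_all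
  then show ?thesis by (simp add: cdata_def cross_def)
qed

lemma cdata_5: "cdata (omega 5) [(4, 0, 1), (2, pt 0), (1, pt 1), (1, pt (- 1))]"
proof -
  have "fixmult 4 (omega 5) (0, 1)" "fixmult 2 (omega 5) (1, 0)" "fixmult 1 (omega 5) (1, 1)" "fixmult 1 (omega 5) (1, - 1)"
    unfolding omega_homog fixmult_infinity[OF refl] fixmult_zero[OF refl] fixmult_coeffs[OF refl] by simp_all
  then show ?thesis by (simp add: cdata_def cross_def)
qed

text \<open>The simple directions are the roots of 3 t^2 - 11 t + 11, whose discriminant is -
  11.\<close>

lemma cdata_6:
  obtains s s' where "cdata (omega 6) [(4, 0, 1), (2, pt 0), (1, pt s), (1, pt s')]" "s \<noteq> 0" "s' \<noteq> 0"
proof -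
  obtain u :: complex where u: "u ^ 2 = - 11" by (metis power2_csqrt)
  define s s' where "s = (11 + u) / 6" and "s' = (11 - u) / 6"
  have e: "3 * s ^ 2 - 11 * s + 11 = 0" "3 * s' ^ 2 - 11 * s' + 11 = 0"
    unfolding s_def s'_def power2_eq_square using u[unfolded power2_eq_square] by (simp_all add: field_simps)
  have "u \<noteq> 0" using u by auto
  have "s \<noteq> s'"
  proof
    assume "s = s'"
    then have "11 + u = 11 - u" by (simp add: s_def s'_def)
    then have "2 * u = 0" by algebra
    then show False using \<open>u \<noteq> 0\<close> by simp
  qed
  moreover have "s \<noteq> 0" "s' \<noteq> 0" using e by auto
  ultimately have n: "s \<noteq> s'" "s \<noteq> 0" "s' \<noteq> 0" by blast+
  have "fixmult 4 (omega 6) (0, 1)" "fixmult 2 (omega 6) (1, 0)"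
    unfolding omega_homog fixmult_infinity[OF refl] fixmult_zero[OF refl] by simp_all
  moreover have "fixmult 1 (omega 6) (1, s)"
    unfolding omega_homog fixmult_coeffs[OF refl] using e(1) by (intro conjI; algebra)
  moreover have "fixmult 1 (omega 6) (1, s')"
    unfolding omega_homog fixmult_coeffs[OF refl] using e(2) by (intro conjI; algebra)
  ultimately have "cdata (omega 6) [(4, 0, 1), (2, pt 0), (1, pt s), (1, pt s')]"
    using n by (simp add: cdata_def cross_def)
  then show thesis using that n by blast
qed

lemma cdata_7_8:
  obtains s s' where "cdata (omega 7) [(3, 0, 1), (3, pt 0), (1, pt 1), (1, pt s)]"
    "cdata (omega 8) [(3, 0, 1), (3, pt 0), (1, pt 1), (1, pt s')]" "s \<noteq> 0" "s' \<noteq> 0"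
proof -
  define s s' where "s = (3 - sqrt5) / 2" and "s' = (sqrt21 - 5) / 2"
  \<comment> \<open>Expressing the square roots through the slopes leaves one quadratic relation for
    each form.\<close>
  have q: "sqrt5 = 3 - 2 * s" "sqrt21 = 2 * s' + 5" by (simp_all add: s_def s'_def field_simps)
  have e: "s ^ 2 - 3 * s + 1 = 0" "s' ^ 2 + 5 * s' + 1 = 0"
    unfolding s_def s'_def power2_eq_square using sqrt_consts[unfolded power2_eq_square] by (simp_all add: field_simps)
  then have n: "s \<noteq> 1" "s \<noteq> 0" "s' \<noteq> 1" "s' \<noteq> 0" by auto
  have "fixmult 3 (omega 7) (0, 1)" "fixmult 3 (omega 7) (1, 0)" "fixmult 3 (omega 8) (0, 1)" "fixmult 3 (omega 8) (1, 0)"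
    unfolding omega_homog fixmult_infinity[OF refl] fixmult_zero[OF refl] by simp_all
  moreover have "fixmult 1 (omega 7) (1, 1)" "fixmult 1 (omega 8) (1, 1)"
    unfolding omega_homog fixmult_coeffs[OF refl] by (simp_all add: algebra_simps)
  moreover have "fixmult 1 (omega 7) (1, s)"
    unfolding omega_homog fixmult_coeffs[OF refl] q using e(1) by (intro conjI; algebra)
  moreover have "fixmult 1 (omega 8) (1, s')"
    unfolding omega_homog fixmult_coeffs[OF refl] q using e(2) by (intro conjI; algebra)
  ultimately have "cdata (omega 7) [(3, 0, 1), (3, pt 0), (1, pt 1), (1, pt s)]"
    "cdata (omega 8) [(3, 0, 1), (3, pt 0), (1, pt 1), (1, pt s')]"
    using n by (simp_all add: cdata_def cross_def)
  then show thesis using that n by blast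
qed

lemma cdata_9:
  assumes \<alpha>: "\<alpha> ^ 4 + 310 * \<alpha> ^ 2 = 375"
  obtains s where "cdata (form9 \<alpha>) [(3, 0, 1), (2, pt 0), (2, pt 1), (1, pt s)]" "s \<noteq> 0" "s \<noteq> 1"
proof -
  \<comment> \<open>The solution of 4 \<open>\<alpha>\<close> (2 s - 1) = \<open>\<alpha>\<close> ^
    2 - 5, made polynomial in \<open>\<alpha>\<close> by 1 / \<open>\<alpha>\<close> =
    (\<open>\<alpha>\<close> ^ 3 + 310 \<open>\<alpha>\<close>) / 375.\<close>
  define s where "s = 1 / 2 - (\<alpha> ^ 3 + 235 * \<alpha>) / 600"
  have s: "600 * (2 * s - 1) = - 2 * (\<alpha> ^ 3 + 235 * \<alpha>)" unfolding s_def by (simp add: field_simps)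
  have R1: "4 * \<alpha> * (2 * s - 1) = \<alpha> ^ 2 - 5"
  proof -
    have "600 * (4 * \<alpha> * (2 * s - 1) - (\<alpha> ^ 2 - 5)) = 0" using s \<alpha> by algebra
    then have "4 * \<alpha> * (2 * s - 1) - (\<alpha> ^ 2 - 5) = 0" by (rule mult_zeroD) simp
    then show ?thesis by (rule iffD1[OF right_minus_eq])
  qed
  have R2: "15 * (2 * s - 1) ^ 2 = \<alpha> ^ 2 + 10"
  proof -
    have "(600 * (2 * s - 1)) ^ 2 = 4 * (60000 + 6000 * \<alpha> ^ 2)" unfolding s
    proof -
      have "(- 2 * (\<alpha> ^ 3 + 235 * \<alpha>)) ^ 2 = 4 * (60000 + 6000 * \<alpha> ^ 2) + 4 * (\<alpha> ^ 2 + 160) * (\<alpha> ^ 4 + 310 * \<alpha> ^ 2 - 375)" by algebra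
      then show "(- 2 * (\<alpha> ^ 3 + 235 * \<alpha>)) ^ 2 = 4 * (60000 + 6000 * \<alpha> ^ 2)" unfolding \<alpha> by simp
    qed
    then have "24000 * (15 * (2 * s - 1) ^ 2 - (\<alpha> ^ 2 + 10)) = 0" by algebra
    then have "15 * (2 * s - 1) ^ 2 - (\<alpha> ^ 2 + 10) = 0" by (rule mult_zeroD) simp
    then show ?thesis by (rule iffD1[OF right_minus_eq])
  qed
  have a0: "\<alpha> \<noteq> 0" using \<alpha> by auto
  have e: "15 * (s * (s - 1)) = \<alpha> * (2 * s - 1)"
  proof -
    have "4 * (15 * (s * (s - 1)) - \<alpha> * (2 * s - 1)) = 0" using R1 R2 by algebra
    then have "15 * (s * (s - 1)) - \<alpha> * (2 * s - 1) = 0" by (rule mult_zeroD) simp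
    then show ?thesis by (rule iffD1[OF right_minus_eq])
  qed
  have n: "s \<noteq> 0" "s \<noteq> 1" using e a0 by auto
  have "fixmult 3 (form9 \<alpha>) (0, 1)" "fixmult 2 (form9 \<alpha>) (1, 0)"
    unfolding form9_def fixmult_infinity[OF refl] fixmult_zero[OF refl] by simp_all
  moreover have "fixmult 2 (form9 \<alpha>) (1, 1)"
    unfolding form9_def fixmult_coeffs[OF refl] by (simp add: algebra_simps)
  moreover have "fixmult 1 (form9 \<alpha>) (1, s)"
    unfolding form9_def fixmult_coeffs[OF refl]
  proof (intro conjI)
    let ?A = "0 + s * - (1 - \<alpha>) + (0 + s * (- 2 * \<alpha>)) * s + (0 + s * 0) * s ^ 2 + (2 * (5 + \<alpha>) + s * 0) * s ^ 3 + (- (15 + \<alpha>) + s * 0) * s ^ 4 + (6 + s * 0) * s ^ 5"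
    have "32 * ?A = 0" using R1 R2 by algebra
    then show "?A = 0" by (rule mult_zeroD) simp
    let ?B = "0 + s * (- 2 * \<alpha>) + 2 * (0 + s * 0) * s + 3 * (2 * (5 + \<alpha>) + s * 0) * s ^ 2 + 4 * (- (15 + \<alpha>) + s * 0) * s ^ 3 + 5 * (6 + s * 0) * s ^ 4"
    have "32 * ?B = 0" using R1 R2 by algebra
    then show "?B = 0" by (rule mult_zeroD) simp
  qed
  ultimately have "cdata (form9 \<alpha>) [(3, 0, 1), (2, pt 0), (2, pt 1), (1, pt s)]"
    using n by (simp add: cdata_def cross_def)
  then show thesis using that n by blast
qed

lemma cdata_11: "cdata (omega 11) [(2, 0, 1), (2, pt 0), (2, pt 1), (2, pt (- 1))]"
proof -
  have "fixmult 2 (omega 11) (0, 1)" "fixmult 2 (omega 11) (1, 0)" "fixmult 2 (omega 11) (1, 1)" "fixmult 2 (omega 11) (1, - 1)"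
    unfolding omega_homog fixmult_infinity[OF refl] fixmult_zero[OF refl] fixmult_coeffs[OF refl] by simp_all
  then show ?thesis by (simp add: cdata_def cross_def)
qed

text \<open>The quintic of this Newton map factors as t (t^2 - 1)(3 t^2 - 7); the last factor gives
  the two simple directions.\<close>

lemma cdata_12:
  fixes w :: form2 and u :: complex
  assumes w: "w = (homog 5 [:0, 0, 0, 20, 0, - 12:], homog 5 [:7, 0, - 30, 0, 15, 0:])" and u: "3 * u ^ 2 = 7"
  shows "cdata w [(2, pt 0), (2, pt 1), (2, pt (- 1)), (1, pt u), (1, pt (- u))]"
proof -
  have i: "fixmult 1 w (1, t)" if "3 * t ^ 2 = 7" for t
    unfolding w fixmult_coeffs[OF refl]
  proof (intro conjI)
    have "0 + t * 7 + (0 + t * 0) * t + (0 + t * - 30) * t ^ 2 + (20 + t * 0) * t ^ 3 + (0 + t * 15) * t ^ 4 + (- 12 + t * 0) * t ^ 5 =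
      t * (t ^ 2 - 1) * (3 * t ^ 2 - 7)" by algebra
    then show "0 + t * 7 + (0 + t * 0) * t + (0 + t * - 30) * t ^ 2 + (20 + t * 0) * t ^ 3 + (0 + t * 15) * t ^ 4 + (- 12 + t * 0) * t ^ 5 = 0"
      unfolding that by simp
    show "0 + t * 0 + 2 * (0 + t * - 30) * t + 3 * (20 + t * 0) * t ^ 2 + 4 * (0 + t * 15) * t ^ 3 + 5 * (- 12 + t * 0) * t ^ 4 = 0"
      by (simp add: eval_nat_numeral)
  qed
  have n: "u \<noteq> 0" "u \<noteq> 1" "u \<noteq> - 1"
  proof -
    show "u \<noteq> 0" proof assume "u = 0" then show False using u by simp qed
    show "u \<noteq> 1" proof assume "u = 1" then show False using u by simp qed
    show "u \<noteq> - 1" proof assume "u = - 1" then show False using u by simp qed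
  qed
  have "u \<noteq> - u"
  proof
    assume "u = - u"
    then have "2 * u = 0" by algebra
    then show False using n(1) by simp
  qed
  have "fixmult 2 w (1, 0)" "fixmult 2 w (1, 1)" "fixmult 2 w (1, - 1)"
    unfolding w fixmult_zero[OF refl] fixmult_coeffs[OF refl] by simp_all
  moreover have "fixmult 1 w (1, u)" "fixmult 1 w (1, - u)" using u by (intro i; simp)+
  moreover have "1 \<noteq> - u"
  proof
    assume "1 = - u"
    then have "u = - 1" by (metis minus_minus)
    then show False using n(3) by blast
  qed
  ultimately show ?thesis using n n[symmetric] \<open>u \<noteq> - u\<close>
    by (simp add: cdata_def cross_pt)
qed

text \<open>The Newton map of t^5 - t: apart from 0, the marked directions are the fourth roots of
  unity.\<close>

lemma cdata_13:
  fixes w :: form2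
  assumes w: "w = (homog 5 [:0, 0, 0, 0, 0, - 4:], homog 5 [:- 1, 0, 0, 0, 5, 0:])"
  shows "cdata w [(4, pt 0), (1, pt 1), (1, pt (- 1)), (1, pt \<i>), (1, pt (- \<i>))]"
proof -
  have i: "fixmult 1 w (1, t)" if "t ^ 2 = - 1" for t
    unfolding w fixmult_coeffs[OF refl] using that by (intro conjI) (algebra | simp add: eval_nat_numeral algebra_simps)+
  have "fixmult 4 w (1, 0)" "fixmult 1 w (1, 1)" "fixmult 1 w (1, - 1)"
    unfolding w fixmult_zero[OF refl] fixmult_coeffs[OF refl] by simp_all
  moreover have "fixmult 1 w (1, \<i>)" "fixmult 1 w (1, - \<i>)" by (rule i; simp)+
  ultimately show ?thesis by (simp add: cdata_def cross_def complex_eq_iff)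
qed

text \<open>The quintic of this Newton map is t (t - 1)(3 t^3 - 2 t^2 - 2 t - 2), and the three
  simple directions are the roots of the cubic factor.\<close>

lemma cdata_14:
  fixes w :: form2
  assumes w: "w = (homog 5 [:0, 0, 0, 0, 15, - 12:], homog 5 [:2, 0, 0, - 20, 15, 0:])"
  obtains r1 r2 r3 where "cdata w [(3, pt 0), (2, pt 1), (1, pt r1), (1, pt r2), (1, pt r3)]"
proof -
  have "poly [:- 2, - 2, - 2, 3:] 0 \<noteq> poly [:- 2, - 2, - 2, 3 :: complex:] 1" by simp
  then have "\<not> constant (poly [:- 2, - 2, - 2, 3 :: complex:])" unfolding constant_def by blast
  then obtain r1 where "poly [:- 2, - 2, - 2, 3:] r1 = (0 :: complex)"
    using fundamental_theorem_of_algebra by blast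
  then have r1: "3 * r1 ^ 3 - 2 * r1 ^ 2 - 2 * r1 - 2 = 0" unfolding poly_pCons poly_0 by algebra
  \<comment> \<open>u is a square root of the discriminant of 3 t^2 + (3 r1 - 2) t + (3 r1^2 - 2 r1
    - 2), the quotient of the cubic by t - r1.\<close>
  obtain u where u: "u ^ 2 = (3 * r1 - 2) ^ 2 - 12 * (3 * r1 ^ 2 - 2 * r1 - 2)" by (metis power2_csqrt)
  define r2 r3 where "r2 = (2 - 3 * r1 + u) / 6" and "r3 = (2 - 3 * r1 - u) / 6"
  have d: "6 * r2 = 2 - 3 * r1 + u" "6 * r3 = 2 - 3 * r1 - u" by (simp_all add: r2_def r3_def)
  have c: "3 * r2 ^ 3 - 2 * r2 ^ 2 - 2 * r2 - 2 = 0" "3 * r3 ^ 3 - 2 * r3 ^ 2 - 2 * r3 - 2 = 0"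
  proof -
    have "216 * (3 * r2 ^ 3 - 2 * r2 ^ 2 - 2 * r2 - 2) = 0" using d(1) r1 u by algebra
    then show "3 * r2 ^ 3 - 2 * r2 ^ 2 - 2 * r2 - 2 = 0" by (rule mult_zeroD) simp
    have "216 * (3 * r3 ^ 3 - 2 * r3 ^ 2 - 2 * r3 - 2) = 0" using d(2) r1 u by algebra
    then show "3 * r3 ^ 3 - 2 * r3 ^ 2 - 2 * r3 - 2 = 0" by (rule mult_zeroD) simp
  qed
  have u0: "u \<noteq> 0"
  proof
    assume "u = 0"
    then have "(3 * r1 - 2) ^ 2 - 12 * (3 * r1 ^ 2 - 2 * r1 - 2) = 0" using u by simp
    then show False using r1 by algebra
  qed
  have n23: "r2 \<noteq> r3" using u0 by (simp add: r2_def r3_def)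
  have n1: "t \<noteq> r1" if t: "6 * t = 2 - 3 * r1 + v" "v ^ 2 = (3 * r1 - 2) ^ 2 - 12 * (3 * r1 ^ 2 - 2 * r1 - 2)" for t v
  proof
    assume "t = r1"
    then have t': "6 * r1 = 2 - 3 * r1 + v" using t(1) by blast
    have "9 * r1 - 2 - v = 6 * r1 - (2 - 3 * r1 + v)" by algebra
    then have "9 * r1 - 2 - v = 0" unfolding t' by simp
    then show False using t(2) r1 by algebra
  qed
  have n12: "r2 \<noteq> r1" by (rule n1[OF d(1) u])
  have "(- u) ^ 2 = (3 * r1 - 2) ^ 2 - 12 * (3 * r1 ^ 2 - 2 * r1 - 2)" using u by simp
  from n1[OF _ this] have n13: "r3 \<noteq> r1" using d(2) by simp
  have z: "t \<noteq> 0" "t \<noteq> 1" if "3 * t ^ 3 - 2 * t ^ 2 - 2 * t - 2 = 0" for t :: complex using that by auto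
  have fx: "fixmult 1 w (1, t)" if "3 * t ^ 3 - 2 * t ^ 2 - 2 * t - 2 = 0" for t
    unfolding w fixmult_coeffs[OF refl] using that by (intro conjI) (algebra | simp add: eval_nat_numeral algebra_simps)+
  have "fixmult 3 w (1, 0)" "fixmult 2 w (1, 1)"
    unfolding w fixmult_zero[OF refl] fixmult_coeffs[OF refl] by simp_all
  then have "cdata w [(3, pt 0), (2, pt 1), (1, pt r1), (1, pt r2), (1, pt r3)]"
    using fx[OF r1] fx[OF c(1)] fx[OF c(2)] z[OF r1] z[OF c(1)] z[OF c(2)] n12 n12[symmetric] n13 n13[symmetric] n23
      z[OF r1, symmetric] z[OF c(1), symmetric] z[OF c(2), symmetric]
    by (simp add: cdata_def cross_pt)
  then show thesis by (rule that)
qed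

text \<open>
  The multipliers in the following lemmas are Bezout cofactors over the field generated by the coefficients:
  \<open>common_n\<close> says that the two forms of number n have no common zero, and \<open>double_n\<close> that
  \<open>A(1, t) + t B(1, t)\<close> has no double root.
\<close>

lemma common_1:
  fixes t :: complex
  assumes "(1) * t ^ 5 = 0" "(((- 1)) :: complex) = 0"
  shows False
  using assms(2) by simp

lemma double_1:
  fixes t :: complex
  assumes "((- 1)) * t + (1) * t ^ 5 = 0" "((- 1)) + (5) * t ^ 4 = 0"
  shows False
proof -
  have "z * ((((- 25)) * t ^ 3) * (((- 1)) * t + (1) * t ^ 5) + (((- 4)) + (5) * t ^ 4) * (((- 1)) + (5) * t ^ 4)) = z * 4" for z :: complex by algebra
  from this[of 1] show False unfolding assms by simp
qed

lemma common_2: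
  fixes t :: complex
  assumes "(10) * t ^ 2 + (10) * t ^ 3 + (5) * t ^ 4 + (1) * t ^ 5 = 0" "((- 1)) + ((- 5)) * t = 0"
  shows False
proof -
  have "z * (((3125)) * ((10) * t ^ 2 + (10) * t ^ 3 + (5) * t ^ 4 + (1) * t ^ 5) + (((- 1024)) + (5120) * t + (5650) * t ^ 2 + (3000) * t ^ 3 + (625) * t ^ 4) * (((- 1)) + ((- 5)) * t)) = z * 1024" for z :: complex by algebra
  from this[of 1] show False unfolding assms by simp
qed

lemma double_2:
  fixes t :: complex
  assumes "((- 1)) * t + (5) * t ^ 2 + (10) * t ^ 3 + (5) * t ^ 4 + (1) * t ^ 5 = 0" "((- 1)) + (10) * t + (30) * t ^ 2 + (20) * t ^ 3 + (5) * t ^ 4 = 0"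
  shows False
proof -
  have "z * ((((- 74975)) + ((- 203025)) * t + ((- 133275)) * t ^ 2 + ((- 33175)) * t ^ 3) * (((- 1)) * t + (5) * t ^ 2 + (10) * t ^ 3 + (5) * t ^ 4 + (1) * t ^ 5) + (((- 3928)) + (35695) * t + (67260) * t ^ 2 + (33290) * t ^ 3 + (6635) * t ^ 4) * (((- 1)) + (10) * t + (30) * t ^ 2 + (20) * t ^ 3 + (5) * t ^ 4)) = z * 3928" for z :: complex by algebra
  from this[of 1] show False unfolding assms by simp
qed

lemma common_3:
  fixes t :: complex
  assumes "(10) * t ^ 3 + (5) * t ^ 4 + (1) * t ^ 5 = 0" "((- 1)) + ((- 5)) * t + ((- 10)) * t ^ 2 = 0"
  shows False
proof -
  have "z * ((((- 2875)) + ((- 15250)) * t) * ((10) * t ^ 3 + (5) * t ^ 4 + (1) * t ^ 5) + (((- 864)) + (4320) * t + ((- 12960)) * t ^ 2 + ((- 7150)) * t ^ 3 + ((- 1525)) * t ^ 4) * (((- 1)) + ((- 5)) * t + ((- 10)) * t ^ 2)) = z * 864" for z :: complex by algebra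
  from this[of 1] show False unfolding assms by simp
qed

lemma double_3:
  fixes t :: complex
  assumes "((- 1)) * t + ((- 5)) * t ^ 2 + (5) * t ^ 4 + (1) * t ^ 5 = 0" "((- 1)) + ((- 10)) * t + (20) * t ^ 3 + (5) * t ^ 4 = 0"
  shows False
proof -
  have "z * (((6100) + (1475) * t + ((- 12700)) * t ^ 2 + ((- 3275)) * t ^ 3) * (((- 1)) * t + ((- 5)) * t ^ 2 + (5) * t ^ 4 + (1) * t ^ 5) + (((- 294)) + ((- 3160)) * t + ((- 375)) * t ^ 2 + (3195) * t ^ 3 + (655) * t ^ 4) * (((- 1)) + ((- 10)) * t + (20) * t ^ 3 + (5) * t ^ 4)) = z * 294" for z :: complex by algebra
  from this[of 1] show False unfolding assms by simp
qed

lemma common_4: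
  fixes t :: complex
  assumes "(5) * t ^ 4 + ((- 3)) * t ^ 5 = 0" "(3) + ((- 5)) * t = 0"
  shows False
proof -
  have "z * (((3125)) * ((5) * t ^ 4 + ((- 3)) * t ^ 5) + ((432) + (720) * t + (1200) * t ^ 2 + (2000) * t ^ 3 + ((- 1875)) * t ^ 4) * ((3) + ((- 5)) * t)) = z * 1296" for z :: complex by algebra
  from this[of 1] show False unfolding assms by simp
qed

lemma double_4:
  fixes t :: complex
  assumes "(3) * t + ((- 5)) * t ^ 2 + (5) * t ^ 4 + ((- 3)) * t ^ 5 = 0" "(3) + ((- 10)) * t + (20) * t ^ 3 + ((- 15)) * t ^ 4 = 0"
  shows False
proof -
  have "z * (((4300) + (525) * t + ((- 4100)) * t ^ 2 + (8475) * t ^ 3) * ((3) * t + ((- 5)) * t ^ 2 + (5) * t ^ 4 + ((- 3)) * t ^ 5) + ((726) + ((- 1880)) * t + (375) * t ^ 2 + (1385) * t ^ 3 + ((- 1695)) * t ^ 4) * ((3) + ((- 10)) * t + (20) * t ^ 3 + ((- 15)) * t ^ 4)) = z * 2178" for z :: complex by algebra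
  from this[of 1] show False unfolding assms by simp
qed

lemma common_5:
  fixes t :: complex
  assumes "(5) * t ^ 3 + ((- 3)) * t ^ 5 = 0" "(((- 2)) :: complex) = 0"
  shows False
  using assms(2) by simp

lemma double_5:
  fixes t :: complex
  assumes "((- 2)) * t + (5) * t ^ 3 + ((- 3)) * t ^ 5 = 0" "((- 2)) + (15) * t ^ 2 + ((- 15)) * t ^ 4 = 0"
  shows False
proof -
  have "z * ((((- 75)) * t + (225) * t ^ 3) * (((- 2)) * t + (5) * t ^ 3 + ((- 3)) * t ^ 5) + (((- 4)) + (45) * t ^ 2 + ((- 45)) * t ^ 4) * (((- 2)) + (15) * t ^ 2 + ((- 15)) * t ^ 4)) = z * 8" for z :: complex by algebra
  from this[of 1] show False unfolding assms by simp
qed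

lemma common_6:
  fixes t :: complex
  assumes "(220) * t ^ 3 + ((- 165)) * t ^ 4 + (36) * t ^ 5 = 0" "(((- 121)) :: complex) = 0"
  shows False
  using assms(2) by simp

lemma double_6:
  fixes t :: complex
  assumes "((- 121)) * t + (220) * t ^ 3 + ((- 165)) * t ^ 4 + (36) * t ^ 5 = 0" "((- 121)) + (660) * t ^ 2 + ((- 660)) * t ^ 3 + (180) * t ^ 4 = 0"
  shows False
proof -
  have "z * ((((- 36300)) + ((- 79200)) * t + (237600) * t ^ 2 + ((- 104400)) * t ^ 3) * (((- 121)) * t + (220) * t ^ 3 + ((- 165)) * t ^ 4 + (36) * t ^ 5) + (((- 7139)) + (36300) * t + (40260) * t ^ 2 + ((- 66660)) * t ^ 3 + (20880) * t ^ 4) * (((- 121)) + (660) * t ^ 2 + ((- 660)) * t ^ 3 + (180) * t ^ 4)) = z * 863819" for z :: complex by algebra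
  from this[of 1] show False unfolding assms by simp
qed

text \<open>\<open>sqrt5\<close> is handled as an indeterminate whose minimal polynomial is a third
  generator, so that the certificate is again a polynomial identity.\<close>

lemma common_7:
  fixes t :: complex
  assumes "(5 + (- 1) * sqrt5) * t ^ 4 + ((- 2)) * t ^ 5 = 0" "(7 + (- 3) * sqrt5) + ((- 10) + 4 * sqrt5) * t = 0" "((- 5) + 1 * sqrt5 ^ 2) = 0"
  shows False
proof -
  have "z * (((625 + 275 * sqrt5)) * ((5 + (- 1) * sqrt5) * t ^ 4 + ((- 2)) * t ^ 5) + ((28 + 12 * sqrt5) + (100 + 44 * sqrt5) * t + (360 + 160 * sqrt5) * t ^ 2 + (1300 + 580 * sqrt5) * t ^ 3 + ((- 1175) + (- 525) * sqrt5) * t ^ 4) * ((7 + (- 3) * sqrt5) + ((- 10) + 4 * sqrt5) * t) - (((- 36)) + ((- 84)) * t + ((- 304)) * t ^ 2 + ((- 1100)) * t ^ 3 + (3620) * t ^ 4 + ((- 2100)) * t ^ 5) * ((- 5) + 1 * sqrt5 ^ 2)) = z * 16" for z :: complex by algebra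
  from this[of 1] show False unfolding assms by simp
qed

lemma double_7:
  fixes t :: complex
  assumes "(7 + (- 3) * sqrt5) * t + ((- 10) + 4 * sqrt5) * t ^ 2 + (5 + (- 1) * sqrt5) * t ^ 4 + ((- 2)) * t ^ 5 = 0" "(7 + (- 3) * sqrt5) + ((- 20) + 8 * sqrt5) * t + (20 + (- 4) * sqrt5) * t ^ 3 + ((- 10)) * t ^ 4 = 0" "((- 5) + 1 * sqrt5 ^ 2) = 0"
  shows False
proof -
  have "z * (((500 + 220 * sqrt5) + ((- 1530) + (- 680) * sqrt5) * t + ((- 3900) + (- 1740) * sqrt5) * t ^ 2 + (5875 + 2625 * sqrt5) * t ^ 3) * ((7 + (- 3) * sqrt5) * t + ((- 10) + 4 * sqrt5) * t ^ 2 + (5 + (- 1) * sqrt5) * t ^ 4 + ((- 2)) * t ^ 5) + ((14 + 6 * sqrt5) + ((- 400) + (- 176) * sqrt5) * t + (450 + 200 * sqrt5) * t ^ 2 + (1105 + 493 * sqrt5) * t ^ 3 + ((- 1175) + (- 525) * sqrt5) * t ^ 4) * ((7 + (- 3) * sqrt5) + ((- 20) + 8 * sqrt5) * t + (20 + (- 4) * sqrt5) * t ^ 3 + ((- 10)) * t ^ 4) - (((- 18)) + ((- 84)) * t + (912) * t ^ 2 + (2597) * t ^ 3 + ((- 8832)) * t ^ 4 + (6180) * t ^ 5 + ((- 232)) * t ^ 6 + ((- 525)) * t ^ 7) * ((- 5) + 1 * sqrt5 ^ 2)) = z * 8" for z :: complex by algebra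
  from this[of 1] show False unfolding assms by simp
qed

lemma common_8:
  fixes t :: complex
  assumes "(15 + (- 5) * sqrt21) * t ^ 4 + (6) * t ^ 5 = 0" "(69 + (- 15) * sqrt21) + ((- 90) + 20 * sqrt21) * t = 0" "((- 21) + 1 * sqrt21 ^ 2) = 0"
  shows False
proof -
  have "z * ((((- 271875) + (- 59375) * sqrt21)) * ((15 + (- 5) * sqrt21) * t ^ 4 + (6) * t ^ 5) + ((5796 + 1260 * sqrt21) + ((- 36540) + (- 7980) * sqrt21) * t + (231000 + 50400 * sqrt21) * t ^ 2 + ((- 1459500) + (- 318500) * sqrt21) * t ^ 3 + (988125 + 215625 * sqrt21) * t ^ 4) * ((69 + (- 15) * sqrt21) + ((- 90) + 20 * sqrt21) * t) - (((- 18900)) + (144900) * t + ((- 915600)) * t ^ 2 + (5785500) * t ^ 3 + ((- 9307500)) * t ^ 4 + (4312500) * t ^ 5) * ((- 21) + 1 * sqrt21 ^ 2)) = z * 3024" for z :: complex by algebra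
  from this[of 1] show False unfolding assms by simp
qed

lemma double_8:
  fixes t :: complex
  assumes "(69 + (- 15) * sqrt21) * t + ((- 90) + 20 * sqrt21) * t ^ 2 + (15 + (- 5) * sqrt21) * t ^ 4 + (6) * t ^ 5 = 0" "(69 + (- 15) * sqrt21) + ((- 180) + 40 * sqrt21) * t + (60 + (- 20) * sqrt21) * t ^ 3 + (30) * t ^ 4 = 0" "((- 21) + 1 * sqrt21 ^ 2) = 0"
  shows False
proof -
  have "z * ((((- 328425) + (- 71725) * sqrt21) + ((- 1922250) + (- 419400) * sqrt21) * t + (8934225 + 1949675 * sqrt21) * t ^ 2 + ((- 7074975) + (- 1543875) * sqrt21) * t ^ 3) * ((69 + (- 15) * sqrt21) * t + ((- 90) + 20 * sqrt21) * t ^ 2 + (15 + (- 5) * sqrt21) * t ^ 4 + (6) * t ^ 5) + ((3864 + 840 * sqrt21) + (279705 + 61085 * sqrt21) * t + (462000 + 100800 * sqrt21) * t ^ 2 + ((- 2160060) + (- 471380) * sqrt21) * t ^ 3 + (1414995 + 308775 * sqrt21) * t ^ 4) * ((69 + (- 15) * sqrt21) + ((- 180) + 40 * sqrt21) * t + (60 + (- 20) * sqrt21) * t ^ 3 + (30) * t ^ 4) - (((- 12600)) + (193200) * t + (5787900) * t ^ 2 + ((- 26547225)) * t ^ 3 + (37801725) * t ^ 4 + ((- 18445500)) * t ^ 5 + ((- 320775)) * t ^ 6 + (1543875) * t ^ 7) * ((- 21) + 1 * sqrt21 ^ 2)) = z * 2016" for z :: complex by algebra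
  from this[of 1] show False unfolding assms by simp
qed

text \<open>\<open>\<alpha>\<close> enters only through its quartic, so one certificate covers both
  \<open>omega 9\<close> and \<open>omega 10\<close>.\<close>

lemma common_9:
  fixes t :: complex
  assumes "(10 + 2 * \<alpha>) * t ^ 3 + ((- 15) + (- 1) * \<alpha>) * t ^ 4 + (6) * t ^ 5 = 0" "((- 1) + 1 * \<alpha>) + ((- 2) * \<alpha>) * t = 0" "((- 375) + 310 * \<alpha> ^ 2 + 1 * \<alpha> ^ 4) = 0"
  shows False
proof -
  have "z * (((343875 * \<alpha> + 1105 * \<alpha> ^ 3)) * ((10 + 2 * \<alpha>) * t ^ 3 + ((- 15) + (- 1) * \<alpha>) * t ^ 4 + (6) * t ^ 5) + ((1866 + 1866 * \<alpha> + 6 * \<alpha> ^ 2 + 6 * \<alpha> ^ 3) + (43875 + 40143 * \<alpha> + 141 * \<alpha> ^ 2 + 129 * \<alpha> ^ 3) * t + (987750 + 900000 * \<alpha> + 3174 * \<alpha> ^ 2 + 2892 * \<alpha> ^ 3) * t ^ 2 + ((- 2063250) + (- 600000) * \<alpha> + (- 6630) * \<alpha> ^ 2 + (- 1928) * \<alpha> ^ 3) * t ^ 3 + (1031625 + 3315 * \<alpha> ^ 2) * t ^ 4) * (((- 1) + 1 * \<alpha>) + ((- 2) * \<alpha>) * t) - ((6) + (117) * t + (2634) * t ^ 2 + ((- 5502)) * t ^ 3 + (2751) * t ^ 4) * ((- 375) + 310 * \<alpha> ^ 2 + 1 * \<alpha> ^ 4)) = z * 384" for z :: complex by algebra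
  from this[of 1] show False unfolding assms by simp
qed

lemma double_9:
  fixes t :: complex
  assumes "((- 1) + 1 * \<alpha>) * t + ((- 2) * \<alpha>) * t ^ 2 + (10 + 2 * \<alpha>) * t ^ 3 + ((- 15) + (- 1) * \<alpha>) * t ^ 4 + (6) * t ^ 5 = 0" "((- 1) + 1 * \<alpha>) + ((- 4) * \<alpha>) * t + (30 + 6 * \<alpha>) * t ^ 2 + ((- 60) + (- 4) * \<alpha>) * t ^ 3 + (30) * t ^ 4 = 0" "((- 375) + 310 * \<alpha> ^ 2 + 1 * \<alpha> ^ 4) = 0"
  shows False
proof -
  have "z * ((((- 110550) + 14889650 * \<alpha> + (- 354) * \<alpha> ^ 2 + 47846 * \<alpha> ^ 3) + ((- 108689175) + (- 114049905) * \<alpha> + (- 349257) * \<alpha> ^ 2 + (- 366479) * \<alpha> ^ 3) * t + (326730825 + 114049905 * \<alpha> + 1049895 * \<alpha> ^ 2 + 366479 * \<alpha> ^ 3) * t ^ 2 + ((- 217820550) + (- 699930) * \<alpha> ^ 2) * t ^ 3) * (((- 1) + 1 * \<alpha>) * t + ((- 2) * \<alpha>) * t ^ 2 + (10 + 2 * \<alpha>) * t ^ 3 + ((- 15) + (- 1) * \<alpha>) * t ^ 4 + (6) * t ^ 5) + ((61267 + 61267 * \<alpha> + 197 * \<alpha> ^ 2 + 197 * \<alpha> ^ 3) + (2991675 + (- 12253593) * \<alpha> + 9613 * \<alpha> ^ 2 + (- 39375) * \<alpha> ^ 3) * t + (40572435 + 36393177 * \<alpha> + 130373 * \<alpha> ^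 2 + 116943 * \<alpha> ^ 3) * t ^ 2 + ((- 87128220) + (- 24262118) * \<alpha> + (- 279972) * \<alpha> ^ 2 + (- 77962) * \<alpha> ^ 3) * t ^ 3 + (43564110 + 139986 * \<alpha> ^ 2) * t ^ 4) * (((- 1) + 1 * \<alpha>) + ((- 4) * \<alpha>) * t + (30 + 6 * \<alpha>) * t ^ 2 + ((- 60) + (- 4) * \<alpha>) * t ^ 3 + (30) * t ^ 4) - ((197) + (7683) * t + ((- 186546)) * t ^ 2 + (412357) * t ^ 3 + ((- 342756)) * t ^ 4 + (163893) * t ^ 5 + ((- 54631)) * t ^ 6) * ((- 375) + 310 * \<alpha> ^ 2 + 1 * \<alpha> ^ 4)) = z * 12608" for z :: complex by algebra
  from this[of 1] show False unfolding assms by simp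
qed

lemma common_11:
  fixes t :: complex
  assumes "(5) * t ^ 3 + ((- 1)) * t ^ 5 = 0" "(1) + ((- 5)) * t ^ 2 = 0"
  shows False
proof -
  have "z * (((125) * t) * ((5) * t ^ 3 + ((- 1)) * t ^ 5) + ((24) + (120) * t ^ 2 + ((- 25)) * t ^ 4) * ((1) + ((- 5)) * t ^ 2)) = z * 24" for z :: complex by algebra
  from this[of 1] show False unfolding assms by simp
qed

lemma double_11:
  fixes t :: complex
  assumes "(1) * t + ((- 1)) * t ^ 5 = 0" "(1) + ((- 5)) * t ^ 4 = 0"
  shows False
proof -
  have "z * (((25) * t ^ 3) * ((1) * t + ((- 1)) * t ^ 5) + ((4) + ((- 5)) * t ^ 4) * ((1) + ((- 5)) * t ^ 4)) = z * 4" for z :: complex by algebra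
  from this[of 1] show False unfolding assms by simp
qed

lemma common_12:
  fixes t :: complex
  assumes "(20) * t ^ 3 + ((- 12)) * t ^ 5 = 0" "(7) + ((- 30)) * t ^ 2 + (15) * t ^ 4 = 0"
  shows False
proof -
  have "z * (((825) * t + ((- 675)) * t ^ 3) * ((20) * t ^ 3 + ((- 12)) * t ^ 5) + ((112) + (480) * t ^ 2 + ((- 540)) * t ^ 4) * ((7) + ((- 30)) * t ^ 2 + (15) * t ^ 4)) = z * 784" for z :: complex by algebra
  from this[of 1] show False unfolding assms by simp
qed

lemma double_12:
  fixes t :: complex
  assumes "(7) * t + ((- 10)) * t ^ 3 + (3) * t ^ 5 = 0" "(7) + ((- 30)) * t ^ 2 + (15) * t ^ 4 = 0"
  shows False
proof -
  have "z * (((825) * t + ((- 675)) * t ^ 3) * ((7) * t + ((- 10)) * t ^ 3 + (3) * t ^ 5) + ((112) + ((- 345)) * t ^ 2 + (135) * t ^ 4) * ((7) + ((- 30)) * t ^ 2 + (15) * t ^ 4)) = z * 784" for z :: complex by algebra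
  from this[of 1] show False unfolding assms by simp
qed

lemma common_13:
  fixes t :: complex
  assumes "((- 4)) * t ^ 5 = 0" "((- 1)) + (5) * t ^ 4 = 0"
  shows False
proof -
  have "z * ((((- 25)) * t ^ 3) * (((- 4)) * t ^ 5) + (((- 4)) + ((- 20)) * t ^ 4) * (((- 1)) + (5) * t ^ 4)) = z * 4" for z :: complex by algebra
  from this[of 1] show False unfolding assms by simp
qed

lemma double_13:
  fixes t :: complex
  assumes "((- 1)) * t + (1) * t ^ 5 = 0" "((- 1)) + (5) * t ^ 4 = 0"
  shows False
proof -
  have "z * ((((- 25)) * t ^ 3) * (((- 1)) * t + (1) * t ^ 5) + (((- 4)) + (5) * t ^ 4) * (((- 1)) + (5) * t ^ 4)) = z * 4" for z :: complex by algebra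
  from this[of 1] show False unfolding assms by simp
qed

lemma common_14:
  fixes t :: complex
  assumes "(15) * t ^ 4 + ((- 12)) * t ^ 5 = 0" "(2) + ((- 20)) * t ^ 3 + (15) * t ^ 4 = 0"
  shows False
proof -
  have "z * (((125) + (100) * t + (4600) * t ^ 2 + ((- 4350)) * t ^ 3) * ((15) * t ^ 4 + ((- 12)) * t ^ 5) + ((339) + (3390) * t ^ 3 + ((- 3480)) * t ^ 4) * ((2) + ((- 20)) * t ^ 3 + (15) * t ^ 4)) = z * 678" for z :: complex by algebra
  from this[of 1] show False unfolding assms by simp
qed

lemma double_14:
  fixes t :: complex
  assumes "(2) * t + ((- 5)) * t ^ 4 + (3) * t ^ 5 = 0" "(2) + ((- 20)) * t ^ 3 + (15) * t ^ 4 = 0"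
  shows False
proof -
  have "z * (((125) + (100) * t + (4600) * t ^ 2 + ((- 4350)) * t ^ 3) * ((2) * t + ((- 5)) * t ^ 4 + (3) * t ^ 5) + ((339) + ((- 125)) * t + ((- 100)) * t ^ 2 + ((- 1210)) * t ^ 3 + (870) * t ^ 4) * ((2) + ((- 20)) * t ^ 3 + (15) * t ^ 4)) = z * 678" for z :: complex by algebra
  from this[of 1] show False unfolding assms by simp
qed

section \<open>The types of the fourteen pairs\<close>

lemma has_type_1: "has_type (omega 1) [4, 4]"
proof -
  note N = has_typeI[OF omega_homog(1) _ _ _ _ cdata_1]
  show ?thesis
  apply (rule N[unfolded list.map fst_conv])
  subgoal by simp
  subgoal by simp
  subgoal premises prem for t
  proof (rule common_1)
    show "(1) * t ^ 5 = 0" using prem(1) by (algebra | simp)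
    show "(((- 1)) :: complex) = 0" using prem(2) by (algebra | simp)
  qed
  subgoal premises prem for t
  proof (rule double_1)
    show "((- 1)) * t + (1) * t ^ 5 = 0" using prem(1) by (algebra | simp)
    show "((- 1)) + (5) * t ^ 4 = 0" using prem(2) by (algebra | simp)
  qed
  done
qed

lemma has_type_2: "has_type (omega 2) [4, 3, 1]"
proof -
  note N = has_typeI[OF omega_homog(2) _ _ _ _ cdata_2]
  show ?thesis
  apply (rule N[unfolded list.map fst_conv])
  subgoal by simp
  subgoal by simp
  subgoal premises prem for t
  proof (rule common_2)
    show "(10) * t ^ 2 + (10) * t ^ 3 + (5) * t ^ 4 + (1) * t ^ 5 = 0" using prem(1) by (algebra | simp)
    show "((- 1)) + ((- 5)) * t = 0" using prem(2) by (algebra | simp)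
  qed
  subgoal premises prem for t
  proof (rule double_2)
    show "((- 1)) * t + (5) * t ^ 2 + (10) * t ^ 3 + (5) * t ^ 4 + (1) * t ^ 5 = 0" using prem(1) by (algebra | simp)
    show "((- 1)) + (10) * t + (30) * t ^ 2 + (20) * t ^ 3 + (5) * t ^ 4 = 0" using prem(2) by (algebra | simp)
  qed
  done
qed

lemma has_type_3: "has_type (omega 3) [4, 2, 2]"
proof -
  note N = has_typeI[OF omega_homog(3) _ _ _ _ cdata_3]
  show ?thesis
  apply (rule N[unfolded list.map fst_conv])
  subgoal by simp
  subgoal by simp
  subgoal premises prem for t
  proof (rule common_3)
    show "(10) * t ^ 3 + (5) * t ^ 4 + (1) * t ^ 5 = 0" using prem(1) by (algebra | simp)
    show "((- 1)) + ((- 5)) * t + ((- 10)) * t ^ 2 = 0" using prem(2) by (algebra | simp)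
  qed
  subgoal premises prem for t
  proof (rule double_3)
    show "((- 1)) * t + ((- 5)) * t ^ 2 + (5) * t ^ 4 + (1) * t ^ 5 = 0" using prem(1) by (algebra | simp)
    show "((- 1)) + ((- 10)) * t + (20) * t ^ 3 + (5) * t ^ 4 = 0" using prem(2) by (algebra | simp)
  qed
  done
qed

lemma has_type_4: "has_type (omega 4) [3, 3, 2]"
proof -
  note N = has_typeI[OF omega_homog(4) _ _ _ _ cdata_4]
  show ?thesis
  apply (rule N[unfolded list.map fst_conv])
  subgoal by simp
  subgoal by simp
  subgoal premises prem for t
  proof (rule common_4)
    show "(5) * t ^ 4 + ((- 3)) * t ^ 5 = 0" using prem(1) by (algebra | simp)
    show "(3) + ((- 5)) * t = 0" using prem(2) by (algebra | simp)
  qed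
  subgoal premises prem for t
  proof (rule double_4)
    show "(3) * t + ((- 5)) * t ^ 2 + (5) * t ^ 4 + ((- 3)) * t ^ 5 = 0" using prem(1) by (algebra | simp)
    show "(3) + ((- 10)) * t + (20) * t ^ 3 + ((- 15)) * t ^ 4 = 0" using prem(2) by (algebra | simp)
  qed
  done
qed

lemma has_type_5: "has_type (omega 5) [4, 2, 1, 1]"
proof -
  note N = has_typeI[OF omega_homog(5) _ _ _ _ cdata_5]
  show ?thesis
  apply (rule N[unfolded list.map fst_conv])
  subgoal by simp
  subgoal by simp
  subgoal premises prem for t
  proof (rule common_5)
    show "(5) * t ^ 3 + ((- 3)) * t ^ 5 = 0" using prem(1) by (algebra | simp)
    show "(((- 2)) :: complex) = 0" using prem(2) by (algebra | simp)
  qed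
  subgoal premises prem for t
  proof (rule double_5)
    show "((- 2)) * t + (5) * t ^ 3 + ((- 3)) * t ^ 5 = 0" using prem(1) by (algebra | simp)
    show "((- 2)) + (15) * t ^ 2 + ((- 15)) * t ^ 4 = 0" using prem(2) by (algebra | simp)
  qed
  done
qed

lemma has_type_6: "has_type (omega 6) [4, 2, 1, 1]"
proof -
  obtain s s' where L: "cdata (omega 6) [(4, 0, 1), (2, pt 0), (1, pt s), (1, pt s')]"
    using cdata_6 .
  have "has_type (omega 6) (map fst [(4, 0, 1), (2, pt 0), (1, pt s), (1, pt s')])"
  apply (rule has_typeI[OF omega_homog(6) _ _ _ _ L])
  subgoal by simp
  subgoal by simp
  subgoal premises prem for t
  proof (rule common_6)
    show "(220) * t ^ 3 + ((- 165)) * t ^ 4 + (36) * t ^ 5 = 0" using prem(1) by (algebra | simp)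
    show "(((- 121)) :: complex) = 0" using prem(2) by (algebra | simp)
  qed
  subgoal premises prem for t
  proof (rule double_6)
    show "((- 121)) * t + (220) * t ^ 3 + ((- 165)) * t ^ 4 + (36) * t ^ 5 = 0" using prem(1) by (algebra | simp)
    show "((- 121)) + (660) * t ^ 2 + ((- 660)) * t ^ 3 + (180) * t ^ 4 = 0" using prem(2) by (algebra | simp)
  qed
  done
  then show ?thesis by simp
qed

lemma has_type_7: "has_type (omega 7) [3, 3, 1, 1]"
proof -
  note rel = sqrt_consts
  obtain s s' where L: "cdata (omega 7) [(3, 0, 1), (3, pt 0), (1, pt 1), (1, pt s)]" "cdata (omega 8) [(3, 0, 1), (3, pt 0), (1, pt 1), (1, pt s')]"
    using cdata_7_8 .
  have "has_type (omega 7) (map fst [(3, 0, 1), (3, pt 0), (1, pt 1), (1, pt s)])"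
  apply (rule has_typeI[OF omega_homog(7) _ _ _ _ L(1)])
  subgoal by simp
  subgoal by simp
  subgoal premises prem for t
  proof (rule common_7)
    show "(5 + (- 1) * sqrt5) * t ^ 4 + ((- 2)) * t ^ 5 = 0" using prem(1) by (algebra | simp)
    show "(7 + (- 3) * sqrt5) + ((- 10) + 4 * sqrt5) * t = 0" using prem(2) by (algebra | simp)
    show "((- 5) + 1 * sqrt5 ^ 2) = 0" using rel by (algebra | simp)
  qed
  subgoal premises prem for t
  proof (rule double_7)
    show "(7 + (- 3) * sqrt5) * t + ((- 10) + 4 * sqrt5) * t ^ 2 + (5 + (- 1) * sqrt5) * t ^ 4 + ((- 2)) * t ^ 5 = 0" using prem(1) by (algebra | simp)
    show "(7 + (- 3) * sqrt5) + ((- 20) + 8 * sqrt5) * t + (20 + (- 4) * sqrt5) * t ^ 3 + ((- 10)) * t ^ 4 = 0" using prem(2) by (algebra | simp)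
    show "((- 5) + 1 * sqrt5 ^ 2) = 0" using rel by (algebra | simp)
  qed
  done
  then show ?thesis by simp
qed

lemma has_type_8: "has_type (omega 8) [3, 3, 1, 1]"
proof -
  note rel = sqrt_consts
  obtain s s' where L: "cdata (omega 7) [(3, 0, 1), (3, pt 0), (1, pt 1), (1, pt s)]" "cdata (omega 8) [(3, 0, 1), (3, pt 0), (1, pt 1), (1, pt s')]"
    using cdata_7_8 .
  have "has_type (omega 8) (map fst [(3, 0, 1), (3, pt 0), (1, pt 1), (1, pt s')])"
  apply (rule has_typeI[OF omega_homog(8) _ _ _ _ L(2)])
  subgoal by simp
  subgoal by simp
  subgoal premises prem for t
  proof (rule common_8)
    show "(15 + (- 5) * sqrt21) * t ^ 4 + (6) * t ^ 5 = 0" using prem(1) by (algebra | simp)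
    show "(69 + (- 15) * sqrt21) + ((- 90) + 20 * sqrt21) * t = 0" using prem(2) by (algebra | simp)
    show "((- 21) + 1 * sqrt21 ^ 2) = 0" using rel by (algebra | simp)
  qed
  subgoal premises prem for t
  proof (rule double_8)
    show "(69 + (- 15) * sqrt21) * t + ((- 90) + 20 * sqrt21) * t ^ 2 + (15 + (- 5) * sqrt21) * t ^ 4 + (6) * t ^ 5 = 0" using prem(1) by (algebra | simp)
    show "(69 + (- 15) * sqrt21) + ((- 180) + 40 * sqrt21) * t + (60 + (- 20) * sqrt21) * t ^ 3 + (30) * t ^ 4 = 0" using prem(2) by (algebra | simp)
    show "((- 21) + 1 * sqrt21 ^ 2) = 0" using rel by (algebra | simp)
  qed
  done
  then show ?thesis by simp
qed

lemma has_type_9: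
  assumes rel: "\<alpha> ^ 4 + 310 * \<alpha> ^ 2 = 375"
  shows "has_type (form9 \<alpha>) [3, 2, 2, 1]"
proof -
  obtain s where L: "cdata (form9 \<alpha>) [(3, 0, 1), (2, pt 0), (2, pt 1), (1, pt s)]"
    using cdata_9[OF rel] .
  have "has_type (form9 \<alpha>) (map fst [(3, 0, 1), (2, pt 0), (2, pt 1), (1, pt s)])"
  apply (rule has_typeI[OF form9_def _ _ _ _ L])
  subgoal by simp
  subgoal by simp
  subgoal premises prem for t
  proof (rule common_9)
    show "(10 + 2 * \<alpha>) * t ^ 3 + ((- 15) + (- 1) * \<alpha>) * t ^ 4 + (6) * t ^ 5 = 0" using prem(1) by (algebra | simp)
    show "((- 1) + 1 * \<alpha>) + ((- 2) * \<alpha>) * t = 0" using prem(2) by (algebra | simp)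
    have "((- 375) + 310 * \<alpha> ^ 2 + 1 * \<alpha> ^ 4) = (\<alpha> ^ 4 + 310 * \<alpha> ^ 2) - 375" by algebra
    then show "((- 375) + 310 * \<alpha> ^ 2 + 1 * \<alpha> ^ 4) = 0" unfolding rel by simp
  qed
  subgoal premises prem for t
  proof (rule double_9)
    show "((- 1) + 1 * \<alpha>) * t + ((- 2) * \<alpha>) * t ^ 2 + (10 + 2 * \<alpha>) * t ^ 3 + ((- 15) + (- 1) * \<alpha>) * t ^ 4 + (6) * t ^ 5 = 0" using prem(1) by (algebra | simp)
    show "((- 1) + 1 * \<alpha>) + ((- 4) * \<alpha>) * t + (30 + 6 * \<alpha>) * t ^ 2 + ((- 60) + (- 4) * \<alpha>) * t ^ 3 + (30) * t ^ 4 = 0" using prem(2) by (algebra | simp)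
    have "((- 375) + 310 * \<alpha> ^ 2 + 1 * \<alpha> ^ 4) = (\<alpha> ^ 4 + 310 * \<alpha> ^ 2) - 375" by algebra
    then show "((- 375) + 310 * \<alpha> ^ 2 + 1 * \<alpha> ^ 4) = 0" unfolding rel by simp
  qed
  done
  then show ?thesis by simp
qed

lemma has_type_11: "has_type (omega 11) [2, 2, 2, 2]"
proof -
  note N = has_typeI[OF omega_homog(11) _ _ _ _ cdata_11]
  show ?thesis
  apply (rule N[unfolded list.map fst_conv])
  subgoal by simp
  subgoal by simp
  subgoal premises prem for t
  proof (rule common_11)
    show "(5) * t ^ 3 + ((- 1)) * t ^ 5 = 0" using prem(1) by (algebra | simp)
    show "(1) + ((- 5)) * t ^ 2 = 0" using prem(2) by (algebra | simp)
  qed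
  subgoal premises prem for t
  proof (rule double_11)
    show "(1) * t + ((- 1)) * t ^ 5 = 0" using prem(1) by (algebra | simp)
    show "(1) + ((- 5)) * t ^ 4 = 0" using prem(2) by (algebra | simp)
  qed
  done
qed

text \<open>The list and the cofactors are given for the Newton form, and the type is carried over
  to \<open>omega 12\<close> by linear equivalence; \<open>omega 13\<close> and
  \<open>omega 14\<close> are treated alike.\<close>

lemma has_type_12: "has_type (omega 12) [2, 2, 2, 1, 1]"
proof -
  obtain v :: complex where v: "v ^ 2 = 7 / 3" by (metis power2_csqrt)
  have "3 * v ^ 2 = 7" unfolding v by simp
  note L = cdata_12[OF refl this]
  note N = has_typeI[OF refl _ _ _ _ L]
  have "has_type (homog 5 [:0, 0, 0, 20, 0, - 12:], homog 5 [:7, 0, - 30, 0, 15, 0:]) [2, 2, 2, 1, 1]"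
  apply (rule N[unfolded list.map fst_conv])
  subgoal by simp
  subgoal by simp
  subgoal premises prem for t
  proof (rule common_12)
    show "(20) * t ^ 3 + ((- 12)) * t ^ 5 = 0" using prem(1) by (algebra | simp)
    show "(7) + ((- 30)) * t ^ 2 + (15) * t ^ 4 = 0" using prem(2) by (algebra | simp)
  qed
  subgoal premises prem for t
  proof (rule double_12)
    show "(7) * t + ((- 10)) * t ^ 3 + (3) * t ^ 5 = 0" using prem(1) by (algebra | simp)
    show "(7) + ((- 30)) * t ^ 2 + (15) * t ^ 4 = 0" using prem(2) by (algebra | simp)
  qed
  done
  with omega_12_newton show ?thesis by (rule has_type_lconj)
qed

lemma has_type_13: "has_type (omega 13) [4, 1, 1, 1, 1]"
proof -
  note L = cdata_13[OF refl]
  note N = has_typeI[OF refl _ _ _ _ L]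
  have "has_type (homog 5 [:0, 0, 0, 0, 0, - 4:], homog 5 [:- 1, 0, 0, 0, 5, 0:]) [4, 1, 1, 1, 1]"
  apply (rule N[unfolded list.map fst_conv])
  subgoal by simp
  subgoal by simp
  subgoal premises prem for t
  proof (rule common_13)
    show "((- 4)) * t ^ 5 = 0" using prem(1) by (algebra | simp)
    show "((- 1)) + (5) * t ^ 4 = 0" using prem(2) by (algebra | simp)
  qed
  subgoal premises prem for t
  proof (rule double_13)
    show "((- 1)) * t + (1) * t ^ 5 = 0" using prem(1) by (algebra | simp)
    show "((- 1)) + (5) * t ^ 4 = 0" using prem(2) by (algebra | simp)
  qed
  done
  with omega_13_newton show ?thesis by (rule has_type_lconj)
qed

lemma has_type_14: "has_type (omega 14) [3, 2, 1, 1, 1]"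
proof -
  obtain r1 r2 r3 where L: "cdata (homog 5 [:0, 0, 0, 0, 15, - 12:], homog 5 [:2, 0, 0, - 20, 15, 0:]) [(3, pt 0), (2, pt 1), (1, pt r1), (1, pt r2), (1, pt r3)]" using cdata_14[OF refl] .
  note N = has_typeI[OF refl _ _ _ _ L]
  have "has_type (homog 5 [:0, 0, 0, 0, 15, - 12:], homog 5 [:2, 0, 0, - 20, 15, 0:]) [3, 2, 1, 1, 1]"
  apply (rule N[unfolded list.map fst_conv])
  subgoal by simp
  subgoal by simp
  subgoal premises prem for t
  proof (rule common_14)
    show "(15) * t ^ 4 + ((- 12)) * t ^ 5 = 0" using prem(1) by (algebra | simp)
    show "(2) + ((- 20)) * t ^ 3 + (15) * t ^ 4 = 0" using prem(2) by (algebra | simp)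
  qed
  subgoal premises prem for t
  proof (rule double_14)
    show "(2) * t + ((- 5)) * t ^ 4 + (3) * t ^ 5 = 0" using prem(1) by (algebra | simp)
    show "(2) + ((- 20)) * t ^ 3 + (15) * t ^ 4 = 0" using prem(2) by (algebra | simp)
  qed
  done
  with omega_14_newton show ?thesis by (rule has_type_lconj)
qed

section \<open>Pairwise inequivalence\<close>

definition omega_types :: "nat list list" where
  "omega_types = [[4, 4], [4, 3, 1], [4, 2, 2], [3, 3, 2], [4, 2, 1, 1], [4, 2, 1, 1], [3, 3, 1, 1], [3, 3, 1, 1],
    [3, 2, 2, 1], [3, 2, 2, 1], [2, 2, 2, 2], [2, 2, 2, 1, 1], [4, 1, 1, 1, 1], [3, 2, 1, 1, 1]]"

lemma sqrt61: "complex_of_real (sqrt 61) ^ 2 = 61"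
  unfolding of_real_power[symmetric] by simp

lemma form9_roots: "a_const ^ 4 + 310 * a_const ^ 2 = 375" "(\<i> * b_const) ^ 4 + 310 * (\<i> * b_const) ^ 2 = 375"
proof -
  have *: "x ^ 4 + 310 * x ^ 2 = 375" if "x ^ 2 = y" "y ^ 2 + 310 * y = 375" for x y :: complex
  proof -
    have "x ^ 4 = (x ^ 2) ^ 2" by algebra
    then show ?thesis using that by simp
  qed
  define S where "S = complex_of_real (sqrt 61)"
  have S: "S ^ 2 = 61" unfolding S_def by (rule sqrt61)
  have "(5 * (4 * S - 31)) ^ 2 + 310 * (5 * (4 * S - 31)) = 375 + 400 * (S ^ 2 - 61)" by algebra
  then have 1: "(5 * (4 * S - 31)) ^ 2 + 310 * (5 * (4 * S - 31)) = 375" unfolding S by simp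
  have "(- 5 * (4 * S + 31)) ^ 2 + 310 * (- 5 * (4 * S + 31)) = 375 + 400 * (S ^ 2 - 61)" by algebra
  then have 2: "(- 5 * (4 * S + 31)) ^ 2 + 310 * (- 5 * (4 * S + 31)) = 375" unfolding S by simp
  show "a_const ^ 4 + 310 * a_const ^ 2 = 375" by (rule *[OF a_const_b_const(1) 1[unfolded S_def]])
  show "(\<i> * b_const) ^ 4 + 310 * (\<i> * b_const) ^ 2 = 375" by (rule *[OF a_const_b_const(2) 2[unfolded S_def]])
qed

lemma omega_form9: "omega 9 = form9 a_const" "omega 10 = form9 (\<i> * b_const)"
  unfolding omega_homog form9_def by (rule refl)+

lemma index_cases:
  assumes "i \<in> {1..14 :: nat}"
  obtains "i = 1" | "i = 2" | "i = 3" | "i = 4" | "i = 5" | "i = 6" | "i = 7" | "i = 8" | "i = 9" | "i = 10" | "i = 11" | "i = 12" | "i = 13" | "i = 14"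
proof -
  have "i = 1 \<or> i = 2 \<or> i = 3 \<or> i = 4 \<or> i = 5 \<or> i = 6 \<or> i = 7 \<or> i = 8 \<or> i = 9 \<or> i = 10 \<or> i = 11 \<or> i = 12 \<or> i = 13 \<or> i = 14"
    using assms unfolding atLeastAtMost_iff by presburger
  then show thesis using that by blast
qed

lemma has_type_omega:
  assumes "i \<in> {1..14}"
  shows "has_type (omega i) (omega_types ! (i - 1))"
proof -
  have 9: "has_type (omega 9) [3, 2, 2, 1]" unfolding omega_form9 by (rule has_type_9[OF form9_roots(1)])
  have 10: "has_type (omega 10) [3, 2, 2, 1]" unfolding omega_form9 by (rule has_type_9[OF form9_roots(2)])
  note T = has_type_1 has_type_2 has_type_3 has_type_4 has_type_5 has_type_6 has_type_7 has_type_8 9 10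
    has_type_11 has_type_12 has_type_13 has_type_14
  from assms show ?thesis
    by (cases rule: index_cases) (simp_all add: omega_types_def T One_nat_def[symmetric] del: One_nat_def)
qed

text \<open>The threshold counts preserved by \<open>type_count\<close>; since multiplicities are at
  most 4 they determine the partition.\<close>

definition counts :: "nat list \<Rightarrow> nat list" where
  "counts ms = map (\<lambda>k. length (filter (\<lambda>m. k \<le> m) ms)) [1, 2, 3, 4]"

lemma counts_distinct:
  "\<forall>i\<in>set [1..<15]. \<forall>j\<in>set [1..<15]. counts (omega_types ! (i - 1)) = counts (omega_types ! (j - 1)) \<longrightarrow>
     i = j \<or> (i, j) \<in> {(5, 6), (6, 5), (7, 8), (8, 7), (9, 10), (10, 9)}"
  unfolding counts_def omega_types_def by code_simp

lemma fixmult_image: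
  assumes P: "pulls p q r s k w' w" and "hform w'" "cdata w' L" "fixmult m w (v1, v2)" "1 \<le> m" "(v1, v2) \<noteq> (0, 0)"
  shows "\<exists>(m', v') \<in> set L. cross (p * v1 + q * v2, r * v1 + s * v2) v' = 0 \<and> m \<le> m'"
proof -
  have d: "p * s - q * r \<noteq> 0" using P by (simp add: pulls_def)
  have "(p * v1 + q * v2, r * v1 + s * v2) \<noteq> (0, 0)"
  proof
    assume "(p * v1 + q * v2, r * v1 + s * v2) = (0, 0)"
    then have "p * v1 + q * v2 = 0" "r * v1 + s * v2 = 0" by simp_all
    then have "(p * s - q * r) * v1 = 0" "(p * s - q * r) * v2 = 0" by algebra+
    then show False using d assms(6) by simp
  qed
  moreover have "fixmult m w' (p * v1 + q * v2, r * v1 + s * v2)" using assms(4) fixmult_pulls[OF P] by blast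
  ultimately show ?thesis using cdata_complete(2)[OF assms(2,3)] assms(5) by blast
qed

text \<open>The directions of multiplicity 4 and 2 are unique, so an equivalence is diagonal. A
  diagonal map cannot create the coefficient of x y^4, which is 0 in \<open>omega 5\<close> and -
  165 in \<open>omega 6\<close>.\<close>

lemma not_lconj_5_6: "\<not> lconj (omega 5) (omega 6)"
proof
  assume "lconj (omega 5) (omega 6)"
  then obtain p q r s k where P: "pulls p q r s k (omega 6) (omega 5)" unfolding lconj_def by blast
  obtain t t' where L: "cdata (omega 6) [(4, 0, 1), (2, pt 0), (1, pt t), (1, pt t')]" using cdata_6 .
  have w: "hform (omega 6)" using has_type_6 unfolding has_type_def by blast
  have "fixmult 4 (omega 5) (0, 1)" "fixmult 2 (omega 5) (1, 0)"
    unfolding omega_homog fixmult_infinity[OF refl] fixmult_zero[OF refl] by simp_all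
  from fixmult_image[OF P w L this(1)] fixmult_image[OF P w L this(2)]
  have q: "q = 0" and pr: "p = 0 \<or> r = 0" by (auto simp: cross_def)
  have d: "p * s - q * r \<noteq> 0" using P by (simp add: pulls_def)
  have r: "r = 0" and ps: "p \<noteq> 0" "s \<noteq> 0" using pr d q by auto
  have "k * (5 * x ^ 2 * y ^ 3 - 3 * y ^ 5) = p * (220 * (p * x) ^ 2 * (s * y) ^ 3 - 165 * (p * x) * (s * y) ^ 4 + 36 * (s * y) ^ 5)" for x y
    using pullsD(1)[OF P, of x y] unfolding omega_homog fst_conv homog_5_pCons q r by algebra
  \<comment> \<open>The difference of the two values isolates the part odd in x, which is absent on
    the left.\<close>
  from this[of 1 1] this[of "- 1" 1] have "p ^ 2 * s ^ 4 * 330 = 0" unfolding power_one mult_1_right by algebra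
  then show False using ps by simp
qed

text \<open>The ratio a4 b1 / (a5 b0) is unchanged by diagonal maps and by the exchange of the axes.
  It is stated cross-multiplied, so that no coefficient has to be nonzero.\<close>

lemma diag_invariant:
  assumes P: "pulls p q r s k (homog 5 [:0, 0, 0, 0, c4, c5:], homog 5 [:d0, d1, 0, 0, 0, 0:])
      (homog 5 [:0, 0, 0, 0, a4, a5:], homog 5 [:b0, b1, 0, 0, 0, 0:])"
    and z: "q = 0 \<and> r = 0 \<or> p = 0 \<and> s = 0"
  shows "a4 * b1 * (c5 * d0) = a5 * b0 * (c4 * d1)"
proof -
  have k: "k \<noteq> 0" using P by (simp add: pulls_def)
  have e: "k * (a4 * x * y ^ 4 + a5 * y ^ 5) = p * (c4 * (p * x + q * y) * (r * x + s * y) ^ 4 + c5 * (r * x + s * y) ^ 5) +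
        r * (d0 * (p * x + q * y) ^ 5 + d1 * (p * x + q * y) ^ 4 * (r * x + s * y))"
    "k * (b0 * x ^ 5 + b1 * x ^ 4 * y) = q * (c4 * (p * x + q * y) * (r * x + s * y) ^ 4 + c5 * (r * x + s * y) ^ 5) +
        s * (d0 * (p * x + q * y) ^ 5 + d1 * (p * x + q * y) ^ 4 * (r * x + s * y))" for x y
    using pullsD[OF P, of x y] unfolding fst_conv snd_conv homog_5_pCons by algebra+
  from z have "\<exists>u. k * a4 * (k * b1) = u * (c4 * d1) \<and> k * a5 * (k * b0) = u * (c5 * d0)"
  proof
    assume z: "q = 0 \<and> r = 0"
    have f: "k * (a4 * x * y ^ 4 + a5 * y ^ 5) = p * (c4 * (p * x) * (s * y) ^ 4 + c5 * (s * y) ^ 5)"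
      "k * (b0 * x ^ 5 + b1 * x ^ 4 * y) = s * (d0 * (p * x) ^ 5 + d1 * (p * x) ^ 4 * (s * y))" for x y
      using e[of x y] z by simp_all
    have 1: "2 * (k * a5) = 2 * (p * s ^ 5 * c5)" "2 * (k * a4) = 2 * (p ^ 2 * s ^ 4 * c4)"
      using f(1)[of 1 1] f(1)[of "- 1" 1] unfolding power_one mult_1_right by algebra+
    have 2: "2 * (k * b0) = 2 * (s * p ^ 5 * d0)" "2 * (k * b1) = 2 * (p ^ 4 * s ^ 2 * d1)"
      using f(2)[of 1 1] f(2)[of 1 "- 1"] unfolding power_one mult_1_right by algebra+
    have 3: "k * a5 = p * s ^ 5 * c5" "k * a4 = p ^ 2 * s ^ 4 * c4" "k * b0 = s * p ^ 5 * d0" "k * b1 = p ^ 4 * s ^ 2 * d1"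
      using 1 2 by (simp_all only: mult_cancel_left zero_neq_numeral[symmetric] simp_thms)
    show ?thesis unfolding 3 by (intro exI[of _ "p ^ 6 * s ^ 6"] conjI) algebra+
  next
    assume z: "p = 0 \<and> s = 0"
    have f: "k * (a4 * x * y ^ 4 + a5 * y ^ 5) = r * (d0 * (q * y) ^ 5 + d1 * (q * y) ^ 4 * (r * x))"
      "k * (b0 * x ^ 5 + b1 * x ^ 4 * y) = q * (c4 * (q * y) * (r * x) ^ 4 + c5 * (r * x) ^ 5)" for x y
      using e[of x y] z by simp_all
    have 1: "2 * (k * a5) = 2 * (r * q ^ 5 * d0)" "2 * (k * a4) = 2 * (q ^ 4 * r ^ 2 * d1)"
      using f(1)[of 1 1] f(1)[of "- 1" 1] unfolding power_one mult_1_right by algebra+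
    have 2: "2 * (k * b0) = 2 * (q * r ^ 5 * c5)" "2 * (k * b1) = 2 * (q ^ 2 * r ^ 4 * c4)"
      using f(2)[of 1 1] f(2)[of 1 "- 1"] unfolding power_one mult_1_right by algebra+
    have 3: "k * a5 = r * q ^ 5 * d0" "k * a4 = q ^ 4 * r ^ 2 * d1" "k * b0 = q * r ^ 5 * c5" "k * b1 = q ^ 2 * r ^ 4 * c4"
      using 1 2 by (simp_all only: mult_cancel_left zero_neq_numeral[symmetric] simp_thms)
    show ?thesis unfolding 3 by (intro exI[of _ "q ^ 6 * r ^ 6"] conjI) algebra+
  qed
  then obtain u where u: "k * a4 * (k * b1) = u * (c4 * d1)" "k * a5 * (k * b0) = u * (c5 * d0)" by blast
  have "k ^ 2 * (a4 * b1 * (c5 * d0) - a5 * b0 * (c4 * d1)) =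
    (k * a4 * (k * b1)) * (c5 * d0) - (k * a5 * (k * b0)) * (c4 * d1)" by algebra
  also have "\<dots> = 0" unfolding u by algebra
  finally show ?thesis using k by simp
qed

text \<open>The two directions of multiplicity 3 are fixed or exchanged, so
  \<open>diag_invariant\<close> applies, and its values for the two forms differ.\<close>

lemma not_lconj_7_8: "\<not> lconj (omega 7) (omega 8)"
proof
  assume "lconj (omega 7) (omega 8)"
  then obtain p q r s k where P: "pulls p q r s k (omega 8) (omega 7)" unfolding lconj_def by blast
  obtain t t' where L: "cdata (omega 7) [(3, 0, 1), (3, pt 0), (1, pt 1), (1, pt t)]" "cdata (omega 8) [(3, 0, 1), (3, pt 0), (1, pt 1), (1, pt t')]"
    using cdata_7_8 .
  have w: "hform (omega 8)" using has_type_8 unfolding has_type_def by blast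
  have "fixmult 3 (omega 7) (0, 1)" "fixmult 3 (omega 7) (1, 0)"
    unfolding omega_homog fixmult_infinity[OF refl] fixmult_zero[OF refl] by simp_all
  from fixmult_image[OF P w L(2) this(1)] fixmult_image[OF P w L(2) this(2)]
  have z: "q = 0 \<or> s = 0" "p = 0 \<or> r = 0" by (auto simp: cross_def)
  have d: "p * s - q * r \<noteq> 0" using P by (simp add: pulls_def)
  have "q = 0 \<and> r = 0 \<or> p = 0 \<and> s = 0" using z d by auto
  from diag_invariant[OF P[unfolded omega_homog] this]
  have "(5 - sqrt5) * (- 2 * (5 - 2 * sqrt5)) * (6 * (3 * (23 - 5 * sqrt21))) =
    - 2 * (7 - 3 * sqrt5) * (5 * (3 - sqrt21) * (- 10 * (9 - 2 * sqrt21)))" .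
  then have "(5 - sqrt5) * (- 2 * (5 - 2 * sqrt5)) * (6 * (3 * (23 - 5 * sqrt21))) +
    2 * (7 - 3 * sqrt5) * (5 * (3 - sqrt21) * (- 10 * (9 - 2 * sqrt21))) = 0" by algebra
  \<comment> \<open>Modulo the two minimal polynomials the difference is this product; its
    irrational factors are nonzero since both have norm 4.\<close>
  then have "(7 - 3 * sqrt5) * (23 - 5 * sqrt21) * 480 = 0" using sqrt_consts by algebra
  moreover have "(7 - 3 * sqrt5) * (7 + 3 * sqrt5) = 49 - 9 * sqrt5 ^ 2" "(23 - 5 * sqrt21) * (23 + 5 * sqrt21) = 529 - 25 * sqrt21 ^ 2"
    by algebra+
  then have "(7 - 3 * sqrt5) * (7 + 3 * sqrt5) = 4" "(23 - 5 * sqrt21) * (23 + 5 * sqrt21) = 4"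
    unfolding sqrt_consts by simp_all
  then have "7 - 3 * sqrt5 \<noteq> 0" "23 - 5 * sqrt21 \<noteq> 0" by auto
  ultimately show False by simp
qed

text \<open>Infinity is the only direction of multiplicity 3, while 0 and 1 are fixed or exchanged;
  up to scalars this leaves the identity and y -> x - y. Hence the parameter of \<open>form9\<close>
  is determined up to sign, but the squares of the two parameters differ by 40 sqrt 61.\<close>

lemma not_lconj_9_10: "\<not> lconj (omega 9) (omega 10)"
proof
  define \<alpha> \<beta> where "\<alpha> = a_const" and "\<beta> = \<i> * b_const"
  assume "lconj (omega 9) (omega 10)"
  then obtain p q r s k where P: "pulls p q r s k (form9 \<beta>) (form9 \<alpha>)" unfolding lconj_def omega_form9 \<alpha>_def \<beta>_def by blast
  obtain t where L: "cdata (form9 \<beta>) [(3, 0, 1), (2, pt 0), (2, pt 1), (1, pt t)]"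
    using cdata_9[OF form9_roots(2)] unfolding \<beta>_def by blast
  have w: "hform (form9 \<beta>)" using has_type_9[OF form9_roots(2)] unfolding has_type_def \<beta>_def by blast
  have "fixmult 3 (form9 \<alpha>) (0, 1)" "fixmult 2 (form9 \<alpha>) (1, 0)"
    unfolding form9_def fixmult_infinity[OF refl] fixmult_zero[OF refl] by simp_all
  moreover have "fixmult 2 (form9 \<alpha>) (1, 1)"
    unfolding form9_def fixmult_coeffs[OF refl] by (simp add: algebra_simps)
  ultimately have q: "q = 0" and z: "p = 0 \<or> r = 0 \<or> p = r" "p + q = 0 \<or> r + s = 0 \<or> p + q = r + s"
    using fixmult_image[OF P w L, of 3 0 1] fixmult_image[OF P w L, of 2 1 0] fixmult_image[OF P w L, of 2 1 1]
    by (auto simp: cross_def)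
  have d: "p * s - q * r \<noteq> 0" and k: "k \<noteq> 0" using P by (simp_all add: pulls_def)
  have ps: "p \<noteq> 0" "s \<noteq> 0" using d q by auto
  have e: "k * (- (1 - \<alpha>) * x ^ 5 - 2 * \<alpha> * x ^ 4 * y) = s * (- (1 - \<beta>) * (p * x) ^ 5 - 2 * \<beta> * (p * x) ^ 4 * (r * x + s * y))" for x y
    using pullsD(2)[OF P, of x y] unfolding form9_def fst_conv snd_conv homog_5_pCons q by algebra
  have E: "k * (1 - \<alpha>) = s * ((1 - \<beta>) * p ^ 5 + 2 * \<beta> * p ^ 4 * r)" "2 * (k * \<alpha>) = 2 * (s * \<beta> * p ^ 4 * s)"
    using e[of 1 0] e[of 1 1] unfolding power_one mult_1_right mult_zero_right by algebra+
  have E2: "k * \<alpha> = s * \<beta> * p ^ 4 * s" using E(2) by simp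
  consider "r = 0" "p = s" | "r = p" "s = - p" using z ps q by (auto simp: eq_neg_iff_add_eq_0 add.commute)
  then have "\<alpha> ^ 2 = \<beta> ^ 2"
  proof cases
    case 1
    have "k = p ^ 6" using E(1) E2 unfolding 1(1) 1(2)[symmetric] by algebra
    then have "k * (\<alpha> - \<beta>) = 0" using E2 unfolding 1(2)[symmetric] by algebra
    then have "\<alpha> = \<beta>" using k by simp
    then show ?thesis by simp
  next
    case 2
    have "k = - (p ^ 6)" using E(1) E2 unfolding 2 by algebra
    then have "k * (\<alpha> + \<beta>) = 0" using E2 unfolding 2 by algebra
    then have "\<alpha> + \<beta> = 0" using k by simp
    then show ?thesis by algebra
  qed
  then have "complex_of_real (sqrt 61) = 0" unfolding \<alpha>_def \<beta>_def a_const_b_const by simp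
  then show False using sqrt61 by simp
qed

theorem omega_not_lconj:
  assumes "i \<in> {1..14}" "j \<in> {1..14}" "i \<noteq> j"
  shows "\<not> lconj (omega i) (omega j)"
proof
  assume c: "lconj (omega i) (omega j)"
  have "counts (omega_types ! (i - 1)) = counts (omega_types ! (j - 1))"
    unfolding counts_def using type_count[OF c has_type_omega[OF assms(1)] has_type_omega[OF assms(2)]] by simp
  moreover have "i \<in> set [1..<15]" "j \<in> set [1..<15]" using assms by auto
  ultimately have "(i, j) \<in> {(5, 6), (6, 5), (7, 8), (8, 7), (9, 10), (10, 9)}" using counts_distinct assms(3) by blast
  moreover have "\<not> lconj (omega 6) (omega 5)" "\<not> lconj (omega 8) (omega 7)" "\<not> lconj (omega 10) (omega 9)"
    using not_lconj_5_6 not_lconj_7_8 not_lconj_9_10 lconj_sym by blast+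
  ultimately show False using c not_lconj_5_6 not_lconj_7_8 not_lconj_9_10 by auto
qed

section \<open>Realising a pair by coprime polynomials\<close>

lemma eval2_map_poly: "eval2 P x y = poly (map_poly (\<lambda>p. poly p x) P) y"
  unfolding eval2_def by (induction P) (simp_all add: map_poly_pCons)

text \<open>The zero must differ from the origin. If D is constant in y it is taken as (x, 1);
  otherwise x is chosen nonzero and off the zeros of the leading coefficient, so that the degree in
  y does not drop.\<close>

lemma nonunit_has_zero:
  fixes D :: "complex poly poly"
  assumes "D \<noteq> 0" "\<not> is_unit D"
  obtains x y where "x \<noteq> 0 \<or> y \<noteq> 0" "eval2 D x y = 0"
proof (cases "degree D = 0")
  case True
  then obtain d where d: "D = [:d:]" by (rule degree_eq_zeroE)
  have "\<not> is_unit d" using assms(2) unfolding d by (simp add: is_unit_const_poly_iff)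
  moreover have "d \<noteq> 0" using assms(1) d by simp
  ultimately have "degree d \<noteq> 0" by (simp add: is_unit_iff_degree)
  then obtain x where "poly d x = 0" using fundamental_theorem_of_algebra[of d] by (auto simp: constant_degree)
  then show thesis using that[of x 1] by (simp add: eval2_def d)
next
  case False
  have "lead_coeff D \<noteq> 0" using assms(1) by simp
  then have "finite {x. poly (lead_coeff D) x = 0}" by (rule poly_roots_finite)
  then have "finite (insert 0 {x. poly (lead_coeff D) x = 0})" by simp
  then obtain x where x: "x \<noteq> 0" "poly (lead_coeff D) x \<noteq> 0"
    using ex_new_if_finite[OF infinite_UNIV_char_0, of "insert 0 {x. poly (lead_coeff D) x = 0}"] by auto
  define P where "P = map_poly (\<lambda>p. poly p x) D"
  have "coeff P (degree D) \<noteq> 0" using x(2) by (simp add: P_def coeff_map_poly)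
  then have "degree D \<le> degree P" by (rule le_degree)
  then have "degree P \<noteq> 0" using False by simp
  then obtain y where "poly P y = 0" using fundamental_theorem_of_algebra[of P] by (auto simp: constant_degree)
  then show thesis using that[of x y] x(1) by (simp add: eval2_map_poly P_def)
qed

text \<open>A nonunit common divisor would vanish somewhere off the origin, and there both forms of
  the pair would vanish.\<close>

lemma hform_coprime:
  assumes w: "hform w"
  obtains A B where "hom_poly2 5 A" "hom_poly2 5 B" "coprime A B" "eval2 A = fst w" "eval2 B = snd w"
proof -
  obtain a b where ab: "fst w = homog 5 a" "snd w = homog 5 b" "degree a \<le> 5" "degree b \<le> 5"
    using hform_obtain[OF w] .
  define Q where "Q f = (\<Sum>i\<le>5. monom (monom (coeff f i) (5 - i)) i)" for f :: "complex poly"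
  have cQ: "coeff (coeff (Q f) i) j = (if i \<le> 5 \<and> j = 5 - i then coeff f i else 0)" for f i j
  proof -
    have "coeff (Q f) i = (\<Sum>k\<le>5. if k = i then monom (coeff f i) (5 - i) else 0)"
      unfolding Q_def coeff_sum coeff_monom by (rule sum.cong) auto
    also have "\<dots> = (if i \<le> 5 then monom (coeff f i) (5 - i) else 0)" by simp
    finally show ?thesis by auto
  qed
  have h: "hom_poly2 5 (Q f)" for f unfolding hom_poly2_def cQ by (auto split: if_splits)
  have ev: "eval2 (Q f) = homog 5 f" for f
    unfolding eval2_homog[OF h] by (intro ext, unfold homog_5_pCons) (simp add: homog_5 cQ)
  have "coprime (Q a) (Q b)"
  proof (rule coprimeI)
    fix D assume D: "D dvd Q a" "D dvd Q b"
    show "is_unit D"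
    proof (rule ccontr)
      assume u: "\<not> is_unit D"
      have dv: "eval2 F x y = 0" if "eval2 D x y = 0" "D dvd F" for F x y
        using that unfolding dvd_def eval2_def by auto
      have "D \<noteq> 0"
      proof
        assume "D = 0"
        then have "eval2 (Q a) 1 1 = 0" "eval2 (Q b) 1 1 = 0" using dv[of 1 1] D by (simp_all add: eval2_def)
        then show False using hform_nonzero[OF w, of 1 1] unfolding ab ev by simp
      qed
      then obtain x y where "x \<noteq> 0 \<or> y \<noteq> 0" "eval2 D x y = 0" using nonunit_has_zero u by blast
      then show False using dv D hform_nonzero[OF w, of x y] unfolding ab ev[symmetric] by blast
    qed
  qed
  then show thesis using that h ev ab by metis
qed

lemma hom_form_chart: "given_in_chart (mat 1) (hom_form w) w"
  unfolding given_in_chart_def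
  by (intro exI[of _ 1]) (simp add: pair_hom_form matrix_vector_mul_lid)

lemma homogeneous_hom_form:
  assumes w: "hform w"
  shows "homogeneous_foliation 5 (hom_form w)"
proof -
  obtain A B where AB: "hom_poly2 5 A" "hom_poly2 5 B" "coprime A B" "eval2 A = fst w" "eval2 B = snd w"
    using hform_coprime[OF w] .
  have "given_in_chart (mat 1) (hom_form w) (eval2 A, eval2 B)" using hom_form_chart[of w] AB(4,5) by simp
  moreover have "invertible (mat 1 :: complex^3^3)" by (simp add: invertible_det_nz)
  ultimately show ?thesis
    unfolding homogeneous_foliation_def using AB(1-3) foliation_hom_form[OF w] has_degree_hom_form[OF w] by blast
qed

theorem theoremA:
  shows "(\<exists>!r :: real. 8 * r ^ 3 - 52 * r ^ 2 + 134 * r - 15 = 0) \<and>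
    (\<exists>H :: nat \<Rightarrow> form.
       (\<forall>i\<in>{1..14}. given_in_chart (mat 1) (H i) (omega i) \<and>
          homogeneous_foliation 5 (H i) \<and> convex_foliation (H i)) \<and>
       (\<forall>i\<in>{1..14}. \<forall>j\<in>{1..14}. i \<noteq> j \<longrightarrow> \<not> conjugate (H i) (H j)) \<and>
       (\<forall>F. homogeneous_foliation 5 F \<and> convex_foliation F \<longrightarrow>
          (\<exists>i\<in>{1..14}. conjugate F (H i))))"
proof (intro conjI exI[of _ "\<lambda>i. hom_form (omega i)"] ballI impI allI)
  show "\<exists>!r :: real. 8 * r ^ 3 - 52 * r ^ 2 + 134 * r - 15 = 0" by (rule rho_unique)
next
  fix i :: nat assume i: "i \<in> {1..14}"
  have w: "hform (omega i)" "simple_tang (omega i)" using has_type_omega[OF i] unfolding has_type_def by blast+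
  show "given_in_chart (mat 1) (hom_form (omega i)) (omega i)" by (rule hom_form_chart)
  show "homogeneous_foliation 5 (hom_form (omega i))" by (rule homogeneous_hom_form[OF w(1)])
  show "convex_foliation (hom_form (omega i))"
    by (rule convexI[OF w has_type_crit_fixed[OF has_type_omega[OF i]]])
next
  fix i j :: nat assume ij: "i \<in> {1..14}" "j \<in> {1..14}" "i \<noteq> j"
  have "hform (omega i)" "hform (omega j)"
    using has_type_omega[OF ij(1)] has_type_omega[OF ij(2)] unfolding has_type_def by blast+
  then show "\<not> conjugate (hom_form (omega i)) (hom_form (omega j))"
    using conjugate_lconj omega_not_lconj[OF ij] by blast
next
  fix F assume F: "homogeneous_foliation 5 F \<and> convex_foliation F"
  obtain w where w: "hform w" "conjugate (hom_form w) F" using homogeneous_foliation_hom_form F by blast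
  have F_w: "conjugate F (hom_form w)" by (rule conjugate_sym[OF w(2)])
  \<comment> \<open>Convexity is carried from F to the cone over w, where it becomes the condition
    that critical directions are fixed.\<close>
  have "convex_foliation (hom_form w)" using convex_conjugate[OF F_w _ foliation_hom_form[OF w(1)]] F by blast
  then obtain i where i: "i \<in> {1..14}" "lconj w (omega i)" using classification[OF w(1)] convex_crit_fixed[OF w(1)] by blast
  show "\<exists>i\<in>{1..14}. conjugate F (hom_form (omega i))"
    using conjugate_trans[OF F_w lconj_conjugate[OF i(2)]] i(1) by blast
qed

end
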